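(* For each integer $\tau>1$ there exists a 2HAM tile assembly system $\mathcal{S}=(U_\tau,\tau)$ (with the default initial state) which strongly simultaneously simulates all 2HAM tile assembly systems $\mathcal{T}=(T,\tau)$ with temperature $\tau$ and default initial state.
   Context: Two-handed Tile Assembly Model (2HAM). A tile type is a non-rotatable unit square each of whose four sides carries a glue, consisting of a label (a finite string) and a strength (a nonnegative integer). For a finite set $T$ of tile types, an assembly is a partial function $\alpha:\mathbb{Z}^2 \dashrightarrow T$. Two tiles at adjacent positions interact if the glues on their abutting sides have equal labels and positive strength; the binding graph of $\alpha$ has the occupied positions as vertices and an edge, weighted by the glue strength, between each interacting pair. For a positive integer $\tau$ (the temperature), $\alpha$ is $\tau$-stable if every cut of its binding graph has total weight at least $\tau$. A supertile $\tilde{\alpha}$ is the equivalence class of an assembly under translation. For supertiles $\tilde\alpha,\tilde\beta$, the combination set $C^\tau_{\tilde\alpha,\tilde\beta}$ is the set of supertiles $\tilde\gamma$ for which there exist $\alpha\in\tilde\alpha$, $\beta\in\tilde\beta$ with disjoint domains such that $\alpha\cup\beta$ is $\tau$-stable and lies in $\tilde\gamma$. A 2HAM TAS $(T,\tau)$ has the default initial state consisting of infinitely many copies of each single tile of $T$. Its producible supertiles $\mathcal{A}[\mathcal{T}]$ are those obtainable, starting from single tiles, by repeatedly replacing two available supertiles $\tilde\alpha,\tilde\beta$ by some $\tilde\gamma\in C^\tau_{\tilde\alpha,\tilde\beta}$ (including results of infinite such sequences). Write $\tilde\alpha\to^1_{\mathcal{T}}\tilde\beta$ if $\tilde\beta$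 arises from $\tilde\alpha$ by one attachment step with some producible supertile, $\tilde\alpha\to^{\leq1}_{\mathcal{T}}\tilde\beta$ if $\tilde\alpha=\tilde\beta$ or $\tilde\alpha\to^1_{\mathcal{T}}\tilde\beta$, and $\tilde\alpha\to_{\mathcal{T}}\tilde\beta$ if $\tilde\beta$ results from $\tilde\alpha$ by a sequence of such steps (possibly none). Block representations. For tile sets $U,T$ and $m\geq1$, an $m$-block over $U$ is a partial function $\mathbb{Z}_m\times\mathbb{Z}_m\dashrightarrow U$; for an assembly $\alpha$ over $U$, $\alpha^m_{x,y}(i,j)=\alpha(mx+i,my+j)$. An $m$-block representation function is a partial function $R$ from $m$-blocks over $U$ to $T$, inducing $R^*(\alpha)(x,y)=R(\alpha^m_{x,y})$ and $\tilde R(\tilde\alpha)=\{R^*(\alpha):\alpha\in\tilde\alpha\}$. $\alpha$ maps cleanly to $R^*(\alpha)$ if either $\alpha$ has at most one nonempty $m$-block, or for every nonempty block $\alpha^m_{x,y}$ some $(x+u,y+v)$ with $(u,v)\in\{(0,0),(\pm1,0),(0,\pm1)\}$ lies in the domain of $R^*(\alpha)$; $\tilde\alpha$ maps cleanly to $\tilde R(\tilde\alpha)$ if $\tilde R(\tilde\alpha)$ is a supertile and every $\alpha\in\tilde\alpha$ maps cleanly. Simultaneous strong simulation. Fix a standard enumeration $\mathcal{T}_0=(T_0,\tau),\mathcal{T}_1=(T_1,\tau),\dots$ of all temperature-$\tau$ 2HAM TASs (with default initial state), and for each $i$ a block representation function $R_i$ from blocks over $U_\tau$ to $T_i$. Let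 $\mathcal{U}=(U_\tau,\tau)$. $\mathcal{U}$ strongly simultaneously simulates $\langle\mathcal{T}_i\rangle$ (via $\langle R_i\rangle$) if: (a) simultaneous equivalent productions: for every $\tilde\alpha\in\mathcal{A}[\mathcal{U}]$ there is at most one $i$ with $\tilde R_i(\tilde\alpha)\in\mathcal{A}[\mathcal{T}_i]$; for every $i$ and every $\tilde\beta\in\mathcal{A}[\mathcal{T}_i]$ there is $\tilde\alpha\in\mathcal{A}[\mathcal{U}]$ with $\tilde R_i(\tilde\alpha)=\tilde\beta$; and for every $\tilde\alpha\in\mathcal{A}[\mathcal{U}]$ there is at most one $i$ such that $\tilde\alpha$ maps cleanly to $\tilde R_i(\tilde\alpha)$; (b) following: for all $\tilde\alpha,\tilde\beta\in\mathcal{A}[\mathcal{U}]$ with $\tilde\alpha\to^1_{\mathcal{U}}\tilde\beta$ there is at most one $i$ with $\tilde R_i(\tilde\alpha)\to^{\leq1}_{\mathcal{T}_i}\tilde R_i(\tilde\beta)$; (c) strong modeling: for every $i$, all $\tilde\alpha,\tilde\beta\in\mathcal{A}[\mathcal{T}_i]$ and $\tilde\gamma\in C^\tau_{\tilde\alpha,\tilde\beta}$, and all $\tilde\alpha',\tilde\beta'\in\mathcal{A}[\mathcal{U}]$ with $\tilde R_i(\tilde\alpha')=\tilde\alpha$, $\tilde R_i(\tilde\beta')=\tilde\beta$, there exist $\tilde\alpha'',\tilde\beta'',\tilde\gamma'\in\mathcal{A}[\mathcal{U}]$ with $\tilde\alpha'\to_{\mathcal{U}}\tilde\alpha''$, $\tilde\beta'\to_{\mathcal{U}}\tilde\beta''$,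 $\tilde R_i(\tilde\alpha'')=\tilde\alpha$, $\tilde R_i(\tilde\beta'')=\tilde\beta$, $\tilde R_i(\tilde\gamma')=\tilde\gamma$ and $\tilde\gamma'\in C^\tau_{\tilde\alpha'',\tilde\beta''}$. (In the paper's definition of strong modeling, the condition printed as $\tilde\beta'\to\tilde\alpha''$ is read as $\tilde\beta'\to\tilde\beta''$.) *)

theory Defs
  imports Main
begin

text \<open>A glue is a label (finite string) together with a strength.\<close>
type_synonym glue = "string \<times> nat"

datatype tile = Tile (glueN: glue) (glueE: glue) (glueS: glue) (glueW: glue)

type_synonym pos = "int \<times> int"
type_synonym assembly = "pos \<Rightarrow> tile option"
type_synonym supertile = "assembly set"

definition bond :: "assembly \<Rightarrow> pos \<Rightarrow> pos \<Rightarrow> nat" where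
  "bond \<alpha> p q = (case (\<alpha> p, \<alpha> q) of
      (Some t, Some u) \<Rightarrow>
        (if q = (fst p + 1, snd p) \<and> glueE t = glueW u \<and> 0 < snd (glueE t) then snd (glueE t)
         else if q = (fst p, snd p + 1) \<and> glueN t = glueS u \<and> 0 < snd (glueN t) then snd (glueN t)
         else 0)
    | _ \<Rightarrow> 0)"

definition weight :: "assembly \<Rightarrow> pos \<Rightarrow> pos \<Rightarrow> nat" where
  "weight \<alpha> p q = bond \<alpha> p q + bond \<alpha> q p"

text \<open>tau-stability: every cut (A, dom - A) of the binding graph has total weight at least tau
  (total weight of a possibly infinite family of nonnegative weights is at least tau iff
  some finite subfamily has weight at least tau).\<close>
definition stable :: "nat \<Rightarrow> assembly \<Rightarrow> bool" where
  "stable \<tau> \<alpha> \<longleftrightarrow>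
     (\<forall>A. A \<subseteq> dom \<alpha> \<and> A \<noteq> {} \<and> dom \<alpha> - A \<noteq> {} \<longrightarrow>
        (\<exists>F. finite F \<and> F \<subseteq> A \<times> (dom \<alpha> - A) \<and> \<tau> \<le> (\<Sum>(p,q)\<in>F. weight \<alpha> p q)))"

definition translate :: "assembly \<Rightarrow> pos \<Rightarrow> assembly" where
  "translate \<alpha> v = (\<lambda>p. \<alpha> (fst p - fst v, snd p - snd v))"

definition supertile_of :: "assembly \<Rightarrow> supertile" where
  "supertile_of \<alpha> = range (translate \<alpha>)"

definition is_supertile :: "supertile \<Rightarrow> bool" where
  "is_supertile S \<longleftrightarrow> (\<exists>\<alpha>. \<alpha> \<noteq> Map.empty \<and> S = supertile_of \<alpha>)"

definition combination :: "nat \<Rightarrow> supertile \<Rightarrow> supertile \<Rightarrow> supertile set" where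
  "combination \<tau> A B =
     {supertile_of (\<alpha> ++ \<beta>) | \<alpha> \<beta>.
        \<alpha> \<in> A \<and> \<beta> \<in> B \<and> dom \<alpha> \<inter> dom \<beta> = {} \<and> stable \<tau> (\<alpha> ++ \<beta>)}"

definition chain_lim :: "(nat \<Rightarrow> assembly) \<Rightarrow> assembly" where
  "chain_lim f p = (if \<exists>k. f k p \<noteq> None then f (LEAST k. f k p \<noteq> None) p else None)"

inductive_set producible :: "nat \<Rightarrow> tile set \<Rightarrow> supertile set" for \<tau> T where
  single: "t \<in> T \<Longrightarrow> supertile_of (Map.empty((0,0) \<mapsto> t)) \<in> producible \<tau> T"
| comb: "A \<in> producible \<tau> T \<Longrightarrow> B \<in> producible \<tau> T \<Longrightarrow> C \<in> combination \<tau> A B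
          \<Longrightarrow> C \<in> producible \<tau> T"
| limit: "supertile_of (f 0) \<in> producible \<tau> T
          \<Longrightarrow> (\<And>k. supertile_of (g k) \<in> producible \<tau> T)
          \<Longrightarrow> (\<And>k. dom (f k) \<inter> dom (g k) = {})
          \<Longrightarrow> (\<And>k. f (Suc k) = f k ++ g k)
          \<Longrightarrow> (\<And>k. stable \<tau> (f (Suc k)))
          \<Longrightarrow> supertile_of (chain_lim f) \<in> producible \<tau> T"

definition one_step :: "nat \<Rightarrow> tile set \<Rightarrow> supertile \<Rightarrow> supertile \<Rightarrow> bool" where
  "one_step \<tau> T A B \<longleftrightarrow> (\<exists>C \<in> producible \<tau> T. B \<in> combination \<tau> A C)"

definition le1_step :: "nat \<Rightarrow> tile set \<Rightarrow> supertile \<Rightarrow> supertile \<Rightarrow> bool" where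
  "le1_step \<tau> T A B \<longleftrightarrow> is_supertile A \<and> is_supertile B \<and> (A = B \<or> one_step \<tau> T A B)"

definition steps :: "nat \<Rightarrow> tile set \<Rightarrow> supertile \<Rightarrow> supertile \<Rightarrow> bool" where
  "steps \<tau> T = (one_step \<tau> T)\<^sup>*\<^sup>*"

text \<open>An m-block: partial function on Z_m x Z_m, represented as a partial function on
  nat x nat that is undefined outside {0..<m} x {0..<m}.\<close>
type_synonym block = "nat \<times> nat \<Rightarrow> tile option"

text \<open>A block representation function: block size m together with a partial map
  from blocks to tiles.\<close>
type_synonym blockrep = "nat \<times> (block \<Rightarrow> tile option)"

definition block_at :: "nat \<Rightarrow> assembly \<Rightarrow> int \<Rightarrow> int \<Rightarrow> block" where
  "block_at m \<alpha> x y = (\<lambda>(i,j). if i < m \<and> j < m then \<alpha> (int m * x + int i, int m * y + int j) else None)"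

definition valid_blockrep :: "tile set \<Rightarrow> tile set \<Rightarrow> blockrep \<Rightarrow> bool" where
  "valid_blockrep U T R \<longleftrightarrow> 1 \<le> fst R \<and> ran (snd R) \<subseteq> T \<and>
     (\<forall>b \<in> dom (snd R). ran b \<subseteq> U \<and> (\<forall>i j. b (i,j) \<noteq> None \<longrightarrow> i < fst R \<and> j < fst R))"

definition rep_star :: "blockrep \<Rightarrow> assembly \<Rightarrow> assembly" where
  "rep_star R \<alpha> = (\<lambda>(x,y). snd R (block_at (fst R) \<alpha> x y))"

definition rep_tilde :: "blockrep \<Rightarrow> supertile \<Rightarrow> supertile" where
  "rep_tilde R S = rep_star R ` S"

definition maps_cleanly :: "blockrep \<Rightarrow> assembly \<Rightarrow> bool" where
  "maps_cleanly R \<alpha> \<longleftrightarrow>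
     (\<forall>p q. block_at (fst R) \<alpha> (fst p) (snd p) \<noteq> Map.empty
            \<and> block_at (fst R) \<alpha> (fst q) (snd q) \<noteq> Map.empty \<longrightarrow> p = q)
   \<or> (\<forall>x y. block_at (fst R) \<alpha> x y \<noteq> Map.empty \<longrightarrow>
        (\<exists>(u,v) \<in> {(0,0),(1,0),(-1,0),(0,1),(0,-1)}. rep_star R \<alpha> (x+u, y+v) \<noteq> None))"

definition supertile_maps_cleanly :: "blockrep \<Rightarrow> supertile \<Rightarrow> bool" where
  "supertile_maps_cleanly R S \<longleftrightarrow> is_supertile (rep_tilde R S) \<and> (\<forall>\<alpha>\<in>S. maps_cleanly R \<alpha>)"

definition at_most_one :: "(nat \<Rightarrow> bool) \<Rightarrow> bool" where
  "at_most_one P \<longleftrightarrow> (\<forall>i j. P i \<and> P j \<longrightarrow> i = j)"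

definition strongly_simultaneously_simulates ::
  "nat \<Rightarrow> tile set \<Rightarrow> (nat \<Rightarrow> tile set) \<Rightarrow> (nat \<Rightarrow> blockrep) \<Rightarrow> bool" where
  "strongly_simultaneously_simulates \<tau> U Ts R \<longleftrightarrow>
     \<comment> \<open>(a) simultaneous equivalent productions\<close>
     (\<forall>A \<in> producible \<tau> U. at_most_one (\<lambda>i. rep_tilde (R i) A \<in> producible \<tau> (Ts i)))
   \<and> (\<forall>i. \<forall>B \<in> producible \<tau> (Ts i). \<exists>A \<in> producible \<tau> U. rep_tilde (R i) A = B)
   \<and> (\<forall>A \<in> producible \<tau> U. at_most_one (\<lambda>i. supertile_maps_cleanly (R i) A))
     \<comment> \<open>(b) following\<close>
   \<and> (\<forall>A \<in> producible \<tau> U. \<forall>B \<in> producible \<tau> U. one_step \<tau> U A B \<longrightarrow>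
        at_most_one (\<lambda>i. le1_step \<tau> (Ts i) (rep_tilde (R i) A) (rep_tilde (R i) B)))
     \<comment> \<open>(c) strong modeling\<close>
   \<and> (\<forall>i. \<forall>A \<in> producible \<tau> (Ts i). \<forall>B \<in> producible \<tau> (Ts i). \<forall>C \<in> combination \<tau> A B.
        \<forall>A' \<in> producible \<tau> U. \<forall>B' \<in> producible \<tau> U.
          rep_tilde (R i) A' = A \<and> rep_tilde (R i) B' = B \<longrightarrow>
          (\<exists>A'' \<in> producible \<tau> U. \<exists>B'' \<in> producible \<tau> U. \<exists>C' \<in> producible \<tau> U.
             steps \<tau> U A' A'' \<and> steps \<tau> U B' B'' \<and>
             rep_tilde (R i) A'' = A \<and> rep_tilde (R i) B'' = B \<and> rep_tilde (R i) C' = C \<and>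
             C' \<in> combination \<tau> A'' B''))"

end

theory Submission
  imports Defs "HOL-Library.Countable" "HOL-Library.Product_Plus"
begin

text \<open>
  The simulator is allowed to produce more than the simulated systems do: the first and the third condition only
  ask that no supertile be readable for two different systems. So it suffices that every producible supertile of
  the simulator can be read unambiguously, that every supertile of every system is represented, and that every
  attachment of the simulated system can be carried out.

  A seed grows a square spiral of nondeterministically chosen size \<open>n\<close>; the size encodes the index of the simulated
  system, and one free bit on every ring encodes a tile of it. The finished square grows strips on its four sides
  whose teeth interlock with those of a neighbouring square exactly if both have the same size, and two pairs of
  leaves of strengths \<open>\<tau> - 1\<close> and \<open>1\<close> then bind any two neighbouring squares, whatever tiles they encode.
  Hence every producible supertile is either a seedless fragment of at most three tiles, or a family of partial
  squares which, if there are several, have equal size and are aligned on a lattice. An attachment of the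
  simulated system is carried out by completing two squares that represent adjacent tiles.
\<close>

section \<open>Assemblies and stability\<close>

text \<open>The obstacle is two-handed growth: a tile need not wait for its inputs, because its
  outputs can also hold it, and pieces without a seed can form apart from any cell. Directed glues
  tame this. A stable union of two parts needs a link of strength \<tau> or two different links, and
  the structural analysis uses nothing else about strengths, so all \<tau> > 1 are treated alike.
  What stays invariant is that each tile occurs together with everything that must precede it in its
  own cell. Only leaves, which also bind sideways to a foreign cell, can be early. Strip growth is
  routed through the teeth, so a leaf beyond the middle row certifies all teeth before it. Sizes are
  congruent to 1 modulo 4 for two reasons: the middle row of a strip then always meets the
  four-periodic pattern at the same phase, and all differences of sizes are multiples of that
  period. Finally, a supertile is a class under translation, so a cell must be readable wherever the
  grid of windows happens to cut it.\<close>

lemma translate_apply: "translate \<alpha> v p = \<alpha> (p - v)"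
  by (simp add: translate_def minus_prod_def)

lemma translate_zero [simp]: "translate \<alpha> 0 = \<alpha>"
  by (rule ext) (simp add: translate_apply)

lemma translate_translate [simp]: "translate (translate \<alpha> u) v = translate \<alpha> (u + v)"
  by (rule ext) (simp add: translate_apply algebra_simps)

lemma dom_translate: "p \<in> dom (translate \<alpha> v) \<longleftrightarrow> p - v \<in> dom \<alpha>"
  by (simp add: translate_apply domIff)

lemma self_in_supertile [simp]: "\<alpha> \<in> supertile_of \<alpha>"
  unfolding supertile_of_def by (metis rangeI translate_zero)

lemma supertile_of_translate [simp]: "supertile_of (translate \<alpha> v) = supertile_of \<alpha>"
proof -
  have "translate \<alpha> u = translate (translate \<alpha> v) (u - v)" for u by simp
  then show ?thesis unfolding supertile_of_def by (metis (no_types, lifting) image_cong rangeI subsetI subset_antisym image_subset_iff translate_translate)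
qed

lemma supertile_of_eqI: "\<alpha> \<in> supertile_of \<beta> \<Longrightarrow> supertile_of \<alpha> = supertile_of \<beta>"
  by (auto simp: supertile_of_def[of \<beta>])

lemma weight_translate: "weight (translate \<alpha> v) (p + v) (q + v) = weight \<alpha> p q"
  by (auto simp: weight_def bond_def translate_apply prod_eq_iff split: option.splits)

lemma weight_mono_eq:
  assumes "\<alpha> \<subseteq>\<^sub>m \<gamma>" "p \<in> dom \<alpha>" "q \<in> dom \<alpha>"
  shows "weight \<gamma> p q = weight \<alpha> p q"
proof -
  have "\<gamma> p = \<alpha> p" "\<gamma> q = \<alpha> q" using assms by (auto simp: map_le_def)
  then show ?thesis by (simp add: weight_def bond_def)
qed

lemma weight_commute: "weight \<alpha> p q = weight \<alpha> q p"
  by (simp add: weight_def)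

lemma stable_translate:
  assumes "stable \<tau> \<alpha>" shows "stable \<tau> (translate \<alpha> v)"
  unfolding stable_def
proof (intro allI impI)
  fix A assume A: "A \<subseteq> dom (translate \<alpha> v) \<and> A \<noteq> {} \<and> dom (translate \<alpha> v) - A \<noteq> {}"
  define B where "B = {p. p + v \<in> A}"
  have d: "p + v \<in> dom (translate \<alpha> v) \<longleftrightarrow> p \<in> dom \<alpha>" for p by (simp add: dom_translate)
  have 1: "B \<subseteq> dom \<alpha>" using A d unfolding B_def by blast
  obtain a where "a \<in> A" using A by auto
  then have "a - v \<in> B" unfolding B_def by simp
  then have 2: "B \<noteq> {}" by auto
  obtain b where "b \<in> dom (translate \<alpha> v) - A" using A by auto
  then have "b - v \<in> dom \<alpha> - B" using d[of "b - v"] unfolding B_def by simp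
  then have 3: "dom \<alpha> - B \<noteq> {}" by auto
  from assms 1 2 3 obtain F where F: "finite F" "F \<subseteq> B \<times> (dom \<alpha> - B)"
      "\<tau> \<le> (\<Sum>(p,q)\<in>F. weight \<alpha> p q)" unfolding stable_def by blast
  let ?f = "\<lambda>(p,q). (p + v, q + v)"
  have inj: "inj_on ?f F" by (auto simp: inj_on_def)
  have "(\<Sum>(p,q)\<in>?f ` F. weight (translate \<alpha> v) p q) = (\<Sum>(p,q)\<in>F. weight \<alpha> p q)"
    by (rule sum.reindex_cong[OF inj refl]) (simp only: case_prod_unfold fst_conv snd_conv weight_translate)
  moreover have "?f ` F \<subseteq> A \<times> (dom (translate \<alpha> v) - A)"
  proof
    fix x assume "x \<in> ?f ` F"
    then obtain y where y: "x = ?f y" "y \<in> F" by blast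
    define p q where "p = fst y" and "q = snd y"
    have x: "x = (p + v, q + v)" "(p, q) \<in> F" using y by (simp_all add: p_def q_def case_prod_unfold)
    then have "p \<in> B" "q \<in> dom \<alpha>" "q \<notin> B" using F(2) by auto
    then show "x \<in> A \<times> (dom (translate \<alpha> v) - A)" using d x(1) unfolding B_def by blast
  qed
  ultimately show "\<exists>F. finite F \<and> F \<subseteq> A \<times> (dom (translate \<alpha> v) - A) \<and>
      \<tau> \<le> (\<Sum>(p,q)\<in>F. weight (translate \<alpha> v) p q)"
    using F(1,3) by (metis finite_imageI)
qed

lemma stable_single: "stable \<tau> [p \<mapsto> t]"
  unfolding stable_def by (auto simp: subset_singleton_iff)

lemma stable_cutE:
  assumes "stable \<tau> \<gamma>" "A \<subseteq> dom \<gamma>" "A \<noteq> {}" "dom \<gamma> - A \<noteq> {}"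
  obtains F where "finite F" "F \<subseteq> A \<times> (dom \<gamma> - A)" "\<tau> \<le> (\<Sum>(p,q)\<in>F. weight \<gamma> p q)"
  using assms unfolding stable_def by blast

text \<open>A cut that separates two tiles of a stable part is already paid for inside that part.
  This is the common reason why unions and limits stay stable.\<close>

lemma cut_from_sub:
  assumes st: "stable \<tau> \<alpha>" and le: "\<alpha> \<subseteq>\<^sub>m \<gamma>"
    and ne: "A \<inter> dom \<alpha> \<noteq> {}" "dom \<alpha> - A \<noteq> {}" and A: "A \<subseteq> dom \<gamma>"
  shows "\<exists>F. finite F \<and> F \<subseteq> A \<times> (dom \<gamma> - A) \<and> \<tau> \<le> (\<Sum>(p,q)\<in>F. weight \<gamma> p q)"
proof -
  have "dom \<alpha> - A \<inter> dom \<alpha> \<noteq> {}" using ne by auto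
  from stable_cutE[OF st _ ne(1) this] obtain F where F: "finite F"
    "F \<subseteq> (A \<inter> dom \<alpha>) \<times> (dom \<alpha> - A \<inter> dom \<alpha>)" "\<tau> \<le> (\<Sum>(p,q)\<in>F. weight \<alpha> p q)" by auto
  have "(\<Sum>(p,q)\<in>F. weight \<gamma> p q) = (\<Sum>(p,q)\<in>F. weight \<alpha> p q)"
  proof (intro sum.cong refl)
    fix x assume "x \<in> F"
    then have "fst x \<in> dom \<alpha>" "snd x \<in> dom \<alpha>" using F(2) by auto
    then show "(case x of (p, q) \<Rightarrow> weight \<gamma> p q) = (case x of (p, q) \<Rightarrow> weight \<alpha> p q)"
      using weight_mono_eq[OF le] by (simp add: case_prod_unfold)
  qed
  moreover have "dom \<alpha> \<subseteq> dom \<gamma>" using le by (rule map_le_implies_dom_le)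
  then have "F \<subseteq> A \<times> (dom \<gamma> - A)" using F(2) by blast
  ultimately show ?thesis using F(1,3) by metis
qed

lemma map_le_map_add_disj: "dom \<alpha> \<inter> dom \<beta> = {} \<Longrightarrow> \<alpha> \<subseteq>\<^sub>m \<alpha> ++ \<beta>"
  using map_add_comm map_le_map_add by metis

text \<open>Only the cut between the two parts is new; every other cut splits one of them.\<close>

lemma stable_join:
  assumes a: "stable \<tau> \<alpha>" and b: "stable \<tau> \<beta>" and dj: "dom \<alpha> \<inter> dom \<beta> = {}"
    and F: "finite F" "F \<subseteq> dom \<alpha> \<times> dom \<beta>" "\<tau> \<le> (\<Sum>(p,q)\<in>F. weight (\<alpha> ++ \<beta>) p q)"
  shows "stable \<tau> (\<alpha> ++ \<beta>)"
  unfolding stable_def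
proof (intro allI impI)
  let ?g = "\<alpha> ++ \<beta>"
  fix A assume A: "A \<subseteq> dom ?g \<and> A \<noteq> {} \<and> dom ?g - A \<noteq> {}"
  have la: "\<alpha> \<subseteq>\<^sub>m ?g" by (rule map_le_map_add_disj[OF dj])
  have lb: "\<beta> \<subseteq>\<^sub>m ?g" by simp
  consider "A \<inter> dom \<alpha> \<noteq> {}" "dom \<alpha> - A \<noteq> {}" | "A \<inter> dom \<beta> \<noteq> {}" "dom \<beta> - A \<noteq> {}"
    | "A = dom \<alpha>" | "A = dom \<beta>" using A dj unfolding dom_map_add by blast
  then show "\<exists>F. finite F \<and> F \<subseteq> A \<times> (dom ?g - A) \<and> \<tau> \<le> (\<Sum>(p,q)\<in>F. weight ?g p q)"
  proof cases
    case 1 then show ?thesis using cut_from_sub[OF a la] A by blast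
  next
    case 2 then show ?thesis using cut_from_sub[OF b lb] A by blast
  next
    case 3
    then have "F \<subseteq> A \<times> (dom ?g - A)" unfolding dom_map_add using F(2) dj by blast
    then show ?thesis using F by blast
  next
    case 4
    have inj: "inj_on prod.swap F" by simp
    have "(\<Sum>(p,q)\<in>prod.swap ` F. weight ?g p q) = (\<Sum>(p,q)\<in>F. weight ?g p q)"
      by (rule sum.reindex_cong[OF inj refl])
        (simp only: case_prod_unfold fst_swap snd_swap, rule weight_commute)
    then have w: "\<tau> \<le> (\<Sum>(p,q)\<in>prod.swap ` F. weight ?g p q)" using F(3) by (simp only:)
    have s1: "prod.swap ` F \<subseteq> dom \<beta> \<times> dom \<alpha>"
      using image_mono[OF F(2), of prod.swap] by (simp only: product_swap)
    have s2: "dom \<alpha> \<subseteq> dom ?g - A" unfolding dom_map_add 4 using dj by blast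
    have "prod.swap ` F \<subseteq> A \<times> (dom ?g - A)"
      by (rule subset_trans[OF s1]) (use s2 4 in \<open>simp add: Sigma_mono\<close>)
    then show ?thesis using w finite_imageI[OF F(1)] by (intro exI conjI)
  qed
qed

lemma stable_join_cut:
  assumes st: "stable \<tau> (\<alpha> ++ \<beta>)" and dj: "dom \<alpha> \<inter> dom \<beta> = {}"
    and ne: "dom \<alpha> \<noteq> {}" "dom \<beta> \<noteq> {}"
  obtains F where "finite F" "F \<subseteq> dom \<alpha> \<times> dom \<beta>" "\<tau> \<le> (\<Sum>(p,q)\<in>F. weight (\<alpha> ++ \<beta>) p q)"
proof -
  have d: "dom (\<alpha> ++ \<beta>) - dom \<alpha> = dom \<beta>" unfolding dom_map_add using dj by blast
  show ?thesis
  proof (rule stable_cutE[OF st, of "dom \<alpha>"])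
    show "dom \<alpha> \<subseteq> dom (\<alpha> ++ \<beta>)" by simp
  qed (use ne d that in \<open>simp_all del: dom_eq_empty_conv dom_map_add\<close>)
qed

text \<open>This dichotomy, one sufficient link or two links of whatever strength, is all that is
  later used about how a cut reaches the threshold.\<close>

lemma sum_ge_two_positive:
  fixes w :: "'a \<Rightarrow> nat"
  assumes "finite F" "\<tau> \<le> sum w F" "0 < \<tau>"
  shows "(\<exists>x\<in>F. \<tau> \<le> w x) \<or> (\<exists>x\<in>F. \<exists>y\<in>F. x \<noteq> y \<and> 0 < w x \<and> 0 < w y)"
proof (rule ccontr)
  assume n: "\<not> ?thesis"
  have "sum w F \<noteq> 0" using assms by linarith
  then obtain x where x: "x \<in> F" "0 < w x" by (metis gr0I sum.neutral)
  then have "w y = 0" if "y \<in> F - {x}" for y using n that by (metis DiffE insertI1 not_gr_zero)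
  then have "sum w F = w x" using sum.remove[OF assms(1) x(1), of w] by simp
  then show False using n x assms(2) by auto
qed

lemma chain_mono:
  assumes "\<And>k. f (Suc k) = f k ++ g k" "\<And>k. dom (f k) \<inter> dom (g k) = {}" "j \<le> k"
  shows "f j \<subseteq>\<^sub>m f k"
  using assms(3)
proof (induction rule: dec_induct)
  case (step k)
  have "f k \<subseteq>\<^sub>m f (Suc k)" using assms(1,2) map_le_map_add_disj by metis
  then show ?case using step.IH map_le_trans by blast
qed simp

lemma chain_lim_Some_iff:
  assumes "\<And>j k. j \<le> k \<Longrightarrow> f j \<subseteq>\<^sub>m f k"
  shows "chain_lim f p = Some t \<longleftrightarrow> (\<exists>k. f k p = Some t)"
proof
  assume "chain_lim f p = Some t"
  then show "\<exists>k. f k p = Some t" unfolding chain_lim_def by (auto split: if_splits)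
next
  assume "\<exists>k. f k p = Some t"
  then obtain k where k: "f k p = Some t" by auto
  let ?j = "LEAST k. f k p \<noteq> None"
  have j: "f ?j p \<noteq> None" using k by (intro LeastI[of "\<lambda>k. f k p \<noteq> None" k]) simp
  have "?j \<le> k" using k by (intro Least_le) simp
  then have "f ?j p = f k p" using assms[of ?j k] j by (auto simp: map_le_def domIff)
  then show "chain_lim f p = Some t" using j k unfolding chain_lim_def by auto
qed

lemma chain_lim_le:
  assumes "\<And>j k. j \<le> k \<Longrightarrow> f j \<subseteq>\<^sub>m f k"
  shows "f k \<subseteq>\<^sub>m chain_lim f"
  using chain_lim_Some_iff[of f, OF assms] unfolding map_le_def by force

lemma stable_chain_lim:
  assumes mono: "\<And>j k. j \<le> k \<Longrightarrow> f j \<subseteq>\<^sub>m f k" and st: "\<And>k. stable \<tau> (f (Suc k))"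
  shows "stable \<tau> (chain_lim f)"
  unfolding stable_def
proof (intro allI impI)
  fix A assume A: "A \<subseteq> dom (chain_lim f) \<and> A \<noteq> {} \<and> dom (chain_lim f) - A \<noteq> {}"
  then obtain p q where p: "p \<in> A" and q: "q \<in> dom (chain_lim f) - A" by (metis all_not_in_conv)
  obtain j where j: "p \<in> dom (f j)" using p A chain_lim_Some_iff[of f, OF mono] by blast
  obtain k where k: "q \<in> dom (f k)" using q chain_lim_Some_iff[of f, OF mono] by blast
  \<comment> \<open>A single stage that meets both sides of the cut; the successor is taken because
    only successor stages are assumed stable.\<close>
  let ?l = "Suc (max j k)"
  have "dom (f j) \<subseteq> dom (f ?l)" "dom (f k) \<subseteq> dom (f ?l)"
    by (intro map_le_implies_dom_le mono; simp)+
  then have "A \<inter> dom (f ?l) \<noteq> {}" "dom (f ?l) - A \<noteq> {}" using p q j k by blast+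
  moreover have "f ?l \<subseteq>\<^sub>m chain_lim f" by (rule chain_lim_le[of f, OF mono])
  ultimately show "\<exists>F. finite F \<and> F \<subseteq> A \<times> (dom (chain_lim f) - A) \<and>
      \<tau> \<le> (\<Sum>(p,q)\<in>F. weight (chain_lim f) p q)"
    using cut_from_sub[OF st, of "max j k" "chain_lim f" A] A by simp
qed

lemma producible_is_supertile: "A \<in> producible \<tau> T \<Longrightarrow> is_supertile A"
proof (induction rule: producible.induct)
  case (single t)
  then show ?case unfolding is_supertile_def by (metis map_upd_nonempty)
next
  case (comb A B C)
  then obtain \<alpha> \<beta> where C: "C = supertile_of (\<alpha> ++ \<beta>)" "\<alpha> \<in> A" unfolding combination_def by auto
  obtain \<alpha>0 where a: "\<alpha>0 \<noteq> Map.empty" "A = supertile_of \<alpha>0" using comb.IH(1) unfolding is_supertile_def by auto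
  then obtain v where "\<alpha> = translate \<alpha>0 v" using C(2) unfolding supertile_of_def by auto
  then have "\<alpha>0 = translate \<alpha> (- v)" by simp
  then have "\<alpha> \<noteq> Map.empty" using a(1) by (auto simp: translate_def fun_eq_iff)
  then have "\<alpha> ++ \<beta> \<noteq> Map.empty" by simp
  then show ?case using C(1) unfolding is_supertile_def by blast
next
  case (limit f g)
  obtain \<alpha>0 where a: "\<alpha>0 \<noteq> Map.empty" "supertile_of (f 0) = supertile_of \<alpha>0" using limit.IH(1) unfolding is_supertile_def by auto
  then obtain v where "\<alpha>0 = translate (f 0) v" using self_in_supertile unfolding supertile_of_def by blast
  then have "f 0 \<noteq> Map.empty" using a(1) by (auto simp: translate_def fun_eq_iff)
  then have "dom (f 0) \<noteq> {}" by simp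
  moreover have "dom (f 0) \<subseteq> dom (chain_lim f)"
    by (intro map_le_implies_dom_le chain_lim_le chain_mono[of f g, OF limit.hyps(4,3)])
  ultimately have "chain_lim f \<noteq> Map.empty" by auto
  then show ?case unfolding is_supertile_def by blast
qed

lemma is_supertile_nonempty:
  assumes "is_supertile A" "\<alpha> \<in> A" shows "\<alpha> \<noteq> Map.empty"
proof -
  obtain \<alpha>0 where a: "\<alpha>0 \<noteq> Map.empty" "A = supertile_of \<alpha>0" using assms(1) unfolding is_supertile_def by auto
  then obtain v where "\<alpha> = translate \<alpha>0 v" using assms(2) unfolding supertile_of_def by auto
  then have "\<alpha>0 = translate \<alpha> (- v)" by simp
  then show ?thesis using a(1) by (auto simp: translate_def fun_eq_iff)
qed

lemma is_supertile_eq: "is_supertile A \<Longrightarrow> \<alpha> \<in> A \<Longrightarrow> A = supertile_of \<alpha>"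
  unfolding is_supertile_def using supertile_of_eqI by metis

lemma producible_stable: "A \<in> producible \<tau> T \<Longrightarrow> \<alpha> \<in> A \<Longrightarrow> stable \<tau> \<alpha>"
proof (induction arbitrary: \<alpha> rule: producible.induct)
  case (single t)
  then show ?case unfolding supertile_of_def using stable_translate[OF stable_single] by auto
next
  case (comb A B C)
  then show ?case unfolding combination_def supertile_of_def by (auto intro: stable_translate)
next
  case (limit f g)
  have "stable \<tau> (chain_lim f)"
    by (rule stable_chain_lim[of f, OF chain_mono[of f g, OF limit.hyps(4,3)] limit.hyps(5)])
  then show ?case using limit.prems unfolding supertile_of_def by (auto intro: stable_translate)
qed

section \<open>The tile set\<close>

datatype dr = DN | DE | DS | DW

fun vec :: "dr \<Rightarrow> pos" where
  "vec DN = (0, 1)" | "vec DE = (1, 0)" | "vec DS = (0, -1)" | "vec DW = (-1, 0)"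

fun opp :: "dr \<Rightarrow> dr" where
  "opp DN = DS" | "opp DE = DW" | "opp DS = DN" | "opp DW = DE"

fun lft :: "dr \<Rightarrow> dr" where
  "lft DN = DW" | "lft DW = DS" | "lft DS = DE" | "lft DE = DN"

abbreviation rgt :: "dr \<Rightarrow> dr" where "rgt h \<equiv> opp (lft h)"

text \<open>The direction in which the rows of a strip are counted. Opposite sides count the same
  way, so facing strips can be compared row by row.\<close>

fun fw :: "dr \<Rightarrow> dr" where
  "fw DE = DN" | "fw DW = DN" | "fw DN = DW" | "fw DS = DW"

text \<open>Of two facing strips exactly one is high; high and low strips use disjoint rows of the
  line they share.\<close>

fun hi :: "dr \<Rightarrow> bool" where
  "hi DE = True" | "hi DN = True" | "hi DW = False" | "hi DS = False"

lemma opp_opp [simp]: "opp (opp d) = d" by (cases d) auto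
lemma opp_eq_iff [simp]: "opp d = opp d' \<longleftrightarrow> d = d'" by (cases d; cases d') auto
lemma opp_neq [simp]: "opp d \<noteq> d" "d \<noteq> opp d" by (cases d; simp)+
lemma vec_opp: "vec (opp d) = - vec d" by (cases d) auto
lemma vec_inj [simp]: "vec d = vec d' \<longleftrightarrow> d = d'" by (cases d; cases d') auto
lemma vec_nz [simp]: "vec d \<noteq> 0" by (cases d) (auto simp: zero_prod_def)
lemma dr_UNIV: "(UNIV :: dr set) = {DN, DE, DS, DW}" using dr.exhaust by auto
lemma dr_all: "(\<forall>d. P d) \<longleftrightarrow> P DN \<and> P DE \<and> P DS \<and> P DW" by (metis dr.exhaust)

text \<open>A cell is a square spiral around a seed. Ring \<open>j\<close> carries a symbol: \<open>Sy c b\<close> with a bounded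
  counter \<open>c\<close> and one bit \<open>b\<close> of the encoded word, \<open>PP\<close> on the last but one ring and \<open>FF\<close> on the last.\<close>

datatype sym = Sy nat bool | PP | FF

text \<open>\<open>0\<close> and \<open>99\<close> lie outside the counter range. \<open>0\<close>
  announces that the final ring comes next; \<open>99\<close> is never sent, since the final ring
  emits \<open>StripL\<close> in place of \<open>StL\<close>.\<close>

fun cls :: "sym \<Rightarrow> nat" where
  "cls (Sy c b) = c" | "cls PP = 0" | "cls FF = 99"

text \<open>What a ring tells the tiles outside it: \<open>Ax\<close> marks the middle of a side,
  \<open>Co\<close> the place just before a corner, \<open>Cn\<close> the place just after one,
  \<open>En\<close> the end of a ring, \<open>Sd\<close> a place beside the seed, \<open>Pl\<close>
  any other place.\<close>

datatype ic = Pl | Ax | Co | Cn | En | Sd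

text \<open>All glues are directed: a glue carries one of the following messages from an output side of a tile to an
  input side of its neighbour.\<close>

datatype cont = Pth sym | CorL sym | StL nat | St1L | Wl bool ic | StripL | Nxt dr nat | Sg dr nat
  | Tl1 dr nat | Tl2 dr nat | LfS dr nat | LfV dr nat | Neu nat | CorS

instance dr :: countable by countable_datatype
instance sym :: countable by countable_datatype
instance ic :: countable by countable_datatype
instance cont :: countable by countable_datatype

fun strong :: "cont \<Rightarrow> bool" where
  "strong (CorL s) = True" | "strong (StL c) = True" | "strong St1L = True" | "strong StripL = True"
| "strong (Sg o' r) = True" | "strong (Tl1 o' r) = True" | "strong (Tl2 o' r) = True"
| "strong CorS = True" | "strong _ = False"

text \<open>\<open>Neu 13\<close> and \<open>Neu 19\<close> are the bonds meant to hold neighbouring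
  cells together; with strengths \<open>\<tau> - 1\<close> and \<open>1\<close> neither suffices
  alone.\<close>

fun heavy :: "cont \<Rightarrow> bool" where
  "heavy (Pth s) = True" | "heavy (Nxt o' r) = True" | "heavy (LfV o' r) = True"
| "heavy (Neu r) = (r = 13)" | "heavy _ = False"

definition str :: "nat \<Rightarrow> cont \<Rightarrow> nat" where
  "str \<tau> c = (if strong c then \<tau> else if heavy c then \<tau> - 1 else 1)"

text \<open>\<open>St1\<close>, \<open>St\<close>, \<open>Run\<close>, \<open>Cor\<close> are the first tile, the edge tiles and the corners of a ring. Along each
  side of the finished square runs a strip of tiles \<open>Sc\<close>; at certain rows it carries a tooth of two tiles \<open>T1\<close>,
  \<open>T2\<close> or a leaf \<open>Lf\<close>, all placed in the line shared with the neighbouring cell. \<open>KC\<close> turns the corner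
  from the east strip to the north strip. The number in a strip tile is the state of its row.\<close>

datatype kind = Seed | St1 sym | St nat sym | Run dr sym ic | Cor dr sym | Sc dr nat | T1 dr nat
  | T2 dr nat | Lf dr nat | KC

text \<open>Arguments are row states, not row numbers. A tooth covers its row and the next (tooth
  \<open>21\<close> only its own), so together with the leaves the shared line is divided into high
  1-2, low 3-6, high 7-8, low 9-10, high 11-13, low 14-16, high 17-19, low 20-21. States 7 to 10
  repeat until the middle row, which has state 11.\<close>

definition tooth :: "dr \<Rightarrow> nat \<Rightarrow> bool" where
  "tooth o' r = (if hi o' then r \<in> {1, 7, 11, 17} else r \<in> {3, 5, 9, 15, 21})"

definition leafr :: "dr \<Rightarrow> nat \<Rightarrow> bool" where
  "leafr o' r = (if hi o' then r \<in> {13, 19} else r \<in> {14, 20})"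

definition nxr :: "dr \<Rightarrow> nat \<Rightarrow> nat" where
  "nxr o' r = (if r = 10 then 7 else if o' = DE \<and> r = 20 then 20 else r + 1)"

text \<open>The label under which a row is announced. The row before cannot know whether the middle
  row (\<open>11\<close> instead of \<open>9\<close>) or the end of the east strip
  (\<open>21\<close> instead of \<open>20\<close>) comes next; both candidates share a label and the
  wall class \<open>wlc\<close> decides.\<close>

definition lb :: "dr \<Rightarrow> nat \<Rightarrow> nat" where
  "lb o' r = (if r = 11 then 9 else if o' = DE \<and> r = 21 then 20 else r)"

definition wlc :: "dr \<Rightarrow> nat \<Rightarrow> ic" where
  "wlc o' r = (if r = 11 then Ax else if o' = DN \<and> r = 0 then Cn else if o' = DE \<and> r = 21 then Co else Pl)"

text \<open>Every tile other than the seed has one input of strength \<open>\<tau>\<close> (for strip tiles: if \<open>stst\<close> or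
  \<open>sgt\<close> holds), or two weak inputs of strengths \<open>\<tau> - 1\<close> and \<open>1\<close>.\<close>

definition stst :: "dr \<Rightarrow> nat \<Rightarrow> bool" where
  "stst o' r \<longleftrightarrow> r = 0 \<and> (o' = DE \<or> o' = DS) \<or> r = 1 \<and> o' = DW"

text \<open>The rows of the high leaves. A high leaf may be there before the strip tile beside it; a
  single strong input prevents that tile from being held by the leaf and only one of two weak
  inputs.\<close>

definition sgt :: "dr \<Rightarrow> nat \<Rightarrow> bool" where
  "sgt o' r \<longleftrightarrow> hi o' \<and> (r = 13 \<or> r = 19)"

text \<open>A tooth interrupts its strip: its row sends no \<open>Nxt\<close>, and the next row
  receives it from the tip \<open>T2\<close>. Hence a strip cannot grow past a missing tooth. The
  flag \<open>True\<close> in \<open>Wl\<close> marks the final ring, whose walls no further ring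
  accepts.\<close>

fun out :: "kind \<Rightarrow> dr \<Rightarrow> cont option" where
  "out Seed d = (case d of DE \<Rightarrow> Some St1L | DS \<Rightarrow> Some (Wl False Ax) | _ \<Rightarrow> Some (Wl False Sd))"
| "out (St1 s) d = (case d of DN \<Rightarrow> Some (CorL s) | DS \<Rightarrow> Some (Wl False En) | DE \<Rightarrow> Some (Wl False Ax) | DW \<Rightarrow> None)"
| "out (St c s) d = (case d of DN \<Rightarrow> Some (Pth s) | DS \<Rightarrow> Some (Wl False En) | DE \<Rightarrow> Some (Wl (s = FF) Pl) | DW \<Rightarrow> None)"
| "out (Run h s c) d =
    (if d = h then Some (if h = DE then (if c = En then (if s = FF then StripL else StL (cls s)) else Pth s)
        else if c = Co \<or> c = Sd then CorL s else Pth s)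
     else if d = rgt h then Some (if s = FF \<and> (h = DE \<and> c = En \<or> h = DS \<and> c = Co) then StripL
        else Wl (s = FF) (if c = Ax \<or> c = Sd then Ax else Pl))
     else None)"
| "out (Cor h s) d = (if d = lft h then Some (Pth s) else if d = rgt h then Some (Wl (s = FF) Co)
     else if d = h then Some (Wl (s = FF) Cn) else None)"
| "out (Sc o' r) d =
    (if d = o' then (if tooth o' r then Some (Tl1 o' r) else if leafr o' r then Some (LfS o' r) else None)
     else if d = fw o' then
       (if tooth o' r then None else if sgt o' (r + 1) then Some (Sg o' (r + 1))
        else if o' = DE \<and> r = 21 then Some CorS else if o' = DN \<and> r = 19 then None
        else Some (Nxt o' (lb o' (nxr o' r))))
     else None)"
| "out (T1 o' r) d =
    (if d = fw o' then (if r = 21 then None else Some (Tl2 o' r))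
     else if d = opp (fw o') then (if \<not> hi o' \<and> (r = 15 \<or> r = 21) then Some (LfV o' (r - 1)) else None)
     else None)"
| "out (T2 o' r) d =
    (if d = opp o' then Some (Nxt o' (r + 1))
     else if d = fw o' then (if hi o' \<and> (r = 11 \<or> r = 17) then Some (LfV o' (r + 2)) else None)
     else None)"
| "out (Lf o' r) d = (if hi o' \<and> d = fw o' then Some (Neu r) else None)"
| "out KC d = (if d = DW then Some (Nxt DN 0) else None)"

fun inp :: "kind \<Rightarrow> dr \<Rightarrow> cont option" where
  "inp Seed d = None"
| "inp (St1 s) d = (if d = DW then Some St1L else None)"
| "inp (St c s) d = (if d = DW then Some (StL c) else None)"
| "inp (Run h s c) d = (if d = opp h then Some (Pth s) else if d = lft h then Some (Wl False c) else None)"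
| "inp (Cor h s) d = (if d = opp h then Some (CorL s) else None)"
| "inp (Sc o' r) d =
    (if stst o' r then (if d = opp o' then Some StripL else None)
     else if sgt o' r then (if d = opp (fw o') then Some (Sg o' r) else None)
     else if d = opp o' then Some (Wl True (wlc o' r))
     else if d = (if 0 < r \<and> tooth o' (r - 1) then o' else opp (fw o')) then Some (Nxt o' (lb o' r))
     else None)"
| "inp (T1 o' r) d = (if d = opp o' then Some (Tl1 o' r) else None)"
| "inp (T2 o' r) d = (if d = opp (fw o') then Some (Tl2 o' r) else None)"
| "inp (Lf o' r) d =
    (if d = opp o' then Some (LfS o' r)
     else if hi o' then (if d = opp (fw o') then Some (LfV o' r) else None)
     else if d = fw o' then Some (LfV o' r) else if d = opp (fw o') then Some (Neu (r - 1)) else None)"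
| "inp KC d = (if d = DS then Some CorS else None)"

fun oks :: "sym \<Rightarrow> bool" where
  "oks (Sy c b) = (1 \<le> c \<and> c \<le> 15)" | "oks PP = True" | "oks FF = True"

definition nxc :: "nat \<Rightarrow> nat" where "nxc c = (if c = 15 then 12 else c + 1)"

text \<open>The free choices of a growing cell sit in \<open>St1\<close> and \<open>St\<close>: a
  bit for each ring, and after counter \<open>11\<close> or \<open>15\<close> the option to announce
  the end by \<open>PP\<close>.\<close>

fun okk :: "kind \<Rightarrow> bool" where
  "okk Seed = True"
| "okk (St1 s) = (\<exists>b. s = Sy 1 b)"
| "okk (St c s) = (c = 0 \<and> s = FF \<or> 1 \<le> c \<and> c \<le> 15 \<and> (\<exists>b. s = Sy (nxc c) b) \<or> (c = 11 \<or> c = 15) \<and> s = PP)"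
| "okk (Run h s c) = oks s"
| "okk (Cor h s) = (h \<noteq> DE \<and> oks s)"
| "okk (Sc o' r) = (r \<le> 21 \<and> (o' = DN \<longrightarrow> r \<le> 19) \<and> (o' = DW \<longrightarrow> 1 \<le> r))"
| "okk (T1 o' r) = tooth o' r"
| "okk (T2 o' r) = (tooth o' r \<and> r \<noteq> 21)"
| "okk (Lf o' r) = leafr o' r"
| "okk KC = True"

definition flow :: "kind \<Rightarrow> dr \<Rightarrow> kind \<Rightarrow> cont \<Rightarrow> bool" where
  "flow k d k' c \<longleftrightarrow> out k d = Some c \<and> inp k' (opp d) = Some c"

text \<open>The direction of flow is part of the label; otherwise two tiles that both send, or both
  expect, the same message would bind.\<close>

definition lab :: "kind \<Rightarrow> dr \<Rightarrow> (dr \<times> cont) option" where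
  "lab k d = (case out k d of Some c \<Rightarrow> Some (d, c)
     | None \<Rightarrow> (case inp k d of Some c \<Rightarrow> Some (opp d, c) | None \<Rightarrow> None))"

definition gl :: "nat \<Rightarrow> kind \<Rightarrow> dr \<Rightarrow> glue" where
  "gl \<tau> k d = (case lab k d of None \<Rightarrow> ([], 0) | Some l \<Rightarrow> (replicate (to_nat l) CHR ''x'', str \<tau> (snd l)))"

definition tile :: "nat \<Rightarrow> kind \<Rightarrow> tile" where
  "tile \<tau> k = Tile (gl \<tau> k DN) (gl \<tau> k DE) (gl \<tau> k DS) (gl \<tau> k DW)"

type_synonym kasm = "pos \<Rightarrow> kind option"

definition tl :: "nat \<Rightarrow> kasm \<Rightarrow> assembly" where
  "tl \<tau> \<kappa> = (\<lambda>p. map_option (tile \<tau>) (\<kappa> p))"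

definition UU :: "nat \<Rightarrow> tile set" where "UU \<tau> = tile \<tau> ` {k. okk k}"

lemma finite_UU: "finite (UU \<tau>)"
proof -
  let ?S = "{s. oks s}"
  have "?S \<subseteq> (\<lambda>(c,b). Sy c b) ` ({..15} \<times> UNIV) \<union> {PP, FF}"
  proof
    fix s assume "s \<in> ?S" then show "s \<in> (\<lambda>(c,b). Sy c b) ` ({..15} \<times> UNIV) \<union> {PP, FF}"
      by (cases s) auto
  qed
  then have S: "finite ?S" by (rule finite_subset) simp
  have I: "finite (UNIV :: ic set)"
    by (rule finite_subset[of _ "{Pl, Ax, Co, Cn, En, Sd}"]) (auto intro: ic.exhaust)
  have D: "finite (UNIV :: dr set)" by (simp add: dr_UNIV)
  let ?N = "{..21::nat}"
  let ?K = "{Seed, KC} \<union> St1 ` ?S \<union> (\<lambda>(c,s). St c s) ` (?N \<times> ?S)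
    \<union> (\<lambda>(h,s,c). Run h s c) ` (UNIV \<times> ?S \<times> UNIV) \<union> (\<lambda>(h,s). Cor h s) ` (UNIV \<times> ?S)
    \<union> (\<lambda>(h,s). Sc h s) ` (UNIV \<times> ?N) \<union> (\<lambda>(h,s). T1 h s) ` (UNIV \<times> ?N)
    \<union> (\<lambda>(h,s). T2 h s) ` (UNIV \<times> ?N) \<union> (\<lambda>(h,s). Lf h s) ` (UNIV \<times> ?N)"
  have "{k. okk k} \<subseteq> ?K"
  proof
    fix k assume "k \<in> {k. okk k}" then show "k \<in> ?K"
      by (cases k) (auto simp: image_iff tooth_def leafr_def nxc_def split: if_splits)
  qed
  moreover have "finite ?K" using S I D by simp
  ultimately show ?thesis unfolding UU_def by (meson finite_imageI finite_subset)
qed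

section \<open>Directed links and recovery of a kind from its tile\<close>

lemma out_inp_disjoint:
  assumes "okk k" "out k d = Some c" shows "inp k d = None"
proof (cases k)
  case (Run h s c) then show ?thesis using assms by (cases h; cases d) (auto split: if_splits)
next
  case (Cor h s) then show ?thesis using assms by (cases h; cases d) (auto split: if_splits)
next
  case (Sc h s) then show ?thesis using assms
    by (cases h; cases d) (auto simp: tooth_def leafr_def stst_def sgt_def split: if_splits)
next
  case (T1 h s) then show ?thesis using assms by (cases h; cases d) (auto split: if_splits)
next
  case (T2 h s) then show ?thesis using assms by (cases h; cases d) (auto split: if_splits)
next
  case (Lf h s) then show ?thesis using assms by (cases h; cases d) (auto split: if_splits)
qed (use assms in \<open>auto split: dr.splits if_splits\<close>)

lemma lab_out: "lab k d = Some (d, c) \<longleftrightarrow> out k d = Some c"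
  by (auto simp: lab_def split: option.splits)

lemma lab_inp: "okk k \<Longrightarrow> lab k d = Some (opp d, c) \<longleftrightarrow> inp k d = Some c"
  using out_inp_disjoint by (force simp: lab_def split: option.splits)

lemma lab_dir: "lab k d = Some (e, c) \<Longrightarrow> e = d \<or> e = opp d"
  by (auto simp: lab_def split: option.splits)

lemma str_pos: "1 < \<tau> \<Longrightarrow> 0 < str \<tau> c"
  by (simp add: str_def)

lemma gl_eq: "1 < \<tau> \<Longrightarrow> gl \<tau> k d = gl \<tau> k' d' \<longleftrightarrow> lab k d = lab k' d'"
  using str_pos[of \<tau>] by (auto simp: gl_def split: option.splits dest: arg_cong[where f = length])

lemma gl_pos: "1 < \<tau> \<Longrightarrow> 0 < snd (gl \<tau> k d) \<longleftrightarrow> lab k d \<noteq> None"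
  using str_pos[of \<tau>] by (auto simp: gl_def split: option.splits)

lemma tile_sel [simp]: "glueN (tile \<tau> k) = gl \<tau> k DN" "glueE (tile \<tau> k) = gl \<tau> k DE"
  "glueS (tile \<tau> k) = gl \<tau> k DS" "glueW (tile \<tau> k) = gl \<tau> k DW"
  by (simp_all add: tile_def)

definition lk :: "nat \<Rightarrow> kind \<Rightarrow> dr \<Rightarrow> kind \<Rightarrow> nat" where
  "lk \<tau> k d k' = (if gl \<tau> k d = gl \<tau> k' (opp d) then snd (gl \<tau> k d) else 0)"

lemma weight_adj:
  assumes "\<kappa> p = Some k" "\<kappa> (p + vec d) = Some k'"
  shows "weight (tl \<tau> \<kappa>) p (p + vec d) = lk \<tau> k d k'"
proof -
  obtain x y where p: "p = (x, y)" by fastforce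
  show ?thesis using assms unfolding p
    by (cases d) (auto simp: weight_def bond_def tl_def lk_def)
qed

lemma weight_nonadj:
  assumes "\<And>d. q \<noteq> p + vec d" shows "weight \<alpha> p q = 0"
proof -
  have "q \<noteq> (fst p + 1, snd p)" "q \<noteq> (fst p, snd p + 1)" "p \<noteq> (fst q + 1, snd q)" "p \<noteq> (fst q, snd q + 1)"
    using assms[of DE] assms[of DN] assms[of DW] assms[of DS] by (auto simp: prod_eq_iff)
  then show ?thesis by (simp add: weight_def bond_def split: option.splits)
qed

lemma lk_flow:
  assumes "okk k" "okk k'" "flow k d k' c" shows "lk \<tau> k d k' = str \<tau> c"
proof -
  have "lab k d = Some (d, c)" using assms(3) by (simp add: flow_def lab_out)
  moreover have "lab k' (opp d) = Some (d, c)"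
    using lab_inp[OF assms(2), of "opp d" c] assms(3) by (simp add: flow_def)
  ultimately show ?thesis by (simp add: lk_def gl_def)
qed

lemma lk_flow':
  assumes "okk k" "okk k'" "flow k' (opp d) k c" shows "lk \<tau> k d k' = str \<tau> c"
proof -
  have "lab k' (opp d) = Some (opp d, c)" using assms(3) by (simp add: flow_def lab_out)
  moreover have "lab k d = Some (opp d, c)"
    using lab_inp[OF assms(1), of d c] assms(3) by (simp add: flow_def)
  ultimately show ?thesis by (simp add: lk_def gl_def)
qed

lemma lk_posE:
  assumes "okk k" "okk k'" "0 < lk \<tau> k d k'" "1 < \<tau>"
  obtains c where "flow k d k' c" | c where "flow k' (opp d) k c"
proof -
  have g: "gl \<tau> k d = gl \<tau> k' (opp d)" "0 < snd (gl \<tau> k d)"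
    using assms(3) unfolding lk_def by (simp_all split: if_splits)
  have "lab k d \<noteq> None" using g(2) gl_pos[OF assms(4)] by simp
  then obtain e c where l1: "lab k d = Some (e, c)" by auto
  have l2: "lab k' (opp d) = Some (e, c)" using g(1) l1 gl_eq[OF assms(4)] by simp
  note l = l1 l2
  from lab_dir[OF l(1)] show ?thesis
  proof
    assume "e = d"
    then have "flow k d k' c" using l lab_out[of k d c] lab_inp[OF assms(2), of "opp d" c] by (simp add: flow_def)
    then show ?thesis using that by blast
  next
    assume "e = opp d"
    then have "flow k' (opp d) k c" using l lab_out[of k' "opp d" c] lab_inp[OF assms(1), of d c] by (simp add: flow_def)
    then show ?thesis using that by blast
  qed
qed

lemma fw_neq [simp]: "fw d \<noteq> d" "d \<noteq> fw d" "opp (fw d) \<noteq> d" "d \<noteq> opp (fw d)" "opp d \<noteq> fw d" "fw d \<noteq> opp d"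
  by (cases d; simp)+

lemma lft_neq [simp]: "lft d \<noteq> d" "d \<noteq> lft d" "opp (lft d) \<noteq> d" "d \<noteq> opp (lft d)" "opp d \<noteq> lft d" "lft d \<noteq> opp d"
  by (cases d; simp)+

text \<open>Inputs alone identify every kind except \<open>St1\<close> and \<open>St\<close>, whose
  freely chosen symbol shows in the output to the north. This is what allows kinds to be read back
  from tiles.\<close>

lemma inp_inj:
  assumes ok: "okk k" "okk k'" and e: "\<And>d. inp k d = inp k' d" "\<And>d. out k d = out k' d"
  shows "k = k'"
proof (cases k)
  case Seed
  have "inp k' d = None" for d using e(1)[of d] Seed by simp
  from this[of DN] this[of DE] this[of DS] this[of DW] show ?thesis using Seed
    by (cases k') (auto simp: dr_all split: if_splits elim: dr.exhaust; metis dr.exhaust opp.simps)+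
next
  case (St1 s)
  then show ?thesis using e(1)[of DW] e(2)[of DN] ok by (cases k') (auto split: if_splits)
next
  case (St c s)
  then show ?thesis using e(1)[of DW] e(2)[of DN] by (cases k') (auto split: if_splits)
next
  case (Run h s c)
  then show ?thesis using e(1)[of "opp h"] e(1)[of "lft h"] by (cases k') (auto split: if_splits)
next
  case (Cor h s)
  then show ?thesis using e(1)[of "opp h"] by (cases k') (auto split: if_splits)
next
  case (Sc o' r)
  show ?thesis
  proof (cases "stst o' r")
    case True
    then show ?thesis using Sc e(1)[of "opp o'"] by (cases k') (auto simp: stst_def split: if_splits)
  next
    case F: False
    show ?thesis
    proof (cases "sgt o' r")
      case True
      then show ?thesis using Sc F e(1)[of "opp (fw o')"] by (cases k') (auto split: if_splits)
    next
      case False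
      then show ?thesis using Sc F ok e(1)[of "opp o'"] e(1)[of "if 0 < r \<and> tooth o' (r - 1) then o' else opp (fw o')"]
        by (cases k') (auto simp: lb_def wlc_def split: if_splits)
    qed
  qed
next
  case (T1 o' r)
  then show ?thesis using e(1)[of "opp o'"] by (cases k') (auto split: if_splits)
next
  case (T2 o' r)
  then show ?thesis using e(1)[of "opp (fw o')"] by (cases k') (auto split: if_splits)
next
  case (Lf o' r)
  then show ?thesis using e(1)[of "opp o'"] by (cases k') (auto split: if_splits)
next
  case KC
  then show ?thesis using e(1)[of DS] by (cases k') (auto split: if_splits)
qed

lemma lab_inj:
  assumes ok: "okk k" "okk k'" and e: "\<And>d. lab k d = lab k' d"
  shows "k = k'"
proof (rule inp_inj[OF ok])
  fix d
  show "out k d = out k' d" using e[of d] lab_out[of k d] lab_out[of k' d] by (metis not_None_eq)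
  show "inp k d = inp k' d" using e[of d] lab_inp[OF ok(1), of d] lab_inp[OF ok(2), of d] by (metis not_None_eq)
qed

lemma tile_inj: "1 < \<tau> \<Longrightarrow> okk k \<Longrightarrow> okk k' \<Longrightarrow> tile \<tau> k = tile \<tau> k' \<Longrightarrow> k = k'"
proof (rule lab_inj)
  fix d assume t: "1 < \<tau>" and e: "tile \<tau> k = tile \<tau> k'"
  have "gl \<tau> k d = gl \<tau> k' d" using e by (cases d) (simp_all add: tile_def)
  then show "lab k d = lab k' d" using gl_eq[OF t] by simp
qed

section \<open>The layout of a cell\<close>

text \<open>A slot names a place in a cell with \<open>n\<close> rings; \<open>n = 0\<close> stands for a spiral whose number of rings is
  not yet decided. \<open>Rg j h i\<close> is the \<open>i\<close>-th tile of the side with heading \<open>h\<close> of ring \<open>j\<close>.\<close>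

datatype slot = SS | Rg nat dr nat | Col dr nat | M1 dr nat | M2 dr nat | Le dr nat | KK

definition cnt :: "nat \<Rightarrow> nat" where "cnt j = (if j \<le> 15 then j else 12 + j mod 4)"

text \<open>For \<open>n = 0\<close> neither exceptional case occurs on a ring
  \<open>j \<ge> 1\<close>, so an undecided spiral carries counters only.\<close>

definition sym_at :: "nat \<Rightarrow> (nat \<Rightarrow> bool) \<Rightarrow> nat \<Rightarrow> sym" where
  "sym_at n w j = (if j = n then FF else if j + 1 = n then PP else Sy (cnt j) (w j))"

definition okn :: "nat \<Rightarrow> bool" where "okn n \<longleftrightarrow> n = 0 \<or> 13 \<le> n \<and> n mod 4 = 1"

fun hn :: "dr \<Rightarrow> nat" where "hn DN = 0" | "hn DW = 1" | "hn DS = 2" | "hn DE = 3"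

definition icl :: "nat \<Rightarrow> dr \<Rightarrow> nat \<Rightarrow> ic" where
  "icl j h i = (if h = DE \<and> i + 1 = 2 * j then En
     else if j = 1 then (if h = DE then Ax else Sd)
     else if i = 0 then Cn else if i + 2 = 2 * j \<and> h \<noteq> DE then Co else if i + 1 = j then Ax else Pl)"

text \<open>The east strip idles in state \<open>20\<close> because it has to reach the corner,
  however far away, before the north strip can start; the other strips stop a fixed number of rows
  beyond the middle.\<close>

definition rs :: "nat \<Rightarrow> dr \<Rightarrow> nat \<Rightarrow> nat" where
  "rs n o' g = (if g < 7 then g else if g < n then 7 + (g - 7) mod 4
     else if o' = DE \<and> n + 9 \<le> g then (if g < 2 * n then 20 else 21) else 11 + (g - n))"

fun knd :: "nat \<Rightarrow> (nat \<Rightarrow> bool) \<Rightarrow> slot \<Rightarrow> kind" where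
  "knd n w SS = Seed"
| "knd n w (Rg j h i) =
     (if h = DN \<and> i = 0 then (if j = 1 then St1 (sym_at n w 1) else St (cls (sym_at n w (j - 1))) (sym_at n w j))
      else if h \<noteq> DE \<and> i + 1 = 2 * j then Cor h (sym_at n w j) else Run h (sym_at n w j) (icl j h i))"
| "knd n w (Col o' g) = Sc o' (rs n o' g)"
| "knd n w (M1 o' g) = T1 o' (rs n o' g)"
| "knd n w (M2 o' g) = T2 o' (rs n o' g)"
| "knd n w (Le o' g) = Lf o' (rs n o' g)"
| "knd n w KK = KC"

fun top :: "nat \<Rightarrow> dr \<Rightarrow> nat" where
  "top n DE = 2 * n" | "top n DN = n + 8" | "top n DS = n + 10" | "top n DW = n + 10"

text \<open>The west strip lacks row \<open>0\<close>: it leaves from the last \<open>Run\<close>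
  tile of the south-going side, one place before the corner.\<close>

definition vcol :: "nat \<Rightarrow> dr \<Rightarrow> nat \<Rightarrow> bool" where
  "vcol n o' g \<longleftrightarrow> n \<noteq> 0 \<and> g \<le> top n o' \<and> (o' = DW \<longrightarrow> 1 \<le> g)"

fun valid :: "nat \<Rightarrow> slot \<Rightarrow> bool" where
  "valid n SS = True"
| "valid n (Rg j h i) = (1 \<le> j \<and> i < 2 * j \<and> (n = 0 \<or> j \<le> n))"
| "valid n (Col o' g) = vcol n o' g"
| "valid n (M1 o' g) = (vcol n o' g \<and> tooth o' (rs n o' g))"
| "valid n (M2 o' g) = (vcol n o' g \<and> tooth o' (rs n o' g) \<and> rs n o' g \<noteq> 21)"
| "valid n (Le o' g) = (vcol n o' g \<and> leafr o' (rs n o' g))"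
| "valid n KK = (n \<noteq> 0)"

fun rpos :: "int \<Rightarrow> dr \<Rightarrow> int \<Rightarrow> pos" where
  "rpos j DN i = (j, i - j + 1)" | "rpos j DW i = (j - 1 - i, j)"
| "rpos j DS i = (- j, j - 1 - i)" | "rpos j DE i = (i - j + 1, - j)"

fun sp :: "dr \<Rightarrow> int \<Rightarrow> int \<Rightarrow> pos" where
  "sp DE a b = (a, b)" | "sp DW a b = (- a, b)" | "sp DN a b = (- b, a)" | "sp DS a b = (- b, - a)"

fun pos :: "nat \<Rightarrow> slot \<Rightarrow> pos" where
  "pos n SS = 0"
| "pos n (Rg j h i) = rpos (int j) h (int i)"
| "pos n (Col o' g) = sp o' (int n + 1) (int g - int n)"
| "pos n (M1 o' g) = sp o' (int n + 2) (int g - int n)"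
| "pos n (M2 o' g) = sp o' (int n + 2) (int g - int n + 1)"
| "pos n (Le o' g) = sp o' (int n + 2) (int g - int n)"
| "pos n KK = (int n + 1, int n + 1)"

text \<open>\<open>anc n x y\<close>: slot \<open>y\<close> is filled before slot \<open>x\<close> whenever a cell grows by itself. The two inputs of a
  leaf are the exception: a leaf only forces the ancestors that are common to its possible orders of arrival.\<close>

definition rle :: "nat \<Rightarrow> nat \<Rightarrow> nat \<Rightarrow> nat \<Rightarrow> nat \<Rightarrow> nat \<Rightarrow> bool" where
  "rle j' h' i' j h i \<longleftrightarrow> j' < j \<or> j' = j \<and> (h' < h \<or> h' = h \<and> i' \<le> i)"

text \<open>The values \<open>3 * g\<close>, \<open>3 * g + 1\<close>, \<open>3 * g + 2\<close>
  order the tiles of a row along the detour through its tooth. The west strip leaves before the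
  final ring closes and so forces only part of it; the north strip forces the whole east strip and
  the corner tile.\<close>

fun stranc :: "nat \<Rightarrow> dr \<Rightarrow> nat \<Rightarrow> slot \<Rightarrow> bool" where
  "stranc n o' k SS = True"
| "stranc n o' k (Rg j h i) = (o' = DW \<longrightarrow> rle j (hn h) i n 2 (2 * n - 2))"
| "stranc n o' k (Col e g) = (e = o' \<and> 3 * g \<le> k \<or> o' = DN \<and> e = DE)"
| "stranc n o' k (M1 e g) = (e = o' \<and> 3 * g + 1 \<le> k \<or> o' = DN \<and> e = DE)"
| "stranc n o' k (M2 e g) = (e = o' \<and> 3 * g + 2 \<le> k \<or> o' = DN \<and> e = DE)"
| "stranc n o' k (Le e g) = False"
| "stranc n o' k KK = (o' = DN)"

fun anc :: "nat \<Rightarrow> slot \<Rightarrow> slot \<Rightarrow> bool" where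
  "anc n SS x = (x = SS)"
| "anc n (Rg j h i) x = (case x of SS \<Rightarrow> True | Rg j' h' i' \<Rightarrow> rle j' (hn h') i' j (hn h) i | _ \<Rightarrow> False)"
| "anc n (Col o' g) x = stranc n o' (3 * g) x"
| "anc n (M1 o' g) x = stranc n o' (3 * g + 1) x"
| "anc n (M2 o' g) x = stranc n o' (3 * g + 2) x"
| "anc n (Le o' g) x = (x = Le o' g \<or> (if hi o' then stranc n o' (3 * (g - 2) + 2) x else stranc n o' (3 * g) x))"
| "anc n KK x = (x = KK \<or> stranc n DE (6 * n) x)"

lemma anc_refl [simp]: "anc n x x"
  by (cases x) (auto simp: rle_def)

definition is_leaf :: "slot \<Rightarrow> bool" where "is_leaf x \<longleftrightarrow> (\<exists>o' g. x = Le o' g)"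

text \<open>A growth order. Ring \<open>j\<close> has \<open>8 * j\<close> tiles and stays below
  \<open>8 * (j + 1) * (j + 1)\<close>; the strips follow all rings, the east strip and
  \<open>KK\<close> precede the other strips, and leaves come last.\<close>

fun rk :: "nat \<Rightarrow> slot \<Rightarrow> nat" where
  "rk n SS = 0"
| "rk n (Rg j h i) = 8 * (j * j) + 2 * j * hn h + i"
| "rk n (Col o' g) = 8 * ((n + 2) * (n + 2)) + (if o' = DE then 0 else 6 * n + 20) + 3 * g"
| "rk n (M1 o' g) = 8 * ((n + 2) * (n + 2)) + (if o' = DE then 0 else 6 * n + 20) + 3 * g + 1"
| "rk n (M2 o' g) = 8 * ((n + 2) * (n + 2)) + (if o' = DE then 0 else 6 * n + 20) + 3 * g + 2"
| "rk n (Le o' g) = 8 * ((n + 2) * (n + 2)) + 20 * n + 200"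
| "rk n KK = 8 * ((n + 2) * (n + 2)) + 6 * n + 10"

lemma hn_le: "hn h \<le> 3" by (cases h) auto
lemma rk_Rg_less: "i < 2 * j \<Longrightarrow> j \<le> n \<Longrightarrow> rk n (Rg j h i) < 8 * ((n + 2) * (n + 2))"
proof -
  assume a: "i < 2 * j" "j \<le> n"
  have "rk n (Rg j h i) < 8 * (j * j) + 8 * j"
    using a by (cases h) simp_all
  also have "\<dots> \<le> 8 * ((j + 2) * (j + 2))" by (simp add: algebra_simps)
  also have "\<dots> \<le> 8 * ((n + 2) * (n + 2))" using a mult_le_mono[of "j + 2" "n + 2" "j + 2" "n + 2"] by simp
  finally show ?thesis .
qed

lemma rk_ring: "i' < 2 * j' \<Longrightarrow> j' < j \<Longrightarrow> rk n (Rg j' h' i') < rk n (Rg j h i)"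
proof -
  assume a: "i' < 2 * j'" "j' < j"
  have "rk n (Rg j' h' i') < 8 * (j' * j') + 8 * j'"
    using a by (cases h') simp_all
  also have "\<dots> \<le> 8 * ((j' + 1) * (j' + 1))" by (simp add: algebra_simps)
  also have "\<dots> \<le> 8 * (j * j)" using a mult_le_mono[of "j' + 1" j "j' + 1" j] by simp
  finally show ?thesis by simp
qed

text \<open>The symbol of ring \<open>j\<close> records the ring number up to 15 and afterwards only modulo 4, so that a
  penultimate ring is admitted exactly when the final ring number is \<open>1\<close> modulo 4 and at least 13.\<close>

lemma cnt_Suc: "1 \<le> j \<Longrightarrow> cnt (Suc j) = nxc (cnt j)"
proof -
  assume "1 \<le> j"
  show ?thesis
  proof (cases "j < 15")
    case False
    have "j mod 4 < 4" by simp
    moreover have "Suc j mod 4 = (if j mod 4 = 3 then 0 else Suc (j mod 4))" by presburger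
    ultimately show ?thesis using False by (auto simp: cnt_def nxc_def)
  qed (auto simp: cnt_def nxc_def)
qed

lemma cnt_bounds: "1 \<le> j \<Longrightarrow> 1 \<le> cnt j \<and> cnt j \<le> 15"
  by (auto simp: cnt_def)

lemma cnt_penult: "1 \<le> j \<Longrightarrow> cnt j = 11 \<or> cnt j = 15 \<longleftrightarrow> okn (j + 2)"
proof -
  assume "1 \<le> j"
  show ?thesis unfolding cnt_def okn_def by presburger
qed

lemma oks_sym_at: "1 \<le> j \<Longrightarrow> oks (sym_at n w j)"
  using cnt_bounds by (simp add: sym_at_def)

lemma okk_knd:
  assumes "okn n" "valid n x" shows "okk (knd n w x)"
proof (cases x)
  case (Rg j h i)
  have j: "1 \<le> j" using assms Rg by simp
  show ?thesis
  proof (cases "h = DN \<and> i = 0")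
    case T: True
    show ?thesis
    proof (cases "j = 1")
      case True
      then show ?thesis using Rg T assms by (auto simp: sym_at_def cnt_def okn_def)
    next
      case False
      then obtain j' where j': "j = Suc j'" "1 \<le> j'" using j by (cases j) auto
      show ?thesis using Rg T assms j' cnt_Suc[OF j'(2)] cnt_bounds[OF j'(2)] cnt_penult[OF j'(2)]
        by (auto simp: sym_at_def)
    qed
  qed (use Rg j oks_sym_at in auto)
next
  case (Col o' g)
  then show ?thesis using assms by (cases o') (auto simp: vcol_def rs_def okn_def)
qed (use assms in auto)

section \<open>Which slot of a cell feeds which\<close>

fun prv :: "slot \<Rightarrow> slot" where
  "prv (Rg j h i) = (if 0 < i then Rg j h (i - 1) else (case h of
       DN \<Rightarrow> (if j = 1 then SS else Rg (j - 1) DE (2 * j - 3))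
     | DW \<Rightarrow> Rg j DN (2 * j - 1) | DS \<Rightarrow> Rg j DW (2 * j - 1) | DE \<Rightarrow> Rg j DS (2 * j - 1)))"
| "prv x = x"

text \<open>The sender of the wall message: the neighbour one ring further in, except at the end of
  a ring, where it is that ring's own first tile.\<close>

fun inr :: "slot \<Rightarrow> slot" where
  "inr (Rg j h i) = (if h = DE \<and> i + 1 = 2 * j then Rg j DN 0 else if j = 1 then SS
     else if 0 < i then Rg (j - 1) h (i - 1) else (case h of
       DN \<Rightarrow> SS | DW \<Rightarrow> Rg (j - 1) DN (2 * j - 3) | DS \<Rightarrow> Rg (j - 1) DW (2 * j - 3) | DE \<Rightarrow> Rg (j - 1) DS (2 * j - 3)))"
| "inr x = x"

definition md :: "dr \<Rightarrow> nat \<Rightarrow> dr" where "md h i = (if h = DN \<and> i = 0 then DE else h)"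

text \<open>By the last claim the ancestors of a ring slot form a chain, so the presence of the
  predecessor vouches for all of them.\<close>

lemma prv_props:
  assumes "valid n (Rg j h i)"
  shows "valid n (prv (Rg j h i))" "rpos (int j) h (int i) = pos n (prv (Rg j h i)) + vec (md h i)"
    "anc n (Rg j h i) (prv (Rg j h i))" "rk n (prv (Rg j h i)) < rk n (Rg j h i)"
    "\<And>z. valid n z \<Longrightarrow> anc n (Rg j h i) z \<Longrightarrow> z = Rg j h i \<or> anc n (prv (Rg j h i)) z"
proof -
  show "valid n (prv (Rg j h i))" using assms by (cases h) auto
  show "rpos (int j) h (int i) = pos n (prv (Rg j h i)) + vec (md h i)"
    using assms by (cases h) (auto simp: md_def zero_prod_def)
  show "anc n (Rg j h i) (prv (Rg j h i))" using assms by (cases h) (auto simp: rle_def)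
  show "rk n (prv (Rg j h i)) < rk n (Rg j h i)"
  proof (cases "i = 0 \<and> h = DN")
    case True
    show ?thesis
    proof (cases "j = 1")
      case False
      then show ?thesis using True assms rk_ring[of "2 * j - 3" "j - 1" j n DE h i] by auto
    qed (use True in auto)
  next
    case False
    then show ?thesis using assms by (cases h; cases "i = 0"; simp; arith)
  qed
  fix z assume z: "valid n z" "anc n (Rg j h i) z"
  show "z = Rg j h i \<or> anc n (prv (Rg j h i)) z"
  proof (cases z)
    case (Rg j' h' i')
    then show ?thesis using z assms hn_le[of h'] by (cases h; cases h') (auto simp: rle_def)
  qed (use z assms in \<open>auto split: dr.splits\<close>)
qed

lemma inr_props:
  assumes "valid n (Rg j h i)" "\<not> (h = DN \<and> i = 0)" "h = DE \<or> i + 1 \<noteq> 2 * j"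
  shows "valid n (inr (Rg j h i))" "pos n (inr (Rg j h i)) = rpos (int j) h (int i) + vec (lft h)"
    "anc n (Rg j h i) (inr (Rg j h i))" "rk n (inr (Rg j h i)) < rk n (Rg j h i)"
    "out (knd n w (inr (Rg j h i))) (rgt h) = Some (Wl False (icl j h i))"
proof -
  show "valid n (inr (Rg j h i))" using assms by (cases h) auto
  show "pos n (inr (Rg j h i)) = rpos (int j) h (int i) + vec (lft h)"
    using assms by (cases h) (auto simp: zero_prod_def)
  show "anc n (Rg j h i) (inr (Rg j h i))" using assms by (cases h) (auto simp: rle_def)
  show "rk n (inr (Rg j h i)) < rk n (Rg j h i)"
  proof (cases "h = DE \<and> i + 1 = 2 * j")
    case True
    then show ?thesis using assms by simp
  next
    case F: False
    show ?thesis
    proof (cases "j = 1")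
      case True
      then show ?thesis using F assms by simp
    next
      case False
      then have r: "rk n (Rg (j - 1) h' (2 * j - 3)) < rk n (Rg j h i)" for h'
        using assms by (intro rk_ring) auto
      show ?thesis
      proof (cases "i = 0")
        case True
        then show ?thesis using F False assms r by (cases h) (simp_all del: rk.simps)
      next
        case i: False
        have "i + 1 \<noteq> 2 * j" "i < 2 * j" using assms F by auto
        then have "i - 1 < 2 * (j - 1)" using i by arith
        then have "rk n (Rg (j - 1) h (i - 1)) < rk n (Rg j h i)" using False i assms by (intro rk_ring) auto
        then show ?thesis using F False i by (auto simp del: rk.simps)
      qed
    qed
  qed
  have s: "sym_at n w (j - 1) \<noteq> FF" if "1 < j" using assms(1) that by (auto simp: sym_at_def)
  have s': "sym_at n w (j - Suc 0) \<noteq> FF" if "1 < j" using s[OF that] by simp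
  have "j \<noteq> n \<Longrightarrow> sym_at n w j \<noteq> FF" by (auto simp: sym_at_def)
  show "out (knd n w (inr (Rg j h i))) (rgt h) = Some (Wl False (icl j h i))"
  proof (cases "h = DE \<and> i + 1 = 2 * j")
    case True
    then show ?thesis using assms by (simp add: icl_def)
  next
    case F: False
    show ?thesis
    proof (cases "j = 1")
      case True
      then show ?thesis using F assms by (cases h) (simp_all add: icl_def)
    next
      case False
      then have j: "1 < j" using assms by simp
      show ?thesis
      proof (cases "i = 0")
        case True
        then show ?thesis using F j assms s'[OF j] by (cases h) (simp_all add: icl_def)
      next
        case i: False
        obtain i' j' where ij: "i = Suc i'" "j = Suc j'" "1 \<le> j'" using i j by (cases i; cases j) auto
        then show ?thesis using F assms s'[OF j] by (cases h) (auto simp: icl_def)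
      qed
    qed
  qed
qed

definition mainc :: "nat \<Rightarrow> (nat \<Rightarrow> bool) \<Rightarrow> nat \<Rightarrow> dr \<Rightarrow> nat \<Rightarrow> cont" where
  "mainc n w j h i = (if h = DN \<and> i = 0 then (if j = 1 then St1L else StL (cls (sym_at n w (j - 1))))
     else if h \<noteq> DE \<and> i + 1 = 2 * j then CorL (sym_at n w j) else Pth (sym_at n w j))"

lemma prv_out:
  assumes "valid n (Rg j h i)"
  shows "out (knd n w (prv (Rg j h i))) (md h i) = Some (mainc n w j h i)"
proof (cases "i = 0")
  case T: True
  show ?thesis
  proof (cases "j = 1")
    case True
    then show ?thesis using T by (cases h) (simp_all add: md_def mainc_def icl_def)
  next
    case False
    have "sym_at n w (j - Suc 0) \<noteq> FF" "j \<noteq> 0" using assms False by (auto simp: sym_at_def)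
    then show ?thesis using T False assms by (cases h) (auto simp: md_def mainc_def icl_def)
  qed
next
  case False
  then obtain i' where "i = Suc i'" by (cases i) auto
  then show ?thesis using assms by (cases h; cases "j = 1") (auto simp: md_def mainc_def icl_def)
qed

lemma rs_step:
  fixes o' :: dr and g :: nat
  assumes "okn n" "n \<noteq> 0"
  defines "r \<equiv> rs n o' g" and "r' \<equiv> rs n o' (Suc g)"
  shows "r' = r + 1 \<and> r \<noteq> 10 \<and> \<not> (o' = DE \<and> (r = 20 \<or> r = 21)) \<or> r = 10 \<and> r' = 7 \<or> r = 8 \<and> r' = 11
    \<or> o' = DE \<and> r = 20 \<and> (r' = 20 \<or> r' = 21) \<or> o' = DE \<and> r = 21 \<and> 2 * n \<le> g"
proof -
  have n: "13 \<le> n" "n mod 4 = 1" using assms by (auto simp: okn_def)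
  consider "Suc g < 7" | "g = 6" | "7 \<le> g" "Suc g < n" | "Suc g = n" | "n \<le> g" by linarith
  then show ?thesis
  proof cases
    case 3
    then obtain k where k: "g = 7 + k" using le_Suc_ex by blast
    have "Suc k mod 4 = (if k mod 4 = 3 then 0 else Suc (k mod 4))" by presburger
    then show ?thesis using 3 k by (auto simp: r_def r'_def rs_def)
  next
    case 4
    \<comment> \<open>Here the congruence of \<open>n\<close> enters: it puts row
      \<open>n - 1\<close> at phase 1 of the period, in state \<open>8\<close>, so the middle row is
      always entered from \<open>8\<close>.\<close>
    define k where "k = n div 4 - 2"
    have "n = 4 * (n div 4) + 1" using n by (metis mult_div_mod_eq)
    then have "g - 7 = 4 * k + 1" using n 4 unfolding k_def by linarith
    then have "(g - 7) mod 4 = 1" by (simp only:) presburger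
    then show ?thesis using 4 n by (auto simp: r_def r'_def rs_def)
  qed (use n in \<open>auto simp: r_def r'_def rs_def\<close>)
qed

lemma rs_facts:
  assumes "okn n" "n \<noteq> 0"
  shows "rs n o' g = 0 \<longleftrightarrow> g = 0" "rs n o' g = 1 \<longleftrightarrow> g = 1" "rs n o' g = 11 \<longleftrightarrow> g = n"
    "11 \<le> rs n o' g \<longleftrightarrow> n \<le> g" "g < n \<Longrightarrow> rs n o' g \<le> 10"
    "rs n DE g = 21 \<longleftrightarrow> 2 * n \<le> g" "n \<le> g \<Longrightarrow> o' \<noteq> DE \<or> g \<le> n + 8 \<Longrightarrow> rs n o' g = 11 + (g - n)"
proof -
  have n: "13 \<le> n" using assms by (auto simp: okn_def)
  have m: "(g - 7) mod 4 < 4" by simp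
  show "rs n o' g = 0 \<longleftrightarrow> g = 0" "rs n o' g = 1 \<longleftrightarrow> g = 1" "rs n o' g = 11 \<longleftrightarrow> g = n"
    "11 \<le> rs n o' g \<longleftrightarrow> n \<le> g" "g < n \<Longrightarrow> rs n o' g \<le> 10"
    "rs n DE g = 21 \<longleftrightarrow> 2 * n \<le> g" "n \<le> g \<Longrightarrow> o' \<noteq> DE \<or> g \<le> n + 8 \<Longrightarrow> rs n o' g = 11 + (g - n)"
    using n m by (auto simp: rs_def)
qed

definition stp :: "dr \<Rightarrow> nat \<Rightarrow> nat \<Rightarrow> bool" where
  "stp o' a b \<longleftrightarrow> b = a + 1 \<and> a \<noteq> 10 \<and> \<not> (o' = DE \<and> (a = 20 \<or> a = 21)) \<or> a = 10 \<and> b = 7 \<or> a = 8 \<and> b = 11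
      \<or> o' = DE \<and> a = 20 \<and> (b = 20 \<or> b = 21)"

text \<open>The announcement made in one row fits each possible next state, although the row does
  not know how far the middle or the end is.\<close>

lemma stp_tooth:
  assumes "stp o' a b"
  shows "0 < b \<and> tooth o' (b - 1) \<longleftrightarrow> tooth o' a"
    "tooth o' a \<Longrightarrow> b = a + 1 \<and> lb o' b = b \<and> \<not> sgt o' b"
    "\<not> tooth o' a \<Longrightarrow> (sgt o' (a + 1) \<longleftrightarrow> sgt o' b) \<and> (sgt o' b \<longrightarrow> a + 1 = b) \<and> (\<not> sgt o' b \<longrightarrow> lb o' (nxr o' a) = lb o' b) \<and> \<not> (o' = DE \<and> a = 21)"
proof -
  from assms consider "b = a + 1" "a \<noteq> 10" "\<not> (o' = DE \<and> (a = 20 \<or> a = 21))" | "a = 10" "b = 7" | "a = 8" "b = 11"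
    | "o' = DE" "a = 20" "b = 20" | "o' = DE" "a = 20" "b = 21" unfolding stp_def by blast
  then show "0 < b \<and> tooth o' (b - 1) \<longleftrightarrow> tooth o' a"
    by cases (simp_all add: tooth_def)
  from assms consider "b = a + 1" "a \<noteq> 10" "\<not> (o' = DE \<and> (a = 20 \<or> a = 21))" | "a = 10" "b = 7" | "a = 8" "b = 11"
    | "o' = DE" "a = 20" "b = 20" | "o' = DE" "a = 20" "b = 21" unfolding stp_def by blast
  then show "b = a + 1 \<and> lb o' b = b \<and> \<not> sgt o' b" if "tooth o' a"
    using that by cases (auto simp: tooth_def lb_def sgt_def split: if_splits)
  from assms consider "b = a + 1" "a \<noteq> 10" "\<not> (o' = DE \<and> (a = 20 \<or> a = 21))" | "a = 10" "b = 7" | "a = 8" "b = 11"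
    | "o' = DE" "a = 20" "b = 20" | "o' = DE" "a = 20" "b = 21" unfolding stp_def by blast
  then show "(sgt o' (a + 1) \<longleftrightarrow> sgt o' b) \<and> (sgt o' b \<longrightarrow> a + 1 = b) \<and> (\<not> sgt o' b \<longrightarrow> lb o' (nxr o' a) = lb o' b) \<and> \<not> (o' = DE \<and> a = 21)" if "\<not> tooth o' a"
    using that by cases (auto simp: lb_def sgt_def nxr_def)
qed

fun wls :: "nat \<Rightarrow> dr \<Rightarrow> nat \<Rightarrow> slot" where
  "wls n DE g = (if g = 0 then Rg n DE (2 * n - 1) else Rg n DN (g - 1))"
| "wls n DS g = Rg n DE (2 * n - 1 - g)"
| "wls n DW g = Rg n DS (2 * n - 1 - g)"
| "wls n DN g = (if g = 0 then Rg n DN (2 * n - 1) else Rg n DW (g - 1))"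

lemma okn_ge: "okn n \<Longrightarrow> n \<noteq> 0 \<Longrightarrow> 13 \<le> n" by (auto simp: okn_def)

lemma wls_props:
  assumes "okn n" "vcol n o' g"
  shows "valid n (wls n o' g)" "pos n (wls n o' g) = pos n (Col o' g) + vec (opp o')"
    "anc n (Col o' g) (wls n o' g)" "rk n (wls n o' g) < 8 * ((n + 2) * (n + 2))"
    "out (knd n w (wls n o' g)) o' = Some (if stst o' (rs n o' g) then StripL else Wl True (wlc o' (rs n o' g)))"
proof -
  have n0: "n \<noteq> 0" using assms by (simp add: vcol_def)
  have n: "13 \<le> n" using okn_ge[OF assms(1) n0] .
  have t: "g \<le> top n o'" "o' = DW \<longrightarrow> 1 \<le> g" using assms by (auto simp: vcol_def)
  show v: "valid n (wls n o' g)" using n t by (cases o') auto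
  show "pos n (wls n o' g) = pos n (Col o' g) + vec (opp o')" using n t by (cases o') auto
  show "anc n (Col o' g) (wls n o' g)" using n t by (cases o') (auto simp: rle_def)
  obtain h i where "wls n o' g = Rg n h i" by (cases o'; cases "g = 0") auto
  then show "rk n (wls n o' g) < 8 * ((n + 2) * (n + 2))" using v rk_Rg_less[of i n n h] by (simp del: rk.simps)
  note f = rs_facts[OF assms(1) n0]
  have s: "sym_at n w n = FF" by (simp add: sym_at_def)
  show "out (knd n w (wls n o' g)) o' = Some (if stst o' (rs n o' g) then StripL else Wl True (wlc o' (rs n o' g)))"
  proof (cases o')
    case DE
    consider "g = 0" | "g = 1" | "2 \<le> g" "g < 2 * n" | "g = 2 * n" using t DE by fastforce
    then show ?thesis using n DE f s by cases (auto simp: stst_def wlc_def icl_def)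
  next
    case DS
    have "2 * n - 1 - g + 1 = n \<longleftrightarrow> g = n" "2 * n - Suc g \<noteq> 0" using t DS n by auto
    then show ?thesis using n DS f s t by (auto simp: stst_def wlc_def icl_def)
  next
    case DW
    have "2 * n - 1 - g + 1 = n \<longleftrightarrow> g = n" "2 * n - 1 - g + 1 \<noteq> 2 * n" "2 * n - Suc g \<noteq> 0"
        "2 * n - 1 - g + 2 = 2 * n \<longleftrightarrow> g = 1" using t DW n by auto
    then show ?thesis using n DW f s t by (auto simp: stst_def wlc_def icl_def)
  next
    case DN
    then show ?thesis using n DN f s t by (auto simp: stst_def wlc_def icl_def)
  qed
qed

text \<open>Meant for rows that do not start a strip. Among rows \<open>0\<close> this leaves only
  the north strip, hence \<open>KK\<close>.\<close>

definition cpr :: "nat \<Rightarrow> dr \<Rightarrow> nat \<Rightarrow> slot" where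
  "cpr n o' g = (if g = 0 then KK else if tooth o' (rs n o' (g - 1)) then M2 o' (g - 1) else Col o' (g - 1))"

definition psd :: "dr \<Rightarrow> nat \<Rightarrow> dr" where
  "psd o' r = (if 0 < r \<and> tooth o' (r - 1) then o' else opp (fw o'))"

lemma cpr_props:
  fixes o' :: dr and g :: nat
  assumes "okn n" "vcol n o' g" "\<not> stst o' (rs n o' g)"
  defines "r \<equiv> rs n o' g"
  shows "valid n (cpr n o' g)" "pos n (cpr n o' g) = pos n (Col o' g) + vec (psd o' r)"
    "anc n (Col o' g) (cpr n o' g)" "rk n (cpr n o' g) < rk n (Col o' g)"
    "out (knd n w (cpr n o' g)) (opp (psd o' r)) = Some (if sgt o' r then Sg o' r else Nxt o' (lb o' r))"
    "\<And>z. valid n z \<Longrightarrow> anc n (Col o' g) z \<Longrightarrow> z = Col o' g \<or> anc n (cpr n o' g) z"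
proof -
  have n0: "n \<noteq> 0" using assms by (simp add: vcol_def)
  have n: "13 \<le> n" using okn_ge[OF assms(1) n0] .
  have t: "g \<le> top n o'" "o' = DW \<longrightarrow> 1 \<le> g" using assms by (auto simp: vcol_def)
  have A: "valid n (cpr n o' g) \<and> pos n (cpr n o' g) = pos n (Col o' g) + vec (psd o' r)
    \<and> anc n (Col o' g) (cpr n o' g) \<and> rk n (cpr n o' g) < rk n (Col o' g) \<and>
    out (knd n w (cpr n o' g)) (opp (psd o' r)) = Some (if sgt o' r then Sg o' r else Nxt o' (lb o' r)) \<and>
    (\<forall>z. valid n z \<longrightarrow> anc n (Col o' g) z \<longrightarrow> z = Col o' g \<or> anc n (cpr n o' g) z)"
  proof (cases g)
    case 0
    then have r: "r = 0" using rs_facts(1)[OF assms(1) n0] by (simp add: r_def)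
    then have o: "o' = DN" using assms(3) 0 t unfolding r_def stst_def by (cases o') auto
    have nt: "x < 2 * n" if "tooth DE (rs n DE x)" for x
      using that rs_facts(6)[OF assms(1) n0, of x] by (cases "2 * n \<le> x") (auto simp: tooth_def)
    have "z = Col DN 0 \<or> anc n KK z" if "valid n z" "anc n (Col DN 0) z" for z
      using that n nt by (cases z) (fastforce simp: vcol_def)+
    then show ?thesis using o 0 r n0 by (auto simp: cpr_def psd_def sgt_def lb_def)
  next
    case (Suc g')
    let ?r = "rs n o' g'"
    have st: "stp o' ?r r"
      using rs_step[OF assms(1) n0, of o' g'] t Suc unfolding r_def stp_def by auto
    have d: "\<not> (o' = DN \<and> ?r = 19)"
    proof
      assume "o' = DN \<and> ?r = 19"
      then have "n \<le> g'" "g' = n + 8" using rs_facts(4)[OF assms(1) n0, where o' = DN and g = g'] rs_facts(7)[OF assms(1) n0, where o' = DN and g = g'] by auto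
      then show False using t Suc \<open>o' = DN \<and> ?r = 19\<close> by simp
    qed
    have vc: "vcol n o' g'"
    proof -
      have "\<not> (o' = DW \<and> g' = 0)" 
        using assms(3) Suc rs_facts(2)[OF assms(1) n0, where o' = DW and g = "Suc g'"] by (auto simp: stst_def)
      then show ?thesis using t Suc n0 by (auto simp: vcol_def)
    qed
    note tt = stp_tooth(1)[OF st]
    have r21: "?r \<noteq> 21"
    proof
      assume r: "?r = 21"
      then have "n \<le> g'" using rs_facts(4)[OF assms(1) n0, where o' = o' and g = g'] by simp
      then show False using r t Suc n by (cases o') (auto simp: rs_def split: if_splits)
    qed
    show ?thesis
    proof (cases "tooth o' ?r")
      case True
      have zz: "z = Col o' g \<or> anc n (M2 o' g') z" if "valid n z" "anc n (Col o' g) z" for z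
        using that Suc n by (cases z) (auto, presburger+)
      have c: "cpr n o' g = M2 o' g'" "psd o' r = o'" using True Suc tt by (simp_all add: cpr_def psd_def)
      have "out (knd n w (M2 o' g')) (opp o') = Some (if sgt o' r then Sg o' r else Nxt o' (lb o' r))"
        using stp_tooth(2)[OF st True] by auto
      moreover have "pos n (M2 o' g') = pos n (Col o' g) + vec o'" using Suc by (cases o') auto
      ultimately show ?thesis using zz c True vc r21 Suc by simp
    next
      case False
      have l: "(sgt o' (?r + 1) \<longleftrightarrow> sgt o' r) \<and> (sgt o' r \<longrightarrow> ?r + 1 = r) \<and> (\<not> sgt o' r \<longrightarrow> lb o' (nxr o' ?r) = lb o' r) \<and> \<not> (o' = DE \<and> ?r = 21)"
        by (rule stp_tooth(3)[OF st False])
      have zz: "z = Col o' g \<or> anc n (Col o' g') z" if z: "valid n z" "anc n (Col o' g) z" for z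
      proof (cases z)
        case (M1 e x)
        then have "e = o' \<Longrightarrow> x \<noteq> g'" using z False by auto
        then show ?thesis using M1 z Suc by auto
      next
        case (M2 e x)
        then have "e = o' \<Longrightarrow> x \<noteq> g'" using z False by auto
        then show ?thesis using M2 z Suc by auto
      qed (use z Suc in auto)
      have c: "cpr n o' g = Col o' g'" "psd o' r = opp (fw o')" using False Suc tt by (simp_all add: cpr_def psd_def)
      have "out (knd n w (Col o' g')) (fw o') = Some (if sgt o' r then Sg o' r else Nxt o' (lb o' r))"
        using l d False by (cases "sgt o' r") auto
      moreover have "pos n (Col o' g') = pos n (Col o' g) + vec (opp (fw o'))" using Suc by (cases o') auto
      ultimately show ?thesis using zz c vc Suc by simp
    qed
  qed
  note c2 = conjunct2[OF A] note c3 = conjunct2[OF c2] note c4 = conjunct2[OF c3] note c5 = conjunct2[OF c4]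
  show "valid n (cpr n o' g)" by (rule conjunct1[OF A])
  show "pos n (cpr n o' g) = pos n (Col o' g) + vec (psd o' r)" by (rule conjunct1[OF c2])
  show "anc n (Col o' g) (cpr n o' g)" by (rule conjunct1[OF c3])
  show "rk n (cpr n o' g) < rk n (Col o' g)" by (rule conjunct1[OF c4])
  show "out (knd n w (cpr n o' g)) (opp (psd o' r)) = Some (if sgt o' r then Sg o' r else Nxt o' (lb o' r))"
    by (rule conjunct1[OF c5])
  show "\<And>z. valid n z \<Longrightarrow> anc n (Col o' g) z \<Longrightarrow> z = Col o' g \<or> anc n (cpr n o' g) z"
    using conjunct2[OF c5] by simp
qed

lemma leaf_row:
  assumes "okn n" "vcol n o' g" "leafr o' (rs n o' g)"
  shows "hi o' \<Longrightarrow> g = n + 2 \<and> rs n o' g = 13 \<or> g = n + 8 \<and> rs n o' g = 19"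
    "\<not> hi o' \<Longrightarrow> g = n + 3 \<and> rs n o' g = 14 \<or> g = n + 9 \<and> rs n o' g = 20"
proof -
  have n0: "n \<noteq> 0" using assms by (simp add: vcol_def)
  have g: "n \<le> g" using rs_facts(4)[OF assms(1) n0, of o' g] assms(3) by (auto simp: leafr_def split: if_splits)
  show "hi o' \<Longrightarrow> g = n + 2 \<and> rs n o' g = 13 \<or> g = n + 8 \<and> rs n o' g = 19"
    "\<not> hi o' \<Longrightarrow> g = n + 3 \<and> rs n o' g = 14 \<or> g = n + 9 \<and> rs n o' g = 20"
    using g assms(3) okn_ge[OF assms(1) n0] by (auto simp: leafr_def rs_def split: if_splits)
qed

lemma leaf_sup:
  assumes "okn n" "vcol n o' g" "leafr o' (rs n o' g)"
  shows "hi o' \<Longrightarrow> 2 \<le> g \<and> valid n (M2 o' (g - 2)) \<and> rs n o' (g - 2) + 2 = rs n o' g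
      \<and> (rs n o' (g - 2) = 11 \<or> rs n o' (g - 2) = 17)"
    "\<not> hi o' \<Longrightarrow> valid n (M1 o' (g + 1)) \<and> rs n o' (g + 1) = rs n o' g + 1 \<and> (rs n o' (g + 1) = 15 \<or> rs n o' (g + 1) = 21)"
    "\<not> tooth o' (rs n o' g)"
proof -
  have n0: "n \<noteq> 0" using assms by (simp add: vcol_def)
  have n: "13 \<le> n" using okn_ge[OF assms(1) n0] .
  show "2 \<le> g \<and> valid n (M2 o' (g - 2)) \<and> rs n o' (g - 2) + 2 = rs n o' g
      \<and> (rs n o' (g - 2) = 11 \<or> rs n o' (g - 2) = 17)" if h: "hi o'"
    using leaf_row(1)[OF assms h] n h assms(2) by (cases o') (auto simp: rs_def vcol_def tooth_def)
  show "valid n (M1 o' (g + 1)) \<and> rs n o' (g + 1) = rs n o' g + 1 \<and> (rs n o' (g + 1) = 15 \<or> rs n o' (g + 1) = 21)" if h: "\<not> hi o'"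
    using leaf_row(2)[OF assms h] n h assms(2) by (cases o') (auto simp: rs_def vcol_def tooth_def)
  show "\<not> tooth o' (rs n o' g)" using assms(3) by (auto simp: tooth_def leafr_def)
qed

lemma match_Rg:
  assumes "valid n (Rg j h i)" "inp (knd n w (Rg j h i)) d = Some c"
  shows "d = opp (md h i) \<and> c = mainc n w j h i
    \<or> d = lft h \<and> c = Wl False (icl j h i) \<and> \<not> (h = DN \<and> i = 0) \<and> (h = DE \<or> i + 1 \<noteq> 2 * j)"
  using assms(2) by (auto simp: md_def mainc_def split: if_splits)

text \<open>Soundness of the layout: inputs are supplied by earlier slots of the same cell.
  \<open>Neu\<close> is left out because it comes from a neighbouring cell.\<close>

lemma match:
  assumes n: "okn n" and v: "valid n x" and ic: "inp (knd n w x) d = Some c" and nn: "\<And>r. c \<noteq> Neu r"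
  shows "\<exists>y. valid n y \<and> pos n y = pos n x + vec d \<and> out (knd n w y) (opp d) = Some c \<and> rk n y < rk n x
    \<and> (\<not> is_leaf x \<longrightarrow> anc n x y)"
proof (cases x)
  case SS
  then show ?thesis using ic by simp
next
  case (Rg j h i)
  have v': "valid n (Rg j h i)" using v Rg by simp
  from match_Rg[OF v'] ic Rg consider
      (a) "d = opp (md h i)" "c = mainc n w j h i"
    | (b) "d = lft h" "c = Wl False (icl j h i)" "\<not> (h = DN \<and> i = 0)" "h = DE \<or> i + 1 \<noteq> 2 * j" by blast
  then show ?thesis
  proof cases
    case a
    then show ?thesis using prv_props[OF v'] prv_out[OF v', of w] Rg
      by (intro exI[of _ "prv (Rg j h i)"]) (auto simp: vec_opp simp del: rk.simps prv.simps knd.simps anc.simps)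
  next
    case b
    then show ?thesis using inr_props(1-4)[OF v' b(3,4)] inr_props(5)[OF v' b(3,4), of w] Rg
      by (intro exI[of _ "inr (Rg j h i)"]) (auto simp: vec_opp simp del: rk.simps inr.simps knd.simps anc.simps)
  qed
next
  case (Col o' g)
  have v': "vcol n o' g" using v Col by simp
  let ?r = "rs n o' g"
  have "d = opp o' \<and> c = (if stst o' ?r then StripL else Wl True (wlc o' ?r)) \<or>
     \<not> stst o' ?r \<and> d = psd o' ?r \<and> c = (if sgt o' ?r then Sg o' ?r else Nxt o' (lb o' ?r))"
    using ic Col by (auto simp: psd_def sgt_def tooth_def split: if_splits)
  then show ?thesis
  proof
    assume a: "d = opp o' \<and> c = (if stst o' ?r then StripL else Wl True (wlc o' ?r))"
    then show ?thesis using wls_props(1-4)[OF n v'] wls_props(5)[OF n v', of w] Col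
      by (intro exI[of _ "wls n o' g"]) (auto simp: is_leaf_def simp del: wls.simps knd.simps)
  next
    assume "\<not> stst o' ?r \<and> d = psd o' ?r \<and> c = (if sgt o' ?r then Sg o' ?r else Nxt o' (lb o' ?r))"
    then show ?thesis using cpr_props(1-4)[OF n v'] cpr_props(5)[OF n v', of w] Col
      by (intro exI[of _ "cpr n o' g"]) (auto simp: is_leaf_def simp del: knd.simps)
  qed
next
  case (M1 o' g)
  then show ?thesis using ic v
    by (intro exI[of _ "Col o' g"]) (cases o'; auto simp: split: if_splits)
next
  case (M2 o' g)
  then show ?thesis using ic v
    by (intro exI[of _ "M1 o' g"]) (cases o'; auto simp: split: if_splits)
next
  case (Le o' g)
  have v': "vcol n o' g" "leafr o' (rs n o' g)" using v Le by auto
  have b: "g \<le> n + 10"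
    using leaf_row[OF n v'] by (cases "hi o'") auto
  consider (p) "d = opp o'" "c = LfS o' (rs n o' g)" | (q) "hi o'" "d = opp (fw o')" "c = LfV o' (rs n o' g)"
    | (r) "\<not> hi o'" "d = fw o'" "c = LfV o' (rs n o' g)" using ic Le nn by (auto split: if_splits)
  then show ?thesis
  proof cases
    case p
    then show ?thesis using Le v' leaf_sup(3)[OF n v'] b
      by (intro exI[of _ "Col o' g"]) (cases o'; auto simp: is_leaf_def)
  next
    case q
    have "d = opp (fw o')" by fact
    then show ?thesis using Le v' leaf_sup(1)[OF n v' q(1)] q \<open>g \<le> n + 10\<close>
      by (intro exI[of _ "M2 o' (g - 2)"]) (cases o'; auto simp: is_leaf_def)
  next
    case r
    then show ?thesis using Le v' leaf_sup(2)[OF n v' r(1)] b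
      by (intro exI[of _ "M1 o' (g + 1)"]) (cases o'; auto simp: is_leaf_def)
  qed
next
  case KK
  have n0: "n \<noteq> 0" using v KK by simp
  have "rs n DE (2 * n) = 21" using rs_facts(6)[OF n n0] by simp
  then show ?thesis using KK ic n0 by (intro exI[of _ "Col DE (2 * n)"]) (auto simp: vcol_def tooth_def sgt_def split: if_splits)
qed

section \<open>The converse: a message found in a cell determines the slot it is meant for\<close>

lemma compl_main:
  assumes "valid n x" "out (knd n w x) d = Some c" "c = Pth s \<or> c = CorL s"
  shows "\<exists>j i. valid n (Rg j d i) \<and> x = prv (Rg j d i) \<and> md d i = d \<and> c = mainc n w j d i"
proof (cases x)
  case (Rg j h i)
  have v: "1 \<le> j" "i < 2 * j" "n = 0 \<or> j \<le> n" using assms Rg by auto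
  consider (s) "h = DN" "i = 0" | (c) "h \<noteq> DE" "i + 1 = 2 * j" "\<not> (h = DN \<and> i = 0)" | (r) "\<not> (h = DN \<and> i = 0)" "h = DE \<or> i + 1 \<noteq> 2 * j" by blast
  then show ?thesis
  proof cases
    case s
    then have "d = DN" using assms Rg by (auto split: if_splits dr.splits)
    then show ?thesis using s v assms Rg by (intro exI[of _ j] exI[of _ 1]) (auto simp: md_def mainc_def split: if_splits)
  next
    case c
    then have "d = lft h" using assms Rg by (auto split: if_splits)
    moreover obtain j' where "j = Suc j'" using v by (cases j) auto
    moreover have "i = 2 * j - 1" using c by simp
    ultimately show ?thesis using c v assms Rg by (intro exI[of _ j] exI[of _ 0]) (cases h; auto simp: md_def mainc_def)
  next
    case r
    then have d: "d = h" "h = DE \<longrightarrow> i + 1 \<noteq> 2 * j" using assms Rg by (auto simp: icl_def split: if_splits)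
    then have "i + 1 < 2 * j" using r v by auto
    then show ?thesis using r d v assms Rg by (intro exI[of _ j] exI[of _ "i + 1"]) (auto simp: md_def mainc_def icl_def split: if_splits)
  qed
qed (use assms in \<open>auto split: if_splits dr.splits\<close>)

lemma compl_StL:
  assumes "valid n x" "out (knd n w x) d = Some (StL q)"
  shows "d = DE \<and> (\<exists>j. x = Rg j DE (2 * j - 1) \<and> 1 \<le> j \<and> q = cls (sym_at n w j) \<and> sym_at n w j \<noteq> FF)"
proof (cases x)
  case (Rg j h i)
  then show ?thesis using assms by (auto simp: icl_def split: if_splits dr.splits)
qed (use assms in \<open>auto split: if_splits dr.splits\<close>)

lemma compl_St1L:
  assumes "valid n x" "out (knd n w x) d = Some St1L" shows "d = DE \<and> x = SS"
proof (cases x)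
  case (Rg j h i)
  then show ?thesis using assms by (auto simp: icl_def split: if_splits dr.splits)
qed (use assms in \<open>auto split: if_splits dr.splits\<close>)

lemma compl_StripL:
  assumes "okn n" "valid n x" "out (knd n w x) d = Some StripL"
  shows "\<exists>g. vcol n d g \<and> stst d (rs n d g) \<and> x = wls n d g \<and>
    (\<forall>z. valid n z \<longrightarrow> anc n (Col d g) z \<longrightarrow> z = Col d g \<or> anc n x z)"
proof (cases x)
  case (Rg j h i)
  have "sym_at n w j = FF" and c: "(d = DE \<or> d = DS) \<and> h = DE \<and> i + 1 = 2 * j \<or> d = DW \<and> h = DS \<and> i + 2 = 2 * j"
    using assms Rg by (auto simp: icl_def split: if_splits dr.splits)
  then have j: "j = n" by (auto simp: sym_at_def split: if_splits)
  have n0: "n \<noteq> 0" using assms Rg j by simp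
  have n: "13 \<le> n" using okn_ge[OF assms(1) n0] .
  from c show ?thesis
  proof
    assume a: "(d = DE \<or> d = DS) \<and> h = DE \<and> i + 1 = 2 * j"
    have "z = Col d 0 \<or> anc n x z" if z: "valid n z" "anc n (Col d 0) z" for z
    proof (cases z)
      case z': (Rg a b e)
      show ?thesis using z z' Rg a j hn_le[of b] by (cases b) (auto simp: rle_def)
    qed (use z a Rg in auto)
    then show ?thesis using a Rg j n by (intro exI[of _ 0]) (auto simp: vcol_def stst_def rs_def)
  next
    assume a: "d = DW \<and> h = DS \<and> i + 2 = 2 * j"
    have "z = Col d 1 \<or> anc n x z" if z: "valid n z" "anc n (Col d 1) z" for z
    proof (cases z)
      case z': (Rg a b e)
      show ?thesis using z z' Rg a j by (auto simp: rle_def)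
    qed (use z a Rg in \<open>auto simp: vcol_def\<close>)
    then show ?thesis using a Rg j n by (intro exI[of _ 1]) (auto simp: vcol_def stst_def rs_def)
  qed
qed (use assms in \<open>auto split: if_splits dr.splits\<close>)

lemma vcol_Suc:
  assumes "okn n" "vcol n o' g" "g \<noteq> top n o'" shows "vcol n o' (Suc g)" "\<not> stst o' (rs n o' (Suc g))"
proof -
  have n0: "n \<noteq> 0" using assms by (simp add: vcol_def)
  show "vcol n o' (Suc g)" using assms by (auto simp: vcol_def)
  show "\<not> stst o' (rs n o' (Suc g))"
    using rs_facts(1,2)[OF assms(1) n0, where o' = o' and g = "Suc g"] assms(2) by (auto simp: stst_def vcol_def)
qed

lemma rs_top: "okn n \<Longrightarrow> n \<noteq> 0 \<Longrightarrow> rs n o' (top n o') = (if o' = DN then 19 else 21)"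
  using okn_ge[of n] by (cases o') (auto simp: rs_def)

lemma compl_Nxt:
  assumes n: "okn n" and v: "valid n x" and c: "out (knd n w x) d = Some c" "c = Nxt o' q \<or> c = Sg o' q"
  shows "\<exists>g. vcol n o' g \<and> \<not> stst o' (rs n o' g) \<and> x = cpr n o' g \<and> d = opp (psd o' (rs n o' g))
    \<and> c = (if sgt o' (rs n o' g) then Sg o' (rs n o' g) else Nxt o' (lb o' (rs n o' g)))"
proof -
  have "\<exists>g. vcol n o' g \<and> \<not> stst o' (rs n o' g) \<and> x = cpr n o' g \<and> pos n x = pos n (Col o' g) + vec (opp d)"
  proof (cases x)
    case (Rg j h i)
    then show ?thesis using v c by (auto simp: icl_def split: if_splits dr.splits)
  next
    case (Col e g)
    then have e: "e = o'" "d = fw o'" "\<not> tooth o' (rs n o' g)" using c by (auto split: if_splits)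
    have n0: "n \<noteq> 0" using v Col by (simp add: vcol_def)
    have "g \<noteq> top n o'"
    proof
      assume "g = top n o'"
      then have "rs n o' g = (if o' = DN then 19 else 21)" using rs_top[OF n n0] by simp
      then show False using c Col e by (cases o') (auto simp: sgt_def tooth_def split: if_splits)
    qed
    moreover have "pos n x = pos n (Col o' (Suc g)) + vec (opp d)" using Col e by (cases o') auto
    ultimately show ?thesis using vcol_Suc[OF n, of o' g] v Col e
      by (intro exI[of _ "Suc g"]) (simp add: cpr_def)
  next
    case (M2 e g)
    then have e: "e = o'" "d = opp o'" "tooth o' (rs n o' g)" "rs n o' g \<noteq> 21" using c v by (auto split: if_splits)
    have n0: "n \<noteq> 0" using v M2 by (simp add: vcol_def)
    have "g \<noteq> top n o'"
    proof
      assume "g = top n o'"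
      then have "rs n o' g = (if o' = DN then 19 else 21)" using rs_top[OF n n0] by simp
      then show False using e by (auto simp: tooth_def split: if_splits)
    qed
    moreover have "pos n x = pos n (Col o' (Suc g)) + vec (opp d)" using M2 e by (cases o') auto
    ultimately show ?thesis using vcol_Suc[OF n, of o' g] v M2 e
      by (intro exI[of _ "Suc g"]) (simp add: cpr_def)
  next
    case KK
    then have "o' = DN" "d = DW" using c by (auto split: if_splits)
    then show ?thesis using KK c v by (intro exI[of _ 0]) (auto simp: vcol_def cpr_def stst_def)
  qed (use v c in \<open>auto split: if_splits dr.splits\<close>)
  then obtain g where g: "vcol n o' g" "\<not> stst o' (rs n o' g)" "x = cpr n o' g" "pos n x = pos n (Col o' g) + vec (opp d)" by blast
  have "vec (opp d) = vec (psd o' (rs n o' g))" using cpr_props(2)[OF n g(1,2)] g(3,4) by simp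
  then have "opp d = psd o' (rs n o' g)" by simp
  then have d: "d = opp (psd o' (rs n o' g))" by (metis opp_opp)
  then show ?thesis using cpr_props(5)[OF n g(1,2), of w] c g by auto
qed

lemma rs_inv:
  assumes n: "okn n" "n \<noteq> 0" and "11 \<le> rs n o' g" "o' \<noteq> DE \<or> rs n o' g \<le> 19"
  shows "g = n + (rs n o' g - 11)"
proof -
  have "n \<le> g" using rs_facts(4)[OF n] assms(3) by blast
  moreover have "o' \<noteq> DE \<or> g \<le> n + 8"
  proof (rule ccontr)
    assume "\<not> ?thesis"
    then show False using assms(4) okn_ge[OF n] by (auto simp: rs_def split: if_splits)
  qed
  ultimately show ?thesis using rs_facts(7)[OF n, of g o'] by simp
qed

lemma rs_plus: "okn n \<Longrightarrow> n \<noteq> 0 \<Longrightarrow> k \<le> 8 \<or> o' \<noteq> DE \<Longrightarrow> rs n o' (n + k) = 11 + k"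
  using rs_facts(7)[of n "n + k" o'] by auto

lemma compl_LfV:
  assumes n: "okn n" and v: "valid n x" and o: "out (knd n w x) d = Some (LfV o' q)"
  shows "\<exists>g. q = rs n o' g \<and> valid n (Le o' g) \<and>
       (if hi o' then x = M2 o' (g - 2) \<and> 2 \<le> g \<and> d = fw o' else x = M1 o' (g + 1) \<and> d = opp (fw o'))"
proof (cases x)
  case (Rg j h i)
  then show ?thesis using o by (auto split: if_splits dr.splits)
next
  case (M1 e g)
  have e: "e = o'" "\<not> hi o'" "d = opp (fw o')" "rs n o' g = 15 \<or> rs n o' g = 21" "q = rs n o' g - 1" "vcol n o' g"
    using o v M1 by (auto split: if_splits)
  have n0: "n \<noteq> 0" using e by (simp add: vcol_def)
  have oo: "o' \<noteq> DE" using e by auto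
  then have g: "g = n + 4 \<and> q = 14 \<or> g = n + 10 \<and> q = 20" using rs_inv[OF n n0, of o' g] e by auto
  then have "rs n o' (g - 1) = q" using rs_plus[OF n n0, of 3 o'] rs_plus[OF n n0, of 9 o'] oo by (auto simp: add.commute)
  then show ?thesis using e M1 g n0
    by (intro exI[of _ "g - 1"]) (cases o'; auto simp: vcol_def leafr_def)
next
  case (M2 e g)
  have e: "e = o'" "hi o'" "d = fw o'" "rs n o' g = 11 \<or> rs n o' g = 17" "q = rs n o' g + 2" "vcol n o' g"
    using o v M2 by (auto split: if_splits)
  have n0: "n \<noteq> 0" using e by (simp add: vcol_def)
  have "g = n + (rs n o' g - 11)" by (rule rs_inv[OF n n0]) (use e in auto)
  then have g: "g = n \<and> q = 13 \<or> g = n + 6 \<and> q = 19" using e by auto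
  have "rs n o' (g + 2) = q" using g rs_plus[OF n n0, of 2 o'] rs_plus[OF n n0, of 8 o'] by (auto simp: add.commute)
  then show ?thesis using e M2 g okn_ge[OF n n0]
    by (intro exI[of _ "g + 2"]) (cases o'; auto simp: vcol_def leafr_def)
qed (use o v in \<open>auto split: if_splits dr.splits\<close>)

lemma compl_strip:
  assumes n: "okn n" and v: "valid n x" and o: "out (knd n w x) d = Some c"
  shows "c = Tl1 o' q \<Longrightarrow> \<exists>g. x = Col o' g \<and> d = o' \<and> q = rs n o' g \<and> valid n (M1 o' g)"
    "c = Tl2 o' q \<Longrightarrow> \<exists>g. x = M1 o' g \<and> d = fw o' \<and> q = rs n o' g \<and> valid n (M2 o' g)"
    "c = CorS \<Longrightarrow> x = Col DE (2 * n) \<and> d = DN \<and> n \<noteq> 0"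
    "c = LfS o' q \<Longrightarrow> \<exists>g. x = Col o' g \<and> d = o' \<and> q = rs n o' g \<and> valid n (Le o' g)"
    "c = Neu q \<Longrightarrow> \<exists>o' g. x = Le o' g \<and> hi o' \<and> d = fw o' \<and> q = rs n o' g"
proof -
  have R: "c \<noteq> Tl1 o' q \<and> c \<noteq> Tl2 o' q \<and> c \<noteq> CorS \<and> c \<noteq> LfS o' q \<and> c \<noteq> LfV o' q \<and> c \<noteq> Neu q" if "x = Rg j h i" for j h i
    using o that by (auto split: if_splits dr.splits)
  show "\<exists>g. x = Col o' g \<and> d = o' \<and> q = rs n o' g \<and> valid n (M1 o' g)" if "c = Tl1 o' q"
    using R that o v by (cases x) (auto split: if_splits dr.splits)
  show "\<exists>g. x = M1 o' g \<and> d = fw o' \<and> q = rs n o' g \<and> valid n (M2 o' g)" if "c = Tl2 o' q"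
    using R that o v by (cases x) (auto split: if_splits dr.splits)
  show "x = Col DE (2 * n) \<and> d = DN \<and> n \<noteq> 0" if c: "c = CorS"
  proof (cases x)
    case (Col e g)
    have "e = DE" "d = DN" "rs n DE g = 21" "n \<noteq> 0" "g \<le> 2 * n" using o v c Col by (auto simp: vcol_def split: if_splits)
    then show ?thesis using Col rs_facts(6)[OF n] by simp
  qed (use R c o v in \<open>auto split: if_splits dr.splits\<close>)
  show "\<exists>g. x = Col o' g \<and> d = o' \<and> q = rs n o' g \<and> valid n (Le o' g)" if "c = LfS o' q"
    using R that o v by (cases x) (auto split: if_splits dr.splits)
  show "\<exists>o' g. x = Le o' g \<and> hi o' \<and> d = fw o' \<and> q = rs n o' g" if "c = Neu q"
    using R that o v by (cases x) (auto split: if_splits dr.splits)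
qed

section \<open>The shape of producible supertiles\<close>

lemma hn0: "hn h = 0 \<longleftrightarrow> h = DN" by (cases h) auto

text \<open>\<open>n\<close> and \<open>w\<close> are guesses. An unfinished cell need not determine
  them, and different tiles of one cell may be witnessed by different guesses.\<close>

definition sup :: "kasm \<Rightarrow> pos \<Rightarrow> nat \<Rightarrow> (nat \<Rightarrow> bool) \<Rightarrow> slot \<Rightarrow> bool" where
  "sup \<kappa> c n w x \<longleftrightarrow> okn n \<and> valid n x \<and>
     (\<forall>y. valid n y \<and> anc n x y \<longrightarrow> \<kappa> (c + pos n y) = Some (knd n w y))"

definition V1 :: "kasm \<Rightarrow> bool" where
  "V1 \<kappa> \<longleftrightarrow> (\<forall>p k. \<kappa> p = Some k \<longrightarrow> (\<exists>c n w x. p = c + pos n x \<and> sup \<kappa> c n w x))"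

text \<open>The first tile of the final ring carries \<open>FF\<close>, so its presence pins down
  the size.\<close>

definition fin :: "kasm \<Rightarrow> pos \<Rightarrow> nat \<Rightarrow> bool" where
  "fin \<kappa> c n \<longleftrightarrow> n \<noteq> 0 \<and> (\<exists>w. sup \<kappa> c n w (Rg n DN 0))"

text \<open>Two seeds in one supertile are joined by leaves, so both cells are finished, have the same size \<open>n\<close>, and
  lie on a common lattice of period \<open>2 n + 4\<close>.\<close>

definition V2 :: "kasm \<Rightarrow> bool" where
  "V2 \<kappa> \<longleftrightarrow> (\<forall>c c'. \<kappa> c = Some Seed \<and> \<kappa> c' = Some Seed \<and> c \<noteq> c' \<longrightarrow>
     (\<exists>n u v. fin \<kappa> c n \<and> fin \<kappa> c' n \<and> c' = c + ((2 * int n + 4) * u, (2 * int n + 4) * v)))"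

definition VV :: "kasm \<Rightarrow> bool" where "VV \<kappa> \<longleftrightarrow> V1 \<kappa> \<and> V2 \<kappa>"

lemma supD: "sup \<kappa> c n w x \<Longrightarrow> \<kappa> (c + pos n x) = Some (knd n w x)"
  unfolding sup_def using anc_refl by blast

lemma sup_anc: "sup \<kappa> c n w x \<Longrightarrow> valid n y \<Longrightarrow> anc n x y \<Longrightarrow> \<kappa> (c + pos n y) = Some (knd n w y)"
  unfolding sup_def by blast

lemma anc_SS [simp]: "anc n x SS" by (cases x) auto

lemma sup_seed: "sup \<kappa> c n w x \<Longrightarrow> \<kappa> c = Some Seed"
  using sup_anc[of \<kappa> c n w x SS] by simp

lemma sup_mono: "sup \<kappa> c n w x \<Longrightarrow> \<kappa> \<subseteq>\<^sub>m \<kappa>' \<Longrightarrow> sup \<kappa>' c n w x"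
  unfolding sup_def map_le_def by (metis domIff option.discI)

lemma sup_sub:
  "sup \<kappa> c n w x \<Longrightarrow> valid n y \<Longrightarrow> (\<And>z. valid n z \<Longrightarrow> anc n y z \<Longrightarrow> anc n x z) \<Longrightarrow> sup \<kappa> c n w y"
  unfolding sup_def by blast

lemma fin_mono: "fin \<kappa> c n \<Longrightarrow> \<kappa> \<subseteq>\<^sub>m \<kappa>' \<Longrightarrow> fin \<kappa>' c n"
  unfolding fin_def using sup_mono by blast

lemma V1_E:
  assumes "V1 \<kappa>" "\<kappa> p = Some k"
  obtains c n w x where "p = c + pos n x" "sup \<kappa> c n w x" "k = knd n w x" "okn n" "valid n x"
proof -
  obtain c n w x where "p = c + pos n x" "sup \<kappa> c n w x" using assms unfolding V1_def by blast
  moreover then have "k = knd n w x" using supD assms(2) by fastforce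
  ultimately show ?thesis using that unfolding sup_def by blast
qed

lemma V1_okk: "V1 \<kappa> \<Longrightarrow> \<kappa> p = Some k \<Longrightarrow> okk k"
  using V1_E okk_knd by metis

lemma V1_input:
  assumes v: "V1 \<kappa>" and p: "\<kappa> p = Some k" and i: "inp k d = Some c" and l: "\<And>o' r. k \<noteq> Lf o' r"
  shows "\<exists>k'. \<kappa> (p + vec d) = Some k' \<and> out k' (opp d) = Some c"
proof -
  obtain a n w x where x: "p = a + pos n x" "sup \<kappa> a n w x" "k = knd n w x" "okn n" "valid n x" by (rule V1_E[OF v p])
  have nl: "\<not> is_leaf x" using l x(3) unfolding is_leaf_def by (metis knd.simps(6))
  have "c \<noteq> Neu r" for r using i l by (cases k) (auto split: if_splits)
  then obtain y where y: "valid n y" "pos n y = pos n x + vec d" "out (knd n w y) (opp d) = Some c" "anc n x y"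
    using match[OF x(4,5), of w d c] i x(3) nl by blast
  then have "\<kappa> (a + pos n y) = Some (knd n w y)" using sup_anc[OF x(2)] by blast
  then show ?thesis using y x(1) by (metis add.assoc)
qed

text \<open>No input of the new tile is inspected: it is enough that an existing slot
  \<open>x\<close> vouches for all other ancestors. This covers tiles whose inputs are linked late
  or in an unusual order.\<close>

lemma attach_slot:
  assumes V: "VV \<kappa>" and p: "\<kappa> p = None" and k: "k \<noteq> Seed"
    and x: "sup \<kappa> c n w x" and y: "valid n y" "p = c + pos n y" "k = knd n w y"
    and a: "\<And>z. valid n z \<Longrightarrow> anc n y z \<Longrightarrow> z = y \<or> anc n x z"
  shows "VV (\<kappa>(p \<mapsto> k))"
proof -
  let ?k = "\<kappa>(p \<mapsto> k)"
  have le: "\<kappa> \<subseteq>\<^sub>m ?k" using p by (auto simp: map_le_def)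
  have s: "sup ?k c n w y" unfolding sup_def
  proof (intro conjI allI impI)
    fix z assume z: "valid n z \<and> anc n y z"
    show "?k (c + pos n z) = Some (knd n w z)"
    proof (cases "z = y")
      case True then show ?thesis using y by simp
    next
      case False
      then have "\<kappa> (c + pos n z) = Some (knd n w z)" using a z sup_anc[OF x] by blast
      then show ?thesis using le p by auto
    qed
  qed (use x y in \<open>auto simp: sup_def\<close>)
  have "V1 ?k" unfolding V1_def
  proof (intro allI impI)
    fix q k' assume q: "?k q = Some k'"
    show "\<exists>c n w x. q = c + pos n x \<and> sup ?k c n w x"
    proof (cases "q = p")
      case True then show ?thesis using s y(2) by blast
    next
      case False
      then obtain c n w x where "q = c + pos n x" "sup \<kappa> c n w x"
        using q V unfolding VV_def V1_def by (metis fun_upd_other)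
      then show ?thesis using sup_mono[OF _ le] by blast
    qed
  qed
  moreover have "V2 ?k" unfolding V2_def
  proof (intro allI impI)
    fix a b assume ab: "?k a = Some Seed \<and> ?k b = Some Seed \<and> a \<noteq> b"
    then have "\<kappa> a = Some Seed" "\<kappa> b = Some Seed" using k by (auto split: if_splits)
    then obtain n u v where "fin \<kappa> a n" "fin \<kappa> b n" "b = a + ((2 * int n + 4) * u, (2 * int n + 4) * v)"
      using V ab unfolding VV_def V2_def by blast
    then show "\<exists>n u v. fin ?k a n \<and> fin ?k b n \<and> b = a + ((2 * int n + 4) * u, (2 * int n + 4) * v)"
      using fin_mono[OF _ le] by blast
  qed
  ultimately show ?thesis unfolding VV_def by blast
qed

text \<open>A partial spiral does not fix its size, so the guess may be revised as long as it agrees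
  on the symbols already placed.\<close>

lemma sup_reparam:
  assumes "sup \<kappa> c n w (Rg j h i)" "okn n'" "valid n' (Rg j h i)" "\<And>a. 1 \<le> a \<Longrightarrow> a \<le> j \<Longrightarrow> sym_at n w a = sym_at n' w' a"
  shows "sup \<kappa> c n' w' (Rg j h i)"
  unfolding sup_def
proof (intro conjI allI impI)
  fix y assume y: "valid n' y \<and> anc n' (Rg j h i) y"
  have v: "valid n (Rg j h i)" using assms(1) unfolding sup_def by blast
  show "\<kappa> (c + pos n' y) = Some (knd n' w' y)"
  proof (cases y)
    case SS then show ?thesis using sup_seed[OF assms(1)] by simp
  next
    case (Rg a b e)
    have le: "a \<le> j" "1 \<le> a" using y Rg by (auto simp: rle_def)
    have "valid n y" "anc n (Rg j h i) y" using y Rg v le by auto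
    then have "\<kappa> (c + pos n y) = Some (knd n w y)" using sup_anc[OF assms(1)] by blast
    moreover have "knd n w y = knd n' w' y"
      using Rg assms(4)[OF le(2,1)] assms(4)[of "a - 1"] le by (auto simp del: One_nat_def) 
    ultimately show ?thesis using Rg by simp
  qed (use y in auto)
qed (use assms in auto)

lemma lb_wlc_inj:
  assumes "okk (Sc o' a)" "okk (Sc o' b)" "lb o' a = lb o' b" "wlc o' a = wlc o' b"
  shows "a = b"
  using assms by (auto simp: lb_def wlc_def split: if_splits)

text \<open>One input locates the slot. A second one, if any, settles what the location leaves open:
  the wall class of a \<open>Run\<close> tile, or the row state behind an ambiguous label.\<close>

lemma attach:
  assumes V: "VV \<kappa>" and p: "\<kappa> p = None" and k: "k \<noteq> Seed" "okk k" "\<And>o' r. k \<noteq> Lf o' r"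
    and i: "\<And>d c. inp k d = Some c \<Longrightarrow> \<exists>k'. \<kappa> (p + vec d) = Some k' \<and> out k' (opp d) = Some c"
  shows "VV (\<kappa>(p \<mapsto> k))"
proof -
  have v1: "V1 \<kappa>" using V unfolding VV_def by simp
  have src: "\<exists>a n w x. p = a + pos n x + vec (opp d) \<and> sup \<kappa> a n w x \<and> okn n \<and> valid n x \<and> out (knd n w x) (opp d) = Some c"
    if "inp k d = Some c" for d c
  proof -
    from i[OF that] obtain k' where k': "\<kappa> (p + vec d) = Some k'" "out k' (opp d) = Some c" by blast
    obtain a n w x where "p + vec d = a + pos n x" "sup \<kappa> a n w x" "k' = knd n w x" "okn n" "valid n x" by (rule V1_E[OF v1 k'(1)])
    moreover then have "p = a + pos n x + vec (opp d)" by (simp add: vec_opp algebra_simps)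
    ultimately show ?thesis using k'(2) by blast
  qed
  have chk: "out (knd n w z) (opp d) = Some c"
    if "inp k d = Some c" "sup \<kappa> a n w x" "p = a + pos n y" "valid n z" "pos n z = pos n y + vec d" "anc n x z" for d c a n w x y z
  proof -
    have "\<kappa> (a + pos n z) = Some (knd n w z)" using sup_anc that by blast
    moreover have "a + pos n z = p + vec d" using that by (simp add: add.assoc)
    ultimately show ?thesis using i[OF that(1)] by auto
  qed
  show ?thesis
  proof (cases k)
    case Seed then show ?thesis using k by simp
  next
    case (St1 s)
    then have "inp k DW = Some St1L" by simp
    from src[OF this] obtain a n w x where x: "p = a + pos n x + vec DE" "sup \<kappa> a n w x" "okn n" "valid n x" "out (knd n w x) DE = Some St1L" by auto
    have [simp]: "x = SS" using compl_St1L[OF x(4,5)] by simp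
    obtain b where b: "s = Sy 1 b" using k(2) St1 by auto
    have "sup \<kappa> a 0 (\<lambda>_. b) SS" using sup_seed[OF x(2)] by (auto simp: sup_def okn_def)
    then show ?thesis by (rule attach_slot[OF V p k(1), of _ _ _ _ "Rg 1 DN 0"])
      (use x St1 b in \<open>auto simp: sym_at_def cnt_def rle_def hn0 split: slot.splits\<close>)
  next
    case (St q s)
    then have "inp k DW = Some (StL q)" by simp
    from src[OF this] obtain a n w x where x: "p = a + pos n x + vec DE" "sup \<kappa> a n w x" "okn n" "valid n x" "out (knd n w x) DE = Some (StL q)" by auto
    obtain j where j: "x = Rg j DE (2 * j - 1)" "1 \<le> j" "q = cls (sym_at n w j)" "sym_at n w j \<noteq> FF"
      using compl_StL[OF x(4,5)] by auto
    have jn: "n = 0 \<or> j < n" using x(4) j by (auto simp: sym_at_def split: if_splits)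
    \<comment> \<open>The new symbol dictates the revised guess: \<open>FF\<close> keeps the size, a
      further counter returns to the open value \<open>0\<close>, and \<open>PP\<close> commits to
      \<open>j + 2\<close>.\<close>
    have "\<exists>n' w'. okn n' \<and> valid n' (Rg (Suc j) DN 0) \<and> k = knd n' w' (Rg (Suc j) DN 0) \<and>
        (\<forall>a. 1 \<le> a \<longrightarrow> a \<le> j \<longrightarrow> sym_at n w a = sym_at n' w' a)"
    proof (cases "q = 0")
      case True
      then have "s = FF" using k(2) St by auto
      moreover have "sym_at n w j = PP" using True j cnt_bounds[OF j(2)] by (auto simp: sym_at_def split: if_splits)
      then have "n = Suc j" using j by (auto simp: sym_at_def split: if_splits)
      ultimately show ?thesis using St True x(3) j by (intro exI[of _ n] exI[of _ w]) (auto simp: sym_at_def)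
    next
      case False
      then have sj: "sym_at n w j = Sy (cnt j) (w j)" "j \<noteq> n" "j + 1 \<noteq> n" using j by (auto simp: sym_at_def split: if_splits)
      then have q: "q = cnt j" using j by simp
      have jn': "n = 0 \<or> j + 1 < n" using jn sj by auto
      have "(\<exists>b. s = Sy (nxc q) b) \<or> (q = 11 \<or> q = 15) \<and> s = PP" using k(2) St False by auto
      then show ?thesis
      proof
        assume "\<exists>b. s = Sy (nxc q) b"
        then obtain b where b: "s = Sy (nxc q) b" by blast
        then show ?thesis using St q j(2) cnt_Suc[OF j(2)] jn'
          by (intro exI[of _ 0] exI[of _ "w(Suc j := b)"]) (auto simp: sym_at_def okn_def)
      next
        assume a: "(q = 11 \<or> q = 15) \<and> s = PP"
        then have "okn (j + 2)" using cnt_penult[OF j(2)] q by simp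
        then show ?thesis using St q a j(2) jn'
          by (intro exI[of _ "j + 2"] exI[of _ w]) (auto simp: sym_at_def)
      qed
    qed
    then obtain n' w' where n': "okn n'" "valid n' (Rg (Suc j) DN 0)" "k = knd n' w' (Rg (Suc j) DN 0)"
        "\<And>a. 1 \<le> a \<Longrightarrow> a \<le> j \<Longrightarrow> sym_at n w a = sym_at n' w' a" by blast
    have "valid n' x" using n'(2) j by auto
    then have "sup \<kappa> a n' w' x" using sup_reparam[of \<kappa> a n w j DE "2 * j - 1" n' w'] x(2) n' j(1) by simp
    moreover have "x = prv (Rg (Suc j) DN 0)" using j by auto
    moreover have "p = a + pos n' (Rg (Suc j) DN 0)" using x(1) j by (simp add: algebra_simps)
    ultimately show ?thesis using attach_slot[OF V p k(1) _ n'(2) _ n'(3)] prv_props(5)[OF n'(2)] by blast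
  next
    case (Run h s c)
    then have i1: "inp k (opp h) = Some (Pth s)" and i2: "inp k (lft h) = Some (Wl False c)" by auto
    from src[OF i1] obtain a n w x where x: "p = a + pos n x + vec h" "sup \<kappa> a n w x" "okn n" "valid n x" "out (knd n w x) h = Some (Pth s)" by auto
    obtain j i' where j: "valid n (Rg j h i')" "x = prv (Rg j h i')" "md h i' = h" "Pth s = mainc n w j h i'"
      using compl_main[OF x(4,5), of s] by auto
    have py: "p = a + pos n (Rg j h i')" using x(1) j prv_props(2)[OF j(1)] by (simp add: add.assoc)
    have ni: "\<not> (h = DN \<and> i' = 0)" "h = DE \<or> i' + 1 \<noteq> 2 * j" "s = sym_at n w j"
      using j(3,4) by (auto simp: md_def mainc_def split: if_splits)
    note ip = inr_props[OF j(1) ni(1,2)]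
    have "inr (Rg j h i') \<noteq> Rg j h i'" using ip(4) by fastforce
    then have "anc n x (inr (Rg j h i'))" using prv_props(5)[OF j(1) ip(1) ip(3)] j(2) by simp
    then have "out (knd n w (inr (Rg j h i'))) (rgt h) = Some (Wl False c)"
      using chk[OF i2 x(2) py ip(1)] ip(2) by simp
    then have "c = icl j h i'" using ip(5)[of w] by simp
    then have "k = knd n w (Rg j h i')" using Run ni by auto
    then show ?thesis using attach_slot[OF V p k(1) x(2) j(1) py] prv_props(5)[OF j(1)] j(2) by blast
  next
    case (Cor h s)
    then have i1: "inp k (opp h) = Some (CorL s)" by auto
    from src[OF i1] obtain a n w x where x: "p = a + pos n x + vec h" "sup \<kappa> a n w x" "okn n" "valid n x" "out (knd n w x) h = Some (CorL s)" by auto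
    obtain j i' where j: "valid n (Rg j h i')" "x = prv (Rg j h i')" "md h i' = h" "CorL s = mainc n w j h i'"
      using compl_main[OF x(4,5), of s] by auto
    have py: "p = a + pos n (Rg j h i')" using x(1) j prv_props(2)[OF j(1)] by (simp add: add.assoc)
    have "k = knd n w (Rg j h i')" using Cor j(3,4) by (auto simp: md_def mainc_def split: if_splits)
    then show ?thesis using attach_slot[OF V p k(1) x(2) j(1) py] prv_props(5)[OF j(1)] j(2) by blast
  next
    case (Sc o' r)
    show ?thesis
    proof (cases "stst o' r")
      case True
      then have "inp k (opp o') = Some StripL" using Sc by auto
      from src[OF this] obtain a n w x where x: "p = a + pos n x + vec o'" "sup \<kappa> a n w x" "okn n" "valid n x" "out (knd n w x) o' = Some StripL" by auto
      obtain g where g: "vcol n o' g" "stst o' (rs n o' g)" "x = wls n o' g" "\<And>z. valid n z \<Longrightarrow> anc n (Col o' g) z \<Longrightarrow> z = Col o' g \<or> anc n x z"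
        using compl_StripL[OF x(3,4,5)] by blast
      have "rs n o' g = r" using True g(2) by (auto simp: stst_def)
      moreover have "p = a + pos n (Col o' g)" using x(1) wls_props(2)[OF x(3) g(1)] g(3) by (simp add: vec_opp algebra_simps)
      ultimately show ?thesis using attach_slot[OF V p k(1) x(2), of "Col o' g"] g Sc by auto
    next
      case F: False
      define c where "c = (if sgt o' r then Sg o' r else Nxt o' (lb o' r))"
      have "inp k (psd o' r) = Some c" using Sc F by (auto simp: c_def psd_def sgt_def tooth_def)
      from src[OF this] obtain a n w x where x: "p = a + pos n x + vec (opp (psd o' r))" "sup \<kappa> a n w x" "okn n" "valid n x" "out (knd n w x) (opp (psd o' r)) = Some c" by blast
      have "\<exists>q. c = Nxt o' q \<or> c = Sg o' q" by (auto simp: c_def)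
      then obtain g where g: "vcol n o' g" "\<not> stst o' (rs n o' g)" "x = cpr n o' g" "opp (psd o' r) = opp (psd o' (rs n o' g))"
          "c = (if sgt o' (rs n o' g) then Sg o' (rs n o' g) else Nxt o' (lb o' (rs n o' g)))"
        using compl_Nxt[OF x(3,4,5)] by blast
      have py: "p = a + pos n (Col o' g)" using x(1) cpr_props(2)[OF x(3) g(1,2)] g(3,4) by (simp add: vec_opp algebra_simps)
      have anc: "z = Col o' g \<or> anc n x z" if "valid n z" "anc n (Col o' g) z" for z
        using cpr_props(6)[OF x(3) g(1,2) that] g(3) by simp
      have "r = rs n o' g"
      proof (cases "sgt o' r")
        case True then show ?thesis using g(5) by (auto simp: c_def split: if_splits)
      next
        case False
        then have ns: "\<not> sgt o' (rs n o' g)" "lb o' r = lb o' (rs n o' g)" using g(5) by (auto simp: c_def split: if_splits)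
        have i2: "inp k (opp o') = Some (Wl True (wlc o' r))" using Sc F False by simp
        note wp = wls_props[OF x(3) g(1)]
        have "wls n o' g \<noteq> Col o' g" by (cases o') auto
        then have "anc n x (wls n o' g)" using anc[OF wp(1,3)] by simp
        then have "out (knd n w (wls n o' g)) o' = Some (Wl True (wlc o' r))" using chk[OF i2 x(2) py wp(1)] wp(2) by simp
        then have "wlc o' r = wlc o' (rs n o' g)" using wp(5)[of w] g(2) by simp
        moreover have "okk (Sc o' (rs n o' g))" using okk_knd[OF x(3), of "Col o' g" w] g(1) by simp
        ultimately show ?thesis using lb_wlc_inj[of o' r "rs n o' g"] k(2) Sc ns by simp
      qed
      then show ?thesis using attach_slot[OF V p k(1) x(2), of "Col o' g"] g(1) py anc Sc by auto
    qed
  next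
    case (T1 o' r)
    then have "inp k (opp o') = Some (Tl1 o' r)" by auto
    from src[OF this] obtain a n w x where x: "p = a + pos n x + vec o'" "sup \<kappa> a n w x" "okn n" "valid n x" "out (knd n w x) o' = Some (Tl1 o' r)" by auto
    obtain g where g: "x = Col o' g" "r = rs n o' g" "valid n (M1 o' g)" using compl_strip(1)[OF x(3,4,5)] by blast
    have "p = a + pos n (M1 o' g)" using x(1) g(1) by (cases o') (auto simp: algebra_simps)
    then show ?thesis by (rule attach_slot[OF V p k(1) x(2) g(3)]) (use T1 g in \<open>(auto, (case_tac z; auto; presburger)?)\<close>)
  next
    case (T2 o' r)
    then have "inp k (opp (fw o')) = Some (Tl2 o' r)" by auto
    from src[OF this] obtain a n w x where x: "p = a + pos n x + vec (fw o')" "sup \<kappa> a n w x" "okn n" "valid n x" "out (knd n w x) (fw o') = Some (Tl2 o' r)" by auto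
    obtain g where g: "x = M1 o' g" "r = rs n o' g" "valid n (M2 o' g)" using compl_strip(2)[OF x(3,4,5)] by blast
    have "p = a + pos n (M2 o' g)" using x(1) g(1) by (cases o') (auto simp: algebra_simps)
    then show ?thesis by (rule attach_slot[OF V p k(1) x(2) g(3)]) (use T2 g in \<open>(auto, (case_tac z; auto; presburger)?)\<close>)
  next
    case (Lf o' r) then show ?thesis using k by simp
  next
    case KC
    then have "inp k DS = Some CorS" by simp
    from src[OF this] obtain a n w x where x: "p = a + pos n x + vec DN" "sup \<kappa> a n w x" "okn n" "valid n x" "out (knd n w x) DN = Some CorS" by auto
    have g: "x = Col DE (2 * n)" "valid n KK" using compl_strip(3)[OF x(3,4,5)] by auto
    have "p = a + pos n KK" using x(1) g(1) by (auto simp: algebra_simps)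
    then show ?thesis by (rule attach_slot[OF V p k(1) x(2) g(2)]) (use KC g in auto)
  qed
qed

lemma stranc_mono: "k \<le> k' \<Longrightarrow> stranc n o' k z \<Longrightarrow> stranc n o' k' z"
  by (cases z) auto

text \<open>An input other than \<open>Neu\<close> comes from the leaf's own cell and therefore
  locates it. A high leaf forces only the tooth tip before it and a low leaf only the strip tile
  beside it; both are present behind either of the two inputs.\<close>

lemma attach_leaf:
  assumes V: "VV \<kappa>" and p: "\<kappa> p = None" and k: "k = Lf o' r" "okk k"
    and i: "inp k d = Some c" "\<kappa> (p + vec d) = Some k'" "out k' (opp d) = Some c" "c \<noteq> Neu (r - 1)"
  shows "VV (\<kappa>(p \<mapsto> k))"
proof -
  have kS: "k \<noteq> Seed" using k by simp
  have v1: "V1 \<kappa>" using V unfolding VV_def by simp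
  obtain a n w x where x: "p + vec d = a + pos n x" "sup \<kappa> a n w x" "k' = knd n w x" "okn n" "valid n x" by (rule V1_E[OF v1 i(2)])
  have px: "p = a + pos n x + vec (opp d)" using x(1) by (simp add: vec_opp algebra_simps)
  have o: "out (knd n w x) (opp d) = Some c" using i(3) x(3) by simp
  have "c = LfS o' r \<and> d = opp o' \<or> c = LfV o' r" using i(1,4) k(1) by (auto split: if_splits)
  then show ?thesis
  proof
    assume c: "c = LfS o' r \<and> d = opp o'"
    then obtain g where g: "x = Col o' g" "r = rs n o' g" "valid n (Le o' g)"
      using compl_strip(4)[OF x(4,5) o, of o' r] by blast
    have py: "p = a + pos n (Le o' g)" using px g(1) c by (cases o') (auto simp: algebra_simps)
    show ?thesis
    proof (rule attach_slot[OF V p kS x(2) g(3) py])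
      fix z assume z: "valid n z" "anc n (Le o' g) z"
      have "hi o' \<Longrightarrow> 2 \<le> g" using leaf_sup(1)[OF x(4), of o' g] g(3) by simp
      then have "hi o' \<Longrightarrow> 3 * (g - 2) + 2 \<le> 3 * g" by linarith
      then show "z = Le o' g \<or> anc n x z"
        using z g(1) stranc_mono[of "3 * (g - 2) + 2" "3 * g" n o' z] by (cases "hi o'") auto
    qed (use k g in auto)
  next
    assume c: "c = LfV o' r"
    then obtain g where g: "r = rs n o' g" "valid n (Le o' g)"
        "if hi o' then x = M2 o' (g - 2) \<and> 2 \<le> g \<and> opp d = fw o' else x = M1 o' (g + 1) \<and> opp d = opp (fw o')"
      using compl_LfV[OF x(4,5), of w "opp d" o' r] o by blast
    show ?thesis
    proof (cases "hi o'")
      case True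
      then have py: "p = a + pos n (Le o' g)" using px g(3) by (cases o') (auto simp: algebra_simps of_nat_diff)
      show ?thesis
        by (rule attach_slot[OF V p kS x(2) g(2) py]) (use k g True in auto)
    next
      case False
      then have py: "p = a + pos n (Le o' g)" using px g(3) by (cases o') (auto simp: algebra_simps)
      show ?thesis
      proof (rule attach_slot[OF V p kS x(2) g(2) py])
        fix z assume z: "valid n z" "anc n (Le o' g) z"
        then show "z = Le o' g \<or> anc n x z"
          using False g(3) stranc_mono[of "3 * g" "3 * (g + 1) + 1" n o' z] by auto
      qed (use k g in auto)
    qed
  qed
qed

text \<open>Supertiles without a seed: a root with strong descendants. There are at most two generations of them.\<close>

inductive cl :: "kasm \<Rightarrow> pos \<Rightarrow> bool" where
  cl1: "okk k \<Longrightarrow> k \<noteq> Seed \<Longrightarrow> cl [r \<mapsto> k] r"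
| cl2: "cl \<beta> r \<Longrightarrow> \<beta> p = None \<Longrightarrow> okk k \<Longrightarrow> \<beta> (p + vec d) = Some k' \<Longrightarrow> flow k' (opp d) k c \<Longrightarrow> strong c
   \<Longrightarrow> cl (\<beta>(p \<mapsto> k)) r"

lemma inp_inv1: "inp k d = Some (CorL s) \<Longrightarrow> k = Cor (opp d) s"
  by (cases k; simp add: psd_def split: if_splits)

lemma inp_inv2: "inp k d = Some (StL q) \<Longrightarrow> \<exists>s. k = St q s"
  by (cases k; simp add: psd_def split: if_splits)

lemma inp_inv3: "inp k d = Some (Sg o' q) \<Longrightarrow> k = Sc o' q \<and> d = opp (fw o')"
  by (cases k; simp add: psd_def split: if_splits)

lemma inp_inv4: "inp k d = Some (Tl1 o' q) \<Longrightarrow> k = T1 o' q \<and> d = opp o'"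
  by (cases k; simp add: psd_def split: if_splits)

lemma inp_inv5: "inp k d = Some (Tl2 o' q) \<Longrightarrow> k = T2 o' q \<and> d = opp (fw o')"
  by (cases k; simp add: psd_def split: if_splits)

lemma inp_inv6: "inp k d = Some CorS \<Longrightarrow> k = KC \<and> d = DS"
  by (cases k; simp add: psd_def split: if_splits)

lemma inp_inv7: "inp k d = Some StripL \<Longrightarrow> \<exists>r. k = Sc (opp d) r \<and> stst (opp d) r"
  by (cases k; simp add: psd_def split: if_splits)

lemma inp_inv8: "inp k d = Some (Pth s) \<Longrightarrow> \<exists>c. k = Run (opp d) s c"
  by (cases k; simp add: psd_def split: if_splits)

lemma inp_inv9: "inp k d = Some (Wl b c) \<Longrightarrow> (\<exists>h s. k = Run h s c \<and> d = lft h \<and> \<not> b) \<or> (\<exists>r. k = Sc (opp d) r \<and> wlc (opp d) r = c \<and> b)"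
  by (cases k; simp add: psd_def split: if_splits)

lemma inp_inv10: "inp k d = Some (Nxt o' q) \<Longrightarrow> \<exists>r. k = Sc o' r \<and> q = lb o' r \<and> d = psd o' r"
  by (cases k; simp add: psd_def split: if_splits; auto)

lemma inp_inv11: "inp k d = Some (LfS o' q) \<Longrightarrow> k = Lf o' q \<and> d = opp o'"
  by (cases k; simp add: psd_def split: if_splits)

lemma inp_inv12: "inp k d = Some (LfV o' q) \<Longrightarrow> k = Lf o' q \<and> d = (if hi o' then opp (fw o') else fw o')"
  by (cases k; simp add: psd_def split: if_splits)

lemma inp_inv13: "inp k d = Some (Neu q) \<Longrightarrow> \<exists>o' r. k = Lf o' r \<and> q = r - 1 \<and> \<not> hi o' \<and> d = opp (fw o')"
  by (cases k; simp add: psd_def split: if_splits)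

lemmas inp_inv = inp_inv1 inp_inv2 inp_inv3 inp_inv4 inp_inv5 inp_inv6 inp_inv7 inp_inv8 inp_inv9 inp_inv10 inp_inv11 inp_inv12 inp_inv13

definition sch :: "kind \<Rightarrow> dr \<Rightarrow> kind \<Rightarrow> bool" where
  "sch k d k' \<longleftrightarrow> okk k' \<and> (\<exists>c. flow k d k' c \<and> strong c)"

text \<open>Consequently a tile placed by a strong bond has no unmet input.\<close>

lemma strong_unique:
  assumes "okk k" "inp k d = Some c" "strong c" "inp k d' = Some c'"
  shows "d' = d"
  using assms by (cases k) (auto split: if_splits)

lemma strong_not_leaf: "inp k d = Some c \<Longrightarrow> strong c \<Longrightarrow> k \<noteq> Lf o' r"
  by (auto split: if_splits)

text \<open>Hence two links into a tile that is not a leaf meet all of its inputs.\<close>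

lemma two_inputs:
  assumes "okk k" "inp k d = Some c" "inp k d' = Some c'" "d \<noteq> d'" "\<And>o' r. k \<noteq> Lf o' r" "inp k e = Some f"
  shows "e = d \<or> e = d'"
  using assms by (cases k) (auto split: if_splits)

lemma cl_root: "cl \<beta> r \<Longrightarrow> r \<in> dom \<beta>"
  by (induction rule: cl.induct) auto

lemma cl_okk: "cl \<beta> r \<Longrightarrow> \<beta> p = Some k \<Longrightarrow> okk k \<and> k \<noteq> Seed"
proof (induction arbitrary: p k rule: cl.induct)
  case (cl2 \<beta> r q k0 d k' c)
  have "k0 \<noteq> Seed" using cl2.hyps(5) by (auto simp: flow_def)
  then show ?case using cl2 by (auto split: if_splits)
qed (auto split: if_splits)

lemma cl_nonroot:
  "cl \<beta> r \<Longrightarrow> \<beta> p = Some k \<Longrightarrow> p \<noteq> r \<Longrightarrow>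
    \<exists>d c k'. inp k d = Some c \<and> strong c \<and> \<beta> (p + vec d) = Some k' \<and> out k' (opp d) = Some c"
proof (induction arbitrary: p k rule: cl.induct)
  case (cl2 \<beta> r q k0 d k' c)
  show ?case
  proof (cases "p = q")
    case True
    have "q + vec d \<noteq> q" by simp
    then show ?thesis using cl2 True by (intro exI[of _ d] exI[of _ c] exI[of _ k']) (auto simp: flow_def)
  next
    case False
    then obtain d c k' where "inp k d = Some c" "strong c" "\<beta> (p + vec d) = Some k'" "out k' (opp d) = Some c"
      using cl2.IH[of p k] cl2.prems by auto
    moreover then have "p + vec d \<noteq> q" using cl2.hyps(2) by auto
    ultimately show ?thesis by auto
  qed
qed auto

text \<open>The complete list of strong bonds leaving a tile other than the seed; the shapes of
  fragments are read off from it.\<close>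

lemma sch_cases:
  assumes "sch k d k'" "okk k" "k \<noteq> Seed"
  shows "(\<exists>h s i. k = Run h s i \<and> d = h \<and> h \<noteq> DE \<and> k' = Cor h s) \<or>
     (\<exists>s c s'. k = Run DE s En \<and> d = DE \<and> k' = St c s' \<and> c = cls s) \<or>
     (\<exists>s b. k = St1 s \<and> d = DN \<and> k' = Cor DN s) \<or>
     k = Run DE FF En \<and> d = DE \<and> k' = Sc DE 0 \<or>
     k = Run DE FF En \<and> d = DS \<and> k' = Sc DS 0 \<or>
     k = Run DS FF Co \<and> d = DW \<and> k' = Sc DW 1 \<or>
     (\<exists>o' r. k = Sc o' r \<and> tooth o' r \<and> d = o' \<and> k' = T1 o' r) \<or>
     (\<exists>o' r. k = T1 o' r \<and> d = fw o' \<and> k' = T2 o' r) \<or>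
     (\<exists>o' r. k = Sc o' r \<and> hi o' \<and> (r = 12 \<or> r = 18) \<and> \<not> tooth o' r \<and> d = fw o' \<and> k' = Sc o' (r + 1)) \<or>
     k = Sc DE 21 \<and> d = DN \<and> k' = KC"
proof -
  obtain c where c: "out k d = Some c" "inp k' (opp d) = Some c" "strong c" "okk k'"
    using assms(1) by (auto simp: sch_def flow_def)
  show ?thesis
  proof (cases k)
    case (Run h s i)
    have "c = CorL s \<and> h \<noteq> DE \<and> d = h \<or> c = StL (cls s) \<and> h = DE \<and> d = DE \<and> i = En \<or>
      c = StripL \<and> s = FF \<and> (h = DE \<and> i = En \<and> (d = DE \<or> d = DS) \<or> h = DS \<and> i = Co \<and> d = DW)"
    proof (cases "d = h")
      case True
      then show ?thesis using c(1,3) Run by (cases "h = DE"; cases "i = En"; cases "s = FF"; simp split: if_splits; fastforce)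
    next
      case False
      then have "d = rgt h" "c = StripL" "s = FF \<and> (h = DE \<and> i = En \<or> h = DS \<and> i = Co)"
        using c(1,3) Run by (simp_all split: if_splits) auto
      then show ?thesis by auto
    qed
    then show ?thesis
    proof (elim disjE conjE)
      assume a: "c = CorL s" "h \<noteq> DE" "d = h"
      then have "k' = Cor h s" using c(2) inp_inv(1)[of k' "opp d" s] by simp
      then show ?thesis using a Run by simp
    next
      assume a: "c = StL (cls s)" "h = DE" "d = DE" "i = En"
      then have "\<exists>s'. k' = St (cls s) s'" using c(2) inp_inv(2)[of k' "opp d" "cls s"] by simp
      then show ?thesis using a Run by simp
    next
      assume a: "c = StripL" "s = FF" "h = DE" "i = En" "d = DE"
      then have "k' = Sc DE 0" using c(2) inp_inv(7)[of k' "opp d"] by (auto simp: stst_def)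
      then show ?thesis using a Run by simp
    next
      assume a: "c = StripL" "s = FF" "h = DE" "i = En" "d = DS"
      then have "k' = Sc DS 0" using c(2) inp_inv(7)[of k' "opp d"] by (auto simp: stst_def)
      then show ?thesis using a Run by simp
    next
      assume a: "c = StripL" "s = FF" "h = DS" "i = Co" "d = DW"
      then have "k' = Sc DW 1" using c(2) inp_inv(7)[of k' "opp d"] by (auto simp: stst_def)
      then show ?thesis using a Run by simp
    qed
  next
    case (Sc o' r)
    have "c = Tl1 o' r \<and> d = o' \<and> tooth o' r \<or> \<not> tooth o' r \<and> d = fw o' \<and> c = Sg o' (r + 1) \<and> hi o' \<and> (r = 12 \<or> r = 18)
       \<or> c = CorS \<and> o' = DE \<and> r = 21 \<and> d = DN"
    proof (cases "d = o'")
      case True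
      then show ?thesis using c(1,3) Sc by (cases "tooth o' r"; cases "leafr o' r"; simp; fastforce)
    next
      case False
      then have d: "d = fw o'" "\<not> tooth o' r" using c(1) Sc by (simp_all split: if_splits)
      show ?thesis
      proof (cases "sgt o' (r + 1)")
        case True
        then have "c = Sg o' (r + 1)" "hi o'" "r = 12 \<or> r = 18" using c(1) Sc d by (simp_all add: sgt_def)
        then show ?thesis using d by simp
      next
        case False
        then have "c = CorS \<and> o' = DE \<and> r = 21" using c(1,3) Sc d
          by (cases "o' = DE \<and> r = 21"; cases "o' = DN \<and> r = 19"; simp; fastforce)
        then show ?thesis using d by simp
      qed
    qed
    then show ?thesis
    proof (elim disjE conjE)
      assume a: "c = Tl1 o' r" "d = o'" "tooth o' r"
      then have "k' = T1 o' r" using c(2) inp_inv(4)[of k' "opp d"] by simp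
      then show ?thesis using a Sc by simp
    next
      assume a: "\<not> tooth o' r" "d = fw o'" "c = Sg o' (r + 1)" "hi o'" "r = 12"
      then have "k' = Sc o' (r + 1)" using c(2) inp_inv(3)[of k' "opp d" o' "r + 1"] by simp
      then show ?thesis using a Sc by simp
    next
      assume a: "\<not> tooth o' r" "d = fw o'" "c = Sg o' (r + 1)" "hi o'" "r = 18"
      then have "k' = Sc o' (r + 1)" using c(2) inp_inv(3)[of k' "opp d" o' "r + 1"] by simp
      then show ?thesis using a Sc by simp
    next
      assume a: "c = CorS" "o' = DE" "r = 21" "d = DN"
      then have "k' = KC" using c(2) inp_inv(6)[of k' "opp d"] by simp
      then show ?thesis using a Sc by simp
    qed
  next
    case (St1 s)
    have a: "d = DN" "c = CorL s" using c(1,3) St1 by (auto split: dr.splits)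
    then have "k' = Cor DN s" using c(2) inp_inv(1)[of k' "opp d" s] by simp
    then show ?thesis using a St1 by simp
  next
    case (T1 o' r)
    have a: "d = fw o'" "c = Tl2 o' r" using c(1,3) T1 by (auto split: if_splits)
    then have "k' = T2 o' r" using c(2) inp_inv(5)[of k' "opp d"] by simp
    then show ?thesis using a T1 by simp
  next
    case (St q s)
    then have False using c(1,3) by (cases d) auto
    then show ?thesis ..
  next
    case (Cor h s)
    then have False using c(1,3) by (simp split: if_splits; fastforce)
    then show ?thesis ..
  next
    case (T2 o' r)
    then have False using c(1,3) by (simp split: if_splits; fastforce)
    then show ?thesis ..
  next
    case (Lf o' r)
    then have False using c(1,3) by (simp split: if_splits; fastforce)
    then show ?thesis ..
  next
    case KC
    then have False using c(1,3) by (simp split: if_splits; fastforce)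
    then show ?thesis ..
  next
    case Seed
    then show ?thesis using assms(3) by simp
  qed
qed

lemma sch_sch:
  assumes "sch k d k'" "sch k' d' k''" "okk k" "k \<noteq> Seed"
  shows "\<exists>o' r. k = Sc o' r \<and> tooth o' r \<and> d = o' \<and> k' = T1 o' r \<and> d' = fw o' \<and> k'' = T2 o' r"
proof -
  have k': "okk k'" "k' \<noteq> Seed" using assms(1) by (auto simp: sch_def flow_def)
  have n: "\<not> tooth o' 0" "\<not> tooth DW 1" "\<not> tooth o' 13" "\<not> tooth o' 19" for o' by (auto simp: tooth_def)
  show ?thesis using sch_cases[OF assms(1,3,4)]
  proof (elim disjE exE conjE)
    fix o' r assume a: "k = Sc o' r" "tooth o' r" "d = o'" "k' = T1 o' r"
    then show ?thesis using sch_cases[OF assms(2) k'] by simp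
  qed (use sch_cases[OF assms(2) k'] n in \<open>simp, (elim disjE)?; simp\<close>)+
qed

definition Dsc :: "pos \<Rightarrow> kind \<Rightarrow> pos \<Rightarrow> kind \<Rightarrow> bool" where
  "Dsc r k0 q k \<longleftrightarrow> q = r \<and> k = k0 \<or> (\<exists>d. q = r + vec d \<and> sch k0 d k) \<or>
     (\<exists>o' a. k0 = Sc o' a \<and> tooth o' a \<and> k = T2 o' a \<and> q = r + vec o' + vec (fw o'))"

lemma cl_Dsc: "cl \<beta> r \<Longrightarrow> \<beta> r = Some k0 \<Longrightarrow> \<beta> q = Some k \<Longrightarrow> Dsc r k0 q k"
proof (induction arbitrary: q k rule: cl.induct)
  case (cl1 k r)
  then show ?case by (auto simp: Dsc_def split: if_splits)
next
  case (cl2 \<beta> r p k1 d k' c)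
  have "r \<noteq> p" using cl_root[OF cl2.hyps(1)] cl2.hyps(2) by auto
  then have r: "\<beta> r = Some k0" using cl2.prems(1) by simp
  show ?case
  proof (cases "q = p")
    case False
    then show ?thesis using cl2.IH[OF r] cl2.prems by simp
  next
    case True
    then have k: "k = k1" using cl2.prems by simp
    have s: "sch k' (opp d) k1" using cl2.hyps by (auto simp: sch_def)
    have k0: "okk k0" "k0 \<noteq> Seed" using cl_okk[OF cl2.hyps(1) r] by auto
    have p: "p = (p + vec d) + vec (opp d)" by (simp add: vec_opp)
    from cl2.IH[OF r cl2.hyps(4)] have "Dsc r k0 (p + vec d) k'" .
    then consider "p + vec d = r" "k' = k0" | e where "p + vec d = r + vec e" "sch k0 e k'" | o' a where "k' = T2 o' a" 
      unfolding Dsc_def by blast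
    then show ?thesis
    proof cases
      case 1
      then show ?thesis using s p k True unfolding Dsc_def by metis
    next
      case 2
      from sch_sch[OF 2(2) s k0] obtain o' a where "k0 = Sc o' a" "tooth o' a" "e = o'" "opp d = fw o'" "k1 = T2 o' a" by blast
      moreover then have "p = r + vec o' + vec (fw o')" using p 2(1) by metis
      ultimately show ?thesis using k True unfolding Dsc_def by blast
    next
      case 3
      have "okk k'" "k' \<noteq> Seed" using cl_okk[OF cl2.hyps(1,4)] by auto
      then show ?thesis using sch_cases[OF s] 3 by auto
    qed
  qed
qed

text \<open>The uniform bound is what later forces an infinite chain of attachments to contain a
  seed.\<close>

lemma cl_bounded:
  assumes "cl \<beta> r" shows "dom \<beta> \<subseteq> (\<lambda>v. r + v) ` ({-2..2} \<times> {-2..2})"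
proof
  fix q assume "q \<in> dom \<beta>"
  moreover obtain k0 where "\<beta> r = Some k0" using cl_root[OF assms] by auto
  ultimately obtain k where "Dsc r k0 q k" using cl_Dsc[OF assms] by blast
  then consider "q = r + (0,0)" | d where "q = r + vec d" | o' where "q = r + (vec o' + vec (fw o'))"
    unfolding Dsc_def by (auto simp: zero_prod_def[symmetric] add.assoc)
  then show "q \<in> (\<lambda>v. r + v) ` ({-2..2} \<times> {-2..2})"
  proof cases
    case 1 then show ?thesis by (intro image_eqI[of _ _ "(0,0)"]) auto
  next
    case 2 then show ?thesis by (intro image_eqI[of _ _ "vec d"]) (cases d; auto)+
  next
    case 3 then show ?thesis by (intro image_eqI[of _ _ "vec o' + vec (fw o')"]) (cases o'; auto)+
  qed
qed

section \<open>Links between two disjoint parts\<close>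

definition L :: "kasm \<Rightarrow> kasm \<Rightarrow> pos \<Rightarrow> pos \<Rightarrow> cont \<Rightarrow> bool" where
  "L \<kappa> \<kappa>' p q c \<longleftrightarrow> (\<exists>d k k'. \<kappa> p = Some k \<and> \<kappa>' q = Some k' \<and> q = p + vec d \<and> flow k d k' c)"

text \<open>Turns stability of a union into the existence of links and forgets all strengths except
  whether one link alone suffices.\<close>

lemma stable_links:
  assumes t: "1 < \<tau>" and st: "stable \<tau> (tl \<tau> (\<kappa> ++ \<kappa>'))" and dj: "dom \<kappa> \<inter> dom \<kappa>' = {}"
    and ok: "\<And>p k. \<kappa> p = Some k \<Longrightarrow> okk k" "\<And>p k. \<kappa>' p = Some k \<Longrightarrow> okk k" and ne: "dom \<kappa> \<noteq> {}" "dom \<kappa>' \<noteq> {}"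
  shows "(\<exists>p q c. (L \<kappa> \<kappa>' p q c \<or> L \<kappa>' \<kappa> q p c) \<and> strong c) \<or>
    (\<exists>p q c p' q' c'. (L \<kappa> \<kappa>' p q c \<or> L \<kappa>' \<kappa> q p c) \<and> (L \<kappa> \<kappa>' p' q' c' \<or> L \<kappa>' \<kappa> q' p' c') \<and> (p, q) \<noteq> (p', q'))"
proof -
  have d: "dom (tl \<tau> \<kappa>) = dom \<kappa>" "dom (tl \<tau> \<kappa>') = dom \<kappa>'" by (auto simp: tl_def)
  have e: "tl \<tau> (\<kappa> ++ \<kappa>') = tl \<tau> \<kappa> ++ tl \<tau> \<kappa>'" by (rule ext) (auto simp: tl_def map_add_def split: option.splits)
  obtain F where F: "finite F" "F \<subseteq> dom \<kappa> \<times> dom \<kappa>'" "\<tau> \<le> (\<Sum>(p,q)\<in>F. weight (tl \<tau> (\<kappa> ++ \<kappa>')) p q)"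
    by (rule stable_join_cut[of \<tau> "tl \<tau> \<kappa>" "tl \<tau> \<kappa>'"]) (use st dj ne d e in auto)
  let ?w = "\<lambda>x. case x of (p,q) \<Rightarrow> weight (tl \<tau> (\<kappa> ++ \<kappa>')) p q"
  have pos: "\<exists>c. (L \<kappa> \<kappa>' p q c \<or> L \<kappa>' \<kappa> q p c) \<and> weight (tl \<tau> (\<kappa> ++ \<kappa>')) p q = str \<tau> c"
    if a: "(p, q) \<in> F" "0 < weight (tl \<tau> (\<kappa> ++ \<kappa>')) p q" for p q
  proof -
    obtain k k' where k: "\<kappa> p = Some k" "\<kappa>' q = Some k'" using a(1) F(2) by blast
    then have "p \<notin> dom \<kappa>'" using dj by auto
    then have kk: "(\<kappa> ++ \<kappa>') p = Some k" "(\<kappa> ++ \<kappa>') q = Some k'" using k by (auto simp: map_add_def split: option.splits)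
    obtain d where q: "q = p + vec d" using weight_nonadj[of q p "tl \<tau> (\<kappa> ++ \<kappa>')"] a(2) by auto
    have w: "weight (tl \<tau> (\<kappa> ++ \<kappa>')) p q = lk \<tau> k d k'" using weight_adj[of "\<kappa> ++ \<kappa>'" p k d k' \<tau>] kk q by simp
    have okk: "okk k" "okk k'" using ok k by auto
    have "0 < lk \<tau> k d k'" using w a(2) by simp
    then show ?thesis
    proof (rule lk_posE[OF okk _ t])
      fix c assume f: "flow k d k' c"
      then show ?thesis using w lk_flow[OF okk f] k q unfolding L_def by auto
    next
      fix c assume f: "flow k' (opp d) k c"
      have "p = q + vec (opp d)" using q by (simp add: vec_opp)
      then have "L \<kappa>' \<kappa> q p c" unfolding L_def using k f by blast
      then show ?thesis using w lk_flow'[OF okk f] by auto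
    qed
  qed
  from sum_ge_two_positive[OF F(1) F(3)] t have
    "(\<exists>x\<in>F. \<tau> \<le> ?w x) \<or> (\<exists>x\<in>F. \<exists>y\<in>F. x \<noteq> y \<and> 0 < ?w x \<and> 0 < ?w y)" by auto
  then show ?thesis
  proof
    assume "\<exists>x\<in>F. \<tau> \<le> ?w x"
    then obtain p q where pq: "(p, q) \<in> F" "\<tau> \<le> weight (tl \<tau> (\<kappa> ++ \<kappa>')) p q" by auto
    then obtain c where "L \<kappa> \<kappa>' p q c \<or> L \<kappa>' \<kappa> q p c" "weight (tl \<tau> (\<kappa> ++ \<kappa>')) p q = str \<tau> c" using pos t by (metis less_trans less_le_trans zero_less_one)
    moreover then have "strong c" using pq t by (auto simp: str_def split: if_splits)
    ultimately show ?thesis by blast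
  next
    assume "\<exists>x\<in>F. \<exists>y\<in>F. x \<noteq> y \<and> 0 < ?w x \<and> 0 < ?w y"
    then obtain x y where "x \<in> F" "y \<in> F" "x \<noteq> y" "0 < ?w x" "0 < ?w y" by blast
    then obtain p q p' q' where "(p, q) \<in> F" "(p', q') \<in> F" "(p, q) \<noteq> (p', q')" "0 < weight (tl \<tau> (\<kappa> ++ \<kappa>')) p q" "0 < weight (tl \<tau> (\<kappa> ++ \<kappa>')) p' q'"
      by (metis old.prod.case surj_pair)
    note pq = this
    obtain c where "L \<kappa> \<kappa>' p q c \<or> L \<kappa>' \<kappa> q p c" using pos[OF pq(1,4)] by blast
    moreover obtain c' where "L \<kappa> \<kappa>' p' q' c' \<or> L \<kappa>' \<kappa> q' p' c'" using pos[OF pq(2,5)] by blast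
    ultimately show ?thesis using pq(3)
      by (intro disjI2 exI[of _ p] exI[of _ q] exI[of _ c] exI[of _ p'] exI[of _ q'] exI[of _ c']) simp
  qed
qed

text \<open>Every other tile of a fragment has a strong, hence only, input, and that one is already
  supplied inside the fragment.\<close>

lemma L_into_cl:
  assumes "cl \<beta> r" "dom \<kappa> \<inter> dom \<beta> = {}" "L \<kappa> \<beta> p q c"
  shows "q = r"
proof (rule ccontr)
  assume q: "q \<noteq> r"
  obtain d k k' where l: "\<kappa> p = Some k" "\<beta> q = Some k'" "q = p + vec d" "inp k' (opp d) = Some c"
    using assms(3) unfolding L_def flow_def by blast
  obtain e f k'' where e: "inp k' e = Some f" "strong f" "\<beta> (q + vec e) = Some k''" using cl_nonroot[OF assms(1) l(2) q] by blast
  have "opp d = e" using strong_unique[OF _ e(1,2) l(4)] cl_okk[OF assms(1) l(2)] by simp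
  then have "q + vec e = p" using l(3) by (auto simp: vec_opp)
  then show False using e(3) l(1) assms(2) by auto
qed

text \<open>Once the root fits, the rest follows tile by tile, each through its only input.\<close>

lemma cl_extend:
  "cl \<beta> r \<Longrightarrow> dom \<kappa> \<inter> dom \<beta> = {} \<Longrightarrow> \<beta> r = Some k \<Longrightarrow> VV (\<kappa>(r \<mapsto> k)) \<Longrightarrow> VV (\<kappa> ++ \<beta>)"
proof (induction rule: cl.induct)
  case (cl1 k' r)
  have e: "\<kappa> ++ [r \<mapsto> k'] = \<kappa>(r \<mapsto> k')" by simp
  have "k' = k" using cl1.prems(2) by simp
  then show ?case using cl1.prems(3) unfolding e by (simp only:)
next
  case (cl2 \<beta> r p k1 d k' c)
  have "r \<noteq> p" using cl_root[OF cl2.hyps(1)] cl2.hyps(2) by auto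
  moreover have "dom \<kappa> \<inter> dom \<beta> = {}" using cl2.prems(1) by auto
  ultimately have V: "VV (\<kappa> ++ \<beta>)" using cl2.IH cl2.prems(2,3) by (simp del: fun_upd_apply add: fun_upd_other)
  have i: "inp k1 d = Some c" "out k' (opp d) = Some c" using cl2.hyps(5) by (auto simp: flow_def)
  have "VV ((\<kappa> ++ \<beta>)(p \<mapsto> k1))"
  proof (rule attach[OF V])
    show "(\<kappa> ++ \<beta>) p = None" using cl2.prems(1) cl2.hyps(2) by (auto simp: map_add_None)
    show "k1 \<noteq> Seed" using i by auto
    show "okk k1" by fact
    show "\<And>o' r. k1 \<noteq> Lf o' r" using strong_not_leaf[OF i(1) cl2.hyps(6)] .
    fix e f assume e: "inp k1 e = Some f"
    then have "e = d" using strong_unique[OF cl2.hyps(3) i(1) cl2.hyps(6)] by blast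
    then show "\<exists>k'. (\<kappa> ++ \<beta>) (p + vec e) = Some k' \<and> out k' (opp e) = Some f" using cl2.hyps(4) i e by (auto simp: map_add_Some_iff)
  qed
  moreover have "(\<kappa> ++ \<beta>)(p \<mapsto> k1) = \<kappa> ++ \<beta>(p \<mapsto> k1)" by simp
  ultimately show ?case by (simp only:)
qed

lemma out_Sg: "out k d = Some (Sg o' q) \<Longrightarrow> k = Sc o' (q - 1)"
  by (cases k) (simp_all split: if_splits dr.splits)

lemma out_Tl1: "out k d = Some (Tl1 o' q) \<Longrightarrow> k = Sc o' q"
  by (cases k) (simp_all split: if_splits dr.splits)

text \<open>An input that is still open in a valid assembly is one of the two inputs of a leaf that may arrive late:
  the column tile beside a high leaf, the tooth above a low leaf, or the partner leaf.\<close>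

lemma open_input:
  assumes V: "V1 \<kappa>" and dj: "dom \<kappa> \<inter> dom \<beta> = {}" and l: "L \<beta> \<kappa> q p c"
    and ok: "\<And>p k. \<beta> p = Some k \<Longrightarrow> okk k"
  shows "\<exists>a n w o' g. p = a + pos n (Le o' g) \<and> sup \<kappa> a n w (Le o' g) \<and>
    (hi o' \<and> \<beta> q = Some (Sc o' (rs n o' g)) \<and> q = p + vec (opp o') \<or>
     \<not> hi o' \<and> \<beta> q = Some (T1 o' (rs n o' g + 1)) \<and> q = p + vec (fw o') \<or>
     \<not> hi o' \<and> q = p + vec (opp (fw o')) \<and> (\<exists>e. \<beta> q = Some (Lf e (rs n o' g - 1)) \<and> hi e \<and> fw e = fw o'))"
proof -
  obtain d k k' where k: "\<beta> q = Some k" "\<kappa> p = Some k'" "p = q + vec d" "out k d = Some c" "inp k' (opp d) = Some c"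
    using l unfolding L_def flow_def by blast
  have qp: "q = p + vec (opp d)" using k(3) by (simp add: vec_opp)
  have nin: "p + vec (opp d) \<notin> dom \<kappa>" using qp k(1) dj by auto
  have "\<exists>o' r. k' = Lf o' r"
  proof (rule ccontr)
    assume "\<not> ?thesis"
    then show False using V1_input[OF V k(2,5)] nin by auto
  qed
  then obtain o' r where kl: "k' = Lf o' r" by blast
  obtain a n w x where x: "p = a + pos n x" "sup \<kappa> a n w x" "k' = knd n w x" "okn n" "valid n x" by (rule V1_E[OF V k(2)])
  obtain g where g: "x = Le o' g" "r = rs n o' g" using x(3) kl by (cases x) (auto split: if_splits)
  have vl: "vcol n o' g" "leafr o' (rs n o' g)" using x(5) g by auto
  have okk: "okk k" using ok k(1) by blast
  consider (s) "c = LfS o' r" "opp d = opp o'" | (v) "c = LfV o' r" "opp d = (if hi o' then opp (fw o') else fw o')"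
    | (n) "c = Neu (r - 1)" "\<not> hi o'" "opp d = opp (fw o')"
    using k(5) kl by (auto split: if_splits)
  then show ?thesis
  proof cases
    case s
    have "k = Sc o' r" using k(4) s okk by (cases k) (auto split: if_splits dr.splits)
    moreover have "hi o'"
    proof (rule ccontr)
      assume h: "\<not> hi o'"
      then have "anc n x (Col o' g)" using g by simp
      moreover have "valid n (Col o' g)" using vl by simp
      ultimately have "\<kappa> (a + pos n (Col o' g)) \<noteq> None" using sup_anc[OF x(2)] by blast
      moreover have "a + pos n (Col o' g) = p + vec (opp d)" using x(1) g(1) s by (cases o') (auto simp: algebra_simps)
      ultimately show False using nin by auto
    qed
    ultimately show ?thesis using x g k(1) qp s by (intro exI[of _ a] exI[of _ n] exI[of _ w] exI[of _ o'] exI[of _ g]) auto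
  next
    case v
    have "\<not> hi o'"
    proof
      assume h: "hi o'"
      note ls = leaf_sup(1)[OF x(4) vl h]
      then have "anc n x (M2 o' (g - 2))" using g h by simp
      then have "\<kappa> (a + pos n (M2 o' (g - 2))) \<noteq> None" using sup_anc[OF x(2)] ls by blast
      moreover have "a + pos n (M2 o' (g - 2)) = p + vec (opp d)" using x(1) g(1) v h ls by (cases o') (auto simp: algebra_simps of_nat_diff)
      ultimately show False using nin by auto
    qed
    moreover have "k = T1 o' (r + 1)" using k(4) v okk \<open>\<not> hi o'\<close> by (cases k) (auto simp: tooth_def split: if_splits dr.splits)
    ultimately show ?thesis using x g k(1) qp v by (intro exI[of _ a] exI[of _ n] exI[of _ w] exI[of _ o'] exI[of _ g]) auto
  next
    case n
    have "\<exists>e. k = Lf e (r - 1) \<and> hi e \<and> fw e = d" using k(4) n okk by (cases k) (auto split: if_splits dr.splits)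
    then show ?thesis using x g k(1) qp n by (intro exI[of _ a] exI[of _ n] exI[of _ w] exI[of _ o'] exI[of _ g]) auto
  qed
qed

section \<open>Joining a fragment to a family of cells\<close>

context
  fixes \<kappa> \<beta> r k
  assumes V: "VV \<kappa>" and C: "cl \<beta> r" and dj: "dom \<kappa> \<inter> dom \<beta> = {}" and k: "\<beta> r = Some k"
begin

private lemma ok: "okk k" "k \<noteq> Seed" using cl_okk[OF C k] by auto
private lemma okb: "\<beta> p = Some x \<Longrightarrow> okk x" using cl_okk[OF C] by blast
private lemma rn: "\<kappa> r = None" using k dj by (auto simp: domIff)
private lemma v1: "V1 \<kappa>" using V unfolding VV_def by simp

private lemma oi:
  assumes "L \<beta> \<kappa> q p c"
  shows "\<exists>a n w o' g. p = a + pos n (Le o' g) \<and> sup \<kappa> a n w (Le o' g) \<and>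
    (hi o' \<and> \<beta> q = Some (Sc o' (rs n o' g)) \<and> q = p + vec (opp o') \<or>
     \<not> hi o' \<and> \<beta> q = Some (T1 o' (rs n o' g + 1)) \<and> q = p + vec (fw o') \<or>
     \<not> hi o' \<and> q = p + vec (opp (fw o')) \<and> (\<exists>e. \<beta> q = Some (Lf e (rs n o' g - 1)) \<and> hi e \<and> fw e = fw o'))"
proof (rule open_input[OF v1 dj assms])
  fix p k assume "\<beta> p = Some k" then show "okk k" by (rule okb)
qed

private lemma into:
  assumes l: "L \<kappa> \<beta> p q c"
  shows "\<exists>d k'. p = r + vec d \<and> q = r \<and> inp k d = Some c \<and> \<kappa> (r + vec d) = Some k' \<and> out k' (opp d) = Some c"
proof -
  have q: "q = r" using L_into_cl[OF C dj l] .
  obtain d kp k' where "\<kappa> p = Some kp" "\<beta> q = Some k'" "q = p + vec d" "out kp d = Some c" "inp k' (opp d) = Some c"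
    using l unfolding L_def flow_def by blast
  then show ?thesis using q k by (intro exI[of _ "opp d"] exI[of _ kp]) (auto simp: vec_opp)
qed

private lemma strongL:
  assumes l: "L \<kappa> \<beta> p q c" "strong c" shows "VV (\<kappa>(r \<mapsto> k))"
proof -
  obtain d k' where d: "inp k d = Some c" "\<kappa> (r + vec d) = Some k'" "out k' (opp d) = Some c" using into[OF l(1)] by blast
  show ?thesis
  proof (rule attach[OF V rn ok(2,1)])
    show "\<And>o' r. k \<noteq> Lf o' r" using strong_not_leaf[OF d(1) l(2)] .
    fix e f assume e: "inp k e = Some f"
    then have "e = d" using strong_unique[OF ok(1) d(1) l(2)] by blast
    then show "\<exists>k'. \<kappa> (r + vec e) = Some k' \<and> out k' (opp e) = Some f" using d e by auto
  qed
qed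

private lemma two:
  assumes l: "L \<kappa> \<beta> p q c" "L \<kappa> \<beta> p' q' c'" "(p, q) \<noteq> (p', q')" shows "VV (\<kappa>(r \<mapsto> k))"
proof -
  obtain d k1 where d: "p = r + vec d" "inp k d = Some c" "\<kappa> (r + vec d) = Some k1" "out k1 (opp d) = Some c" "q = r" using into[OF l(1)] by blast
  obtain d' k1' where d': "p' = r + vec d'" "inp k d' = Some c'" "\<kappa> (r + vec d') = Some k1'" "out k1' (opp d') = Some c'" "q' = r" using into[OF l(2)] by blast
  have ne: "d \<noteq> d'" using d d' l(3) by auto
  show ?thesis
  proof (cases "\<exists>o' s. k = Lf o' s")
    case True
    then obtain o' s where kl: "k = Lf o' s" by blast
    have "c \<noteq> Neu (s - 1) \<or> c' \<noteq> Neu (s - 1)" using d(2) d'(2) ne kl by (auto split: if_splits)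
    then show ?thesis using attach_leaf[OF V rn kl ok(1) d(2-4)] attach_leaf[OF V rn kl ok(1) d'(2-4)] by blast
  next
    case False
    show ?thesis
    proof (rule attach[OF V rn ok(2,1)])
      show "\<And>o' r. k \<noteq> Lf o' r" using False by blast
      fix e f assume e: "inp k e = Some f"
      then have "e = d \<or> e = d'" using two_inputs[OF ok(1) d(2) d'(2) ne _ e] False by blast
      then show "\<exists>k'. \<kappa> (r + vec e) = Some k' \<and> out k' (opp e) = Some f" using d d' e by auto
    qed
  qed
qed

text \<open>A high leaf came first and now meets the strip tile beside it, carried by a fragment
  rooted one row earlier. That row follows the tooth tip which the leaf forces, so the root fits
  although its wall input is not checked.\<close>

private lemma late_hi:
  assumes x: "p = a + pos n (Le o' g)" "sup \<kappa> a n w (Le o' g)"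
    and h: "hi o'" "\<beta> q = Some (Sc o' (rs n o' g))" "q = p + vec (opp o')" and qr: "q \<noteq> r"
  shows "VV (\<kappa>(r \<mapsto> k))"
proof -
  have n: "okn n" and vl: "vcol n o' g" "leafr o' (rs n o' g)" using x(2) by (auto simp: sup_def)
  have r: "rs n o' g = 13 \<or> rs n o' g = 19" using vl(2) h(1) by (auto simp: leafr_def)
  note ls = leaf_sup(1)[OF n vl h(1)]
  obtain d c k' where d: "inp (Sc o' (rs n o' g)) d = Some c" "strong c" "\<beta> (q + vec d) = Some k'" "out k' (opp d) = Some c"
    using cl_nonroot[OF C h(2) qr] by blast
  have "sgt o' (rs n o' g)" "\<not> stst o' (rs n o' g)" using r h(1) by (auto simp: stst_def sgt_def)
  then have d': "d = opp (fw o')" "c = Sg o' (rs n o' g)" using d(1) by (simp_all split: if_splits)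
  have k': "k' = Sc o' (rs n o' g - 1)" using out_Sg d(4) d' by simp
  have "q + vec d = r"
  proof (rule ccontr)
    assume "q + vec d \<noteq> r"
    then obtain e f where e: "inp k' e = Some f" "strong f" using cl_nonroot[OF C d(3)] by blast
    have "k' = Sc o' 12 \<or> k' = Sc o' 18" using k' r by auto
    then show False using e by (elim disjE) (auto simp: stst_def sgt_def split: if_splits)
  qed
  then have kk: "k = Sc o' (rs n o' g - 1)" and rq: "r = q + vec (opp (fw o'))" using d(3) d' k' k by auto
  have n0: "n \<noteq> 0" using vl by (simp add: vcol_def)
  have gg: "g = n + 2 \<or> g = n + 8" using leaf_row(1)[OF n vl h(1)] by auto
  have c2: "rs n o' (g - 1) = rs n o' g - 1"
    using gg rs_plus[OF n n0, of 1 o'] rs_plus[OF n n0, of 7 o'] rs_plus[OF n n0, of 2 o'] rs_plus[OF n n0, of 8 o']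
    by (auto simp: add.commute)
  have c3: "vcol n o' (g - 1)" using gg vl by (auto simp: vcol_def)
  have c4: "\<not> stst o' (rs n o' (g - 1))" using c2 r by (auto simp: stst_def)
  have c1: "cpr n o' (g - 1) = M2 o' (g - 2)" using ls gg by (auto simp: cpr_def numeral_2_eq_2)
  show ?thesis
  proof (rule attach_slot[OF V rn ok(2)])
    show "sup \<kappa> a n w (M2 o' (g - 2))" by (rule sup_sub[OF x(2)]) (use ls h(1) in auto)
    show "valid n (Col o' (g - 1))" using c3 by simp
    show "r = a + pos n (Col o' (g - 1))" using rq h(3) x(1) ls by (cases o') (auto simp: algebra_simps of_nat_diff)
    show "k = knd n w (Col o' (g - 1))" using kk c2 by simp
    show "\<And>z. valid n z \<Longrightarrow> anc n (Col o' (g - 1)) z \<Longrightarrow> z = Col o' (g - 1) \<or> anc n (M2 o' (g - 2)) z"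
      using cpr_props(6)[OF n c3 c4] c1 by simp
  qed
qed

text \<open>A low leaf meets the tooth of the next row, carried by a fragment whose root is the
  strip tile of that row; this row follows the strip tile forced by the leaf.\<close>

private lemma late_lo:
  assumes x: "p = a + pos n (Le o' g)" "sup \<kappa> a n w (Le o' g)"
    and t: "\<not> hi o'" "\<beta> q = Some (T1 o' (rs n o' g + 1))" "q = p + vec (fw o')" and qr: "q \<noteq> r"
  shows "VV (\<kappa>(r \<mapsto> k))"
proof -
  have n: "okn n" and vl: "vcol n o' g" "leafr o' (rs n o' g)" using x(2) by (auto simp: sup_def)
  have r: "rs n o' g = 14 \<or> rs n o' g = 20" using vl(2) t(1) by (auto simp: leafr_def)
  note ls = leaf_sup(2)[OF n vl t(1)] leaf_sup(3)[OF n vl]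
  obtain d c k' where d: "inp (T1 o' (rs n o' g + 1)) d = Some c" "strong c" "\<beta> (q + vec d) = Some k'" "out k' (opp d) = Some c"
    using cl_nonroot[OF C t(2) qr] by blast
  then have d': "d = opp o'" "c = Tl1 o' (rs n o' g + 1)" by (auto split: if_splits)
  have k': "k' = Sc o' (rs n o' g + 1)" using out_Tl1 d(4) d' by simp
  have "q + vec d = r"
  proof (rule ccontr)
    assume "q + vec d \<noteq> r"
    then obtain e f where e: "inp k' e = Some f" "strong f" using cl_nonroot[OF C d(3)] by blast
    have "k' = Sc o' 15 \<or> k' = Sc o' 21" using k' r by auto
    then show False using e t(1) by (elim disjE) (auto simp: stst_def sgt_def split: if_splits)
  qed
  then have kk: "k = Sc o' (rs n o' g + 1)" and rq: "r = q + vec (opp o')" using d(3) d' k' k by auto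
  have c: "cpr n o' (g + 1) = Col o' g" "rs n o' (g + 1) = rs n o' g + 1" "vcol n o' (g + 1)" "\<not> stst o' (rs n o' (g + 1))"
    using ls r by (auto simp: cpr_def stst_def)
  show ?thesis
  proof (rule attach_slot[OF V rn ok(2)])
    show "sup \<kappa> a n w (Col o' g)" by (rule sup_sub[OF x(2)]) (use vl t(1) in auto)
    show "valid n (Col o' (g + 1))" using c by simp
    show "r = a + pos n (Col o' (g + 1))" using rq t(3) x(1) by (cases o') (auto simp: algebra_simps)
    show "k = knd n w (Col o' (g + 1))" using kk c by simp
    show "\<And>z. valid n z \<Longrightarrow> anc n (Col o' (g + 1)) z \<Longrightarrow> z = Col o' (g + 1) \<or> anc n (Col o' g) z"
      using cpr_props(6)[OF n c(3,4)] c(1) by simp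
  qed
qed

text \<open>Links out of a fragment feed late inputs of leaves. Unless the root fits anyway, they
  start at the root, and its kind fixes the target; so there can be only one of them.\<close>

private lemma root_out:
  assumes l: "L \<beta> \<kappa> q p c" and nv: "\<not> VV (\<kappa>(r \<mapsto> k))"
  shows "q = r \<and> ((\<exists>o' s. hi o' \<and> (s = 13 \<or> s = 19) \<and> k = Sc o' s \<and> r = p + vec (opp o')) \<or> (\<exists>o' s. \<not> hi o' \<and> k = T1 o' s \<and> r = p + vec (fw o'))
     \<or> (\<exists>o' s. hi o' \<and> k = Lf o' s \<and> r = p + vec (opp (fw o'))))"
proof -
  obtain a n w o' g where x: "p = a + pos n (Le o' g)" "sup \<kappa> a n w (Le o' g)" and cs:
    "hi o' \<and> \<beta> q = Some (Sc o' (rs n o' g)) \<and> q = p + vec (opp o') \<or>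
     \<not> hi o' \<and> \<beta> q = Some (T1 o' (rs n o' g + 1)) \<and> q = p + vec (fw o') \<or>
     \<not> hi o' \<and> q = p + vec (opp (fw o')) \<and> (\<exists>e. \<beta> q = Some (Lf e (rs n o' g - 1)) \<and> hi e \<and> fw e = fw o')"
    using oi[OF l] by blast
  have vl: "leafr o' (rs n o' g)" using x(2) by (auto simp: sup_def)
  from cs consider
      (h) "hi o'" "\<beta> q = Some (Sc o' (rs n o' g))" "q = p + vec (opp o')"
    | (t) "\<not> hi o'" "\<beta> q = Some (T1 o' (rs n o' g + 1))" "q = p + vec (fw o')"
    | (u) e where "\<beta> q = Some (Lf e (rs n o' g - 1))" "hi e" "q = p + vec (opp (fw e))" by metis
  then show ?thesis
  proof cases
    case h
    have "q = r" using late_hi[OF x h] nv by blast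
    moreover then have "k = Sc o' (rs n o' g)" using h k by simp
    moreover have "rs n o' g = 13 \<or> rs n o' g = 19" using vl h(1) by (auto simp: leafr_def)
    ultimately show ?thesis using h by blast
  next
    case t
    have "q = r" using late_lo[OF x t] nv by blast
    moreover then have "k = T1 o' (rs n o' g + 1)" using t k by simp
    ultimately show ?thesis using t by blast
  next
    case u
    have "q = r"
    proof (rule ccontr)
      assume "q \<noteq> r"
      then obtain e' f where "inp (Lf e (rs n o' g - 1)) e' = Some f" "strong f" using cl_nonroot[OF C u(1)] by blast
      then show False by (auto split: if_splits)
    qed
    moreover then have "k = Lf e (rs n o' g - 1)" using u k by simp
    ultimately show ?thesis using u by blast
  qed
qed

text \<open>In each case left by \<open>root_out\<close> a single incoming link suffices to place
  the root: its input is strong, or it is a high leaf and the input comes from its own cell.\<close>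

private lemma mixed:
  assumes l: "L \<beta> \<kappa> q p c" and l': "L \<kappa> \<beta> p' q' c'"
  shows "VV (\<kappa>(r \<mapsto> k))"
proof (rule ccontr)
  assume nv: "\<not> ?thesis"
  obtain d k' where d: "inp k d = Some c'" "\<kappa> (r + vec d) = Some k'" "out k' (opp d) = Some c'" using into[OF l'] by blast
  from root_out[OF l nv] consider (a) o' s where "hi o'" "s = 13 \<or> s = 19" "k = Sc o' s" | (b) o' s where "k = T1 o' s" | (c) o' s where "hi o'" "k = Lf o' s" by blast
  then show False
  proof cases
    case a
    then have "stst o' s = False" "sgt o' s" by (auto simp: stst_def sgt_def)
    then have "strong c'" using d(1) a(3) by (auto split: if_splits)
    then show False using strongL[OF l'] nv by blast
  next
    case b
    then have "strong c'" using d(1) by (auto split: if_splits)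
    then show False using strongL[OF l'] nv by blast
  next
    case c
    then have "c' \<noteq> Neu (s - 1)" using d(1) by (auto split: if_splits)
    then show False using attach_leaf[OF V rn c(2) ok(1) d] nv by blast
  qed
qed

lemma join_V_cl:
  assumes lks: "(\<exists>p q c. (L \<kappa> \<beta> p q c \<or> L \<beta> \<kappa> q p c) \<and> strong c) \<or>
    (\<exists>p q c p' q' c'. (L \<kappa> \<beta> p q c \<or> L \<beta> \<kappa> q p c) \<and> (L \<kappa> \<beta> p' q' c' \<or> L \<beta> \<kappa> q' p' c') \<and> (p, q) \<noteq> (p', q'))"
  shows "VV (\<kappa> ++ \<beta>)"
proof -
  have "VV (\<kappa>(r \<mapsto> k))"
  proof (rule ccontr)
    assume nv: "\<not> ?thesis"
    from lks show False
    proof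
      assume "\<exists>p q c. (L \<kappa> \<beta> p q c \<or> L \<beta> \<kappa> q p c) \<and> strong c"
      then obtain p q c where pq: "L \<kappa> \<beta> p q c \<or> L \<beta> \<kappa> q p c" "strong c" by blast
      have "\<not> L \<beta> \<kappa> q p c"
      proof
        assume l: "L \<beta> \<kappa> q p c"
        then obtain k' d where k': "\<kappa> p = Some k'" "inp k' (opp d) = Some c" unfolding L_def flow_def by blast
        obtain a n w o' g where "p = a + pos n (Le o' g)" "sup \<kappa> a n w (Le o' g)" using oi[OF l] by blast
        then have "k' = Lf o' (rs n o' g)" using supD k' by fastforce
        then show False using pq(2) k' by (auto split: if_splits)
      qed
      then show False using pq strongL nv by blast
    next
      assume "\<exists>p q c p' q' c'. (L \<kappa> \<beta> p q c \<or> L \<beta> \<kappa> q p c) \<and> (L \<kappa> \<beta> p' q' c' \<or> L \<beta> \<kappa> q' p' c') \<and> (p, q) \<noteq> (p', q')"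
      then obtain p q c p' q' c' where pq: "L \<kappa> \<beta> p q c \<or> L \<beta> \<kappa> q p c" "L \<kappa> \<beta> p' q' c' \<or> L \<beta> \<kappa> q' p' c'" "(p, q) \<noteq> (p', q')" by blast
      \<comment> \<open>Neither link can enter the fragment, by \<open>two\<close> and
        \<open>mixed\<close>; two links leaving it would coincide by
        \<open>root_out\<close>.\<close>
      have "L \<beta> \<kappa> q p c" "L \<beta> \<kappa> q' p' c'" using pq two mixed nv by blast+
      from root_out[OF this(1) nv] root_out[OF this(2) nv] have "q = r" "q' = r" "p = p'" by auto
      then show False using pq(3) by simp
    qed
  qed
  then show ?thesis by (rule cl_extend[OF C dj k])
qed

end

section \<open>Joining two fragments\<close>

lemma cl_append:
  "cl \<beta>' r' \<Longrightarrow> cl \<beta> r \<Longrightarrow> dom \<beta> \<inter> dom \<beta>' = {} \<Longrightarrow> \<beta>' r' = Some k \<Longrightarrow> \<beta> (r' + vec d) = Some k' \<Longrightarrow>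
    flow k' (opp d) k c \<Longrightarrow> strong c \<Longrightarrow> cl (\<beta> ++ \<beta>') r"
proof (induction rule: cl.induct)
  case (cl1 k1 r')
  have e: "\<beta> ++ [r' \<mapsto> k1] = \<beta>(r' \<mapsto> k1)" by simp
  have k: "k1 = k" using cl1.prems(3) by simp
  have "\<beta> r' = None" using cl1.prems(2) by auto
  then have "cl (\<beta>(r' \<mapsto> k)) r" using cl2[OF cl1.prems(1) _ _ cl1.prems(4,5,6)] cl1.hyps(1) k by simp
  then show ?case using e k by (simp only:)
next
  case (cl2 \<beta>' r' p k1 e k2 f)
  have "r' \<noteq> p" using cl_root[OF cl2.hyps(1)] cl2.hyps(2) by auto
  moreover have "dom \<beta> \<inter> dom \<beta>' = {}" using cl2.prems(2) by auto
  ultimately have C: "cl (\<beta> ++ \<beta>') r" using cl2.IH[OF cl2.prems(1)] cl2.prems(3-6) by simp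
  have "cl ((\<beta> ++ \<beta>')(p \<mapsto> k1)) r"
  proof (rule cl.cl2[OF C _ cl2.hyps(3) _ cl2.hyps(5,6)])
    show "(\<beta> ++ \<beta>') p = None" using cl2.prems(2) cl2.hyps(2) by (auto simp: map_add_None)
    show "(\<beta> ++ \<beta>') (p + vec e) = Some k2" using cl2.hyps(4) by (simp add: map_add_Some_iff)
  qed
  moreover have "(\<beta> ++ \<beta>')(p \<mapsto> k1) = \<beta> ++ \<beta>'(p \<mapsto> k1)" by simp
  ultimately show ?case by (simp only:)
qed

lemma cl_strong:
  assumes C: "cl \<beta> r" "cl \<beta>' r'" and dj: "dom \<beta> \<inter> dom \<beta>' = {}" and l: "L \<beta> \<beta>' p q c" "strong c"
  shows "cl (\<beta> ++ \<beta>') r"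
proof -
  have q: "q = r'" by (rule L_into_cl[OF C(2) dj l(1)])
  obtain d k k' where k: "\<beta> p = Some k" "\<beta>' q = Some k'" "q = p + vec d" "flow k d k' c"
    using l(1) unfolding L_def by blast
  show ?thesis by (rule cl_append[OF C(2,1) dj, of k' "opp d" k c]) (use k q l(2) in \<open>auto simp: vec_opp\<close>)
qed

lemma weak_input:
  assumes "inp k d = Some c" "\<not> strong c"
  shows "(\<exists>h s i. k = Run h s i) \<or> (\<exists>o' r. k = Sc o' r) \<or> (\<exists>o' r. k = Lf o' r)"
  using assms by (cases k) (simp_all split: if_splits; auto)+

lemma sch_Run:
  assumes "sch (Run h s i) d k'" "okk (Run h s i)" "out k' e = Some c" "inp (Run h' s' i') (opp e) = Some c"
  shows "h' = lft h \<or> h' = h \<and> vec d + vec e = vec h + vec (rgt h)"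
proof -
  have c: "e = h' \<and> c = Pth s' \<or> e = rgt h' \<and> c = Wl False i'"
    using assms(4) by (auto split: if_splits) (metis opp_opp)
  have "d = h \<and> h \<noteq> DE \<and> k' = Cor h s \<or> d = DE \<and> h = DE \<and> (\<exists>b s'. k' = St b s') \<or> (\<exists>o' r. k' = Sc o' r \<and> (r = 0 \<or> r = 1))"
    using sch_cases[OF assms(1,2)] by auto
  then show ?thesis
  proof (elim disjE conjE exE)
    assume "d = h" "h \<noteq> DE" "k' = Cor h s"
    then show ?thesis using assms(3) c by (cases h; cases h'; auto split: if_splits)
  next
    fix b s' assume "d = DE" "h = DE" "k' = St b s'"
    then show ?thesis using assms(3) c by (cases h'; cases e; auto split: if_splits)
  next
    fix o' r assume "k' = Sc o' r" "r = 0"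
    then show ?thesis using assms(3) c by (auto split: if_splits)
  next
    fix o' r assume "k' = Sc o' r" "r = 1"
    then show ?thesis using assms(3) c by (auto split: if_splits)
  qed
qed

lemma sch_Sc:
  assumes "sch (Sc o' r) d k'" "okk (Sc o' r)" "out k' e = Some c" "\<not> strong c" "inp k2 (opp e) = Some c" "\<And>o' r. k2 \<noteq> Lf o' r"
  shows "hi o' \<and> (r = 12 \<or> r = 18) \<and> (\<exists>r2. k2 = Sc o' r2 \<and> (lb o' r2 = 14 \<or> lb o' r2 = 20)) \<or> o' = DE \<and> r = 21 \<and> k2 = Sc DN 0"
proof -
  have "tooth o' r \<and> k' = T1 o' r \<or> hi o' \<and> (r = 12 \<or> r = 18) \<and> k' = Sc o' (r + 1) \<or> o' = DE \<and> r = 21 \<and> k' = KC"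
    using sch_cases[OF assms(1,2)] by auto
  then show ?thesis
  proof (elim disjE conjE)
    assume "k' = T1 o' r"
    then have "\<exists>a b. c = LfV a b" using assms(3,4) by (auto split: if_splits)
    then show ?thesis using inp_inv12 assms(5,6) by blast
  next
    assume a: "hi o'" "k' = Sc o' (r + 1)" "r = 12"
    then have "c = LfS o' 13 \<or> c = Nxt o' 14" using assms(3,4)
      by (auto simp: tooth_def leafr_def sgt_def nxr_def lb_def split: if_splits)
    then show ?thesis
    proof
      assume "c = LfS o' 13" then show ?thesis using inp_inv11 assms(5,6) by blast
    next
      assume "c = Nxt o' 14" then show ?thesis using inp_inv10[of k2 "opp e" o' 14] assms(5) a by auto
    qed
  next
    assume a: "hi o'" "k' = Sc o' (r + 1)" "r = 18"
    then have "c = LfS o' 19 \<or> c = Nxt o' 20" using assms(3,4)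
      by (auto simp: tooth_def leafr_def sgt_def nxr_def lb_def split: if_splits)
    then show ?thesis
    proof
      assume "c = LfS o' 19" then show ?thesis using inp_inv11 assms(5,6) by blast
    next
      assume "c = Nxt o' 20" then show ?thesis using inp_inv10[of k2 "opp e" o' 20] assms(5) a by auto
    qed
  next
    assume a: "o' = DE" "r = 21" "k' = KC"
    then have "c = Nxt DN 0" using assms(3) by (auto split: if_splits)
    then obtain r2 where "k2 = Sc DN r2" "0 = lb DN r2" using inp_inv10 assms(5) by blast
    then show ?thesis using a by (auto simp: lb_def split: if_splits)
  qed
qed

lemma sch_src: "sch k d k' \<Longrightarrow> okk k \<Longrightarrow> k \<noteq> Seed \<Longrightarrow> k \<noteq> Lf o' r"
  using sch_cases by force

definition par :: "pos \<Rightarrow> bool" where "par p \<longleftrightarrow> even (fst p + snd p)"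

lemma par_vec [simp]: "par (p + vec d) \<longleftrightarrow> \<not> par p"
  by (cases d) (auto simp: par_def)

lemma T2_feed:
  assumes "out (T2 o' a) e = Some c" "inp k (opp e) = Some c"
  shows "(\<exists>b. k = Sc o' b) \<and> e = opp o' \<or> (\<exists>b. k = Lf o' b)"
proof -
  have "e = opp o' \<and> c = Nxt o' (a + 1) \<or> c = LfV o' (a + 2)" using assms(1) by (simp split: if_splits)
  then show ?thesis using inp_inv10[of k "opp e" o' "a + 1"] inp_inv12[of k "opp e" o' "a + 2"] assms(2) by auto
qed

text \<open>Weak links in both directions would close a cycle of messages. A checkerboard colouring
  of the plane rules out a child on one side against a root or a grandchild on the other; in the
  remaining cases headings, row states or displacements fail to close up.\<close>

lemma cross_links:
  assumes D: "Dsc r k p kp" "Dsc r' k' q kq" and ok: "okk k" "k \<noteq> Seed" "okk k'" "k' \<noteq> Seed"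
    and l: "flow kp d k' c" "r' = p + vec d" "\<not> strong c" and l': "flow kq e k f" "r = q + vec e" "\<not> strong f"
    and ne: "\<not> (p = r \<and> q = r')"
  shows False
proof -
  have o: "out kp d = Some c" "inp k' (opp d) = Some c" "out kq e = Some f" "inp k (opp e) = Some f"
    using l l' by (auto simp: flow_def)
  have c0: "out (Sc o' a) d = Some c \<Longrightarrow> \<not> strong c \<Longrightarrow> \<not> tooth o' a" for o' a d c by (auto split: if_splits)
  consider (0) "p = r" "kp = k" | (1) d1 where "p = r + vec d1" "sch k d1 kp"
    | (2) o' a where "k = Sc o' a" "tooth o' a" "kp = T2 o' a" "p = r + vec o' + vec (fw o')" using D(1) unfolding Dsc_def by blast
  note P = this
  consider (0) "q = r'" "kq = k'" | (1) d2 where "q = r' + vec d2" "sch k' d2 kq"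
    | (2) o' a where "k' = Sc o' a" "tooth o' a" "kq = T2 o' a" "q = r' + vec o' + vec (fw o')" using D(2) unfolding Dsc_def by blast
  note Q = this
  have pr: "par p \<longleftrightarrow> \<not> par r'" "par q \<longleftrightarrow> \<not> par r" using l(2) l'(2) by auto
  show False
  proof (cases rule: P)
    case p: 0
    show False
    proof (cases rule: Q)
      case 0 then show False using p ne by simp
    next
      case 1 then show False using p pr by simp
    next
      case (2 o' a)
      then have "(\<exists>b. k = Sc o' b) \<and> e = opp o' \<or> (\<exists>b. k = Lf o' b)" using T2_feed[of o' a e f k] o by simp
      then show False
      proof (elim disjE conjE exE)
        fix b assume b: "k = Sc o' b" "e = opp o'"
        then have "d = o' \<or> d = fw o'" using o(1) p by (auto split: if_splits)
        moreover have "vec e = - vec o'" using b vec_opp by simp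
        then have "r' + vec (fw o') + vec d = r'" using l(2) l'(2) p 2 by (simp add: algebra_simps)
        then have "vec (fw o') + vec d = 0" by (simp add: add.assoc)
        ultimately show False by (cases o') (auto simp: zero_prod_def)
      next
        fix b assume "k = Lf o' b"
        then have "c = Neu b" using o(1) p by (auto split: if_splits)
        then show False using o(2) 2 by (auto split: if_splits)
      qed
    qed
  next
    case p: (1 d1)
    show False
    proof (cases rule: Q)
      case 0 then show False using p pr by simp
    next
      case (2 o' a) then show False using p pr by simp
    next
      case (1 d2)
      have nl: "k \<noteq> Lf o' a" "k' \<noteq> Lf o' a" for o' a using sch_src p 1 ok by blast+
      then consider (a) h s i where "k = Run h s i" | (b) o' a where "k = Sc o' a" using weak_input[OF o(4) l'(3)] by blast
      note K = this
      from nl consider (a) h s i where "k' = Run h s i" | (b) o' a where "k' = Sc o' a" using weak_input[OF o(2) l(3)] by blast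
      note K' = this
      show False
      proof (cases rule: K)
        case k: (a h s i)
        show False
        proof (cases rule: K')
          case (a h' s' i')
          have x: "h' = lft h \<or> h' = h \<and> vec d1 + vec d = vec h + vec (rgt h)"
            using sch_Run[of h s i d1 kp d c h' s' i'] p ok o k a by simp
          have y: "h = lft h' \<or> h = h' \<and> vec d2 + vec e = vec h' + vec (rgt h')"
            using sch_Run[of h' s' i' d2 kq e f h s i] 1 ok o k a by simp
          have "h' = h \<and> vec d1 + vec d = vec h + vec (rgt h) \<and> vec d2 + vec e = vec h + vec (rgt h)"
            using x y by (cases h; cases h') auto
          moreover have "r' = r + (vec d1 + vec d)" using p(1) l(2) by (simp only: add.assoc)
          moreover have "r = r' + (vec d2 + vec e)" using 1(1) l'(2) by (simp only: add.assoc)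
          ultimately have "r = r + (vec h + vec (rgt h) + (vec h + vec (rgt h)))" by (metis add.assoc)
          then have "vec h + vec (rgt h) + (vec h + vec (rgt h)) = 0" by simp
          then show False by (cases h) (auto simp: zero_prod_def)
        next
          case (b o' a)
          then show False using sch_Sc[of o' a d2 kq e f k] 1 ok o l'(3) k by simp
        qed
      next
        case k: (b o' a)
        have "k' = Sc o'' b \<Longrightarrow> sch (Sc o'' b) d2 kq" for o'' b using 1 by simp
        have x: "hi o' \<and> (a = 12 \<or> a = 18) \<and> (\<exists>r2. k' = Sc o' r2 \<and> (lb o' r2 = 14 \<or> lb o' r2 = 20)) \<or> o' = DE \<and> a = 21 \<and> k' = Sc DN 0"
          using sch_Sc[of o' a d1 kp d c k'] p ok o l(3) k nl by simp
        then obtain o2 a2 where k2: "k' = Sc o2 a2" by blast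
        have "hi o2 \<and> (a2 = 12 \<or> a2 = 18) \<and> (\<exists>r2. k = Sc o2 r2 \<and> (lb o2 r2 = 14 \<or> lb o2 r2 = 20)) \<or> o2 = DE \<and> a2 = 21 \<and> k = Sc DN 0"
          using sch_Sc[of o2 a2 d2 kq e f k] 1 ok o l'(3) k2 nl by simp
        then have y: "hi o2 \<and> (a2 = 12 \<or> a2 = 18) \<and> o' = o2 \<and> (lb o2 a = 14 \<or> lb o2 a = 20) \<or> o2 = DE \<and> a2 = 21 \<and> o' = DN \<and> a = 0"
          using k by simp
        have x': "hi o' \<and> (a = 12 \<or> a = 18) \<and> o2 = o' \<and> (lb o' a2 = 14 \<or> lb o' a2 = 20) \<or> o' = DE \<and> a = 21 \<and> o2 = DN \<and> a2 = 0"
          using x k2 by simp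
        then have "a = 12 \<and> o2 = o' \<or> a = 18 \<and> o2 = o' \<or> o' = DE \<and> a = 21 \<and> o2 = DN" by blast
        then show False
        proof (elim disjE conjE)
          assume "a = 12" "o2 = o'" then show False using y by (simp add: lb_def)
        next
          assume "a = 18" "o2 = o'" then show False using y by (simp add: lb_def)
        next
          assume "o' = DE" "a = 21" "o2 = DN" then show False using y by simp
        qed
      qed
    qed
  next
    case p: (2 o' a)
    have t: "(\<exists>b. k' = Sc o' b) \<and> d = opp o' \<or> (\<exists>b. k' = Lf o' b)" using T2_feed[of o' a d c k'] p o by simp
    show False
    proof (cases rule: Q)
      case 0
      from t show False
      proof (elim disjE conjE exE)
        fix b assume b: "k' = Sc o' b" "d = opp o'"
        then have "e = o' \<or> e = fw o'" using o(3) 0 by (auto split: if_splits)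
        moreover have "vec d = - vec o'" using b vec_opp by simp
        then have "r + vec (fw o') + vec e = r" using l(2) l'(2) p 0 by (simp add: algebra_simps)
        then have "vec (fw o') + vec e = 0" by (simp add: add.assoc)
        ultimately show False by (cases o') (auto simp: zero_prod_def)
      next
        fix b assume "k' = Lf o' b"
        then have "f = Neu b" using o(3) 0 by (auto split: if_splits)
        then show False using o(4) p by (auto split: if_splits)
      qed
    next
      case 1 then show False using p pr by simp
    next
      case (2 o2 a2)
      have "(\<exists>b. k = Sc o2 b) \<and> e = opp o2 \<or> (\<exists>b. k = Lf o2 b)" using T2_feed[of o2 a2 e f k] 2(3) o by simp
      then have u: "(\<exists>b. k = Sc o2 b) \<and> e = opp o2" using p(1) by simp
      then have oo: "o2 = o'" using p by simp
      have "d = opp o'" using t 2(1) by simp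
      then have "r' = r + vec (fw o')" using l(2) p vec_opp by (simp add: algebra_simps)
      moreover have "r = r' + vec (fw o')" using l'(2) 2 u oo vec_opp by (simp add: algebra_simps)
      ultimately have "r = r + (vec (fw o') + vec (fw o'))" by (simp add: add.assoc)
      then have "vec (fw o') + vec (fw o') = 0" by simp
      then show False by (cases o') (auto simp: zero_prod_def)
    qed
  qed
qed

lemma sch_two:
  assumes s: "sch k d1 k1" "sch k d2 k2" "d1 \<noteq> d2" and ok: "okk k" "k \<noteq> Seed"
  shows "(k1 = Cor DS FF \<and> k2 = Sc DW 1 \<or> k2 = Cor DS FF \<and> k1 = Sc DW 1) \<or> (k1 = Sc DE 0 \<and> k2 = Sc DS 0 \<or> k2 = Sc DE 0 \<and> k1 = Sc DS 0)"
proof -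
  have t: "\<not> tooth DE 21" "\<not> tooth DN 21" by (auto simp: tooth_def)
  have nf: "k' \<noteq> St c s'" if "sch (Run DE FF En) DE k'" for k' c s' using that by (auto simp: sch_def flow_def split: if_splits)
  show ?thesis
  proof (cases k)
    case (Run h s i)
    show ?thesis using sch_cases[OF s(1) ok] sch_cases[OF s(2) ok] s nf[of k1] nf[of k2] unfolding Run
      by (elim disjE exE conjE; simp; blast)
  next
    case (Sc o' r)
    show ?thesis using sch_cases[OF s(1) ok] sch_cases[OF s(2) ok] s(3) t unfolding Sc by (elim disjE exE conjE; simp)
  qed (use sch_cases[OF s(1) ok] sch_cases[OF s(2) ok] s(3) in auto)
qed

text \<open>Senders with a common receiver have equal colour. The root together with a tooth tip is
  impossible, since a row with a tooth sends only strong messages. Two children of the root remain;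
  \<open>sch_two\<close> leaves two pairs, and no tile accepts a message from both members of either
  pair.\<close>

lemma double_links:
  assumes D: "Dsc r k p kp" "Dsc r k q kq" and ok: "okk k" "k \<noteq> Seed"
    and l: "flow kp d k' c" "r' = p + vec d" "\<not> strong c" and l': "flow kq e k' f" "r' = q + vec e" "\<not> strong f"
    and ne: "p \<noteq> q"
  shows False
proof -
  have o: "out kp d = Some c" "inp k' (opp d) = Some c" "out kq e = Some f" "inp k' (opp e) = Some f"
    using l l' by (auto simp: flow_def)
  have c0: "out (Sc o' a) d = Some c \<Longrightarrow> \<not> strong c \<Longrightarrow> \<not> tooth o' a" for o' a d c by (auto split: if_splits)
  consider (0) "p = r" "kp = k" | (1) d1 where "p = r + vec d1" "sch k d1 kp"
    | (2) o' a where "k = Sc o' a" "tooth o' a" "kp = T2 o' a" "p = r + vec o' + vec (fw o')" using D(1) unfolding Dsc_def by blast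
  note P = this
  consider (0) "q = r" "kq = k" | (1) d2 where "q = r + vec d2" "sch k d2 kq"
    | (2) o' a where "k = Sc o' a" "tooth o' a" "kq = T2 o' a" "q = r + vec o' + vec (fw o')" using D(2) unfolding Dsc_def by blast
  note Q = this
  have pr: "par p \<longleftrightarrow> par q" using l(2) l'(2) par_vec[of p d] par_vec[of q e] by simp
  have SS: False if "out (Sc DE 0) x = Some u" "inp k' (opp x) = Some u" "out (Sc DS 0) y = Some v" "inp k' (opp y) = Some v" for x y u v
  proof -
    have "u = Nxt DE 1" "v = Nxt DS 1" using that by (auto simp: tooth_def leafr_def sgt_def nxr_def lb_def split: if_splits)
    then show False using inp_inv10[of k' "opp y" DS 1] inp_inv10[of k' "opp x" DE 1] that by auto
  qed
  have CS: False if cs: "out (Cor DS FF) x = Some u" "inp k' (opp x) = Some u" "out (Sc DW 1) y = Some v" "inp k' (opp y) = Some v" for x y u v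
  proof -
    have "v = Nxt DW 2" "u = Pth FF \<or> u = Wl True Co \<or> u = Wl True Cn" using cs by (auto simp: tooth_def leafr_def sgt_def nxr_def lb_def split: if_splits)
    moreover have "\<exists>a. k' = Sc DW a \<and> 2 = lb DW a" using inp_inv10[of k' "opp y" DW 2] cs(4) calculation(1) by auto
    ultimately show False using cs(2) by (auto simp: lb_def wlc_def split: if_splits)
  qed
  show False
  proof (cases rule: P)
    case p: 0
    show False
    proof (cases rule: Q)
      case 0 then show False using p ne by simp
    next
      case 1 then show False using p pr by simp
    next
      case (2 o' a)
      have "out (Sc o' a) d = Some c" using o(1) p(2) 2(1) by (simp only:)
      then show False using c0[OF _ l(3)] 2(2) by blast
    qed
  next
    case p: (1 d1)
    show False
    proof (cases rule: Q)
      case 0 then show False using p pr by simp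
    next
      case (2 o' a) then show False using p pr by simp
    next
      case (1 d2)
      then have "d1 \<noteq> d2" using p ne by auto
      from sch_two[OF p(2) 1(2) this ok] show False
      proof (elim disjE conjE)
        assume "kp = Cor DS FF" "kq = Sc DW 1" then show False using CS[of d c e f] o by blast
      next
        assume "kq = Cor DS FF" "kp = Sc DW 1" then show False using CS[of e f d c] o by blast
      next
        assume "kp = Sc DE 0" "kq = Sc DS 0" then show False using SS[of d c e f] o by blast
      next
        assume "kq = Sc DE 0" "kp = Sc DS 0" then show False using SS[of e f d c] o by blast
      qed
    qed
  next
    case p: (2 o' a)
    show False
    proof (cases rule: Q)
      case 0
      have "out (Sc o' a) e = Some f" using o(3) p(1) 0(2) by (simp only:)
      then show False using c0[OF _ l'(3)] p(2) by blast
    next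
      case 1 then show False using p pr by simp
    next
      case (2 o2 a2)
      then have "o2 = o'" using p(1) by simp
      then show False using p(4) 2(4) ne by simp
    qed
  qed
qed

text \<open>Weak links alone never join two fragments: two of them would be parallel or
  mutual.\<close>

lemma join_cl_cl:
  assumes C: "cl \<beta> r" "cl \<beta>' r'" and dj: "dom \<beta> \<inter> dom \<beta>' = {}"
    and lks: "(\<exists>p q c. (L \<beta> \<beta>' p q c \<or> L \<beta>' \<beta> q p c) \<and> strong c) \<or>
    (\<exists>p q c p' q' c'. (L \<beta> \<beta>' p q c \<or> L \<beta>' \<beta> q p c) \<and> (L \<beta> \<beta>' p' q' c' \<or> L \<beta>' \<beta> q' p' c') \<and> (p, q) \<noteq> (p', q'))"
  shows "\<exists>r. cl (\<beta> ++ \<beta>') r"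
proof -
  have dj': "dom \<beta>' \<inter> dom \<beta> = {}" using dj by auto
  have cm: "\<beta>' ++ \<beta> = \<beta> ++ \<beta>'" by (rule map_add_comm[OF dj'])
  show ?thesis
  proof (cases "\<exists>p q c. (L \<beta> \<beta>' p q c \<or> L \<beta>' \<beta> q p c) \<and> strong c")
    case True
    then show ?thesis using cl_strong[OF C dj] cl_strong[OF C(2,1) dj'] cm by metis
  next
    case F: False
    then obtain p q c p' q' c' where l: "L \<beta> \<beta>' p q c \<or> L \<beta>' \<beta> q p c" "L \<beta> \<beta>' p' q' c' \<or> L \<beta>' \<beta> q' p' c'" "(p, q) \<noteq> (p', q')"
      using lks by blast
    obtain k where k: "\<beta> r = Some k" using cl_root[OF C(1)] by blast
    obtain k' where k': "\<beta>' r' = Some k'" using cl_root[OF C(2)] by blast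
    have ok: "okk k" "k \<noteq> Seed" "okk k'" "k' \<noteq> Seed" using cl_okk C k k' by blast+
    have fwd: "q = r' \<and> \<not> strong c \<and> (\<exists>d kp. r' = p + vec d \<and> flow kp d k' c \<and> Dsc r k p kp)" if l0: "L \<beta> \<beta>' p q c" for p q c
    proof -
      have q: "q = r'" by (rule L_into_cl[OF C(2) dj l0])
      obtain d kp x where x: "\<beta> p = Some kp" "\<beta>' q = Some x" "q = p + vec d" "flow kp d x c" using l0 unfolding L_def by blast
      have "x = k'" using x(2) q k' by simp
      moreover have "Dsc r k p kp" by (rule cl_Dsc[OF C(1) k x(1)])
      moreover have "\<not> strong c" using F l0 by blast
      ultimately show ?thesis using q x by blast
    qed
    have bwd: "p = r \<and> \<not> strong c \<and> (\<exists>d kp. r = q + vec d \<and> flow kp d k c \<and> Dsc r' k' q kp)" if l0: "L \<beta>' \<beta> q p c" for p q c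
    proof -
      have q: "p = r" by (rule L_into_cl[OF C(1) dj' l0])
      obtain d kp x where x: "\<beta>' q = Some kp" "\<beta> p = Some x" "p = q + vec d" "flow kp d x c" using l0 unfolding L_def by blast
      have "x = k" using x(2) q k by simp
      moreover have "Dsc r' k' q kp" by (rule cl_Dsc[OF C(2) k' x(1)])
      moreover have "\<not> strong c" using F l0 by blast
      ultimately show ?thesis using q x by blast
    qed
    have False
    proof (cases "L \<beta> \<beta>' p q c")
      case True
      note a = fwd[OF True]
      show False
      proof (cases "L \<beta> \<beta>' p' q' c'")
        case True
        note b = fwd[OF True]
        have "p \<noteq> p'" using a b l(3) by auto
        moreover obtain d1 e1 d2 e2 where "r' = p + vec d1" "flow e1 d1 k' c" "Dsc r k p e1" "r' = p' + vec d2" "flow e2 d2 k' c'" "Dsc r k p' e2" using a b by blast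
        ultimately show False using a b double_links[of r k p e1 p' e2 d1 k' c r' d2 c'] ok by simp
      next
        case False
        then have "L \<beta>' \<beta> q' p' c'" using l(2) by simp
        note b = bwd[OF this]
        have ne: "\<not> (p = r \<and> q' = r')" using a b l(3) by auto
        obtain d1 e1 d2 e2 where "r' = p + vec d1" "flow e1 d1 k' c" "Dsc r k p e1" "r = q' + vec d2" "flow e2 d2 k c'" "Dsc r' k' q' e2" using a b by blast
        then show False using a b cross_links[of r k p e1 r' k' q' e2 d1 c d2 c', OF _ _ ok] ne by simp
      qed
    next
      case False
      then have "L \<beta>' \<beta> q p c" using l(1) by simp
      note a = bwd[OF this]
      show False
      proof (cases "L \<beta> \<beta>' p' q' c'")
        case True
        note b = fwd[OF True]
        have ne: "\<not> (p' = r \<and> q = r')" using a b l(3) by auto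
        obtain d1 e1 d2 e2 where "r' = p' + vec d1" "flow e1 d1 k' c'" "Dsc r k p' e1" "r = q + vec d2" "flow e2 d2 k c" "Dsc r' k' q e2" using a b by blast
        then show False using a b cross_links[of r k p' e1 r' k' q e2 d1 c' d2 c, OF _ _ ok] ne by simp
      next
        case False
        then have "L \<beta>' \<beta> q' p' c'" using l(2) by simp
        note b = bwd[OF this]
        have "q \<noteq> q'" using a b l(3) by auto
        moreover obtain d1 e1 d2 e2 where "r = q + vec d1" "flow e1 d1 k c" "Dsc r' k' q e1" "r = q' + vec d2" "flow e2 d2 k c'" "Dsc r' k' q' e2" using a b by blast
        ultimately show False using a b double_links[of r' k' q e1 q' e2 d1 k c r d2 c'] ok by simp
      qed
    qed
    then show ?thesis ..
  qed
qed

section \<open>Joining two families of cells\<close>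

lemma fin_unique:
  assumes "fin \<kappa> c n" "fin \<kappa> c n'" shows "n = n'"
proof -
  have lt: False if f: "fin \<kappa> c n" "fin \<kappa> c n'" and l: "n < n'" for n n'
  proof -
    obtain w w' where s: "sup \<kappa> c n w (Rg n DN 0)" "sup \<kappa> c n' w' (Rg n' DN 0)" and n0: "n \<noteq> 0" using f unfolding fin_def by blast
    have "13 \<le> n" using s(1) n0 okn_ge unfolding sup_def by blast
    moreover have "\<kappa> (c + pos n' (Rg n DN 0)) = Some (knd n' w' (Rg n DN 0))"
      by (rule sup_anc[OF s(2)]) (use l n0 in \<open>auto simp: rle_def\<close>)
    moreover have "\<kappa> (c + pos n (Rg n DN 0)) = Some (knd n w (Rg n DN 0))" by (rule supD[OF s(1)])
    ultimately show False using l by (auto simp: sym_at_def split: if_splits)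
  qed
  show ?thesis using lt[OF assms] lt[OF assms(2,1)] by (cases n n' rule: linorder_cases) auto
qed

lemma sup_leaf_fin: "sup \<kappa> c n w (Le o' g) \<Longrightarrow> fin \<kappa> c n"
proof -
  assume s: "sup \<kappa> c n w (Le o' g)"
  have n: "n \<noteq> 0" using s by (auto simp: sup_def vcol_def)
  have "sup \<kappa> c n w (Rg n DN 0)"
  proof (rule sup_sub[OF s])
    show "valid n (Rg n DN 0)" using n by simp
    fix z assume "valid n z" "anc n (Rg n DN 0) z"
    then show "anc n (Le o' g) z" using n by (cases z) (auto simp: rle_def)
  qed
  then show ?thesis using n unfolding fin_def by blast
qed

text \<open>One aligned pair of cells suffices, because within each family all seeds already share
  one size and one lattice.\<close>

lemma V_join:
  assumes V: "VV \<kappa>" "VV \<kappa>'" and dj: "dom \<kappa> \<inter> dom \<kappa>' = {}"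
    and f: "fin \<kappa> a n" "fin \<kappa>' b n" "b = a + ((2 * int n + 4) * u, (2 * int n + 4) * v)"
  shows "VV (\<kappa> ++ \<kappa>')"
proof -
  let ?k = "\<kappa> ++ \<kappa>'"
  have le: "\<kappa> \<subseteq>\<^sub>m ?k" "\<kappa>' \<subseteq>\<^sub>m ?k" using dj map_add_comm[OF dj] map_le_map_add by metis+
  have sk: "?k p = Some x \<longleftrightarrow> \<kappa> p = Some x \<or> \<kappa>' p = Some x" for p x using dj by (auto simp: map_add_Some_iff)
  have "V1 ?k" unfolding V1_def
  proof (intro allI impI)
    fix p x assume "?k p = Some x"
    then show "\<exists>c n w x. p = c + pos n x \<and> sup ?k c n w x"
      using V sup_mono[OF _ le(1)] sup_mono[OF _ le(2)] unfolding sk VV_def V1_def by meson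
  qed
  moreover have one: "\<exists>u v. fin ?k c n \<and> c = a + ((2 * int n + 4) * u, (2 * int n + 4) * v)"
    if "?k c = Some Seed" for c
  proof -
    let ?m = "2 * int n + 4"
    from that consider "\<kappa> c = Some Seed" | "\<kappa>' c = Some Seed" unfolding sk by blast
    then show ?thesis
    proof cases
      case 1
      show ?thesis
      proof (cases "c = a")
        case True then show ?thesis using f fin_mono[OF _ le(1)] by (intro exI[of _ 0]) (auto simp: zero_prod_def[symmetric])
      next
        case False
        moreover have "\<kappa> a = Some Seed" using f(1) sup_seed unfolding fin_def by blast
        ultimately obtain n' u v where n': "fin \<kappa> a n'" "fin \<kappa> c n'" "c = a + ((2 * int n' + 4) * u, (2 * int n' + 4) * v)"
          using V(1) 1 unfolding VV_def V2_def by metis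
        then have "n' = n" using f(1) fin_unique by blast
        then show ?thesis using n' fin_mono[OF _ le(1)] by blast
      qed
    next
      case 2
      show ?thesis
      proof (cases "c = b")
        case True then show ?thesis using f fin_mono[OF _ le(2)] by blast
      next
        case False
        moreover have "\<kappa>' b = Some Seed" using f(2) sup_seed unfolding fin_def by blast
        ultimately obtain n' u' v' where n': "fin \<kappa>' b n'" "fin \<kappa>' c n'" "c = b + ((2 * int n' + 4) * u', (2 * int n' + 4) * v')"
          using V(2) 2 unfolding VV_def V2_def by metis
        then have nn: "n' = n" using f(2) fin_unique by blast
        then have "c = a + (?m * (u + u'), ?m * (v + v'))" using n'(3) f(3) by (simp add: algebra_simps)
        then show ?thesis using n' nn fin_mono[OF _ le(2)] by blast
      qed
    qed
  qed
  have "V2 ?k" unfolding V2_def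
  proof (intro allI impI)
    fix c c' assume c: "?k c = Some Seed \<and> ?k c' = Some Seed \<and> c \<noteq> c'"
    obtain u v where x: "fin ?k c n" "c = a + ((2 * int n + 4) * u, (2 * int n + 4) * v)" using one[of c] c by blast
    obtain u' v' where y: "fin ?k c' n" "c' = a + ((2 * int n + 4) * u', (2 * int n + 4) * v')" using one[of c'] c by blast
    have "c' = c + ((2 * int n + 4) * (u' - u), (2 * int n + 4) * (v' - v))" using x y by (simp add: algebra_simps)
    then show "\<exists>n u v. fin ?k c n \<and> fin ?k c' n \<and> c' = c + ((2 * int n + 4) * u, (2 * int n + 4) * v)" using x y by blast
  qed
  ultimately show ?thesis unfolding VV_def by blast
qed

lemma rs_mod:
  assumes "7 \<le> g" "g < n" shows "rs n o' g = 7 + (g - 7) mod 4"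
  using assms by (simp add: rs_def)

text \<open>Regular high teeth sit in rows congruent to 3 modulo 4 and regular low teeth, from row 5
  on, in rows congruent to 1. The extra high tooth in row 1 and the extra low tooth in row 3 have
  just the residue of the other side.\<close>

lemma hi_tooth_row:
  assumes "okn n" "n \<noteq> 0" "hi e" "g mod 4 = 3" "7 \<le> g" "g < n"
  shows "valid n (M1 e g)"
proof -
  have "(g - 7) mod 4 = 0" using assms(4,5) by presburger
  then have "rs n e g = 7" using assms(5,6) rs_mod[of g n e] by simp
  moreover have "vcol n e g" using assms by (cases e) (simp_all add: vcol_def)
  ultimately show ?thesis using assms(3) by (simp add: tooth_def)
qed

lemma lo_tooth_row:
  assumes "okn n" "n \<noteq> 0" "\<not> hi e" "g mod 4 = 1" "5 \<le> g" "g < n"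
  shows "valid n (M1 e g)"
proof (cases "g = 5")
  case True
  then show ?thesis using assms by (cases e) (auto simp: vcol_def tooth_def rs_def)
next
  case False
  then have g: "9 \<le> g" using assms(4,5) by presburger
  then obtain t where t: "g = 7 + t" using le_Suc_ex[of 7 g] by auto
  have "t mod 4 = 2" using assms(4) unfolding t by presburger
  then have "(g - 7) mod 4 = 2" using t by simp
  then have "rs n e g = 9" using assms(6) g rs_mod[of g n e] by simp
  moreover have "vcol n e g" using assms by (cases e) (simp_all add: vcol_def)
  ultimately show ?thesis using assms(3) by (simp add: tooth_def)
qed

text \<open>The first tooth of a high strip and the first tooth of a low strip are off the four-periodic pattern;
  when strips of different lengths face each other, one of them hits a regular tooth of the other.\<close>

lemma facing_strips_equal:
  assumes s: "sup \<kappa> a n w (Le o' g)" "\<not> hi o'" and s': "sup \<kappa>' b m w' (Le (opp o') g')"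
    and ab: "a = b + sp (opp o') (int n + int m + 4) 0" and dj: "dom \<kappa> \<inter> dom \<kappa>' = {}"
  shows "n = m"
proof (rule ccontr)
  assume ne: "n \<noteq> m"
  have h: "hi (opp o')" using s(2) by (cases o') auto
  have ok: "okn n" "okn m" and vl: "vcol n o' g" "leafr o' (rs n o' g)" "vcol m (opp o') g'" "leafr (opp o') (rs m (opp o') g')"
    using s(1) s' by (auto simp: sup_def)
  have n0: "n \<noteq> 0" "m \<noteq> 0" using vl by (auto simp: vcol_def)
  have n: "13 \<le> n" "13 \<le> m" "n mod 4 = 1" "m mod 4 = 1" using ok n0 by (auto simp: okn_def)
  have g: "n + 3 \<le> g" "m + 2 \<le> g'" using leaf_row(2)[OF ok(1) vl(1,2) s(2)] leaf_row(1)[OF ok(2) vl(3,4) h] by auto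
  \<comment> \<open>The leaf lies beyond the middle row, so it forces every earlier tooth of its
    strip; \<open>hh\<close> is the same for the high strip.\<close>
  have lo: "\<kappa> (a + sp o' (int n + 2) (int x - int n)) \<noteq> None" if "valid n (M1 o' x)" "x < n" for x
    using sup_anc[OF s(1) that(1)] s(2) g that(2) by simp
  have hh: "\<kappa>' (b + sp (opp o') (int m + 2) (int x - int m)) \<noteq> None" if "valid m (M1 (opp o') x)" "x < m" for x
  proof -
    have "3 * x + 1 \<le> 3 * (g' - 2) + 2" using that(2) g(2) by linarith
    then show ?thesis using sup_anc[OF s' that(1)] h by simp
  qed
  have eq: "a + sp o' (int n + 2) y = b + sp (opp o') (int m + 2) y" for y
    unfolding ab by (cases o') auto
  have cl: False if "valid n (M1 o' x)" "x < n" "valid m (M1 (opp o') x')" "x' < m" "int x - int n = int x' - int m" for x x'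
    using lo[OF that(1,2)] hh[OF that(3,4)] that(5) eq[of "int x - int n"] dj by auto
  show False
  proof (cases "m < n")
    \<comment> \<open>Row 1 of the shorter high strip faces row \<open>n - m + 1\<close> of the low
      strip, which is congruent to 1 and at least 5 and so carries a tooth. In the other case row 3
      of the low strip faces row \<open>m - n + 3\<close> of the high strip, congruent to 3 and at
      least 7.\<close>
    case True
    obtain t where t: "n - m = 4 * t" using mod_eq_dvd_iff_nat[of m n 4] True n by (auto elim: dvdE)
    then have t1: "1 \<le> t" using True by simp
    have "valid m (M1 (opp o') 1)" using n h by (cases o') (auto simp: vcol_def tooth_def rs_def)
    moreover have "valid n (M1 o' (n - m + 1))"
      by (rule lo_tooth_row[OF ok(1) n0(1) s(2)]) (use n True t t1 in \<open>simp_all\<close>)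
    ultimately show False using cl[of "n - m + 1" 1] n True by (simp add: of_nat_diff)
  next
    case False
    obtain t where t: "m - n = 4 * t" using mod_eq_dvd_iff_nat[of n m 4] False ne n by (auto elim: dvdE)
    then have t1: "1 \<le> t" using False ne by simp
    have "valid n (M1 o' 3)" using n s(2) by (cases o') (auto simp: vcol_def tooth_def rs_def)
    moreover have "valid m (M1 (opp o') (m - n + 3))"
      by (rule hi_tooth_row[OF ok(2) n0(2) h]) (use n False ne t t1 in \<open>simp_all\<close>)
    moreover have "m - n + 3 < m" using n False by linarith
    ultimately show False using cl[of 3 "m - n + 3"] n False by (simp add: of_nat_diff)
  qed
qed

text \<open>The link feeds a late input of a leaf. If the feeding tile were a strip or tooth tile of
  the other part, its own inputs would need a place that the leaf forces to be occupied here. So the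
  link joins two facing leaves, and these align their cells.\<close>

lemma join_V_link:
  assumes V: "VV \<kappa>" "VV \<kappa>'" and dj: "dom \<kappa> \<inter> dom \<kappa>' = {}" and l: "L \<kappa>' \<kappa> q p c"
  shows "VV (\<kappa> ++ \<kappa>')"
proof -
  have v1: "V1 \<kappa>" "V1 \<kappa>'" using V unfolding VV_def by auto
  have "\<exists>a n w o' g. p = a + pos n (Le o' g) \<and> sup \<kappa> a n w (Le o' g) \<and>
    (hi o' \<and> \<kappa>' q = Some (Sc o' (rs n o' g)) \<and> q = p + vec (opp o') \<or>
     \<not> hi o' \<and> \<kappa>' q = Some (T1 o' (rs n o' g + 1)) \<and> q = p + vec (fw o') \<or>
     \<not> hi o' \<and> q = p + vec (opp (fw o')) \<and> (\<exists>e. \<kappa>' q = Some (Lf e (rs n o' g - 1)) \<and> hi e \<and> fw e = fw o'))"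
    by (rule open_input[OF v1(1) dj l]) (rule V1_okk[OF v1(2)])
  then obtain a n w o' g where x: "p = a + pos n (Le o' g)" "sup \<kappa> a n w (Le o' g)" and cs:
    "hi o' \<and> \<kappa>' q = Some (Sc o' (rs n o' g)) \<and> q = p + vec (opp o') \<or>
     \<not> hi o' \<and> \<kappa>' q = Some (T1 o' (rs n o' g + 1)) \<and> q = p + vec (fw o') \<or>
     \<not> hi o' \<and> q = p + vec (opp (fw o')) \<and> (\<exists>e. \<kappa>' q = Some (Lf e (rs n o' g - 1)) \<and> hi e \<and> fw e = fw o')"
    by metis
  have n: "okn n" and vl: "vcol n o' g" "leafr o' (rs n o' g)" using x(2) by (auto simp: sup_def)
  have n0: "n \<noteq> 0" using vl by (simp add: vcol_def)
  from cs consider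
      (h) "hi o'" "\<kappa>' q = Some (Sc o' (rs n o' g))" "q = p + vec (opp o')"
    | (t) "\<not> hi o'" "\<kappa>' q = Some (T1 o' (rs n o' g + 1))" "q = p + vec (fw o')"
    | (u) e where "\<not> hi o'" "\<kappa>' q = Some (Lf e (rs n o' g - 1))" "hi e" "q = p + vec (opp (fw o'))" "fw e = fw o'" by metis
  then show ?thesis
  proof cases
    case h
    have r: "rs n o' g = 13 \<or> rs n o' g = 19" using vl h(1) by (auto simp: leafr_def)
    have "inp (Sc o' (rs n o' g)) (opp (fw o')) = Some (Sg o' (rs n o' g))" using r h(1) by (auto simp: stst_def sgt_def)
    then obtain k1 where k1: "\<kappa>' (q + vec (opp (fw o'))) = Some k1" "out k1 (opp (opp (fw o'))) = Some (Sg o' (rs n o' g))"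
      using V1_input[OF v1(2) h(2)] by blast
    have k1': "k1 = Sc o' (rs n o' g - 1)" using out_Sg[OF k1(2)] .
    have "inp k1 o' = Some (Nxt o' (rs n o' g - 1))" using k1' r h(1) by (elim disjE) (simp_all add: stst_def sgt_def tooth_def lb_def)
    then obtain k2 where k2: "\<kappa>' (q + vec (opp (fw o')) + vec o') = Some k2" using V1_input[OF v1(2) k1(1)] k1' by blast
    have "\<kappa> (a + pos n (M2 o' (g - 2))) \<noteq> None"
      using sup_anc[OF x(2), of "M2 o' (g - 2)"] leaf_sup(1)[OF n vl h(1)] h(1) by simp
    moreover have "a + pos n (M2 o' (g - 2)) = q + vec (opp (fw o')) + vec o'"
      using leaf_sup(1)[OF n vl h(1)] x(1) h(3) by (cases o') (auto simp: algebra_simps of_nat_diff)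
    ultimately show ?thesis using k2 dj by auto
  next
    case t
    have r: "rs n o' g = 14 \<or> rs n o' g = 20" using vl t(1) by (auto simp: leafr_def)
    have "inp (T1 o' (rs n o' g + 1)) (opp o') = Some (Tl1 o' (rs n o' g + 1))" by simp
    then obtain k1 where k1: "\<kappa>' (q + vec (opp o')) = Some k1" "out k1 (opp (opp o')) = Some (Tl1 o' (rs n o' g + 1))"
      using V1_input[OF v1(2) t(2)] by blast
    have k1': "k1 = Sc o' (rs n o' g + 1)" using out_Tl1[OF k1(2)] .
    have "\<exists>c. inp k1 (opp (fw o')) = Some c" using k1' r t(1) by (elim disjE) (simp_all add: stst_def sgt_def tooth_def lb_def)
    then obtain k2 where k2: "\<kappa>' (q + vec (opp o') + vec (opp (fw o'))) = Some k2" using V1_input[OF v1(2) k1(1)] k1' by blast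
    have "\<kappa> (a + pos n (Col o' g)) \<noteq> None" using sup_anc[OF x(2), of "Col o' g"] vl t(1) by simp
    moreover have "a + pos n (Col o' g) = q + vec (opp o') + vec (opp (fw o'))"
      using x(1) t(3) by (cases o') (auto simp: algebra_simps)
    ultimately show ?thesis using k2 dj by auto
  next
    case (u e)
    have e: "e = opp o'" using u by (cases o'; cases e) auto
    obtain b m w' y where y: "q = b + pos m y" "sup \<kappa>' b m w' y" "Lf e (rs n o' g - 1) = knd m w' y" "okn m" "valid m y"
      by (rule V1_E[OF v1(2) u(2)])
    then obtain g' where g': "y = Le e g'" "rs m e g' = rs n o' g - 1" by (cases y) (auto split: if_splits)
    have vl': "vcol m e g'" "leafr e (rs m e g')" using y g' by auto
    \<comment> \<open>Leaf rows lie at fixed offsets from the middle row, so adjacent leaves put the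
      two centres on one line, even before the sizes are known to agree.\<close>
    have rows: "int g - int n = int g' - int m + 1"
      using leaf_row(2)[OF n vl u(1)] leaf_row(1)[OF y(4) vl' u(3)] g'(2) by auto
    have ab: "a = b + sp (opp o') (int n + int m + 4) 0"
      using x(1) y(1) g'(1) u(4) rows e by (cases o') (auto simp: algebra_simps prod_eq_iff)
    have nm: "n = m" by (rule facing_strips_equal[OF x(2) u(1) _ ab dj, of w' g']) (use y(2) g'(1) e in simp)
    have "\<exists>u v. b = a + ((2 * int n + 4) * u, (2 * int n + 4) * v)"
    proof (cases o')
      case DW then show ?thesis using ab nm by (intro exI[of _ "-1"] exI[of _ 0]) (simp add: prod_eq_iff)
    next
      case DS then show ?thesis using ab nm by (intro exI[of _ 0] exI[of _ "-1"]) (simp add: prod_eq_iff)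
    qed (use u(1) in auto)
    then show ?thesis using V_join[OF V dj sup_leaf_fin[OF x(2)]] sup_leaf_fin y(2) g'(1) nm by blast
  qed
qed

lemma join_V_V:
  assumes V: "VV \<kappa>" "VV \<kappa>'" and dj: "dom \<kappa> \<inter> dom \<kappa>' = {}" and l: "L \<kappa> \<kappa>' p q c \<or> L \<kappa>' \<kappa> q p c"
  shows "VV (\<kappa> ++ \<kappa>')"
proof -
  have dj': "dom \<kappa>' \<inter> dom \<kappa> = {}" using dj by auto
  show ?thesis using l join_V_link[OF V dj] join_V_link[OF V(2,1) dj'] map_add_comm[OF dj] by metis
qed

section \<open>The invariant under translation, combination and limits\<close>

definition kshift :: "kasm \<Rightarrow> pos \<Rightarrow> kasm" where "kshift \<kappa> v = (\<lambda>p. \<kappa> (p - v))"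

lemma kshift_add [simp]: "kshift \<kappa> v (p + v) = \<kappa> p" by (simp add: kshift_def)

lemma tl_kshift: "tl \<tau> (kshift \<kappa> v) = translate (tl \<tau> \<kappa>) v"
  by (rule ext) (simp add: tl_def kshift_def translate_apply)

lemma cl_kshift: "cl \<beta> r \<Longrightarrow> cl (kshift \<beta> v) (r + v)"
proof (induction rule: cl.induct)
  case (cl1 k r)
  have "kshift [r \<mapsto> k] v = [r + v \<mapsto> k]" by (rule ext) (auto simp: kshift_def algebra_simps)
  then show ?case using cl.cl1[OF cl1, of "r + v"] by (simp only:)
next
  case (cl2 \<beta> r p k d k' c)
  have e: "kshift (\<beta>(p \<mapsto> k)) v = (kshift \<beta> v)(p + v \<mapsto> k)" by (rule ext) (auto simp: kshift_def algebra_simps)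
  have "p + v + vec d = p + vec d + v" by (simp add: algebra_simps)
  then have "kshift \<beta> v (p + v + vec d) = Some k'" using cl2.hyps(4) by (simp only: kshift_add)
  then show ?case unfolding e using cl2 by (intro cl.cl2) auto
qed

lemma sup_kshift: "sup \<kappa> c n w x \<Longrightarrow> sup (kshift \<kappa> v) (c + v) n w x"
  unfolding sup_def kshift_def by (simp add: algebra_simps)

lemma VV_kshift:
  assumes "VV \<kappa>" shows "VV (kshift \<kappa> v)"
proof -
  have "V1 (kshift \<kappa> v)" unfolding V1_def
  proof (intro allI impI)
    fix p k assume "kshift \<kappa> v p = Some k"
    then obtain c n w x where "p - v = c + pos n x" "sup \<kappa> c n w x" using assms unfolding VV_def V1_def kshift_def by blast
    then show "\<exists>c n w x. p = c + pos n x \<and> sup (kshift \<kappa> v) c n w x"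
      using sup_kshift[of \<kappa> c n w x v] by (metis add.commute add.assoc diff_add_cancel)
  qed
  moreover have "V2 (kshift \<kappa> v)" unfolding V2_def
  proof (intro allI impI)
    fix c c' assume a: "kshift \<kappa> v c = Some Seed \<and> kshift \<kappa> v c' = Some Seed \<and> c \<noteq> c'"
    then have "\<kappa> (c - v) = Some Seed" "\<kappa> (c' - v) = Some Seed" "c - v \<noteq> c' - v" by (auto simp: kshift_def)
    then obtain n x y where n: "fin \<kappa> (c - v) n" "fin \<kappa> (c' - v) n" "c' - v = (c - v) + ((2 * int n + 4) * x, (2 * int n + 4) * y)"
      using assms unfolding VV_def V2_def by blast
    have "c' = c' - v + v" by simp
    also have "\<dots> = c + ((2 * int n + 4) * x, (2 * int n + 4) * y)" unfolding n(3) by (simp add: algebra_simps)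
    finally have "c' = c + ((2 * int n + 4) * x, (2 * int n + 4) * y)" .
    moreover have "fin (kshift \<kappa> v) c n" "fin (kshift \<kappa> v) c' n"
      using n(1,2) sup_kshift[of \<kappa> "c - v" n _ _ v] sup_kshift[of \<kappa> "c' - v" n _ _ v] unfolding fin_def diff_add_cancel by blast+
    ultimately show "\<exists>n u w. fin (kshift \<kappa> v) c n \<and> fin (kshift \<kappa> v) c' n \<and> c' = c + ((2 * int n + 4) * u, (2 * int n + 4) * w)" by blast
  qed
  ultimately show ?thesis unfolding VV_def by blast
qed

definition kinv :: "kasm \<Rightarrow> bool" where
  "kinv \<kappa> \<longleftrightarrow> (\<exists>r. cl \<kappa> r) \<or> VV \<kappa> \<and> \<kappa> \<noteq> Map.empty"

lemma kinv_okk: "kinv \<kappa> \<Longrightarrow> \<kappa> p = Some k \<Longrightarrow> okk k"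
  unfolding kinv_def VV_def using cl_okk V1_okk by blast

lemma kinv_nonempty: "kinv \<kappa> \<Longrightarrow> dom \<kappa> \<noteq> {}"
  unfolding kinv_def using cl_root by auto

lemma kinv_kshift: "kinv \<kappa> \<Longrightarrow> kinv (kshift \<kappa> v)"
proof -
  assume "kinv \<kappa>"
  then consider r where "cl \<kappa> r" | "VV \<kappa>" "\<kappa> \<noteq> Map.empty" unfolding kinv_def by blast
  then show ?thesis
  proof cases
    case 1 then show ?thesis using cl_kshift unfolding kinv_def by blast
  next
    case 2
    then obtain p where "\<kappa> p \<noteq> None" by (meson ext)
    then have "kshift \<kappa> v (p + v) \<noteq> None" by simp
    then have "kshift \<kappa> v \<noteq> Map.empty" by metis
    then show ?thesis using 2 VV_kshift unfolding kinv_def by blast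
  qed
qed

lemma VV_seed: "VV \<kappa> \<Longrightarrow> \<kappa> \<noteq> Map.empty \<Longrightarrow> \<exists>c. \<kappa> c = Some Seed"
proof -
  assume V: "VV \<kappa>" "\<kappa> \<noteq> Map.empty"
  then obtain p k where "\<kappa> p = Some k" by (meson not_Some_eq ext)
  then show ?thesis using V sup_seed unfolding VV_def V1_def by blast
qed

lemma dom_tl [simp]: "dom (tl \<tau> \<kappa>) = dom \<kappa>" by (auto simp: tl_def)

lemma tl_add: "tl \<tau> (\<kappa> ++ \<kappa>') = tl \<tau> \<kappa> ++ tl \<tau> \<kappa>'"
  by (rule ext) (auto simp: tl_def map_add_def split: option.splits)

text \<open>A canonical inverse of \<open>tl\<close>, so that the stages of a chain yield one
  increasing chain of kinds rather than unrelated choices.\<close>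

definition untl :: "nat \<Rightarrow> assembly \<Rightarrow> kasm" where
  "untl \<tau> \<alpha> = (\<lambda>p. map_option (inv_into {k. okk k} (tile \<tau>)) (\<alpha> p))"

lemma untl_tl:
  assumes "1 < \<tau>" "\<And>p k. \<kappa> p = Some k \<Longrightarrow> okk k" shows "untl \<tau> (tl \<tau> \<kappa>) = \<kappa>"
proof
  fix p
  have "inj_on (tile \<tau>) {k. okk k}" using tile_inj[OF assms(1)] by (auto simp: inj_on_def)
  then show "untl \<tau> (tl \<tau> \<kappa>) p = \<kappa> p" using assms(2)[of p] by (cases "\<kappa> p") (auto simp: untl_def tl_def)
qed

lemma kinv_join:
  assumes t: "1 < \<tau>" and K: "kinv \<kappa>" "kinv \<kappa>'" and dj: "dom \<kappa> \<inter> dom \<kappa>' = {}" and st: "stable \<tau> (tl \<tau> (\<kappa> ++ \<kappa>'))"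
  shows "kinv (\<kappa> ++ \<kappa>')"
proof -
  have l: "(\<exists>p q c. (L \<kappa> \<kappa>' p q c \<or> L \<kappa>' \<kappa> q p c) \<and> strong c) \<or>
    (\<exists>p q c p' q' c'. (L \<kappa> \<kappa>' p q c \<or> L \<kappa>' \<kappa> q p c) \<and> (L \<kappa> \<kappa>' p' q' c' \<or> L \<kappa>' \<kappa> q' p' c') \<and> (p, q) \<noteq> (p', q'))"
    by (rule stable_links[OF t st dj kinv_okk[OF K(1)] kinv_okk[OF K(2)] kinv_nonempty[OF K(1)] kinv_nonempty[OF K(2)]])
  then have l': "(\<exists>p q c. (L \<kappa>' \<kappa> p q c \<or> L \<kappa> \<kappa>' q p c) \<and> strong c) \<or>
    (\<exists>p q c p' q' c'. (L \<kappa>' \<kappa> p q c \<or> L \<kappa> \<kappa>' q p c) \<and> (L \<kappa>' \<kappa> p' q' c' \<or> L \<kappa> \<kappa>' q' p' c') \<and> (p, q) \<noteq> (p', q'))"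
    by blast
  have dj': "dom \<kappa>' \<inter> dom \<kappa> = {}" using dj by auto
  have ne: "\<kappa> ++ \<kappa>' \<noteq> Map.empty" using kinv_nonempty[OF K(1)] by (auto simp: map_add_eq_empty_iff)
  consider (cc) r r' where "cl \<kappa> r" "cl \<kappa>' r'" | (cv) r where "cl \<kappa> r" "VV \<kappa>'" | (vc) r where "VV \<kappa>" "cl \<kappa>' r" | (vv) "VV \<kappa>" "VV \<kappa>'"
    using K unfolding kinv_def by blast
  then show ?thesis
  proof cases
    case cc then show ?thesis using join_cl_cl[OF cc dj l] unfolding kinv_def by blast
  next
    case cv
    obtain k where "\<kappa> r = Some k" using cl_root[OF cv(1)] by blast
    then have "VV (\<kappa>' ++ \<kappa>)" using join_V_cl[OF cv(2,1) dj' _ l'] by blast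
    then show ?thesis using ne map_add_comm[OF dj] unfolding kinv_def by simp
  next
    case vc
    obtain k where "\<kappa>' r = Some k" using cl_root[OF vc(2)] by blast
    then have "VV (\<kappa> ++ \<kappa>')" using join_V_cl[OF vc dj _ l] by blast
    then show ?thesis using ne unfolding kinv_def by simp
  next
    case vv
    obtain p q c where "L \<kappa> \<kappa>' p q c \<or> L \<kappa>' \<kappa> q p c" using l by blast
    then show ?thesis using join_V_V[OF vv dj] ne unfolding kinv_def by blast
  qed
qed

lemma kinv_Seed: "VV [p \<mapsto> Seed]"
proof -
  have "sup [p \<mapsto> Seed] p 0 w SS" for w by (auto simp: sup_def okn_def)
  moreover have "p = p + pos 0 SS" by simp
  ultimately have "V1 [p \<mapsto> Seed]" unfolding V1_def by (metis map_upd_Some_unfold option.distinct(1))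
  moreover have "V2 [p \<mapsto> Seed]" unfolding V2_def by (auto split: if_splits)
  ultimately show ?thesis unfolding VV_def by simp
qed

text \<open>A fragment fits into 25 places, so a strictly growing chain has a stage with a seed; all
  later stages keep that seed and thus cannot be fragments.\<close>

lemma kinv_limit:
  assumes mono: "\<And>i j. i \<le> j \<Longrightarrow> h i \<subseteq>\<^sub>m (h j :: kasm)" and K: "\<And>k. kinv (h k)" and grow: "\<And>k. h (Suc k) \<noteq> h k"
    and lim: "\<And>p k. \<kappa> p = Some k \<longleftrightarrow> (\<exists>i. h i p = Some k)"
  shows "kinv \<kappa>"
proof -
  have le: "h i \<subseteq>\<^sub>m \<kappa>" for i using lim unfolding map_le_def by (metis domD)
  have "\<exists>k0. VV (h k0)"
  proof (rule ccontr)
    assume a: "\<not> ?thesis"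
    have c: "finite (dom (h k)) \<and> card (dom (h k)) \<le> 25" for k
    proof -
      obtain r where r: "cl (h k) r" using K[of k] a unfolding kinv_def by blast
      let ?S = "(\<lambda>v. r + v) ` ({-2..2} \<times> {-2..2} :: pos set)"
      have f: "finite ?S" by simp
      have "card ?S \<le> card ({-2..2} \<times> {-2..2} :: pos set)" by (rule card_image_le) simp
      also have "\<dots> = 25" by simp
      finally have "card ?S \<le> 25" .
      then show ?thesis using cl_bounded[OF r] f card_mono[OF f] finite_subset by (meson le_trans)
    qed
    have "k \<le> card (dom (h k))" for k
    proof (induction k)
      case (Suc k)
      have "dom (h k) \<subset> dom (h (Suc k))"
      proof -
        have l: "h k \<subseteq>\<^sub>m h (Suc k)" using mono by simp
        have "dom (h k) \<noteq> dom (h (Suc k))"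
        proof
          assume e: "dom (h k) = dom (h (Suc k))"
          have "h k p = h (Suc k) p" for p using l e unfolding map_le_def by (metis domIff)
          then show False using grow[of k] by (metis ext)
        qed
        then show ?thesis using map_le_implies_dom_le[OF l] by blast
      qed
      then have "card (dom (h k)) < card (dom (h (Suc k)))" using psubset_card_mono[of "dom (h (Suc k))"] c[of "Suc k"] by blast
      then show ?case using Suc by simp
    qed simp
    from this[of 26] c[of 26] show False by simp
  qed
  then obtain k0 where k0: "VV (h k0)" by blast
  have V: "VV (h k)" if "k0 \<le> k" for k
  proof (rule ccontr)
    assume "\<not> VV (h k)"
    then obtain r where r: "cl (h k) r" using K[of k] unfolding kinv_def by blast
    have "h k0 \<noteq> Map.empty" using kinv_nonempty[OF K[of k0]] by auto
    then obtain c where "h k0 c = Some Seed" using VV_seed[OF k0] by blast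
    then have "h k c = Some Seed" using mono[OF that] unfolding map_le_def by (metis domI)
    then show False using cl_okk[OF r] by blast
  qed
  have late: "\<exists>i\<ge>j. h i p = Some k" if s: "\<kappa> p = Some k" for p k j
  proof -
    obtain i where "h i p = Some k" using s lim[of p k] by blast
    then have "h (max i j) p = Some k" using mono[of i "max i j"] unfolding map_le_def by (metis domI max.cobounded1)
    then show ?thesis by (meson max.cobounded2)
  qed
  have "V1 \<kappa>" unfolding V1_def
  proof (intro allI impI)
    fix p k assume "\<kappa> p = Some k"
    then obtain i where "k0 \<le> i" "h i p = Some k" using late[of p k k0] by blast
    then obtain c n w x where "p = c + pos n x" "sup (h i) c n w x" using V unfolding VV_def V1_def by meson
    then show "\<exists>c n w x. p = c + pos n x \<and> sup \<kappa> c n w x" using sup_mono[OF _ le] by blast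
  qed
  moreover have "V2 \<kappa>" unfolding V2_def
  proof (intro allI impI)
    fix c c' assume a: "\<kappa> c = Some Seed \<and> \<kappa> c' = Some Seed \<and> c \<noteq> c'"
    obtain i where i: "k0 \<le> i" "h i c = Some Seed" using a late[of c Seed k0] by blast
    obtain j where j: "i \<le> j" "h j c' = Some Seed" using a late[of c' Seed i] by blast
    have "h j c = Some Seed" using mono[OF j(1)] i(2) unfolding map_le_def by (metis domI)
    moreover have "VV (h j)" using V i j by simp
    ultimately obtain n u v where "fin (h j) c n" "fin (h j) c' n" "c' = c + ((2 * int n + 4) * u, (2 * int n + 4) * v)"
      using a j unfolding VV_def V2_def by meson
    then show "\<exists>n u v. fin \<kappa> c n \<and> fin \<kappa> c' n \<and> c' = c + ((2 * int n + 4) * u, (2 * int n + 4) * v)"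
      using fin_mono[OF _ le] by blast
  qed
  moreover have "\<kappa> \<noteq> Map.empty" using kinv_nonempty[OF K[of 0]] le[of 0] by (auto simp: map_le_def)
  ultimately show ?thesis unfolding kinv_def VV_def by blast
qed

definition good :: "nat \<Rightarrow> assembly \<Rightarrow> bool" where "good \<tau> \<alpha> \<longleftrightarrow> (\<exists>\<kappa>. \<alpha> = tl \<tau> \<kappa> \<and> kinv \<kappa>)"

lemma good_translate: "good \<tau> \<alpha> \<Longrightarrow> good \<tau> (translate \<alpha> v)"
  unfolding good_def using tl_kshift kinv_kshift by metis

lemma good_supertile: "good \<tau> \<alpha> \<Longrightarrow> \<beta> \<in> supertile_of \<alpha> \<Longrightarrow> good \<tau> \<beta>"
  unfolding supertile_of_def using good_translate by auto

theorem producible_good: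
  assumes t: "1 < \<tau>" and A: "A \<in> producible \<tau> (UU \<tau>)" and a: "\<alpha> \<in> A"
  shows "good \<tau> \<alpha>"
  using A a
proof (induction arbitrary: \<alpha> rule: producible.induct)
  case (single u)
  then obtain k where k: "okk k" "u = tile \<tau> k" unfolding UU_def by blast
  have "kinv [(0,0) \<mapsto> k]"
  proof (cases "k = Seed")
    case True
    have "[(0::int,0::int) \<mapsto> k] \<noteq> Map.empty" by simp
    then show ?thesis using kinv_Seed[of "(0,0)"] True unfolding kinv_def by blast
  next
    case False
    then show ?thesis using cl1[OF k(1)] unfolding kinv_def by blast
  qed
  moreover have "Map.empty((0,0) \<mapsto> u) = tl \<tau> [(0,0) \<mapsto> k]" using k(2) by (auto simp: tl_def)
  ultimately have "good \<tau> (Map.empty((0,0) \<mapsto> u))" unfolding good_def by blast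
  then show ?case using single.prems by (rule good_supertile)
next
  case (comb A B C)
  obtain \<beta> \<gamma> where c: "C = supertile_of (\<beta> ++ \<gamma>)" "\<beta> \<in> A" "\<gamma> \<in> B" "dom \<beta> \<inter> dom \<gamma> = {}" "stable \<tau> (\<beta> ++ \<gamma>)"
    using comb.hyps(3) unfolding combination_def by blast
  obtain \<kappa> \<kappa>' where k: "\<beta> = tl \<tau> \<kappa>" "kinv \<kappa>" "\<gamma> = tl \<tau> \<kappa>'" "kinv \<kappa>'"
    using comb.IH(1)[OF c(2)] comb.IH(2)[OF c(3)] unfolding good_def by blast
  have "kinv (\<kappa> ++ \<kappa>')" by (rule kinv_join[OF t k(2,4)]) (use c k in \<open>simp_all add: tl_add\<close>)
  then have "good \<tau> (\<beta> ++ \<gamma>)" using k unfolding good_def by (metis tl_add)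
  then show ?case using comb.prems c(1) good_supertile by blast
next
  case (limit f g)
  have mono: "j \<le> k \<Longrightarrow> f j \<subseteq>\<^sub>m f k" for j k by (rule chain_mono[of f g, OF limit.hyps(4,3)])
  have g: "good \<tau> (g k)" for k by (rule limit.IH(2)[OF self_in_supertile])
  have G: "good \<tau> (f k)" for k
  proof (induction k)
    case 0 show ?case by (rule limit.IH(1)[OF self_in_supertile])
  next
    case (Suc k)
    obtain \<kappa> \<kappa>' where k: "f k = tl \<tau> \<kappa>" "kinv \<kappa>" "g k = tl \<tau> \<kappa>'" "kinv \<kappa>'" using Suc g[of k] unfolding good_def by blast
    have "kinv (\<kappa> ++ \<kappa>')"
      by (rule kinv_join[OF t k(2,4)]) (use limit.hyps(3)[of k] limit.hyps(5)[of k] limit.hyps(4)[of k] k in \<open>simp_all add: tl_add\<close>)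
    then show ?case using k limit.hyps(4)[of k] unfolding good_def by (metis tl_add)
  qed
  define h where "h k = untl \<tau> (f k)" for k
  have h: "f k = tl \<tau> (h k) \<and> kinv (h k)" for k
  proof -
    obtain \<kappa> where k: "f k = tl \<tau> \<kappa>" "kinv \<kappa>" using G[of k] unfolding good_def by blast
    then have "h k = \<kappa>" unfolding h_def using untl_tl[OF t] kinv_okk by metis
    then show ?thesis using k by simp
  qed
  let ?k = "untl \<tau> (chain_lim f)"
  have lim: "chain_lim f p = Some x \<longleftrightarrow> (\<exists>i. f i p = Some x)" for p x by (rule chain_lim_Some_iff[of f, OF mono])
  have hm: "h i \<subseteq>\<^sub>m h j" if "i \<le> j" for i j
    unfolding map_le_def
  proof
    fix p assume "p \<in> dom (h i)"
    then have "p \<in> dom (f i)" unfolding h_def untl_def by auto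
    then have "f i p = f j p" using mono[OF that] unfolding map_le_def by blast
    then show "h i p = h j p" unfolding h_def untl_def by simp
  qed
  have hl: "?k p = Some x \<longleftrightarrow> (\<exists>i. h i p = Some x)" for p x
    unfolding h_def untl_def map_option_eq_Some lim by blast
  have gr: "h (Suc k) \<noteq> h k" for k
  proof
    assume "h (Suc k) = h k"
    then have "f (Suc k) = f k" using h by simp
    then have "dom (f k ++ g k) = dom (f k)" using limit.hyps(4)[of k] by simp
    then have "dom (g k) \<subseteq> dom (f k)" by (simp only: dom_map_add) blast
    moreover have "dom (g k) \<noteq> {}" using g[of k] kinv_nonempty dom_tl unfolding good_def by metis
    ultimately show False using limit.hyps(3)[of k] by blast
  qed
  have "kinv ?k" by (rule kinv_limit[of h, OF hm _ gr hl]) (use h in auto)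
  moreover have "chain_lim f = tl \<tau> ?k"
  proof
    fix p show "chain_lim f p = tl \<tau> ?k p"
    proof (cases "chain_lim f p")
      case None then show ?thesis by (simp add: tl_def untl_def)
    next
      case (Some x)
      then obtain i where i: "f i p = Some x" using lim by blast
      then obtain k where k: "h i p = Some k" "x = tile \<tau> k" using h[of i] by (auto simp: tl_def)
      then have "?k p = Some k" using hl by blast
      then show ?thesis using Some k by (simp add: tl_def)
    qed
  qed
  ultimately have "good \<tau> (chain_lim f)" unfolding good_def by blast
  then show ?case using limit.prems by (rule good_supertile)
qed

section \<open>Lattices of cells and their growth\<close>

lemma lattice_unique:
  fixes m :: int
  assumes "m * a + s = m * b + t" "\<bar>s - t\<bar> < m" shows "a = b" "s = t"
proof -
  have e: "m * (b - a) = s - t" using assms(1) by (simp add: algebra_simps)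
  have m: "0 < m" using assms(2) by linarith
  have "b - a = 0"
  proof (rule ccontr)
    assume "b - a \<noteq> 0"
    then have "1 \<le> \<bar>b - a\<bar>" by simp
    then have "m * 1 \<le> m * \<bar>b - a\<bar>" using m by (intro mult_left_mono) auto
    then have "m \<le> \<bar>m * (b - a)\<bar>" using m by (simp add: abs_mult)
    then show False using e assms(2) by simp
  qed
  then show "a = b" "s = t" using e by auto
qed

text \<open>The slots in the line shared with a neighbouring cell; only among these could different
  cells of the lattice collide.\<close>

fun mid :: "slot \<Rightarrow> bool" where
  "mid (M1 o' g) = True" | "mid (M2 o' g) = True" | "mid (Le o' g) = True" | "mid _ = False"

fun mdir :: "slot \<Rightarrow> dr" where
  "mdir (M1 o' g) = o'" | "mdir (M2 o' g) = o'" | "mdir (Le o' g) = o'" | "mdir _ = DN"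

fun mrow :: "slot \<Rightarrow> nat" where
  "mrow (M1 o' g) = g" | "mrow (M2 o' g) = Suc g" | "mrow (Le o' g) = g" | "mrow _ = 0"

lemma inj_Rg:
  assumes "1 \<le> j" "i < 2 * j" "1 \<le> j'" "i' < 2 * j'" "rpos (int j) h (int i) = rpos (int j') h' (int i')"
  shows "j = j' \<and> h = h' \<and> i = i'"
  using assms by (cases h; cases h'; simp; linarith)

lemma rpos_bound:
  assumes "1 \<le> j" "i < 2 * j" "rpos (int j) h (int i) = (x, y)"
  shows "\<bar>x\<bar> \<le> int j \<and> \<bar>y\<bar> \<le> int j \<and> (x, y) \<noteq> (0, 0)"
  using assms by (cases h; simp; linarith)

lemma Col_bound:
  assumes "okn n" "vcol n o' g" "pos n (Col o' g) = (x, y)"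
  shows "(\<bar>x\<bar> = int n + 1 \<and> \<bar>y\<bar> \<le> int n \<or> \<bar>x\<bar> \<le> int n \<and> \<bar>y\<bar> = int n + 1)"
  using assms okn_ge[of n] by (cases o'; simp add: vcol_def; linarith)

lemma inj_Col:
  assumes "okn n" "vcol n o' g" "vcol n e g'" "pos n (Col o' g) = pos n (Col e g')"
  shows "o' = e \<and> g = g'"
  using assms okn_ge[of n] by (cases o'; cases e; simp add: vcol_def; linarith)

lemma nonmid_bound:
  assumes "okn n" "n \<noteq> 0" "valid n x" "\<not> mid x"
  shows "\<bar>fst (pos n x)\<bar> \<le> int n + 1 \<and> \<bar>snd (pos n x)\<bar> \<le> int n + 1"
proof (cases x)
  case (Rg j h i)
  obtain a b where ab: "rpos (int j) h (int i) = (a, b)" by fastforce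
  then show ?thesis using rpos_bound[OF _ _ ab] Rg assms by fastforce
next
  case (Col o' g)
  obtain a b where ab: "pos n (Col o' g) = (a, b)" by fastforce
  then have "\<bar>a\<bar> \<le> int n + 1 \<and> \<bar>b\<bar> \<le> int n + 1" using Col_bound[OF assms(1) _ ab] Col assms by fastforce
  then show ?thesis using Col ab by simp
qed (use assms in auto)

lemma inj_nonmid:
  assumes n: "okn n" "n \<noteq> 0" and v: "valid n x" "valid n y" "\<not> mid x" "\<not> mid y" and e: "pos n x = pos n y"
  shows "x = y"
proof -
  have rc: "rpos (int j) h (int i) \<noteq> pos n (Col o' g)" if "valid n (Rg j h i)" "valid n (Col o' g)" for j h i o' g
  proof
    assume a: "rpos (int j) h (int i) = pos n (Col o' g)"
    obtain u w where uw: "rpos (int j) h (int i) = (u, w)" by fastforce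
    then show False using rpos_bound[OF _ _ uw] Col_bound[OF n(1) _ a[symmetric, unfolded uw]] that n by auto
  qed
  have rk: "rpos (int j) h (int i) \<noteq> (int n + 1, int n + 1)" if "valid n (Rg j h i)" for j h i
    using rpos_bound[of j i h "int n + 1" "int n + 1"] that n by auto
  have rz: "rpos (int j) h (int i) \<noteq> 0" if "valid n (Rg j h i)" for j h i
    using rpos_bound[of j i h 0 0] that by (auto simp: zero_prod_def)
  have ck: "pos n (Col o' g) \<noteq> (int n + 1, int n + 1)" if "valid n (Col o' g)" for o' g
    using Col_bound[OF n(1), of o' g "int n + 1" "int n + 1"] that by auto
  have cz: "pos n (Col o' g) \<noteq> 0" if "valid n (Col o' g)" for o' g
    using Col_bound[OF n(1), of o' g 0 0] that by (auto simp: zero_prod_def)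
  show ?thesis
  proof (cases x)
    case SS
    have y0: "pos n y = 0" using e SS by simp
    show ?thesis
    proof (cases y)
      case (Rg j' h' i') then show ?thesis using y0 v rz[of j' h' i'] by simp
    next
      case (Col o2 g2) then show ?thesis using y0 v cz[of o2 g2] by simp
    next
      case KK then show ?thesis using y0 by (simp add: zero_prod_def)
    qed (use SS v in auto)
  next
    case (Rg j h i)
    show ?thesis
    proof (cases y)
      case SS then show ?thesis using Rg e v rz by auto
    next
      case (Rg j' h' i') then show ?thesis using \<open>x = Rg j h i\<close> e v inj_Rg[of j i j' i' h h'] by simp
    next
      case (Col o' g) then show ?thesis using Rg e v rc[of j h i o' g] by simp
    next
      case KK then show ?thesis using Rg e v rk[of j h i] by simp
    qed (use v in auto)
  next
    case (Col o' g)
    show ?thesis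
    proof (cases y)
      case SS then show ?thesis using Col e v cz[of o' g] by simp
    next
      case (Rg j' h' i') then show ?thesis using Col e v rc[of j' h' i' o' g] by simp
    next
      case (Col o2 g2) then show ?thesis using \<open>x = Col o' g\<close> e v inj_Col[OF n(1), of o' g o2 g2] by simp
    next
      case KK then show ?thesis using Col e v ck[of o' g] by simp
    qed (use v in auto)
  next
    case KK
    show ?thesis
    proof (cases y)
      case (Rg j' h' i') then show ?thesis using KK e v rk[of j' h' i'] by simp
    next
      case (Col o2 g2) then show ?thesis using KK e v ck[of o2 g2] by simp
    qed (use KK e v in \<open>auto simp: zero_prod_def\<close>)
  qed (use v in auto)
qed

lemma rs_DW: "okn n \<Longrightarrow> n \<noteq> 0 \<Longrightarrow> o' \<noteq> DE \<or> g \<le> n + 8 \<Longrightarrow> rs n DW g = rs n o' g"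
  by (auto simp: rs_def)

lemma mid_row_le:
  assumes n: "okn n" "n \<noteq> 0" and v: "vcol n o' g" and t: "tooth o' (rs n o' g) \<or> leafr o' (rs n o' g)"
  shows "g \<le> n + 10" "o' = DE \<Longrightarrow> g \<le> n + 8" "rs n o' g \<noteq> 21 \<Longrightarrow> Suc g \<le> n + 10" "o' = DE \<Longrightarrow> tooth o' (rs n o' g) \<Longrightarrow> Suc g \<le> n + 8"
proof -
  show de: "g \<le> n + 8" if "o' = DE"
    using t that by (auto simp: rs_def tooth_def leafr_def split: if_splits)
  show "g \<le> n + 10" using v de by (cases o') (auto simp: vcol_def)
  show "Suc g \<le> n + 10" if "rs n o' g \<noteq> 21"
  proof -
    have "g \<noteq> n + 10"
    proof
      assume g: "g = n + 10"
      then have "o' \<noteq> DE" using de by auto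
      then show False using that g rs_plus[OF n, of 10 o'] by simp
    qed
    then show ?thesis using v de by (cases o') (auto simp: vcol_def)
  qed
  show "Suc g \<le> n + 8" if "o' = DE" "tooth o' (rs n o' g)"
  proof -
    have "g \<noteq> n + 8" using that rs_plus[OF n, of 8 o'] by (auto simp: tooth_def)
    then show ?thesis using de that by simp
  qed
qed

text \<open>The row states a slot of the shared line can occupy, in one numbering for all sides. The
  west strip serves as reference because the numbering of the east strip deviates far beyond the
  middle row.\<close>

fun mst :: "slot \<Rightarrow> nat set" where
  "mst (M1 o' g) = (if hi o' then {1, 7, 11, 17} else {3, 5, 9, 15, 21})"
| "mst (M2 o' g) = (if hi o' then {2, 8, 12, 18} else {4, 6, 10, 16})"
| "mst (Le o' g) = (if hi o' then {13, 19} else {14, 20})"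
| "mst _ = {}"

lemma mid_state:
  assumes n: "okn n" "n \<noteq> 0" and v: "valid n x" "mid x"
  shows "rs n DW (mrow x) \<in> mst x" "mrow x \<le> n + 10" "pos n x = sp (mdir x) (int n + 2) (int (mrow x) - int n)"
proof -
  have A: "rs n DW (mrow x) \<in> mst x \<and> mrow x \<le> n + 10"
  proof (cases x)
    case (M1 o' g)
    then have t: "vcol n o' g" "tooth o' (rs n o' g)" using v by auto
    have "g \<le> n + 10" "o' \<noteq> DE \<or> g \<le> n + 8" using mid_row_le(1,2)[OF n t(1)] t(2) by blast+
    moreover then have "rs n DW g = rs n o' g" using rs_DW[OF n] by blast
    ultimately show ?thesis using M1 t(2) by (simp add: tooth_def split: if_splits)
  next
    case (M2 o' g)
    then have t: "vcol n o' g" "tooth o' (rs n o' g)" "rs n o' g \<noteq> 21" using v by auto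
    have s: "rs n o' (Suc g) = rs n o' g + 1"
    proof -
      have "rs n o' g \<noteq> 10" "rs n o' g \<noteq> 8" "rs n o' g \<noteq> 20" using t(2) by (auto simp: tooth_def split: if_splits)
      then show ?thesis using rs_step[OF n, of o' g] t(3) by auto
    qed
    have "Suc g \<le> n + 10" "o' \<noteq> DE \<or> Suc g \<le> n + 8" using mid_row_le(3,4)[OF n t(1)] t(2,3) by blast+
    moreover then have "rs n DW (Suc g) = rs n o' g + 1" using rs_DW[OF n] s by metis
    ultimately show ?thesis using M2 t(2,3) by (simp add: tooth_def split: if_splits)
  next
    case (Le o' g)
    then have t: "vcol n o' g" "leafr o' (rs n o' g)" using v by auto
    have "g \<le> n + 10" "o' \<noteq> DE \<or> g \<le> n + 8" using mid_row_le(1,2)[OF n t(1)] t(2) by blast+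
    moreover then have "rs n DW g = rs n o' g" using rs_DW[OF n] by blast
    ultimately show ?thesis using Le t(2) by (simp add: leafr_def split: if_splits)
  qed (use v in auto)
  then show "rs n DW (mrow x) \<in> mst x" "mrow x \<le> n + 10" by auto
  show "pos n x = sp (mdir x) (int n + 2) (int (mrow x) - int n)" using v by (cases x) (auto simp: algebra_simps)
qed

lemma mst_disjoint:
  assumes "r \<in> mst x" "r \<in> mst y" "mrow x = mrow y"
  shows "hi (mdir x) = hi (mdir y)" "mdir x = mdir y \<Longrightarrow> x = y"
proof -
  show "hi (mdir x) = hi (mdir y)" using assms by (cases x; cases y; simp split: if_splits; auto)
  show "x = y" if "mdir x = mdir y" using assms that by (cases x; cases y; simp split: if_splits; auto)
qed

definition cpos :: "nat \<Rightarrow> pos \<Rightarrow> slot \<Rightarrow> pos" where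
  "cpos n v x = ((2 * int n + 4) * fst v, (2 * int n + 4) * snd v) + pos n x"

text \<open>The interlocking proper: a high and a low slot never occupy rows of the same state, so
  facing strips of equal size leave room for each other. All other coincidences are excluded by
  distances smaller than the period.\<close>

lemma cpos_inj:
  assumes n: "okn n" "n \<noteq> 0" and v: "valid n x" "valid n y" and e: "cpos n u x = cpos n v y"
  shows "u = v" "x = y"
proof -
  let ?m = "2 * int n + 4"
  have n13: "13 \<le> n" using okn_ge[OF n] .
  obtain a b where ab: "pos n x = (a, b)" by fastforce
  obtain c d where cd: "pos n y = (c, d)" by fastforce
  have e1: "?m * fst u + a = ?m * fst v + c" and e2: "?m * snd u + b = ?m * snd v + d"
    using e ab cd unfolding cpos_def by auto
  have close: "u = v \<and> x = y" if "\<bar>a - c\<bar> < ?m" "\<bar>b - d\<bar> < ?m" "pos n x = pos n y \<Longrightarrow> x = y"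
    using lattice_unique[OF e1 that(1)] lattice_unique[OF e2 that(2)] that(3) ab cd by (auto simp: prod_eq_iff)
  have box: "\<bar>fst (pos n z)\<bar> \<le> int n + 1 \<and> \<bar>snd (pos n z)\<bar> \<le> int n + 1" if "valid n z" "\<not> mid z" for z
    using nonmid_bound[OF n] that by blast
  have ml: "\<exists>r. pos n z = sp (mdir z) (int n + 2) r \<and> \<bar>r\<bar> \<le> int n" if "valid n z" "mid z" for z
    using mid_state(2,3)[OF n that] n13 by (intro exI[of _ "int (mrow z) - int n"]) auto
  have mix: False if z: "valid n z" "mid z" "valid n z'" "\<not> mid z'" and q: "pos n z = (s, t)" "pos n z' = (s', t')"
    and f: "?m * k1 + s = ?m * k2 + s'" "?m * l1 + t = ?m * l2 + t'" for z z' s t s' t' k1 k2 l1 l2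
  proof -
    have bx: "\<bar>s'\<bar> \<le> int n + 1" "\<bar>t'\<bar> \<le> int n + 1" using box[OF z(3,4)] q by auto
    obtain r where r: "(s, t) = sp (mdir z) (int n + 2) r" "\<bar>r\<bar> \<le> int n" using ml[OF z(1,2)] q by auto
    have "\<bar>s\<bar> = int n + 2 \<and> \<bar>t\<bar> \<le> int n \<or> \<bar>t\<bar> = int n + 2 \<and> \<bar>s\<bar> \<le> int n" using r by (cases "mdir z") auto
    then have "\<bar>s - s'\<bar> < ?m" "\<bar>t - t'\<bar> < ?m" "s \<noteq> s' \<or> t \<noteq> t'" using bx by linarith+
    then show False using lattice_unique(2)[OF f(1)] lattice_unique(2)[OF f(2)] by blast
  qed
  have "u = v \<and> x = y"
  proof (cases "mid x")
    case X: False
    show ?thesis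
    proof (cases "mid y")
      case False
      have "\<bar>a\<bar> \<le> int n + 1" "\<bar>b\<bar> \<le> int n + 1" "\<bar>c\<bar> \<le> int n + 1" "\<bar>d\<bar> \<le> int n + 1"
        using box[OF v(1) X] box[OF v(2) False] ab cd by auto
      then show ?thesis using inj_nonmid[OF n v X False] by (intro close) linarith+
    next
      case True
      then show ?thesis using mix[OF v(2) True v(1) X cd ab e1[symmetric] e2[symmetric]] by blast
    qed
  next
    case X: True
    show ?thesis
    proof (cases "mid y")
      case False
      then show ?thesis using mix[OF v(1) X v(2) False ab cd e1 e2] by blast
    next
      case True
      note sx = mid_state[OF n v(1) X] note sy = mid_state[OF n v(2) True]
      define r where "r = int (mrow x) - int n"
      define r' where "r' = int (mrow y) - int n"
      have p: "(a, b) = sp (mdir x) (int n + 2) r" "(c, d) = sp (mdir y) (int n + 2) r'" using sx(3) sy(3) ab cd by (auto simp: r_def r'_def)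
      have rb: "\<bar>r\<bar> \<le> int n" "\<bar>r'\<bar> \<le> int n" using sx(2) sy(2) n13 by (auto simp: r_def r'_def)
      have rows: "mrow x = mrow y \<Longrightarrow> hi (mdir x) = hi (mdir y)" "mrow x = mrow y \<Longrightarrow> mdir x = mdir y \<Longrightarrow> x = y"
        using mst_disjoint[OF sx(1)] sy(1) by auto
      have req: "r = r' \<longleftrightarrow> mrow x = mrow y" by (simp add: r_def r'_def)
      consider (same) "mdir x = mdir y" | (opp) "mdir y = opp (mdir x)" | (perp) "mdir y = lft (mdir x) \<or> mdir y = rgt (mdir x)"
        by (cases "mdir x"; cases "mdir y") auto
      then show ?thesis
      proof cases
        case same
        then have "\<bar>a - c\<bar> < ?m" "\<bar>b - d\<bar> < ?m" using p rb by (cases "mdir x"; auto)+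
        moreover have "x = y" if "pos n x = pos n y"
        proof -
          have "r = r'" using that ab cd p same by (cases "mdir x") auto
          then show ?thesis using rows same req by simp
        qed
        ultimately show ?thesis by (rule close)
      next
        case opp
        have "r = r'"
        proof (cases "mdir x = DE \<or> mdir x = DW")
          case True
          then have "b = r" "d = r'" using p opp by auto
          then show ?thesis using lattice_unique(2)[OF e2] rb by simp
        next
          case False
          then have "a = - r" "c = - r'" using p opp by (cases "mdir x"; auto)+
          then show ?thesis using lattice_unique(2)[OF e1] rb by simp
        qed
        then show ?thesis using rows(1) req opp by (cases "mdir x") auto
      next
        case perp
        have False
        proof (cases "mdir x = DE \<or> mdir x = DW")
          case True
          then have "\<bar>a\<bar> = int n + 2" "c = - r'" using p perp by auto
          then show ?thesis using lattice_unique(2)[OF e1] rb by linarith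
        next
          case False
          then have "\<bar>b\<bar> = int n + 2" "d = r'" using p perp by (cases "mdir x"; auto)+
          then show ?thesis using lattice_unique(2)[OF e2] rb by linarith
        qed
        then show ?thesis ..
      qed
    qed
  qed
  then show "u = v" "x = y" by auto
qed

type_synonym wmap = "pos \<Rightarrow> (nat \<Rightarrow> bool) option"

text \<open>The choice is harmless, since \<open>cpos_inj\<close> makes cell and slot unique for
  each position.\<close>

definition full :: "nat \<Rightarrow> wmap \<Rightarrow> kasm" where
  "full n W p = (if \<exists>v w x. W v = Some w \<and> valid n x \<and> p = cpos n v x
     then Some (SOME k. \<exists>v w x. W v = Some w \<and> valid n x \<and> p = cpos n v x \<and> k = knd n w x) else None)"

lemma full_Some:
  assumes n: "okn n" "n \<noteq> 0"
  shows "full n W p = Some k \<longleftrightarrow> (\<exists>v w x. W v = Some w \<and> valid n x \<and> p = cpos n v x \<and> k = knd n w x)"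
proof
  let ?P = "\<lambda>k. \<exists>v w x. W v = Some w \<and> valid n x \<and> p = cpos n v x \<and> k = knd n w x"
  show "?P k" if a: "full n W p = Some k"
  proof -
    have ex: "\<exists>k. ?P k" and k: "k = (SOME k. ?P k)" using a unfolding full_def by (simp_all split: if_splits) blast
    show ?thesis unfolding k by (rule someI_ex[OF ex])
  qed
  show "full n W p = Some k" if a: "?P k"
  proof -
    obtain v w x where v: "W v = Some w" "valid n x" "p = cpos n v x" "k = knd n w x" using a by blast
    have "k' = k" if "?P k'" for k'
    proof -
      obtain v' w' x' where v': "W v' = Some w'" "valid n x'" "p = cpos n v' x'" "k' = knd n w' x'" using \<open>?P k'\<close> by blast
      have "cpos n v x = cpos n v' x'" using v(3) v'(3) by simp
      from cpos_inj[OF n v(2) v'(2) this] show ?thesis using v v' by simp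
    qed
    then have "(SOME k. ?P k) = k" using a by (intro some_equality)
    moreover have ex: "\<exists>v w x. W v = Some w \<and> valid n x \<and> p = cpos n v x" using v by blast
    ultimately show ?thesis unfolding full_def if_P[OF ex] by (simp only:)
  qed
qed

lemma full_cell: "okn n \<Longrightarrow> n \<noteq> 0 \<Longrightarrow> W v = Some w \<Longrightarrow> valid n x \<Longrightarrow> full n W (cpos n v x) = Some (knd n w x)"
  using full_Some by blast

lemma map_eqI: "(\<And>p t. a p = Some t \<longleftrightarrow> b p = Some t) \<Longrightarrow> a = b"
  by (rule ext) (metis option.exhaust)

lemma full_disjoint:
  assumes n: "okn n" "n \<noteq> 0" and d: "dom W \<inter> dom W' = {}" shows "dom (full n W) \<inter> dom (full n W') = {}"
proof (rule ccontr)
  assume "\<not> ?thesis"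
  then obtain p k k' where "full n W p = Some k" "full n W' p = Some k'" by blast
  then obtain v w x v' w' x' where a: "W v = Some w" "valid n x" "p = cpos n v x" "W' v' = Some w'" "valid n x'" "p = cpos n v' x'"
    unfolding full_Some[OF n] by blast
  have "cpos n v x = cpos n v' x'" using a by simp
  from cpos_inj(1)[OF n a(2,5) this] show False using a d by auto
qed

lemma full_add:
  assumes n: "okn n" "n \<noteq> 0" and d: "dom W \<inter> dom W' = {}" shows "full n (W ++ W') = full n W ++ full n W'"
proof (rule map_eqI)
  fix p k
  have a: "(W ++ W') v = Some w \<longleftrightarrow> W v = Some w \<or> W' v = Some w" for v w using d by (auto simp: map_add_Some_iff)
  have b: "(full n W ++ full n W') p = Some k \<longleftrightarrow> full n W p = Some k \<or> full n W' p = Some k"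
    using full_disjoint[OF n d] by (auto simp: map_add_Some_iff)
  show "full n (W ++ W') p = Some k \<longleftrightarrow> (full n W ++ full n W') p = Some k"
    unfolding b full_Some[OF n] a by blast
qed

lemma full_mono:
  assumes n: "okn n" "n \<noteq> 0" and l: "W \<subseteq>\<^sub>m W'" shows "full n W \<subseteq>\<^sub>m full n W'"
  unfolding map_le_def
proof
  fix p assume "p \<in> dom (full n W)"
  then obtain k where k: "full n W p = Some k" by blast
  then obtain v w x where "W v = Some w" "valid n x" "p = cpos n v x" "k = knd n w x" unfolding full_Some[OF n] by blast
  moreover then have "W' v = Some w" using l by (metis domI map_le_def)
  ultimately have "full n W' p = Some k" unfolding full_Some[OF n] by blast
  then show "full n W p = full n W' p" using k by simp
qed

lemma full_okk: "okn n \<Longrightarrow> n \<noteq> 0 \<Longrightarrow> full n W p = Some k \<Longrightarrow> okk k"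
  using full_Some okk_knd by metis

lemma cpos_shift: "cpos n (v + u) x = cpos n v x + ((2 * int n + 4) * fst u, (2 * int n + 4) * snd u)"
  by (simp add: cpos_def algebra_simps)

lemma full_shift:
  assumes n: "okn n" "n \<noteq> 0"
  shows "full n (\<lambda>v. W (v - u)) = kshift (full n W) ((2 * int n + 4) * fst u, (2 * int n + 4) * snd u)"
proof (rule map_eqI)
  fix p k
  let ?u = "((2 * int n + 4) * fst u, (2 * int n + 4) * snd u)"
  have "full n (\<lambda>v. W (v - u)) p = Some k \<longleftrightarrow> (\<exists>v w x. W v = Some w \<and> valid n x \<and> p = cpos n (v + u) x \<and> k = knd n w x)"
    unfolding full_Some[OF n] by (metis add_diff_cancel diff_add_cancel)
  also have "\<dots> \<longleftrightarrow> full n W (p - ?u) = Some k" unfolding full_Some[OF n] cpos_shift by (metis add_diff_cancel diff_add_cancel)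
  finally show "full n (\<lambda>v. W (v - u)) p = Some k \<longleftrightarrow> kshift (full n W) ?u p = Some k" by (simp add: kshift_def)
qed

section \<open>Completing a single cell\<close>

lemma finite_slots:
  assumes "n \<noteq> 0" shows "finite {x. valid n x}"
proof -
  have D: "finite (UNIV :: dr set)" by (simp add: dr_UNIV)
  let ?G = "UNIV \<times> {..2 * n + 10}"
  let ?S = "{SS, KK} \<union> (\<lambda>(j, h, i). Rg j h i) ` ({..n} \<times> UNIV \<times> {..2 * n}) \<union> (\<lambda>(o', g). Col o' g) ` ?G
    \<union> (\<lambda>(o', g). M1 o' g) ` ?G \<union> (\<lambda>(o', g). M2 o' g) ` ?G \<union> (\<lambda>(o', g). Le o' g) ` ?G"
  have g: "g \<le> 2 * n + 10" if "vcol n o' g" for o' g using that by (cases o') (auto simp: vcol_def)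
  have "{x. valid n x} \<subseteq> ?S"
  proof
    fix x assume "x \<in> {x. valid n x}"
    then show "x \<in> ?S" using assms g by (cases x) (auto simp: image_iff)
  qed
  moreover have "finite ?S" using D by simp
  ultimately show ?thesis by (rule finite_subset)
qed

text \<open>For a leaf the pair \<open>LfV\<close>, \<open>LfS\<close> is used, so a cell can be
  completed with no neighbour present.\<close>

lemma binding_inputs:
  assumes "okk k" "k \<noteq> Seed"
  shows "(\<exists>d c. inp k d = Some c \<and> strong c) \<or>
    (\<exists>d c d' c'. d \<noteq> d' \<and> inp k d = Some c \<and> inp k d' = Some c' \<and> heavy c \<and> (\<forall>r. c \<noteq> Neu r) \<and> (\<forall>r. c' \<noteq> Neu r))"
proof (cases k)
  case (Run h s c)
  then have "inp k (opp h) = Some (Pth s)" "inp k (lft h) = Some (Wl False c)" by auto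
  then show ?thesis by (intro disjI2 exI[of _ "opp h"] exI[of _ "Pth s"] exI[of _ "lft h"] exI[of _ "Wl False c"]) auto
next
  case (Sc o' r)
  show ?thesis
  proof (cases "stst o' r")
    case True
    then have "inp k (opp o') = Some StripL" using Sc by simp
    then show ?thesis by (metis strong.simps(4))
  next
    case F: False
    show ?thesis
    proof (cases "sgt o' r")
      case True
      then have "inp k (opp (fw o')) = Some (Sg o' r)" using Sc F by simp
      then show ?thesis by (metis strong.simps(5))
    next
      case False
      have "inp k (psd o' r) = Some (Nxt o' (lb o' r))" "inp k (opp o') = Some (Wl True (wlc o' r))" "psd o' r \<noteq> opp o'"
        using Sc F False by (simp_all add: psd_def)
      then show ?thesis by (intro disjI2 exI[of _ "psd o' r"] exI[of _ "Nxt o' (lb o' r)"] exI[of _ "opp o'"] exI[of _ "Wl True (wlc o' r)"]) auto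
    qed
  qed
next
  case (Lf o' r)
  let ?d = "if hi o' then opp (fw o') else fw o'"
  have "inp k ?d = Some (LfV o' r)" "inp k (opp o') = Some (LfS o' r)" "?d \<noteq> opp o'" using Lf by auto
  then show ?thesis by (intro disjI2 exI[of _ ?d] exI[of _ "LfV o' r"] exI[of _ "opp o'"] exI[of _ "LfS o' r"]) auto
next
  case (St1 s) then have "inp k DW = Some St1L" by simp then show ?thesis by (metis strong.simps(3))
next
  case (St c s) then have "inp k DW = Some (StL c)" by simp then show ?thesis by (metis strong.simps(2))
next
  case (Cor h s) then have "inp k (opp h) = Some (CorL s)" by simp then show ?thesis by (metis strong.simps(1))
next
  case (T1 o' r) then have "inp k (opp o') = Some (Tl1 o' r)" by simp then show ?thesis by (metis strong.simps(6))
next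
  case (T2 o' r) then have "inp k (opp (fw o')) = Some (Tl2 o' r)" by simp then show ?thesis by (metis strong.simps(7))
next
  case KC then have "inp k DS = Some CorS" by simp then show ?thesis by (metis strong.simps(8))
qed (use assms in simp)

lemma tl_upd: "tl \<tau> (\<kappa>(p \<mapsto> k)) = tl \<tau> \<kappa> ++ [p \<mapsto> tile \<tau> k]"
  by (rule ext) (simp add: tl_def)

lemma attach_stable:
  assumes t: "1 < \<tau>" and st: "stable \<tau> (tl \<tau> \<kappa>)" and p: "\<kappa> p = None" and k: "okk k" "k \<noteq> Seed"
    and ok: "\<And>q k. \<kappa> q = Some k \<Longrightarrow> okk k"
    and src: "\<And>d c. inp k d = Some c \<Longrightarrow> (\<forall>r. c \<noteq> Neu r) \<Longrightarrow> \<exists>k'. \<kappa> (p + vec d) = Some k' \<and> out k' (opp d) = Some c"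
  shows "stable \<tau> (tl \<tau> (\<kappa>(p \<mapsto> k)))"
proof -
  let ?k = "\<kappa>(p \<mapsto> k)"
  have w: "weight (tl \<tau> \<kappa> ++ [p \<mapsto> tile \<tau> k]) (p + vec d) p = str \<tau> c \<and> p + vec d \<in> dom \<kappa>"
    if i: "inp k d = Some c" "\<forall>r. c \<noteq> Neu r" for d c
  proof -
    obtain k' where k': "\<kappa> (p + vec d) = Some k'" "out k' (opp d) = Some c" using src[OF i] by blast
    have ne: "p + vec d \<noteq> p" by simp
    have a: "?k p = Some k" "?k (p + vec d) = Some k'" using k'(1) ne by auto
    have "weight (tl \<tau> ?k) p (p + vec d) = lk \<tau> k d k'" by (rule weight_adj[of ?k, OF a])
    also have "\<dots> = str \<tau> c" by (rule lk_flow'[OF k(1) ok[OF k'(1)]]) (use i k' in \<open>simp add: flow_def\<close>)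
    finally show ?thesis using k' weight_commute unfolding tl_upd by auto
  qed
  have "\<exists>F. finite F \<and> F \<subseteq> dom \<kappa> \<times> {p} \<and> \<tau> \<le> (\<Sum>(a,b)\<in>F. weight (tl \<tau> \<kappa> ++ [p \<mapsto> tile \<tau> k]) a b)"
    using binding_inputs[OF k]
  proof (elim disjE exE conjE)
    fix d c assume a: "inp k d = Some c" "strong c"
    have "\<forall>r. c \<noteq> Neu r" using a by auto
    then show ?thesis using w[OF a(1)] a by (intro exI[of _ "{(p + vec d, p)}"]) (auto simp: str_def)
  next
    fix d c d' c' assume a: "d \<noteq> d'" "inp k d = Some c" "inp k d' = Some c'" "heavy c" "\<forall>r. c \<noteq> Neu r" "\<forall>r. c' \<noteq> Neu r"
    have ne: "(p + vec d, p) \<noteq> (p + vec d', p)" using a(1) by simp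
    have "\<tau> - 1 \<le> str \<tau> c" "1 \<le> str \<tau> c'" using a(4) t by (auto simp: str_def)
    then have "\<tau> \<le> str \<tau> c + str \<tau> c'" by linarith
    then show ?thesis using w[OF a(2,5)] w[OF a(3,6)] ne by (intro exI[of _ "{(p + vec d, p), (p + vec d', p)}"]) auto
  qed
  then obtain F where F: "finite F" "F \<subseteq> dom \<kappa> \<times> {p}" "\<tau> \<le> (\<Sum>(a,b)\<in>F. weight (tl \<tau> \<kappa> ++ [p \<mapsto> tile \<tau> k]) a b)" by auto
  show ?thesis unfolding tl_upd
    by (rule stable_join[OF st stable_single _ F(1) _ F(3)]) (use p F(2) in auto)
qed

lemma single_producible: "t \<in> T \<Longrightarrow> supertile_of [p \<mapsto> t] \<in> producible \<tau> T"
proof -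
  assume "t \<in> T"
  then have "supertile_of (Map.empty((0,0) \<mapsto> t)) \<in> producible \<tau> T" by (rule producible.single)
  moreover have "translate (Map.empty((0,0) \<mapsto> t)) p = [p \<mapsto> t]"
    by (rule ext) (auto simp: translate_apply zero_prod_def[symmetric])
  ultimately show ?thesis by (metis supertile_of_translate)
qed

lemma steps_producible: "steps \<tau> T A B \<Longrightarrow> A \<in> producible \<tau> T \<Longrightarrow> B \<in> producible \<tau> T"
  unfolding steps_def by (induction rule: rtranclp_induct) (auto simp: one_step_def intro: producible.comb)

text \<open>A missing slot of least rank has all its inputs in place by \<open>match\<close>. Its
  position is free, because the assembly never leaves the layout of the whole lattice.\<close>

lemma grow_cell:
  assumes t: "1 < \<tau>" and n: "okn n" "n \<noteq> 0" and W: "W v = Some w"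
  shows "\<kappa> \<subseteq>\<^sub>m full n W \<Longrightarrow> \<kappa> (cpos n v SS) = Some Seed \<Longrightarrow> supertile_of (tl \<tau> \<kappa>) \<in> producible \<tau> (UU \<tau>) \<Longrightarrow>
    \<exists>\<kappa>'. \<kappa> \<subseteq>\<^sub>m \<kappa>' \<and> \<kappa>' \<subseteq>\<^sub>m full n W \<and> (\<forall>x. valid n x \<longrightarrow> \<kappa>' (cpos n v x) \<noteq> None) \<and>
      steps \<tau> (UU \<tau>) (supertile_of (tl \<tau> \<kappa>)) (supertile_of (tl \<tau> \<kappa>'))"
proof (induction "card {x. valid n x \<and> \<kappa> (cpos n v x) = None}" arbitrary: \<kappa> rule: less_induct)
  case less
  let ?M = "\<lambda>\<kappa>. {x. valid n x \<and> \<kappa> (cpos n v x) = None}"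
  show ?case
  proof (cases "?M \<kappa> = {}")
    case True
    then show ?thesis using less.prems(1) by (intro exI[of _ \<kappa>]) (auto simp: steps_def)
  next
    case False
    then obtain x where x: "x \<in> ?M \<kappa>" "\<And>y. y \<in> ?M \<kappa> \<Longrightarrow> rk n x \<le> rk n y"
      using ex_has_least_nat[of "\<lambda>x. x \<in> ?M \<kappa>" _ "rk n"] by blast
    let ?p = "cpos n v x" let ?k = "knd n w x" let ?K = "\<kappa>(?p \<mapsto> ?k)"
    have xv: "valid n x" "\<kappa> ?p = None" using x(1) by auto
    have "x \<noteq> SS" using xv(2) less.prems(2) by auto
    then have kS: "?k \<noteq> Seed" by (cases x) auto
    have ko: "okk ?k" by (rule okk_knd[OF n(1) xv(1)])
    have fv: "full n W ?p = Some ?k" by (rule full_cell[of n W v w x, OF n W xv(1)])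
    have le: "?K \<subseteq>\<^sub>m full n W" using less.prems(1) fv by (auto simp: map_le_def)
    have sk: "stable \<tau> (tl \<tau> \<kappa>)" by (rule producible_stable[OF less.prems(3) self_in_supertile])
    have st: "stable \<tau> (tl \<tau> ?K)"
    proof (rule attach_stable[OF t sk xv(2) ko kS])
      fix q k assume q: "\<kappa> q = Some k"
      then have "full n W q = Some k" using less.prems(1) by (metis domI map_le_def)
      then show "okk k" by (rule full_okk[OF n])
    next
      fix d c assume i: "inp ?k d = Some c" "\<forall>r. c \<noteq> Neu r"
      obtain y where y: "valid n y" "pos n y = pos n x + vec d" "out (knd n w y) (opp d) = Some c" "rk n y < rk n x"
        using match[OF n(1) xv(1) i(1)] i(2) by blast
      have cy: "cpos n v y = ?p + vec d" using y(2) by (simp add: cpos_def add.assoc)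
      have "\<kappa> (cpos n v y) \<noteq> None"
      proof
        assume "\<kappa> (cpos n v y) = None"
        then have "rk n x \<le> rk n y" using x(2)[of y] y(1) by simp
        then show False using y(4) by simp
      qed
      then obtain k' where k': "\<kappa> (cpos n v y) = Some k'" by blast
      then have "full n W (cpos n v y) = Some k'" using less.prems(1) by (metis domI map_le_def)
      then have "k' = knd n w y" using full_cell[of n W v w y, OF n W y(1)] by simp
      then show "\<exists>k'. \<kappa> (?p + vec d) = Some k' \<and> out k' (opp d) = Some c" using k' y(3) cy by auto
    qed
    have "supertile_of (tl \<tau> ?K) \<in> combination \<tau> (supertile_of (tl \<tau> \<kappa>)) (supertile_of [?p \<mapsto> tile \<tau> ?k])"
      unfolding combination_def
    proof (intro CollectI exI conjI)
      show "supertile_of (tl \<tau> ?K) = supertile_of (tl \<tau> \<kappa> ++ [?p \<mapsto> tile \<tau> ?k])" by (simp only: tl_upd)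
      show "dom (tl \<tau> \<kappa>) \<inter> dom [?p \<mapsto> tile \<tau> ?k] = {}" using xv(2) by auto
      show "stable \<tau> (tl \<tau> \<kappa> ++ [?p \<mapsto> tile \<tau> ?k])" using st by (simp only: tl_upd)
    qed simp_all
    moreover have "supertile_of [?p \<mapsto> tile \<tau> ?k] \<in> producible \<tau> (UU \<tau>)" by (rule single_producible) (use ko in \<open>auto simp: UU_def\<close>)
    ultimately have os: "one_step \<tau> (UU \<tau>) (supertile_of (tl \<tau> \<kappa>)) (supertile_of (tl \<tau> ?K))" unfolding one_step_def by blast
    have pr: "supertile_of (tl \<tau> ?K) \<in> producible \<tau> (UU \<tau>)"
      using steps_producible[OF _ less.prems(3)] os unfolding steps_def by blast
    have fin: "finite (?M \<kappa>)" using finite_slots[OF n(2)] by (rule finite_subset[rotated]) auto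
    have "?M ?K \<subset> ?M \<kappa>"
    proof
      show "?M ?K \<subseteq> ?M \<kappa>" by (auto split: if_splits)
      show "?M ?K \<noteq> ?M \<kappa>" using x(1) by auto
    qed
    then have "card (?M ?K) < card (?M \<kappa>)" by (rule psubset_card_mono[OF fin])
    moreover have "?K (cpos n v SS) = Some Seed" using less.prems(2) xv(2) by auto
    ultimately obtain \<kappa>' where k': "?K \<subseteq>\<^sub>m \<kappa>'" "\<kappa>' \<subseteq>\<^sub>m full n W" "\<forall>x. valid n x \<longrightarrow> \<kappa>' (cpos n v x) \<noteq> None"
      "steps \<tau> (UU \<tau>) (supertile_of (tl \<tau> ?K)) (supertile_of (tl \<tau> \<kappa>'))" using less.hyps[OF _ le _ pr] by blast
    have "\<kappa> \<subseteq>\<^sub>m ?K" using xv(2) by (auto simp: map_le_def)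
    then have "\<kappa> \<subseteq>\<^sub>m \<kappa>'" using k'(1) map_le_trans by blast
    moreover have "steps \<tau> (UU \<tau>) (supertile_of (tl \<tau> \<kappa>)) (supertile_of (tl \<tau> \<kappa>'))"
      using os k'(4) unfolding steps_def by (rule converse_rtranclp_into_rtranclp)
    ultimately show ?thesis using k' by blast
  qed
qed

text \<open>\<open>i = 2\<close> and \<open>i = 8\<close> are the two leaf rows counted from the
  middle; the low partner sits one row further.\<close>

lemma bond_slots:
  assumes n: "okn n" "n \<noteq> 0" and e: "hi e" and i: "i = 2 \<or> i = 8"
  shows "valid n (Le e (n + i))" "valid n (Le (opp e) (n + i + 1))"
    "knd n w (Le e (n + i)) = Lf e (11 + i)" "knd n w' (Le (opp e) (n + i + 1)) = Lf (opp e) (12 + i)"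
    "cpos n (v + vec e) (Le (opp e) (n + i + 1)) = cpos n v (Le e (n + i)) + vec (fw e)"
    "flow (Lf e (11 + i)) (fw e) (Lf (opp e) (12 + i)) (Neu (11 + i))"
proof -
  have n13: "13 \<le> n" using okn_ge[OF n] .
  have r: "rs n e (n + i) = 11 + i" using rs_plus[OF n, of i e] i by auto
  have "opp e \<noteq> DE" using e by (cases e) auto
  then have r': "rs n (opp e) (n + i + 1) = 12 + i" using rs_plus[OF n, of "i + 1" "opp e"] by (simp add: add.assoc)
  show "knd n w (Le e (n + i)) = Lf e (11 + i)" using r by simp
  show "knd n w' (Le (opp e) (n + i + 1)) = Lf (opp e) (12 + i)" using r' by simp
  have he: "\<not> hi (opp e)" using e by (cases e) auto
  have "vcol n e (n + i)" using e i n13 by (cases e) (auto simp: vcol_def)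
  then show "valid n (Le e (n + i))" using r i e by (auto simp: leafr_def)
  have "vcol n (opp e) (n + i + 1)" using e i n13 by (cases e) (auto simp: vcol_def)
  then show "valid n (Le (opp e) (n + i + 1))" using r' i he by (auto simp: leafr_def)
  show "cpos n (v + vec e) (Le (opp e) (n + i + 1)) = cpos n v (Le e (n + i)) + vec (fw e)"
    using e by (cases e) (auto simp: cpos_def algebra_simps)
  show "flow (Lf e (11 + i)) (fw e) (Lf (opp e) (12 + i)) (Neu (11 + i))"
    using e by (cases e) (auto simp: flow_def)
qed

text \<open>The two leaf bonds contribute \<open>\<tau> - 1\<close> and \<open>1\<close>, exactly
  the threshold, independently of the words \<open>w\<close> and \<open>w'\<close>.\<close>

lemma stable_hi:
  assumes t: "1 < \<tau>" and n: "okn n" "n \<noteq> 0" and e: "hi e" and st: "stable \<tau> (tl \<tau> \<kappa>)" "stable \<tau> (tl \<tau> \<kappa>')"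
    and dj: "dom \<kappa> \<inter> dom \<kappa>' = {}"
    and c: "\<And>x. valid n x \<Longrightarrow> \<kappa> (cpos n v x) = Some (knd n w x)" "\<And>x. valid n x \<Longrightarrow> \<kappa>' (cpos n (v + vec e) x) = Some (knd n w' x)"
  shows "stable \<tau> (tl \<tau> (\<kappa> ++ \<kappa>'))"
proof -
  let ?p = "\<lambda>i. cpos n v (Le e (n + i))" let ?q = "\<lambda>i. cpos n (v + vec e) (Le (opp e) (n + i + 1))"
  have W: "weight (tl \<tau> (\<kappa> ++ \<kappa>')) (?p i) (?q i) = str \<tau> (Neu (11 + i)) \<and> ?p i \<in> dom \<kappa> \<and> ?q i \<in> dom \<kappa>'" if i: "i = 2 \<or> i = 8" for i
  proof -
    note b = bond_slots[OF n e i]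
    have k: "\<kappa> (?p i) = Some (Lf e (11 + i))" "\<kappa>' (?q i) = Some (Lf (opp e) (12 + i))" using c(1)[OF b(1)] c(2)[OF b(2)] b(3)[of w] b(4)[of w'] by auto
    have "(\<kappa> ++ \<kappa>') (?p i) = Some (Lf e (11 + i))" "(\<kappa> ++ \<kappa>') (?q i) = Some (Lf (opp e) (12 + i))"
      using k dj by (auto simp: map_add_Some_iff)
    moreover have "okk (Lf e (11 + i))" "okk (Lf (opp e) (12 + i))"
      using okk_knd[OF n(1) b(1)] okk_knd[OF n(1) b(2)] b(3)[of w] b(4)[of w'] by metis+
    ultimately have "weight (tl \<tau> (\<kappa> ++ \<kappa>')) (?p i) (?q i) = str \<tau> (Neu (11 + i))"
      using weight_adj[of "\<kappa> ++ \<kappa>'" "?p i" _ "fw e"] lk_flow[OF _ _ b(6)] b(5)[of v] by simp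
    then show ?thesis using k by auto
  qed
  have ne: "(?p 2, ?q 2) \<noteq> (?p 8, ?q 8)" using cpos_inj(2)[OF n bond_slots(1)[OF n e] bond_slots(1)[OF n e], of 2 8 v v] by auto
  have s: "str \<tau> (Neu (11 + 2)) = \<tau> - 1" "str \<tau> (Neu (11 + 8)) = 1" by (auto simp: str_def)
  show ?thesis unfolding tl_add
  proof (rule stable_join[OF st, of "{(?p 2, ?q 2), (?p 8, ?q 8)}"])
    show "dom (tl \<tau> \<kappa>) \<inter> dom (tl \<tau> \<kappa>') = {}" using dj by simp
    show "{(?p 2, ?q 2), (?p 8, ?q 8)} \<subseteq> dom (tl \<tau> \<kappa>) \<times> dom (tl \<tau> \<kappa>')" using W[of 2] W[of 8] by simp
    have "(\<Sum>(p, q)\<in>{(?p 2, ?q 2), (?p 8, ?q 8)}. weight (tl \<tau> \<kappa> ++ tl \<tau> \<kappa>') p q) = (\<tau> - 1) + 1"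
      using W[of 2] W[of 8] ne s by (simp add: tl_add)
    then show "\<tau> \<le> (\<Sum>(p, q)\<in>{(?p 2, ?q 2), (?p 8, ?q 8)}. weight (tl \<tau> \<kappa> ++ tl \<tau> \<kappa>') p q)" using t by simp
  qed simp
qed

lemma stable_adjacent:
  assumes t: "1 < \<tau>" and n: "okn n" "n \<noteq> 0" and st: "stable \<tau> (tl \<tau> \<kappa>)" "stable \<tau> (tl \<tau> \<kappa>')"
    and dj: "dom \<kappa> \<inter> dom \<kappa>' = {}"
    and c: "\<And>x. valid n x \<Longrightarrow> \<kappa> (cpos n v x) = Some (knd n w x)" "\<And>x. valid n x \<Longrightarrow> \<kappa>' (cpos n (v + vec d) x) = Some (knd n w' x)"
  shows "stable \<tau> (tl \<tau> (\<kappa> ++ \<kappa>'))"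
proof (cases "hi d")
  case True then show ?thesis using stable_hi[OF t n True st dj c] by blast
next
  case False
  then have h: "hi (opp d)" by (cases d) auto
  have dj': "dom \<kappa>' \<inter> dom \<kappa> = {}" using dj by auto
  have v: "v = v + vec d + vec (opp d)" by (simp add: vec_opp)
  have c': "\<kappa> (cpos n (v + vec d + vec (opp d)) x) = Some (knd n w x)" if "valid n x" for x using c(1)[OF that] by (simp only: v[symmetric])
  show ?thesis using stable_hi[OF t n h st(2,1) dj' c(2) c'] map_add_comm[OF dj] by simp
qed

section \<open>Layouts of simulated assemblies\<close>

definition lay :: "nat \<Rightarrow> nat \<Rightarrow> (tile \<Rightarrow> nat \<Rightarrow> bool) \<Rightarrow> assembly \<Rightarrow> assembly" where
  "lay \<tau> n enc \<beta> = tl \<tau> (full n (\<lambda>v. map_option enc (\<beta> v)))"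

lemma lay_translate:
  assumes n: "okn n" "n \<noteq> 0"
  shows "supertile_of (lay \<tau> n enc (translate \<beta> u)) = supertile_of (lay \<tau> n enc \<beta>)"
proof -
  have "(\<lambda>v. map_option enc (translate \<beta> u v)) = (\<lambda>v. (\<lambda>v. map_option enc (\<beta> v)) (v - u))" by (simp add: translate_apply)
  then show ?thesis unfolding lay_def using full_shift[OF n, of "\<lambda>v. map_option enc (\<beta> v)" u] tl_kshift by simp
qed

lemma combinationI:
  "\<alpha> \<in> A \<Longrightarrow> \<beta> \<in> B \<Longrightarrow> dom \<alpha> \<inter> dom \<beta> = {} \<Longrightarrow> stable \<tau> (\<alpha> ++ \<beta>) \<Longrightarrow> supertile_of (\<alpha> ++ \<beta>) \<in> combination \<tau> A B"
  unfolding combination_def by blast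

text \<open>Stability in the simulated system serves only to find two adjacent tiles; their cells
  then bind whatever glues the tiles have.\<close>

lemma adjacent_pair:
  assumes t: "1 < \<tau>" and st: "stable \<tau> (\<beta> ++ \<gamma>)" and dj: "dom \<beta> \<inter> dom \<gamma> = {}" and ne: "dom \<beta> \<noteq> {}" "dom \<gamma> \<noteq> {}"
  shows "\<exists>v d. v \<in> dom \<beta> \<and> v + vec d \<in> dom \<gamma>"
proof -
  obtain F where F: "finite F" "F \<subseteq> dom \<beta> \<times> dom \<gamma>" "\<tau> \<le> (\<Sum>(p,q)\<in>F. weight (\<beta> ++ \<gamma>) p q)" by (rule stable_join_cut[OF st dj ne])
  have "\<exists>(p, q)\<in>F. weight (\<beta> ++ \<gamma>) p q \<noteq> 0"
  proof (rule ccontr)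
    assume "\<not> ?thesis"
    then have "(\<Sum>(p,q)\<in>F. weight (\<beta> ++ \<gamma>) p q) = 0" by (intro sum.neutral) auto
    then show False using F(3) t by simp
  qed
  then obtain v v' where vF: "(v, v') \<in> F" and v0: "weight (\<beta> ++ \<gamma>) v v' \<noteq> 0" by blast
  have v: "v \<in> dom \<beta>" "v' \<in> dom \<gamma>" "weight (\<beta> ++ \<gamma>) v v' \<noteq> 0" using F(2) vF v0 by blast+
  then obtain dd where dd: "v' = v + vec dd" using weight_nonadj by metis
  show ?thesis using v(1,2) unfolding dd by blast
qed

lemma lay_comb:
  assumes t: "1 < \<tau>" and n: "okn n" "n \<noteq> 0" and dj: "dom \<beta> \<inter> dom \<gamma> = {}" and st: "stable \<tau> (\<beta> ++ \<gamma>)" and ne: "dom \<beta> \<noteq> {}" "dom \<gamma> \<noteq> {}"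
    and p: "supertile_of (lay \<tau> n enc \<beta>) \<in> producible \<tau> (UU \<tau>)" "supertile_of (lay \<tau> n enc \<gamma>) \<in> producible \<tau> (UU \<tau>)"
  shows "lay \<tau> n enc (\<beta> ++ \<gamma>) = lay \<tau> n enc \<beta> ++ lay \<tau> n enc \<gamma>" "dom (lay \<tau> n enc \<beta>) \<inter> dom (lay \<tau> n enc \<gamma>) = {}"
    "stable \<tau> (lay \<tau> n enc (\<beta> ++ \<gamma>))" "supertile_of (lay \<tau> n enc (\<beta> ++ \<gamma>)) \<in> producible \<tau> (UU \<tau>)"
proof -
  let ?W = "\<lambda>v. map_option enc (\<beta> v)" let ?X = "\<lambda>v. map_option enc (\<gamma> v)"
  have d: "dom ?W \<inter> dom ?X = {}" using dj by auto
  have e: "(\<lambda>v. map_option enc ((\<beta> ++ \<gamma>) v)) = ?W ++ ?X" by (rule ext) (auto simp: map_add_def split: option.splits)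
  have fd: "dom (full n ?W) \<inter> dom (full n ?X) = {}" by (rule full_disjoint[OF n d])
  show 1: "lay \<tau> n enc (\<beta> ++ \<gamma>) = lay \<tau> n enc \<beta> ++ lay \<tau> n enc \<gamma>" unfolding lay_def e full_add[OF n d] tl_add ..
  show 2: "dom (lay \<tau> n enc \<beta>) \<inter> dom (lay \<tau> n enc \<gamma>) = {}" unfolding lay_def using fd by simp
  obtain v dd where v: "v \<in> dom \<beta>" "v + vec dd \<in> dom \<gamma>" using adjacent_pair[OF t st dj ne] by blast
  obtain a b where ab: "\<beta> v = Some a" "\<gamma> (v + vec dd) = Some b" using v by auto
  have "stable \<tau> (tl \<tau> (full n ?W ++ full n ?X))"
  proof (rule stable_adjacent[OF t n _ _ fd, of v "enc a" dd "enc b"])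
    show "stable \<tau> (tl \<tau> (full n ?W))" "stable \<tau> (tl \<tau> (full n ?X))" using producible_stable[OF p(1) self_in_supertile] producible_stable[OF p(2) self_in_supertile] unfolding lay_def by simp_all
    show "full n ?W (cpos n v x) = Some (knd n (enc a) x)" if "valid n x" for x by (rule full_cell[OF n _ that]) (use ab in simp)
    show "full n ?X (cpos n (v + vec dd) x) = Some (knd n (enc b) x)" if "valid n x" for x by (rule full_cell[OF n _ that]) (use ab in simp)
  qed
  then show 3: "stable \<tau> (lay \<tau> n enc (\<beta> ++ \<gamma>))" unfolding lay_def e full_add[OF n d] .
  show "supertile_of (lay \<tau> n enc (\<beta> ++ \<gamma>)) \<in> producible \<tau> (UU \<tau>)"
    unfolding 1 by (rule producible.comb[OF p combinationI[OF self_in_supertile self_in_supertile 2]]) (use 3 1 in simp)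
qed

lemma lay_producible:
  assumes t: "1 < \<tau>" and n: "okn n" "n \<noteq> 0" and B: "B \<in> producible \<tau> T" and b: "\<beta> \<in> B"
  shows "supertile_of (lay \<tau> n enc \<beta>) \<in> producible \<tau> (UU \<tau>)"
  using B b
proof (induction arbitrary: \<beta> rule: producible.induct)
  case (single u)
  let ?b = "Map.empty((0::int,0::int) \<mapsto> u)" let ?W = "\<lambda>v. map_option enc (?b v)" let ?c = "cpos n (0,0) SS"
  have W: "?W (0,0) = Some (enc u)" by simp
  have "full n ?W ?c = Some Seed" using full_cell[of n ?W "(0,0)" "enc u" SS] n W by simp
  then have le: "[?c \<mapsto> Seed] \<subseteq>\<^sub>m full n ?W" by (auto simp: map_le_def)
  have tlS: "tl \<tau> [?c \<mapsto> Seed] = [?c \<mapsto> tile \<tau> Seed]" by (auto simp: tl_def)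
  have pr: "supertile_of (tl \<tau> [?c \<mapsto> Seed]) \<in> producible \<tau> (UU \<tau>)" unfolding tlS by (rule single_producible) (auto simp: UU_def)
  obtain \<kappa> where k: "\<kappa> \<subseteq>\<^sub>m full n ?W" "\<forall>x. valid n x \<longrightarrow> \<kappa> (cpos n (0,0) x) \<noteq> None"
      "steps \<tau> (UU \<tau>) (supertile_of (tl \<tau> [?c \<mapsto> Seed])) (supertile_of (tl \<tau> \<kappa>))"
    using grow_cell[of \<tau> n ?W "(0,0)" "enc u", OF t n W le _ pr] by auto
  have "full n ?W p = \<kappa> p" for p
  proof (cases "full n ?W p")
    case None
    then show ?thesis using k(1) by (metis domIff map_le_def)
  next
    case (Some k')
    then obtain v w x where "?W v = Some w" "valid n x" "p = cpos n v x" unfolding full_Some[OF n] by blast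
    then have "p \<in> dom \<kappa>" using k(2) by (auto split: if_splits)
    then show ?thesis using k(1) by (metis map_le_def)
  qed
  then have "tl \<tau> \<kappa> = lay \<tau> n enc ?b" unfolding lay_def by (metis ext)
  then have "supertile_of (lay \<tau> n enc ?b) \<in> producible \<tau> (UU \<tau>)" using steps_producible[OF k(3) pr] by simp
  then show ?case using single.prems lay_translate[OF n] unfolding supertile_of_def[of ?b] by auto
next
  case (comb A B C)
  obtain \<alpha> \<gamma> where c: "C = supertile_of (\<alpha> ++ \<gamma>)" "\<alpha> \<in> A" "\<gamma> \<in> B" "dom \<alpha> \<inter> dom \<gamma> = {}" "stable \<tau> (\<alpha> ++ \<gamma>)"
    using comb.hyps(3) unfolding combination_def by blast
  have ne: "dom \<alpha> \<noteq> {}" "dom \<gamma> \<noteq> {}"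
    using is_supertile_nonempty[OF producible_is_supertile[OF comb.hyps(1)] c(2)] is_supertile_nonempty[OF producible_is_supertile[OF comb.hyps(2)] c(3)] by simp_all
  have "supertile_of (lay \<tau> n enc (\<alpha> ++ \<gamma>)) \<in> producible \<tau> (UU \<tau>)"
    by (rule lay_comb(4)[OF t n c(4,5) ne comb.IH(1)[OF c(2)] comb.IH(2)[OF c(3)]])
  then show ?case using comb.prems lay_translate[OF n] unfolding c(1) supertile_of_def[of "\<alpha> ++ \<gamma>"] by auto
next
  case (limit f g)
  have mono: "j \<le> k \<Longrightarrow> f j \<subseteq>\<^sub>m f k" for j k by (rule chain_mono[of f g, OF limit.hyps(4,3)])
  have g: "supertile_of (lay \<tau> n enc (g k)) \<in> producible \<tau> (UU \<tau>)" for k by (rule limit.IH(2)[OF self_in_supertile])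
  have ne: "dom (f 0) \<noteq> {}" "dom (g k) \<noteq> {}" for k
    using is_supertile_nonempty[OF producible_is_supertile[OF limit.hyps(1)] self_in_supertile] is_supertile_nonempty[OF producible_is_supertile[OF limit.hyps(2)[of k]] self_in_supertile] by simp_all
  have nf: "dom (f k) \<noteq> {}" for k using ne(1) map_le_implies_dom_le[OF mono[of 0 k]] by blast
  have sk: "stable \<tau> (f k ++ g k)" for k using limit.hyps(4,5) by metis
  have f: "supertile_of (lay \<tau> n enc (f k)) \<in> producible \<tau> (UU \<tau>)" for k
  proof (induction k)
    case 0 show ?case by (rule limit.IH(1)[OF self_in_supertile])
  next
    case (Suc k) show ?case unfolding limit.hyps(4) by (rule lay_comb(4)[OF t n limit.hyps(3) sk nf ne(2) Suc g])
  qed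
  note lc = lay_comb[OF t n limit.hyps(3) sk nf ne(2) f g]
  let ?F = "\<lambda>k. lay \<tau> n enc (f k)"
  have "supertile_of (chain_lim ?F) \<in> producible \<tau> (UU \<tau>)"
  proof (rule producible.limit[of ?F _ _ "\<lambda>k. lay \<tau> n enc (g k)"])
    show "?F (Suc k) = ?F k ++ lay \<tau> n enc (g k)" for k unfolding limit.hyps(4) by (rule lc(1))
    show "stable \<tau> (?F (Suc k))" for k unfolding limit.hyps(4) by (rule lc(3))
  qed (use f g lc(2) in auto)
  \<comment> \<open>A layout is built cell by cell, so it commutes with the limit of a
    chain.\<close>
  moreover have "chain_lim ?F = lay \<tau> n enc (chain_lim f)"
  proof (rule map_eqI)
    fix p x
    have Fm: "?F j \<subseteq>\<^sub>m ?F k" if "j \<le> k" for j k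
      by (rule chain_mono[of ?F "\<lambda>k. lay \<tau> n enc (g k)", OF _ lc(2) that]) (unfold limit.hyps(4), rule lc(1))
    have a: "chain_lim ?F p = Some x \<longleftrightarrow> (\<exists>k. ?F k p = Some x)" by (rule chain_lim_Some_iff[of ?F, OF Fm])
    have b: "chain_lim f q = Some y \<longleftrightarrow> (\<exists>k. f k q = Some y)" for q y by (rule chain_lim_Some_iff[of f, OF mono])
    have c: "lay \<tau> n enc \<beta> p = Some x \<longleftrightarrow> (\<exists>v y s. \<beta> v = Some y \<and> valid n s \<and> p = cpos n v s \<and> x = tile \<tau> (knd n (enc y) s))" for \<beta>
      unfolding lay_def tl_def map_option_eq_Some full_Some[OF n] by blast
    show "chain_lim ?F p = Some x \<longleftrightarrow> lay \<tau> n enc (chain_lim f) p = Some x" unfolding a c b by blast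
  qed
  ultimately have "supertile_of (lay \<tau> n enc (chain_lim f)) \<in> producible \<tau> (UU \<tau>)" by simp
  then show ?case using limit.prems lay_translate[OF n] unfolding supertile_of_def[of "chain_lim f"] by auto
qed

section \<open>Reading blocks\<close>

text \<open>The core of a cell, all but its final ring. Its outermost ring carries
  \<open>PP\<close>, so the core already reveals the size.\<close>

definition cor :: "nat \<Rightarrow> slot \<Rightarrow> bool" where
  "cor n x \<longleftrightarrow> x = SS \<or> (\<exists>j h i. x = Rg j h i \<and> 1 \<le> j \<and> j < n \<and> i < 2 * j)"

definition crn :: "nat \<Rightarrow> dr \<Rightarrow> slot" where "crn j h = Rg j h (2 * j - 1)"

lemma cor_valid: "cor n x \<Longrightarrow> valid n x" by (auto simp: cor_def)

lemma crn_cor: "1 \<le> j \<Longrightarrow> j < n \<Longrightarrow> cor n (crn j h)" by (auto simp: cor_def crn_def)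

lemma knd_crn: "1 \<le> j \<Longrightarrow> knd n w (crn j h) = (if h = DE then Run DE (sym_at n w j) En else Cor h (sym_at n w j))"
  by (auto simp: crn_def icl_def)

lemma anc_cor:
  assumes "1 < n" "cor n y" shows "anc n' (crn (n - 1) DE) y"
proof (cases y)
  case (Rg j h i)
  then have "1 \<le> j" "j < n" "i < 2 * j" using assms by (auto simp: cor_def)
  then show ?thesis using Rg by (cases h) (auto simp: crn_def rle_def)
qed (use assms in \<open>auto simp: cor_def\<close>)

lemma core_slots:
  assumes "1 < n" "sup \<kappa> c n w (crn (n - 1) DE)" "cor n y"
  shows "\<kappa> (c + pos n y) = Some (knd n w y)"
  by (rule sup_anc[OF assms(2) cor_valid[OF assms(3)] anc_cor[OF assms(1,3)]])

text \<open>The penultimate ring of the smaller size would show \<open>PP\<close> in one reading and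
  a counter in the other.\<close>

lemma core_unique:
  assumes n: "13 \<le> n" "13 \<le> n'" and s: "sup \<kappa> c n w (crn (n - 1) DE)" "sup \<kappa> c n' w' (crn (n' - 1) DE)"
  shows "n = n'"
proof -
  have lt: False if n: "13 \<le> n" "n < n'" and s: "sup \<kappa> c n w (crn (n - 1) DE)" "sup \<kappa> c n' w' (crn (n' - 1) DE)" for n n' w w'
  proof -
    have "\<kappa> (c + pos n (crn (n - 1) DE)) = Some (knd n w (crn (n - 1) DE))" by (rule supD[OF s(1)])
    moreover have "\<kappa> (c + pos n' (crn (n - 1) DE)) = Some (knd n' w' (crn (n - 1) DE))"
      by (rule core_slots[OF _ s(2) crn_cor]) (use n in auto)
    moreover have "pos n (crn (n - 1) DE) = pos n' (crn (n - 1) DE)" by (simp add: crn_def)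
    ultimately have "knd n w (crn (n - 1) DE) = knd n' w' (crn (n - 1) DE)" by simp
    then have "sym_at n w (n - 1) = sym_at n' w' (n - 1)" using n by (simp add: knd_crn)
    then show False using n by (auto simp: sym_at_def split: if_splits)
  qed
  show ?thesis using lt[OF n(1) _ s] lt[OF n(2) _ s(2,1)] by (cases n n' rule: linorder_cases) auto
qed

lemma fin_core: "fin \<kappa> c n \<Longrightarrow> \<exists>w. sup \<kappa> c n w (crn (n - 1) DE)"
proof -
  assume "fin \<kappa> c n"
  then obtain w where w: "sup \<kappa> c n w (Rg n DN 0)" and n0: "n \<noteq> 0" unfolding fin_def by blast
  have n: "13 \<le> n" using w n0 okn_ge unfolding sup_def by blast
  have "sup \<kappa> c n w (crn (n - 1) DE)"
  proof (rule sup_sub[OF w])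
    show "valid n (crn (n - 1) DE)" using n by (auto simp: crn_def)
    fix z assume "valid n z" "anc n (crn (n - 1) DE) z"
    then show "anc n (Rg n DN 0) z" using n by (cases z) (auto simp: crn_def rle_def)
  qed
  then show ?thesis by blast
qed

text \<open>A complete core reconciles the guesses behind the tiles of a cell. Core tiles are
  compared directly; a tile beyond the core forces a ring that shows \<open>PP\<close>, hence the
  same size, and no word enters its kind.\<close>

lemma cell_agree:
  assumes n: "okn n" "n \<noteq> 0" and core: "sup \<kappa> c n w (crn (n - 1) DE)" and s: "sup \<kappa> c n' w' x"
  shows "\<exists>y. valid n y \<and> pos n y = pos n' x \<and> knd n w y = knd n' w' x"
proof -
  have n13: "13 \<le> n" using okn_ge[OF n] .
  have v: "valid n' x" "okn n'" using s by (auto simp: sup_def)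
  have strip: "n' = n" if z: "n' \<noteq> 0" "\<And>z. valid n' z \<Longrightarrow> anc n' (crn (n' - 1) DE) z \<Longrightarrow> anc n' x z"
  proof -
    have n'13: "13 \<le> n'" using okn_ge[OF v(2) z(1)] .
    have "sup \<kappa> c n' w' (crn (n' - 1) DE)" by (rule sup_sub[OF s _ z(2)]) (use n'13 in \<open>auto simp: crn_def\<close>)
    then show ?thesis using core_unique[OF n13 n'13 core] by simp
  qed
  have sa: "stranc n' o' k z" if "n' \<noteq> 0" "anc n' (crn (n' - 1) DE) z" for o' k z
    using that by (cases z) (auto simp: crn_def rle_def)
  show ?thesis
  proof (cases x)
    case SS then show ?thesis by (intro exI[of _ SS]) simp
  next
    case (Rg j h i)
    show ?thesis
    proof (cases "j < n")
      case True
      then have c: "cor n x" using Rg v by (auto simp: cor_def)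
      have "\<kappa> (c + pos n x) = Some (knd n w x)" using core_slots[OF _ core c] n13 by simp
      moreover have "\<kappa> (c + pos n' x) = Some (knd n' w' x)" by (rule supD[OF s])
      moreover have p: "pos n x = pos n' x" using Rg by simp
      ultimately have "knd n w x = knd n' w' x" by simp
      then show ?thesis using p cor_valid[OF c] by blast
    next
      case False
      have "n' = n"
      proof -
        have "\<kappa> (c + pos n' (crn (n - 1) DE)) = Some (knd n' w' (crn (n - 1) DE))"
          by (rule sup_anc[OF s]) (use False Rg v n13 in \<open>auto simp: crn_def rle_def\<close>)
        moreover have "\<kappa> (c + pos n (crn (n - 1) DE)) = Some (knd n w (crn (n - 1) DE))" by (rule supD[OF core])
        moreover have "pos n (crn (n - 1) DE) = pos n' (crn (n - 1) DE)" by (simp add: crn_def)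
        ultimately have "knd n w (crn (n - 1) DE) = knd n' w' (crn (n - 1) DE)" by simp
        then have "sym_at n w (n - 1) = sym_at n' w' (n - 1)" using n13 by (simp add: knd_crn)
        moreover have "sym_at n w (n - 1) = PP" using n13 by (auto simp: sym_at_def)
        ultimately have "sym_at n' w' (n - 1) = PP" by simp
        then show ?thesis using n13 by (auto simp: sym_at_def split: if_splits)
      qed
      then have nn: "n' = n" .
      then have "j = n" using False Rg v n by auto
      then have "knd n w x = knd n' w' x" using Rg nn n13 by (simp add: sym_at_def)
      then show ?thesis using v nn by blast
    qed
  next
    case (Col o' g)
    then have n0: "n' \<noteq> 0" using v by (auto simp: vcol_def)
    have "n' = n" by (rule strip[OF n0]) (use Col sa[OF n0] in auto)
    then show ?thesis using v Col by (intro exI[of _ x]) simp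
  next
    case (M1 o' g)
    then have n0: "n' \<noteq> 0" using v by (auto simp: vcol_def)
    have "n' = n" by (rule strip[OF n0]) (use M1 sa[OF n0] in auto)
    then show ?thesis using v M1 by (intro exI[of _ x]) simp
  next
    case (M2 o' g)
    then have n0: "n' \<noteq> 0" using v by (auto simp: vcol_def)
    have "n' = n" by (rule strip[OF n0]) (use M2 sa[OF n0] in auto)
    then show ?thesis using v M2 by (intro exI[of _ x]) simp
  next
    case (Le o' g)
    then have n0: "n' \<noteq> 0" using v by (auto simp: vcol_def)
    have "n' = n" by (rule strip[OF n0]) (use Le sa[OF n0] in auto)
    then show ?thesis using v Le by (intro exI[of _ x]) simp
  next
    case KK
    then have n0: "n' \<noteq> 0" using v by auto
    have "n' = n" by (rule strip[OF n0]) (use KK sa[OF n0] in auto)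
    then show ?thesis using v KK by (intro exI[of _ x]) simp
  qed
qed

text \<open>All assemblies in this interval have the same reading: cores must be complete, anything
  outside them may be missing.\<close>

definition lays :: "nat \<Rightarrow> kasm \<Rightarrow> wmap \<Rightarrow> bool" where
  "lays n \<kappa> W \<longleftrightarrow> \<kappa> \<subseteq>\<^sub>m full n W \<and> (\<forall>v w x. W v = Some w \<and> cor n x \<longrightarrow> \<kappa> (cpos n v x) = Some (knd n w x))"

lemma lays_exists:
  assumes n: "okn n" "n \<noteq> 0" and V: "VV \<kappa>" "\<kappa> \<noteq> Map.empty"
    and core: "\<And>c. \<kappa> c = Some Seed \<Longrightarrow> \<exists>w. sup \<kappa> c n w (crn (n - 1) DE)"
  shows "\<exists>c W. lays n (kshift \<kappa> c) W"
proof -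
  have n13: "13 \<le> n" using okn_ge[OF n] .
  obtain c0 where c0: "\<kappa> c0 = Some Seed" using VV_seed[OF V] by blast
  have lat: "\<exists>u. c = c0 + cpos n u SS" if c: "\<kappa> c = Some Seed" for c
  proof (cases "c = c0")
    case True then show ?thesis by (intro exI[of _ 0]) (simp add: cpos_def zero_prod_def[symmetric])
  next
    case False
    then obtain n' u v where n': "fin \<kappa> c0 n'" "c = c0 + ((2 * int n' + 4) * u, (2 * int n' + 4) * v)"
      using V(1) c c0 unfolding VV_def V2_def by metis
    obtain w w' where w: "sup \<kappa> c0 n w (crn (n - 1) DE)" "sup \<kappa> c0 n' w' (crn (n' - 1) DE)" using core[OF c0] fin_core[OF n'(1)] by blast
    have "13 \<le> n'" using n'(1) okn_ge unfolding fin_def sup_def by blast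
    then have "n' = n" using core_unique[OF n13 _ w] by simp
    then show ?thesis using n'(2) by (intro exI[of _ "(u, v)"]) (simp add: cpos_def)
  qed
  define W where "W v = (if \<kappa> (c0 + cpos n v SS) = Some Seed then Some (SOME w. sup \<kappa> (c0 + cpos n v SS) n w (crn (n - 1) DE)) else None)" for v
  have W: "sup \<kappa> (c0 + cpos n v SS) n w (crn (n - 1) DE)" if "W v = Some w" for v w
  proof -
    have a: "\<kappa> (c0 + cpos n v SS) = Some Seed" "w = (SOME w. sup \<kappa> (c0 + cpos n v SS) n w (crn (n - 1) DE))"
      using that unfolding W_def by (auto split: if_splits)
    show ?thesis unfolding a(2) by (rule someI_ex[OF core[OF a(1)]])
  qed
  have cp: "c0 + cpos n v SS + pos n x = c0 + cpos n v x" for v x by (simp add: cpos_def add.assoc)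
  have "kshift \<kappa> (- c0) \<subseteq>\<^sub>m full n W" unfolding map_le_def
  proof
    fix p assume "p \<in> dom (kshift \<kappa> (- c0))"
    then obtain k where k: "kshift \<kappa> (- c0) p = Some k" by blast
    then have "\<kappa> (p + c0) = Some k" by (simp add: kshift_def)
    moreover have "V1 \<kappa>" using V unfolding VV_def by simp
    ultimately obtain c n' w' x where x: "p + c0 = c + pos n' x" "sup \<kappa> c n' w' x" "k = knd n' w' x" by (meson V1_E)
    obtain u where u: "c = c0 + cpos n u SS" using lat[OF sup_seed[OF x(2)]] by blast
    then obtain w where w: "W u = Some w" using sup_seed[OF x(2)] unfolding W_def by simp
    have "sup \<kappa> c n w (crn (n - 1) DE)" using W[OF w] u by simp
    from cell_agree[OF n this x(2)] obtain y where y: "valid n y" "pos n y = pos n' x" "knd n w y = knd n' w' x" by blast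
    have "p + c0 = c0 + cpos n u SS + pos n y" using x(1) y(2) u by simp
    then have "p + c0 = c0 + cpos n u y" unfolding cp .
    then have "p = cpos n u y" by (simp add: algebra_simps)
    then have "full n W p = Some k" using full_cell[of n W u w y] n w y x(3) by simp
    then show "kshift \<kappa> (- c0) p = full n W p" using k by simp
  qed
  moreover have "kshift \<kappa> (- c0) (cpos n v x) = Some (knd n w x)" if "W v = Some w" "cor n x" for v w x
  proof -
    have "\<kappa> (c0 + cpos n v SS + pos n x) = Some (knd n w x)" using core_slots[OF _ W[OF that(1)] that(2)] n13 by simp
    then show ?thesis unfolding cp kshift_def by (simp add: algebra_simps)
  qed
  ultimately show ?thesis unfolding lays_def by blast
qed

section \<open>The window of a block and its decoding\<close>

definition wnd :: "nat \<Rightarrow> pos \<Rightarrow> pos \<Rightarrow> bool" where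
  "wnd n X p \<longleftrightarrow> (\<exists>i j. i < 2 * n + 4 \<and> j < 2 * n + 4 \<and>
     p = ((2 * int n + 4) * fst X + int i, (2 * int n + 4) * snd X + int j))"

lemma wnd_iff: "wnd n X p \<longleftrightarrow> fst p div (2 * int n + 4) = fst X \<and> snd p div (2 * int n + 4) = snd X"
proof -
  let ?m = "2 * int n + 4"
  have one: "(\<exists>i < 2 * n + 4. q = ?m * x + int i) \<longleftrightarrow> q div ?m = x" for q x
  proof
    assume "\<exists>i < 2 * n + 4. q = ?m * x + int i"
    then obtain i where i: "i < 2 * n + 4" "q = ?m * x + int i" by blast
    have "int i < ?m" using i(1) by simp
    then show "q div ?m = x" using i(2) by (simp add: div_pos_pos_trivial)
  next
    assume a: "q div ?m = x"
    have b: "0 \<le> q mod ?m" "q mod ?m < ?m" by simp_all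
    then have "nat (q mod ?m) < 2 * n + 4" by linarith
    moreover have "q = ?m * x + q mod ?m" using a by (metis mult_div_mod_eq)
    ultimately show "\<exists>i < 2 * n + 4. q = ?m * x + int i" using b(1) by (intro exI[of _ "nat (q mod ?m)"]) simp
  qed
  show ?thesis unfolding wnd_def prod_eq_iff using one[of "fst p" "fst X"] one[of "snd p" "snd X"] by auto
qed

text \<open>A block is read through its seed and those corner tiles of the rings around the seed that lie in the
  window; every ring shows at least one corner, whatever the position of the seed in the window.\<close>

definition bget :: "block \<Rightarrow> pos \<Rightarrow> tile option" where
  "bget b p = (if 0 \<le> fst p \<and> 0 \<le> snd p then b (nat (fst p), nat (snd p)) else None)"

definition decodes :: "nat \<Rightarrow> nat \<Rightarrow> block \<Rightarrow> pos \<Rightarrow> (nat \<Rightarrow> bool) \<Rightarrow> bool" where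
  "decodes \<tau> n b p w \<longleftrightarrow> wnd n 0 p \<and> bget b p = Some (tile \<tau> Seed) \<and>
     (\<forall>j h. 1 \<le> j \<and> j < n \<and> wnd n 0 (p + pos n (crn j h)) \<longrightarrow> bget b (p + pos n (crn j h)) = Some (tile \<tau> (knd n w (crn j h))))"

text \<open>The support conditions make the function a legal block representation, and
  \<open>T \<noteq> {}\<close> guards the case without any tile to return. The choice of the word
  does not matter for a decoder \<open>dc\<close> that depends only on bits shared by all
  decodings.\<close>

definition dec :: "nat \<Rightarrow> nat \<Rightarrow> tile set \<Rightarrow> ((nat \<Rightarrow> bool) \<Rightarrow> tile) \<Rightarrow> block \<Rightarrow> tile option" where
  "dec \<tau> n T dc b = (if T \<noteq> {} \<and> ran b \<subseteq> UU \<tau> \<and> (\<forall>i j. b (i, j) \<noteq> None \<longrightarrow> i < 2 * n + 4 \<and> j < 2 * n + 4)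
       \<and> (\<exists>p w. decodes \<tau> n b p w)
     then Some (dc (SOME w. \<exists>p. decodes \<tau> n b p w)) else None)"

lemma bget_block:
  assumes "wnd n 0 p"
  shows "bget (block_at (2 * n + 4) \<alpha> X Y) p = \<alpha> (((2 * int n + 4) * X, (2 * int n + 4) * Y) + p)"
proof -
  obtain i j where ij: "i < 2 * n + 4" "j < 2 * n + 4" "p = (int i, int j)" using assms unfolding wnd_def by auto
  have "int (2 * n + 4) = 2 * int n + 4" by simp
  then show ?thesis using ij by (simp add: bget_def block_at_def)
qed

lemma crn_pos: "1 \<le> j \<Longrightarrow> pos n (crn j h) = (case h of DN \<Rightarrow> (int j, int j) | DW \<Rightarrow> (- int j, int j) | DS \<Rightarrow> (- int j, - int j) | DE \<Rightarrow> (int j, - int j))"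
  by (cases h) (auto simp: crn_def of_nat_diff)

lemma wnd0: "wnd n 0 p \<longleftrightarrow> 0 \<le> fst p \<and> fst p < 2 * int n + 4 \<and> 0 \<le> snd p \<and> snd p < 2 * int n + 4"
proof
  assume "wnd n 0 p" then show "0 \<le> fst p \<and> fst p < 2 * int n + 4 \<and> 0 \<le> snd p \<and> snd p < 2 * int n + 4" unfolding wnd_def by auto
next
  assume "0 \<le> fst p \<and> fst p < 2 * int n + 4 \<and> 0 \<le> snd p \<and> snd p < 2 * int n + 4"
  then show "wnd n 0 p" unfolding wnd_iff by (simp add: div_pos_pos_trivial)
qed

text \<open>The diagonal from the seed towards the opposite quadrant of the window stays inside for
  all \<open>j < n\<close>, as each half of the window has length \<open>n + 2\<close>.\<close>

lemma visible_corner: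
  assumes "wnd n 0 p" "1 \<le> j" "j < n" shows "\<exists>h. wnd n 0 (p + pos n (crn j h))"
proof -
  have a: "0 \<le> fst p" "fst p < 2 * int n + 4" "0 \<le> snd p" "snd p < 2 * int n + 4" using assms(1) unfolding wnd0 by auto
  have j: "int j < int n" using assms by simp
  consider "fst p < int n + 2" "snd p < int n + 2" | "fst p < int n + 2" "int n + 2 \<le> snd p"
    | "int n + 2 \<le> fst p" "snd p < int n + 2" | "int n + 2 \<le> fst p" "int n + 2 \<le> snd p" by linarith
  then show ?thesis
  proof cases
    case 1 then show ?thesis using a j assms(2) by (intro exI[of _ DN]) (simp add: wnd0 crn_pos)
  next
    case 2 then show ?thesis using a j assms(2) by (intro exI[of _ DE]) (simp add: wnd0 crn_pos)
  next
    case 3 then show ?thesis using a j assms(2) by (intro exI[of _ DW]) (simp add: wnd0 crn_pos)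
  next
    case 4 then show ?thesis using a j assms(2) by (intro exI[of _ DS]) (simp add: wnd0 crn_pos)
  qed
qed

lemma okk_crn: "okn n \<Longrightarrow> 1 \<le> j \<Longrightarrow> j < n \<Longrightarrow> okk (knd n w (crn j h))"
  using okk_knd cor_valid crn_cor by blast

lemma decodes_bits:
  assumes t: "1 < \<tau>" and n: "okn n" and d: "decodes \<tau> n b p w" "decodes \<tau> n b p w'" and j: "1 \<le> j" "j + 2 \<le> n"
  shows "w j = w' j"
proof -
  have p: "wnd n 0 p" using d(1) unfolding decodes_def by blast
  have jn: "j < n" using j by simp
  obtain h where h: "wnd n 0 (p + pos n (crn j h))" using visible_corner[OF p j(1) jn] by blast
  have "tile \<tau> (knd n w (crn j h)) = tile \<tau> (knd n w' (crn j h))" using d h j(1) jn unfolding decodes_def by fastforce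
  then have "knd n w (crn j h) = knd n w' (crn j h)" using tile_inj[OF t] okk_crn[OF n j(1) jn] by blast
  then have "sym_at n w j = sym_at n w' j" using j by (simp add: knd_crn split: if_splits)
  then show ?thesis using j by (auto simp: sym_at_def)
qed

definition rep :: "nat \<Rightarrow> nat \<Rightarrow> tile set \<Rightarrow> ((nat \<Rightarrow> bool) \<Rightarrow> tile) \<Rightarrow> blockrep" where
  "rep \<tau> n T dc = (2 * n + 4, dec \<tau> n T dc)"

text \<open>Only rings up to \<open>n - 2\<close> carry bits, hence the first condition. By the
  second no cell is unreadable: every word names some tile.\<close>

definition dcode :: "nat \<Rightarrow> tile set \<Rightarrow> ((nat \<Rightarrow> bool) \<Rightarrow> tile) \<Rightarrow> bool" where
  "dcode n T dc \<longleftrightarrow> (\<forall>w w'. (\<forall>j. 1 \<le> j \<and> j + 2 \<le> n \<longrightarrow> w j = w' j) \<longrightarrow> dc w = dc w') \<and> (T \<noteq> {} \<longrightarrow> (\<forall>w. dc w \<in> T)) \<and>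
     (\<forall>t\<in>T. \<exists>w. dc w = t)"

lemma dec_SomeD:
  assumes "dec \<tau> n T dc b = Some x"
  shows "T \<noteq> {}" "\<exists>w. x = dc w" "ran b \<subseteq> UU \<tau>" "b (i, j) \<noteq> None \<Longrightarrow> i < 2 * n + 4 \<and> j < 2 * n + 4"
    "\<exists>p w. decodes \<tau> n b p w"
proof -
  have c: "T \<noteq> {} \<and> ran b \<subseteq> UU \<tau> \<and> (\<forall>i j. b (i, j) \<noteq> None \<longrightarrow> i < 2 * n + 4 \<and> j < 2 * n + 4) \<and> (\<exists>p w. decodes \<tau> n b p w)"
    using assms unfolding dec_def by (metis option.distinct(1))
  then show "T \<noteq> {}" "ran b \<subseteq> UU \<tau>" "b (i, j) \<noteq> None \<Longrightarrow> i < 2 * n + 4 \<and> j < 2 * n + 4" "\<exists>p w. decodes \<tau> n b p w" by blast+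
  show "\<exists>w. x = dc w" using assms unfolding dec_def if_P[OF c] by blast
qed

lemma rep_valid:
  assumes d: "dcode n T dc" shows "valid_blockrep (UU \<tau>) T (rep \<tau> n T dc)"
proof -
  have "x \<in> T" if "dec \<tau> n T dc b = Some x" for b x
    using dec_SomeD(1,2)[OF that] d unfolding dcode_def by blast
  then have "ran (dec \<tau> n T dc) \<subseteq> T" unfolding ran_def by blast
  moreover have "ran b \<subseteq> UU \<tau> \<and> (\<forall>i j. b (i, j) \<noteq> None \<longrightarrow> i < 2 * n + 4 \<and> j < 2 * n + 4)" if b: "b \<in> dom (dec \<tau> n T dc)" for b
  proof -
    obtain x where x: "dec \<tau> n T dc b = Some x" using b by blast
    show ?thesis using dec_SomeD(3,4)[OF x] by blast
  qed
  ultimately show ?thesis unfolding valid_blockrep_def rep_def by simp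
qed

lemma decodes_seed:
  assumes t: "1 < \<tau>" and ok: "\<And>q k. \<kappa> q = Some k \<Longrightarrow> okk k"
    and d: "decodes \<tau> n (block_at (2 * n + 4) (translate (tl \<tau> \<kappa>) s) X Y) p w"
  defines "P \<equiv> ((2 * int n + 4) * X, (2 * int n + 4) * Y) + p - s"
  shows "\<kappa> P = Some Seed" "\<And>j h. 1 \<le> j \<Longrightarrow> j < n \<Longrightarrow> okn n \<Longrightarrow> wnd n 0 (p + pos n (crn j h)) \<Longrightarrow> \<kappa> (P + pos n (crn j h)) = Some (knd n w (crn j h))"
    "wnd n (X, Y) (P + s)"
proof -
  let ?b = "block_at (2 * n + 4) (translate (tl \<tau> \<kappa>) s) X Y"
  have p: "wnd n 0 p" using d unfolding decodes_def by blast
  have g: "bget ?b q = map_option (tile \<tau>) (\<kappa> (((2 * int n + 4) * X, (2 * int n + 4) * Y) + q - s))" if "wnd n 0 q" for q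
    unfolding bget_block[OF that] by (simp add: translate_apply tl_def)
  have "map_option (tile \<tau>) (\<kappa> P) = Some (tile \<tau> Seed)" using d g[OF p] unfolding decodes_def P_def by simp
  then obtain k where k: "\<kappa> P = Some k" "tile \<tau> k = tile \<tau> Seed" by auto
  then have "k = Seed" using tile_inj[OF t ok[OF k(1)]] by simp
  then show "\<kappa> P = Some Seed" using k by simp
  show "\<kappa> (P + pos n (crn j h)) = Some (knd n w (crn j h))" if j: "1 \<le> j" "j < n" "okn n" "wnd n 0 (p + pos n (crn j h))" for j h
  proof -
    have e: "((2 * int n + 4) * X, (2 * int n + 4) * Y) + (p + pos n (crn j h)) - s = P + pos n (crn j h)" unfolding P_def by (simp add: algebra_simps)
    have "map_option (tile \<tau>) (\<kappa> (P + pos n (crn j h))) = Some (tile \<tau> (knd n w (crn j h)))"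
      using d j g[OF j(4)] unfolding decodes_def e by simp
    then obtain k where k: "\<kappa> (P + pos n (crn j h)) = Some k" "tile \<tau> k = tile \<tau> (knd n w (crn j h))" by auto
    then have "k = knd n w (crn j h)" using tile_inj[OF t ok[OF k(1)] okk_crn[OF j(3,1,2)]] by simp
    then show ?thesis using k by simp
  qed
  obtain i j where "i < 2 * n + 4" "j < 2 * n + 4" "p = (int i, int j)" using p unfolding wnd_def by auto
  then show "wnd n (X, Y) (P + s)" unfolding wnd_def P_def by (intro exI[of _ i] exI[of _ j]) simp
qed

lemma cpos_SS: "cpos n v x = cpos n v SS + pos n x" by (simp add: cpos_def)

lemma knd_Seed: "knd n w x = Seed \<Longrightarrow> x = SS" by (cases x) (auto split: if_splits)

lemma lays_okk: "okn n \<Longrightarrow> n \<noteq> 0 \<Longrightarrow> lays n \<kappa> W \<Longrightarrow> \<kappa> q = Some k \<Longrightarrow> okk k"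
  unfolding lays_def map_le_def using full_okk by (metis domI)

text \<open>The quotient of \<open>s\<close> by the period shifts the reading; the remainder only
  moves the seed inside its window, where \<open>visible_corner\<close> keeps every bit
  readable.\<close>

lemma rep_lays:
  assumes t: "1 < \<tau>" and n: "okn n" "n \<noteq> 0" and dc: "dcode n T dc" "T \<noteq> {}" and l: "lays n \<kappa> W"
  shows "rep_star (rep \<tau> n T dc) (translate (tl \<tau> \<kappa>) s) =
    translate (\<lambda>v. map_option dc (W v)) (fst s div (2 * int n + 4), snd s div (2 * int n + 4))"
proof
  fix XY :: pos
  let ?m = "2 * int n + 4"
  obtain X Y where XY: "XY = (X, Y)" by fastforce
  let ?u = "(fst s div ?m, snd s div ?m)" let ?v = "(X, Y) - ?u" let ?p = "(fst s mod ?m, snd s mod ?m)"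
  let ?b = "block_at (2 * n + 4) (translate (tl \<tau> \<kappa>) s) X Y"
  have ok: "okk k" if "\<kappa> q = Some k" for q k using lays_okk[OF n l that] .
  have e: "rep_star (rep \<tau> n T dc) (translate (tl \<tau> \<kappa>) s) XY = dec \<tau> n T dc ?b"
    by (simp add: rep_star_def rep_def XY)
  have f: "translate (\<lambda>v. map_option dc (W v)) ?u XY = map_option dc (W ?v)" by (simp add: translate_apply XY)
  have s1: "fst s = ?m * (fst s div ?m) + fst s mod ?m" by (metis mult_div_mod_eq)
  have s2: "snd s = ?m * (snd s div ?m) + snd s mod ?m" by (metis mult_div_mod_eq)
  have base: "(?m * X, ?m * Y) + ?p - s = cpos n ?v SS"
    using s1 s2 by (auto simp: cpos_def prod_eq_iff algebra_simps)
  have ran: "ran ?b \<subseteq> UU \<tau>"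
  proof
    fix x assume "x \<in> ran ?b"
    then obtain i j where "?b (i, j) = Some x" unfolding ran_def by auto
    then have "\<exists>q. translate (tl \<tau> \<kappa>) s q = Some x" by (auto simp: block_at_def split: if_splits)
    then obtain q where "translate (tl \<tau> \<kappa>) s q = Some x" by blast
    then obtain k where "\<kappa> (q - s) = Some k" "x = tile \<tau> k" unfolding translate_apply tl_def by auto
    then show "x \<in> UU \<tau>" using ok unfolding UU_def by blast
  qed
  have supp: "\<forall>i j. ?b (i, j) \<noteq> None \<longrightarrow> i < 2 * n + 4 \<and> j < 2 * n + 4" by (auto simp: block_at_def split: if_splits)
  have sd: "p = ?p \<and> W ?v \<noteq> None" if d: "decodes \<tau> n ?b p w" for p w
  proof -
    define P where "P = (?m * X, ?m * Y) + p - s"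
    have P: "\<kappa> P = Some Seed" "wnd n (X, Y) (P + s)" using decodes_seed(1,3)[OF t ok d] unfolding P_def by auto
    have "full n W P = Some Seed" using P(1) l unfolding lays_def map_le_def by (metis domI)
    then obtain v w' x where x: "W v = Some w'" "P = cpos n v x" "Seed = knd n w' x" unfolding full_Some[OF n] by blast
    then have "x = SS" using knd_Seed[of n w' x] by simp
    then have Pv: "P = (?m * fst v, ?m * snd v)" using x(2) by (simp add: cpos_def)
    then have "fst v + fst s div ?m = X" "snd v + snd s div ?m = Y" using P(2) unfolding wnd_iff by (simp_all add: div_mult_self2 add.commute)
    then have v: "v = ?v" by (auto simp: prod_eq_iff)
    have "p = P + s - (?m * X, ?m * Y)" unfolding P_def by simp
    also have "\<dots> = ?p" using Pv v s1 s2 by (auto simp: prod_eq_iff algebra_simps)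
    finally show ?thesis using v x(1) by simp
  qed
  have wp: "wnd n 0 ?p" by (simp add: wnd0)
  have conv: "decodes \<tau> n ?b ?p w" if w: "W ?v = Some w" for w
  proof -
    have g: "bget ?b (?p + pos n x) = Some (tile \<tau> (knd n w x))" if "wnd n 0 (?p + pos n x)" "cor n x" for x
    proof -
      have "(?m * X, ?m * Y) + (?p + pos n x) - s = cpos n ?v SS + pos n x" unfolding base[symmetric] by (simp add: algebra_simps)
      then have "(?m * X, ?m * Y) + (?p + pos n x) - s = cpos n ?v x" using cpos_SS[of n ?v x] by simp
      then show ?thesis using l w that(2) unfolding bget_block[OF that(1)] translate_apply tl_def lays_def by simp
    qed
    have "bget ?b ?p = Some (tile \<tau> Seed)" using g[of SS] wp by (simp add: cor_def)
    then show ?thesis unfolding decodes_def using wp g crn_cor by blast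
  qed
  have "dec \<tau> n T dc ?b = map_option dc (W ?v)"
  proof (cases "W ?v")
    case None
    then have "\<not> (\<exists>p w. decodes \<tau> n ?b p w)" using sd by blast
    then show ?thesis using None unfolding dec_def by simp
  next
    case (Some w)
    note cw = conv[OF Some]
    have ex: "\<exists>w. \<exists>p. decodes \<tau> n ?b p w" using cw by blast
    define w0 where "w0 = (SOME w. \<exists>p. decodes \<tau> n ?b p w)"
    have "\<exists>p. decodes \<tau> n ?b p w0" unfolding w0_def by (rule someI_ex[OF ex])
    then have d0: "decodes \<tau> n ?b ?p w0" using sd by blast
    have "\<forall>j. 1 \<le> j \<and> j + 2 \<le> n \<longrightarrow> w0 j = w j" using decodes_bits[OF t n(1) d0 cw] by blast
    then have "dc w0 = dc w" using dc(1) unfolding dcode_def by blast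
    moreover have "dec \<tau> n T dc ?b = Some (dc w0)" unfolding dec_def w0_def using dc(2) ran supp cw by auto
    ultimately show ?thesis using Some by simp
  qed
  then show "rep_star (rep \<tau> n T dc) (translate (tl \<tau> \<kappa>) s) XY = translate (\<lambda>v. map_option dc (W v)) ?u XY" using e f by simp
qed

lemma rep_good:
  assumes t: "1 < \<tau>" and n: "okn n" "n \<noteq> 0" and dc: "dcode n T dc" "T \<noteq> {}" and l: "lays n \<kappa> W"
  shows "rep_tilde (rep \<tau> n T dc) (supertile_of (tl \<tau> \<kappa>)) = supertile_of (\<lambda>v. map_option dc (W v))"
proof -
  let ?m = "2 * int n + 4" let ?M = "\<lambda>v. map_option dc (W v)"
  have "rep_tilde (rep \<tau> n T dc) (supertile_of (tl \<tau> \<kappa>)) = range (\<lambda>s. translate ?M (fst s div ?m, snd s div ?m))"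
    unfolding rep_tilde_def supertile_of_def image_image rep_lays[OF t n dc l] ..
  also have "\<dots> = range (translate ?M)"
  proof
    show "range (\<lambda>s. translate ?M (fst s div ?m, snd s div ?m)) \<subseteq> range (translate ?M)" by blast
    show "range (translate ?M) \<subseteq> range (\<lambda>s. translate ?M (fst s div ?m, snd s div ?m))"
    proof
      fix x assume "x \<in> range (translate ?M)"
      then obtain u where u: "x = translate ?M u" by blast
      let ?s = "(?m * fst u, ?m * snd u)"
      have "(fst ?s div ?m, snd ?s div ?m) = u" by (simp add: prod_eq_iff)
      then have "x = translate ?M (fst ?s div ?m, snd ?s div ?m)" using u by (simp only:)
      then show "x \<in> range (\<lambda>s. translate ?M (fst s div ?m, snd s div ?m))" by (rule range_eqI[of x "\<lambda>s. translate ?M (fst s div ?m, snd s div ?m)" ?s])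
    qed
  qed
  finally show ?thesis unfolding supertile_of_def .
qed

text \<open>A supertile contains all translates, so a reading that is a supertile is nonempty for
  every offset of the windows. A well chosen offset exposes just the corners of one diagonal and
  thereby proves the penultimate ring complete. With several seeds, \<open>V2\<close> already
  provides decided cells of equal size.\<close>

lemma rep_core:
  assumes t: "1 < \<tau>" and n: "okn n" "n \<noteq> 0" and A: "A \<in> producible \<tau> (UU \<tau>)"
    and S: "is_supertile (rep_tilde (rep \<tau> n T dc) A)" and k: "tl \<tau> \<kappa> \<in> A" "kinv \<kappa>"
  shows "VV \<kappa>" "\<exists>c. \<kappa> c = Some Seed" "\<And>c. \<kappa> c = Some Seed \<Longrightarrow> \<exists>w. sup \<kappa> c n w (crn (n - 1) DE)"
proof -
  let ?m = "2 * int n + 4"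
  have n13: "13 \<le> n" using okn_ge[OF n] .
  have ok: "okk x" if "\<kappa> q = Some x" for q x using kinv_okk[OF k(2) that] .
  have A_eq: "A = supertile_of (tl \<tau> \<kappa>)" by (rule is_supertile_eq[OF producible_is_supertile[OF A] k(1)])
  have D: "\<exists>X Y p w. decodes \<tau> n (block_at (2 * n + 4) (translate (tl \<tau> \<kappa>) s) X Y) p w" for s
  proof -
    have "rep_star (rep \<tau> n T dc) (translate (tl \<tau> \<kappa>) s) \<in> rep_tilde (rep \<tau> n T dc) A"
      unfolding rep_tilde_def A_eq supertile_of_def by blast
    then have "rep_star (rep \<tau> n T dc) (translate (tl \<tau> \<kappa>) s) \<noteq> Map.empty" using is_supertile_nonempty[OF S] by blast
    then obtain q where "rep_star (rep \<tau> n T dc) (translate (tl \<tau> \<kappa>) s) q \<noteq> None" by (meson ext)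
    then have "dec \<tau> n T dc (block_at (2 * n + 4) (translate (tl \<tau> \<kappa>) s) (fst q) (snd q)) \<noteq> None"
      by (simp add: rep_star_def rep_def case_prod_beta)
    then show ?thesis using dec_SomeD(5) by blast
  qed
  obtain X Y p w where d: "decodes \<tau> n (block_at (2 * n + 4) (translate (tl \<tau> \<kappa>) 0) X Y) p w" using D by blast
  define c0 where "c0 = (?m * X, ?m * Y) + p - 0"
  have c0: "\<kappa> c0 = Some Seed" using decodes_seed(1)[OF t ok d] unfolding c0_def by simp
  then show "\<exists>c. \<kappa> c = Some Seed" by blast
  show V: "VV \<kappa>"
  proof (rule ccontr)
    assume "\<not> VV \<kappa>"
    then obtain r where "cl \<kappa> r" using k(2) unfolding kinv_def by blast
    then show False using cl_okk c0 by blast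
  qed
  show "\<exists>w. sup \<kappa> c n w (crn (n - 1) DE)" if c: "\<kappa> c = Some Seed" for c
  proof (cases "\<forall>c'. \<kappa> c' = Some Seed \<longrightarrow> c' = c")
    case True
    \<comment> \<open>Moves the seed to the upper left place of its window. From there only the
      south-east corner of each ring, its last tile, is visible.\<close>
    let ?s = "(0, ?m - 1) - c"
    obtain X Y p w where d: "decodes \<tau> n (block_at (2 * n + 4) (translate (tl \<tau> \<kappa>) ?s) X Y) p w" using D by blast
    define P where "P = (?m * X, ?m * Y) + p - ?s"
    have "\<kappa> P = Some Seed" using decodes_seed(1)[OF t ok d] unfolding P_def by simp
    then have Pc: "P = c" using True by blast
    have "wnd n (X, Y) (P + ?s)" using decodes_seed(3)[OF t ok d] unfolding P_def by simp
    then have "wnd n (X, Y) (0, ?m - 1)" unfolding Pc by simp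
    then have XY: "X = 0" "Y = 0" unfolding wnd_iff by (auto simp: div_pos_pos_trivial)
    have "p = P + ?s - (?m * X, ?m * Y)" unfolding P_def by simp
    then have p: "p = (0, ?m - 1)" using Pc XY by (simp add: zero_prod_def[symmetric])
    have j: "1 \<le> n - 1" "n - 1 < n" using n13 by auto
    have cp: "pos n (crn (n - 1) DE) = (int n - 1, 1 - int n)" using crn_pos[OF j(1), of n DE] n13 by (simp add: of_nat_diff)
    have vis: "wnd n 0 (p + pos n (crn (n - 1) DE))" unfolding wnd0 p cp using n13 by simp
    have kE: "\<kappa> (c + pos n (crn (n - 1) DE)) = Some (knd n w (crn (n - 1) DE))"
      using decodes_seed(2)[OF t ok d j n(1) vis] Pc unfolding P_def by simp
    moreover have "V1 \<kappa>" using V unfolding VV_def by simp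
    ultimately obtain c' n' w' x where x: "c + pos n (crn (n - 1) DE) = c' + pos n' x" "sup \<kappa> c' n' w' x"
        "knd n w (crn (n - 1) DE) = knd n' w' x" "okn n'" "valid n' x" by (meson V1_E)
    have c': "c' = c" using sup_seed[OF x(2)] True by blast
    have "knd n w (crn (n - 1) DE) = Run DE PP En" using j n13 by (auto simp: knd_crn sym_at_def)
    then have kx: "knd n' w' x = Run DE PP En" using x(3) by simp
    then obtain j' i' where x': "x = Rg j' DE i'" by (cases x) (auto split: if_splits)
    then have i': "icl j' DE i' = En" "sym_at n' w' j' = PP" using kx by (auto split: if_splits)
    have jj: "i' + 1 = 2 * j'" using i'(1) by (auto simp: icl_def split: if_splits)
    have nj: "j' + 1 = n'" using i'(2) by (auto simp: sym_at_def split: if_splits)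
    have "pos n (crn (n - 1) DE) = pos n' x" using x(1) c' by simp
    then have "1 - int n = - int j'" unfolding cp x' by simp
    then have "j' = n - 1" using n13 by simp
    then have "n' = n" "x = crn (n - 1) DE" using nj jj n13 x' by (auto simp: crn_def)
    then show ?thesis using x(2) c' by blast
  next
    case False
    then obtain c1 where c1: "\<kappa> c1 = Some Seed" "c1 \<noteq> c" by blast
    have V2: "V2 \<kappa>" using V unfolding VV_def by simp
    have "\<exists>c'. \<kappa> c' = Some Seed \<and> c' \<noteq> c0" using c c1 by metis
    then obtain n' where f: "fin \<kappa> c0 n'" using V2 c0 unfolding V2_def by metis
    then obtain w' where w': "sup \<kappa> c0 n' w' (crn (n' - 1) DE)" using fin_core by blast
    have n'13: "13 \<le> n'" using f okn_ge unfolding fin_def sup_def by blast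
    have pw: "wnd n 0 p" using d unfolding decodes_def by blast
    have "n' = n"
    proof (rule ccontr)
      assume ne: "n' \<noteq> n"
      \<comment> \<open>The penultimate ring of the smaller size; a visible corner of it would show
        \<open>PP\<close> under one size and a counter under the other.\<close>
      define j where "j = min n n' - 1"
      have j: "1 \<le> j" "j < n" "j < n'" using n13 n'13 by (auto simp: j_def)
      obtain h where h: "wnd n 0 (p + pos n (crn j h))" using visible_corner[OF pw j(1,2)] by blast
      have "\<kappa> (c0 + pos n (crn j h)) = Some (knd n w (crn j h))"
        using decodes_seed(2)[OF t ok d j(1,2) n(1) h] unfolding c0_def .
      moreover have "\<kappa> (c0 + pos n' (crn j h)) = Some (knd n' w' (crn j h))"
        by (rule core_slots[OF _ w' crn_cor[OF j(1,3)]]) (use n'13 in simp)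
      moreover have "pos n (crn j h) = pos n' (crn j h)" by (simp add: crn_def)
      ultimately have "knd n w (crn j h) = knd n' w' (crn j h)" by simp
      then have "sym_at n w j = sym_at n' w' j" using j by (simp add: knd_crn split: if_splits)
      then show False using ne n13 n'13 by (auto simp: sym_at_def j_def min_def split: if_splits)
    qed
    then have f0: "fin \<kappa> c0 n" using f by simp
    have "fin \<kappa> c n"
    proof (cases "c = c0")
      case True then show ?thesis using f0 by simp
    next
      case False
      then obtain n2 where "fin \<kappa> c0 n2" "fin \<kappa> c n2" using V2 c0 c unfolding V2_def by metis
      then show ?thesis using fin_unique f0 by blast
    qed
    then show ?thesis by (rule fin_core)
  qed
qed

lemma lays_shift:
  assumes n: "okn n" "n \<noteq> 0" and l: "lays n \<kappa> W"
  shows "lays n (kshift \<kappa> ((2 * int n + 4) * fst u, (2 * int n + 4) * snd u)) (\<lambda>v. W (v - u))"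
proof -
  let ?u = "((2 * int n + 4) * fst u, (2 * int n + 4) * snd u)"
  have "kshift \<kappa> ?u \<subseteq>\<^sub>m full n (\<lambda>v. W (v - u))"
    using l unfolding lays_def full_shift[OF n] kshift_def map_le_def by (auto simp: domIff)
  moreover have "kshift \<kappa> ?u (cpos n v x) = Some (knd n w x)" if "W (v - u) = Some w" "cor n x" for v w x
  proof -
    have "cpos n v x = cpos n (v - u) x + ?u" using cpos_shift[of n "v - u" u x] by simp
    then have "kshift \<kappa> ?u (cpos n v x) = \<kappa> (cpos n (v - u) x)" by (simp only: kshift_add)
    then show ?thesis using l that unfolding lays_def by simp
  qed
  ultimately show ?thesis unfolding lays_def by blast
qed

text \<open>The translate is adjusted so that the prescribed \<alpha> itself is read; this puts two
  families to be combined on one common lattice.\<close>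

lemma rep_lays_exists:
  assumes t: "1 < \<tau>" and n: "okn n" "n \<noteq> 0" and dc: "dcode n T dc" "T \<noteq> {}" and A': "A' \<in> producible \<tau> (UU \<tau>)"
    and S: "is_supertile (rep_tilde (rep \<tau> n T dc) A')" and a: "\<alpha> \<in> rep_tilde (rep \<tau> n T dc) A'"
  shows "\<exists>\<kappa> W. A' = supertile_of (tl \<tau> \<kappa>) \<and> lays n \<kappa> W \<and> \<alpha> = (\<lambda>v. map_option dc (W v))"
proof -
  have sA: "is_supertile A'" by (rule producible_is_supertile[OF A'])
  then obtain \<alpha>' where "\<alpha>' \<in> A'" unfolding is_supertile_def using self_in_supertile by blast
  then obtain \<kappa> where k: "tl \<tau> \<kappa> \<in> A'" "kinv \<kappa>" using producible_good[OF t A'] unfolding good_def by blast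
  note rc = rep_core[OF t n A' S k]
  have "\<kappa> \<noteq> Map.empty" using rc(2) by auto
  then obtain c W where cW: "lays n (kshift \<kappa> c) W" using lays_exists[OF n rc(1) _ rc(3)] by blast
  have A1: "A' = supertile_of (tl \<tau> (kshift \<kappa> c))" using is_supertile_eq[OF sA k(1)] by (simp add: tl_kshift)
  have "\<alpha> \<in> supertile_of (\<lambda>v. map_option dc (W v))" using a rep_good[OF t n dc cW] A1 by simp
  then obtain u where u: "\<alpha> = translate (\<lambda>v. map_option dc (W v)) u" unfolding supertile_of_def by blast
  let ?k = "kshift (kshift \<kappa> c) ((2 * int n + 4) * fst u, (2 * int n + 4) * snd u)"
  have "A' = supertile_of (tl \<tau> ?k)" using A1 by (simp add: tl_kshift)
  moreover have "lays n ?k (\<lambda>v. W (v - u))" by (rule lays_shift[OF n cW])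
  moreover have "\<alpha> = (\<lambda>v. map_option dc (W (v - u)))" using u by (simp add: translate_apply fun_eq_iff)
  ultimately show ?thesis by (intro exI[of _ ?k] exI[of _ "\<lambda>v. W (v - u)"]) simp
qed

lemma ran_translate: "ran (translate \<alpha> v) \<subseteq> ran \<alpha>"
  unfolding ran_def translate_apply by blast

lemma ran_add_sub: "ran \<alpha> \<subseteq> T \<Longrightarrow> ran \<beta> \<subseteq> T \<Longrightarrow> ran (\<alpha> ++ \<beta>) \<subseteq> T"
  unfolding ran_def map_add_Some_iff by blast

lemma producible_ran: "A \<in> producible \<tau> T \<Longrightarrow> \<alpha> \<in> A \<Longrightarrow> ran \<alpha> \<subseteq> T"
proof (induction arbitrary: \<alpha> rule: producible.induct)
  case (single t)
  then show ?case by (auto simp: supertile_of_def translate_def ran_def split: if_splits)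
next
  case (comb A B C)
  obtain \<beta> \<gamma> where c: "C = supertile_of (\<beta> ++ \<gamma>)" "\<beta> \<in> A" "\<gamma> \<in> B" using comb.hyps(3) unfolding combination_def by blast
  have "ran \<beta> \<subseteq> T" "ran \<gamma> \<subseteq> T" using comb.IH c by auto
  moreover obtain v where "\<alpha> = translate (\<beta> ++ \<gamma>) v" using comb.prems c(1) unfolding supertile_of_def by blast
  ultimately show ?case using ran_add_sub[of \<beta> T \<gamma>] ran_translate by blast
next
  case (limit f g)
  have mono: "j \<le> k \<Longrightarrow> f j \<subseteq>\<^sub>m f k" for j k by (rule chain_mono[of f g, OF limit.hyps(4,3)])
  have g: "ran (g k) \<subseteq> T" for k by (rule limit.IH(2)[OF self_in_supertile])
  have f: "ran (f k) \<subseteq> T" for k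
  proof (induction k)
    case 0 show ?case by (rule limit.IH(1)[OF self_in_supertile])
  next
    case (Suc k) then show ?case using g[of k] ran_add_sub unfolding limit.hyps(4) by blast
  qed
  obtain v where v: "\<alpha> = translate (chain_lim f) v" using limit.prems unfolding supertile_of_def by blast
  have lim: "chain_lim f p = Some x \<longleftrightarrow> (\<exists>i. f i p = Some x)" for p x by (rule chain_lim_Some_iff[of f, OF mono])
  show ?case
  proof
    fix x assume "x \<in> ran \<alpha>"
    then obtain p where "chain_lim f (p - v) = Some x" unfolding v ran_def translate_apply by blast
    then obtain i where "f i (p - v) = Some x" using lim by blast
    then show "x \<in> T" using f[of i] by (meson ranI subsetD)
  qed
qed

lemma producible_tiles: "A \<in> producible \<tau> T \<Longrightarrow> T \<noteq> {}"
  by (induction rule: producible.induct) auto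

text \<open>The code counts the true bits on rings \<open>1\<close> to \<open>n - 2\<close>, which
  takes enough values to index \<open>T\<close>; counts out of range fall back to index
  \<open>0\<close>.\<close>

lemma dcode_ex:
  assumes "finite T" "card T + 2 \<le> n" shows "\<exists>dc. dcode n T dc"
proof -
  obtain f where f: "bij_betw f {0..<card T} T" using ex_bij_betw_nat_finite[OF assms(1)] by blast
  define cn where "cn w = card {j. 1 \<le> j \<and> j + 2 \<le> n \<and> w j}" for w :: "nat \<Rightarrow> bool"
  define dc where "dc w = f (if cn w < card T then cn w else 0)" for w
  have "dc w = dc w'" if "\<forall>j. 1 \<le> j \<and> j + 2 \<le> n \<longrightarrow> w j = w' j" for w w'
  proof -
    have "{j. 1 \<le> j \<and> j + 2 \<le> n \<and> w j} = {j. 1 \<le> j \<and> j + 2 \<le> n \<and> w' j}" using that by blast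
    then show ?thesis by (simp add: dc_def cn_def)
  qed
  moreover have "dc w \<in> T" if "T \<noteq> {}" for w
  proof -
    have "0 < card T" using that assms(1) by (simp add: card_gt_0_iff)
    then show ?thesis unfolding dc_def using bij_betwE[OF f] by auto
  qed
  moreover have "\<exists>w. dc w = t" if tT: "t \<in> T" for t
  proof -
    have "t \<in> f ` {0..<card T}" using f tT unfolding bij_betw_def by simp
    then obtain i where i: "i < card T" "f i = t" by auto
    have "{j. 1 \<le> j \<and> j + 2 \<le> n \<and> j \<le> i} = {1..i}" using i assms(2) by auto
    then have "cn (\<lambda>j. j \<le> i) = i" by (simp add: cn_def)
    then show ?thesis using i by (intro exI[of _ "\<lambda>j. j \<le> i"]) (simp add: dc_def)
  qed
  ultimately show ?thesis unfolding dcode_def by blast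
qed

section \<open>The simulation\<close>

lemma simulate_existing:
  assumes t: "1 < \<tau>" and n: "okn n" "n \<noteq> 0" and dc: "dcode n T dc" and B: "B \<in> producible \<tau> T"
  shows "\<exists>A \<in> producible \<tau> (UU \<tau>). rep_tilde (rep \<tau> n T dc) A = B"
proof -
  have T: "T \<noteq> {}" by (rule producible_tiles[OF B])
  have sB: "is_supertile B" by (rule producible_is_supertile[OF B])
  then obtain \<beta> where b: "\<beta> \<in> B" unfolding is_supertile_def using self_in_supertile by blast
  obtain enc where enc: "\<And>x. x \<in> T \<Longrightarrow> dc (enc x) = x" using dc unfolding dcode_def by metis
  let ?W = "\<lambda>v. map_option enc (\<beta> v)"
  have p: "supertile_of (tl \<tau> (full n ?W)) \<in> producible \<tau> (UU \<tau>)" using lay_producible[OF t n B b, of enc] unfolding lay_def .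
  have l: "lays n (full n ?W) ?W" unfolding lays_def
  proof (intro conjI allI impI)
    fix v w x assume "?W v = Some w \<and> cor n x"
    then show "full n ?W (cpos n v x) = Some (knd n w x)" using full_cell[of n ?W v w x] n cor_valid by blast
  qed simp
  have "map_option dc (?W v) = \<beta> v" for v
  proof (cases "\<beta> v")
    case (Some a)
    then have "a \<in> T" using producible_ran[OF B b] by (meson ranI subsetD)
    then show ?thesis using Some enc by simp
  qed simp
  then have "(\<lambda>v. map_option dc (?W v)) = \<beta>" by (rule ext)
  then have "rep_tilde (rep \<tau> n T dc) (supertile_of (tl \<tau> (full n ?W))) = supertile_of \<beta>"
    using rep_good[OF t n dc T l] by simp
  then show ?thesis using p is_supertile_eq[OF sB b] by blast
qed

lemma lays_mono:
  assumes "lays n \<kappa> W" "\<kappa> \<subseteq>\<^sub>m \<kappa>'" "\<kappa>' \<subseteq>\<^sub>m full n W" shows "lays n \<kappa>' W"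
  using assms unfolding lays_def map_le_def by (metis domI)

lemma lays_add:
  assumes n: "okn n" "n \<noteq> 0" and l: "lays n \<kappa> W" "lays n \<kappa>' W'" and d: "dom W \<inter> dom W' = {}"
  shows "dom \<kappa> \<inter> dom \<kappa>' = {}" "lays n (\<kappa> ++ \<kappa>') (W ++ W')"
proof -
  have le: "\<kappa> \<subseteq>\<^sub>m full n W" "\<kappa>' \<subseteq>\<^sub>m full n W'" using l unfolding lays_def by auto
  show dj: "dom \<kappa> \<inter> dom \<kappa>' = {}"
    using full_disjoint[OF n d] map_le_implies_dom_le[OF le(1)] map_le_implies_dom_le[OF le(2)] by blast
  have a: "(\<kappa> ++ \<kappa>') p = Some k \<longleftrightarrow> \<kappa> p = Some k \<or> \<kappa>' p = Some k" for p k using dj by (auto simp: map_add_Some_iff)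
  have b: "(W ++ W') p = Some k \<longleftrightarrow> W p = Some k \<or> W' p = Some k" for p k using d by (auto simp: map_add_Some_iff)
  have f: "full n W \<subseteq>\<^sub>m full n (W ++ W')" "full n W' \<subseteq>\<^sub>m full n (W ++ W')"
    using full_mono[OF n] map_le_map_add[of W' W] map_le_map_add_disj map_add_comm[OF d] map_le_map_add[of W W'] by metis+
  have x: "\<kappa> ++ \<kappa>' \<subseteq>\<^sub>m full n (W ++ W')" unfolding map_le_def
  proof
    fix p assume "p \<in> dom (\<kappa> ++ \<kappa>')"
    then obtain k where k: "(\<kappa> ++ \<kappa>') p = Some k" by (meson domD)
    then have "full n W p = Some k \<or> full n W' p = Some k" using le unfolding a map_le_def by (metis domI)
    then have "full n (W ++ W') p = Some k" using f unfolding map_le_def by (metis domI)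
    then show "(\<kappa> ++ \<kappa>') p = full n (W ++ W') p" using k by simp
  qed
  have y: "(\<kappa> ++ \<kappa>') (cpos n v x) = Some (knd n w x)" if "(W ++ W') v = Some w" "cor n x" for v w x
    using that l unfolding a b lays_def by blast
  show "lays n (\<kappa> ++ \<kappa>') (W ++ W')" unfolding lays_def
  proof (intro conjI allI impI)
    show "\<kappa> ++ \<kappa>' \<subseteq>\<^sub>m full n (W ++ W')" by (rule x)
    fix v w z assume "(W ++ W') v = Some w \<and> cor n z"
    then show "(\<kappa> ++ \<kappa>') (cpos n v z) = Some (knd n w z)" using y[of v w z] by (elim conjE)
  qed
qed

text \<open>It is enough to complete one cell on each side, those of two adjacent simulated tiles.
  The completion leaves the reading unchanged, and all other cells may stay unfinished.\<close>

lemma simulate_step: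
  assumes t: "1 < \<tau>" and n: "okn n" "n \<noteq> 0" and dc: "dcode n T dc"
    and A: "A \<in> producible \<tau> T" "B \<in> producible \<tau> T" "C \<in> combination \<tau> A B"
    and A': "A' \<in> producible \<tau> (UU \<tau>)" "B' \<in> producible \<tau> (UU \<tau>)" "rep_tilde (rep \<tau> n T dc) A' = A" "rep_tilde (rep \<tau> n T dc) B' = B"
  shows "\<exists>A'' \<in> producible \<tau> (UU \<tau>). \<exists>B'' \<in> producible \<tau> (UU \<tau>). \<exists>C' \<in> producible \<tau> (UU \<tau>).
     steps \<tau> (UU \<tau>) A' A'' \<and> steps \<tau> (UU \<tau>) B' B'' \<and>
     rep_tilde (rep \<tau> n T dc) A'' = A \<and> rep_tilde (rep \<tau> n T dc) B'' = B \<and> rep_tilde (rep \<tau> n T dc) C' = C \<and>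
     C' \<in> combination \<tau> A'' B''"
proof -
  have T: "T \<noteq> {}" by (rule producible_tiles[OF A(1)])
  have sA: "is_supertile A" "is_supertile B" using producible_is_supertile A by blast+
  obtain \<alpha> \<beta> where ab: "C = supertile_of (\<alpha> ++ \<beta>)" "\<alpha> \<in> A" "\<beta> \<in> B" "dom \<alpha> \<inter> dom \<beta> = {}" "stable \<tau> (\<alpha> ++ \<beta>)"
    using A(3) unfolding combination_def by blast
  have "\<alpha> \<noteq> Map.empty" "\<beta> \<noteq> Map.empty" using is_supertile_nonempty sA ab by blast+
  then have ne: "dom \<alpha> \<noteq> {}" "dom \<beta> \<noteq> {}" by simp_all
  obtain \<kappa> W where k: "A' = supertile_of (tl \<tau> \<kappa>)" "lays n \<kappa> W" "\<alpha> = (\<lambda>v. map_option dc (W v))"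
    using rep_lays_exists[OF t n dc T A'(1), of \<alpha>] A'(3) sA(1) ab(2) by blast
  obtain \<kappa>2 X where k2: "B' = supertile_of (tl \<tau> \<kappa>2)" "lays n \<kappa>2 X" "\<beta> = (\<lambda>v. map_option dc (X v))"
    using rep_lays_exists[OF t n dc T A'(2), of \<beta>] A'(4) sA(2) ab(3) by blast
  have dm: "dom W = dom \<alpha>" "dom X = dom \<beta>" using k(3) k2(3) by (auto simp: dom_def)
  have dWX: "dom W \<inter> dom X = {}" using dm ab(4) by simp
  obtain v d where vd: "v \<in> dom \<alpha>" "v + vec d \<in> dom \<beta>" using adjacent_pair[OF t ab(5,4) ne] by blast
  obtain w where w: "W v = Some w" using vd dm by blast
  obtain w2 where w2: "X (v + vec d) = Some w2" using vd dm by blast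
  have seed: "\<kappa> (cpos n v SS) = Some Seed" "\<kappa>2 (cpos n (v + vec d) SS) = Some Seed"
    using k(2) k2(2) w w2 unfolding lays_def cor_def by fastforce+
  have le: "\<kappa> \<subseteq>\<^sub>m full n W" "\<kappa>2 \<subseteq>\<^sub>m full n X" using k(2) k2(2) unfolding lays_def by auto
  obtain \<kappa>' where g: "\<kappa> \<subseteq>\<^sub>m \<kappa>'" "\<kappa>' \<subseteq>\<^sub>m full n W" "\<forall>x. valid n x \<longrightarrow> \<kappa>' (cpos n v x) \<noteq> None"
      "steps \<tau> (UU \<tau>) (supertile_of (tl \<tau> \<kappa>)) (supertile_of (tl \<tau> \<kappa>'))"
    using grow_cell[of \<tau> n W v w, OF t n w le(1) seed(1)] A'(1) k(1) by blast
  obtain \<kappa>2' where g2: "\<kappa>2 \<subseteq>\<^sub>m \<kappa>2'" "\<kappa>2' \<subseteq>\<^sub>m full n X" "\<forall>x. valid n x \<longrightarrow> \<kappa>2' (cpos n (v + vec d) x) \<noteq> None"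
      "steps \<tau> (UU \<tau>) (supertile_of (tl \<tau> \<kappa>2)) (supertile_of (tl \<tau> \<kappa>2'))"
    using grow_cell[of \<tau> n X "v + vec d" w2, OF t n w2 le(2) seed(2)] A'(2) k2(1) by blast
  have l: "lays n \<kappa>' W" "lays n \<kappa>2' X" using lays_mono[OF k(2) g(1,2)] lays_mono[OF k2(2) g2(1,2)] by auto
  note la = lays_add[OF n l dWX]
  let ?A = "supertile_of (tl \<tau> \<kappa>')" let ?B = "supertile_of (tl \<tau> \<kappa>2')" let ?C = "supertile_of (tl \<tau> (\<kappa>' ++ \<kappa>2'))"
  have pA: "?A \<in> producible \<tau> (UU \<tau>)" using steps_producible[OF g(4)] A'(1) k(1) by simp
  have pB: "?B \<in> producible \<tau> (UU \<tau>)" using steps_producible[OF g2(4)] A'(2) k2(1) by simp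
  have st: "stable \<tau> (tl \<tau> (\<kappa>' ++ \<kappa>2'))"
  proof (rule stable_adjacent[OF t n _ _ la(1), of v w d w2])
    show "stable \<tau> (tl \<tau> \<kappa>')" by (rule producible_stable[OF pA self_in_supertile])
    show "stable \<tau> (tl \<tau> \<kappa>2')" by (rule producible_stable[OF pB self_in_supertile])
    show "\<kappa>' (cpos n v x) = Some (knd n w x)" if "valid n x" for x
      using g(2,3) full_cell[of n W v w x, OF n w that] that unfolding map_le_def by (metis domIff)
    show "\<kappa>2' (cpos n (v + vec d) x) = Some (knd n w2 x)" if "valid n x" for x
      using g2(2,3) full_cell[of n X "v + vec d" w2 x, OF n w2 that] that unfolding map_le_def by (metis domIff)
  qed
  have cC: "?C \<in> combination \<tau> ?A ?B"
    unfolding tl_add by (rule combinationI[OF self_in_supertile self_in_supertile]) (use la(1) st in \<open>simp_all add: tl_add\<close>)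
  have pC: "?C \<in> producible \<tau> (UU \<tau>)" by (rule producible.comb[OF pA pB cC])
  have rA: "rep_tilde (rep \<tau> n T dc) ?A = A" using rep_good[OF t n dc T l(1)] k(3) is_supertile_eq[OF sA(1) ab(2)] by simp
  have rB: "rep_tilde (rep \<tau> n T dc) ?B = B" using rep_good[OF t n dc T l(2)] k2(3) is_supertile_eq[OF sA(2) ab(3)] by simp
  have "(\<lambda>v. map_option dc ((W ++ X) v)) = \<alpha> ++ \<beta>" unfolding k(3) k2(3) by (rule ext) (auto simp: map_add_def split: option.splits)
  then have rC: "rep_tilde (rep \<tau> n T dc) ?C = C" using rep_good[OF t n dc T la(2)] ab(1) by simp
  have "steps \<tau> (UU \<tau>) A' ?A" "steps \<tau> (UU \<tau>) B' ?B" using g(4) g2(4) k(1) k2(1) by simp_all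
  then show ?thesis using pA pB pC cC rA rB rC by blast
qed

text \<open>Being readable at size \<open>n\<close> requires a core of size \<open>n\<close> around
  each seed, and a core determines its size, whatever \<open>T\<close> and \<open>dc\<close>
  are.\<close>

lemma rep_unique:
  assumes t: "1 < \<tau>" and n: "okn n" "n \<noteq> 0" "okn n'" "n' \<noteq> 0" and A: "A \<in> producible \<tau> (UU \<tau>)"
    and S: "is_supertile (rep_tilde (rep \<tau> n T dc) A)" "is_supertile (rep_tilde (rep \<tau> n' T' dc') A)"
  shows "n = n'"
proof -
  have "is_supertile A" by (rule producible_is_supertile[OF A])
  then obtain \<alpha> where "\<alpha> \<in> A" unfolding is_supertile_def using self_in_supertile by blast
  then obtain \<kappa> where k: "tl \<tau> \<kappa> \<in> A" "kinv \<kappa>" using producible_good[OF t A] unfolding good_def by blast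
  note r = rep_core[OF t n(1,2) A S(1) k] and r' = rep_core[OF t n(3,4) A S(2) k]
  obtain c where "\<kappa> c = Some Seed" using r(2) by blast
  then obtain w w' where "sup \<kappa> c n w (crn (n - 1) DE)" "sup \<kappa> c n' w' (crn (n' - 1) DE)" using r(3) r'(3) by blast
  then show ?thesis using core_unique okn_ge[OF n(1,2)] okn_ge[OF n(3,4)] by blast
qed

theorem theorem13:
  fixes \<tau> :: nat
  assumes "1 < \<tau>"
  shows "\<exists>U. finite U \<and>
           (\<forall>Ts. bij_betw Ts UNIV {T. finite T} \<longrightarrow>
              (\<exists>R. (\<forall>i. valid_blockrep U (Ts i) (R i)) \<and>
                   strongly_simultaneously_simulates \<tau> U Ts R))"
proof (intro exI[of _ "UU \<tau>"] conjI allI impI finite_UU)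
  fix Ts :: "nat \<Rightarrow> tile set" assume "bij_betw Ts UNIV {T. finite T}"
  then have fin: "finite (Ts i)" for i unfolding bij_betw_def by blast
  \<comment> \<open>Congruent to 1 modulo 4 and at least 13, as \<open>okn\<close> demands;
    injective in \<open>i\<close>; and at least \<open>card (Ts i) + 2\<close>, so that the bits
    suffice for the tiles of \<open>Ts i\<close>.\<close>
  define n where "n i = 4 * (prod_encode (i, card (Ts i)) + 3) + 1" for i
  have n: "okn (n i)" "n i \<noteq> 0" for i unfolding okn_def n_def by presburger+
  have inj: "n i = n j \<Longrightarrow> i = j" for i j unfolding n_def by simp
  have "a \<le> b \<Longrightarrow> a + 2 \<le> 4 * (b + 3) + 1" for a b :: nat by simp
  then have "card (Ts i) + 2 \<le> n i" for i unfolding n_def using le_prod_encode_2 by blast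
  then have "\<forall>i. \<exists>dc. dcode (n i) (Ts i) dc" using dcode_ex[OF fin] by blast
  then obtain dc where dc: "\<And>i. dcode (n i) (Ts i) (dc i)" by metis
  define R where "R i = rep \<tau> (n i) (Ts i) (dc i)" for i
  \<comment> \<open>All uniqueness conditions reduce to this one, since each of them makes both
    readings of a producible supertile supertiles.\<close>
  have uniq: "i = j" if "A \<in> producible \<tau> (UU \<tau>)" "is_supertile (rep_tilde (R i) A)" "is_supertile (rep_tilde (R j) A)" for A i j
    using rep_unique[OF assms n n that[unfolded R_def]] inj by blast
  have "strongly_simultaneously_simulates \<tau> (UU \<tau>) Ts R"
    unfolding strongly_simultaneously_simulates_def at_most_one_def
  proof (intro conjI allI ballI impI)
    fix A i j assume "A \<in> producible \<tau> (UU \<tau>)" "rep_tilde (R i) A \<in> producible \<tau> (Ts i) \<and> rep_tilde (R j) A \<in> producible \<tau> (Ts j)"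
    then show "i = j" using uniq producible_is_supertile by blast
  next
    fix i B assume "B \<in> producible \<tau> (Ts i)"
    then show "\<exists>A \<in> producible \<tau> (UU \<tau>). rep_tilde (R i) A = B" unfolding R_def by (rule simulate_existing[OF assms n dc])
  next
    fix A i j assume "A \<in> producible \<tau> (UU \<tau>)" "supertile_maps_cleanly (R i) A \<and> supertile_maps_cleanly (R j) A"
    then show "i = j" using uniq unfolding supertile_maps_cleanly_def by blast
  next
    fix A B i j assume "A \<in> producible \<tau> (UU \<tau>)"
      "le1_step \<tau> (Ts i) (rep_tilde (R i) A) (rep_tilde (R i) B) \<and> le1_step \<tau> (Ts j) (rep_tilde (R j) A) (rep_tilde (R j) B)"
    then show "i = j" using uniq unfolding le1_step_def by blast
  next
    fix i A B C A' B' assume a: "A \<in> producible \<tau> (Ts i)" "B \<in> producible \<tau> (Ts i)" "C \<in> combination \<tau> A B"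
      "A' \<in> producible \<tau> (UU \<tau>)" "B' \<in> producible \<tau> (UU \<tau>)" "rep_tilde (R i) A' = A \<and> rep_tilde (R i) B' = B"
    have e: "rep_tilde (rep \<tau> (n i) (Ts i) (dc i)) A' = A" "rep_tilde (rep \<tau> (n i) (Ts i) (dc i)) B' = B"
      using a(6) unfolding R_def by simp_all
    show "\<exists>A'' \<in> producible \<tau> (UU \<tau>). \<exists>B'' \<in> producible \<tau> (UU \<tau>). \<exists>C' \<in> producible \<tau> (UU \<tau>).
             steps \<tau> (UU \<tau>) A' A'' \<and> steps \<tau> (UU \<tau>) B' B'' \<and>
             rep_tilde (R i) A'' = A \<and> rep_tilde (R i) B'' = B \<and> rep_tilde (R i) C' = C \<and>
             C' \<in> combination \<tau> A'' B''"
      unfolding R_def by (rule simulate_step[OF assms n dc a(1-5) e])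
  qed
  moreover have "valid_blockrep (UU \<tau>) (Ts i) (R i)" for i unfolding R_def by (rule rep_valid[OF dc])
  ultimately show "\<exists>R. (\<forall>i. valid_blockrep (UU \<tau>) (Ts i) (R i)) \<and> strongly_simultaneously_simulates \<tau> (UU \<tau>) Ts R" by blast
qed

end
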